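(* Suppose there is $\epsilon_0\in(0,1)$ with $\rho_0-\Lambda_2>\epsilon_0$ for all $n$, and there is $M>0$ such that all eigenvalues of $\Sigma_x,\Sigma_y$ lie in $[M^{-1},M]$. Suppose further that $s=s_U+s_V$ satisfies $s\lambda\to0$ and $s=o(p)$. Then there exist $C_1,C_2>0$ such that for $\lambda_1=C\lambda$ with $C>C_1$ and $\lambda_2=C'\lambda$ with $C'>C_2$, the modified COLAR estimators $\hat\alpha_n,\hat\beta_n$ (defined in the context) satisfy $$\inf_{w\in\{\pm1\}}\|w\hat\alpha_n-\alpha_0\|_2+\inf_{w\in\{\pm1\}}\|w\hat\beta_n-\beta_0\|_2=O_p(s^\kappa\lambda)$$ and $$\inf_{w\in\{\pm1\}}\|w\hat\alpha_n-\alpha_0\|_1+\inf_{w\in\{\pm1\}}\|w\hat\beta_n-\beta_0\|_1=O_p(s^{\kappa+1/2}\lambda),$$ with $\kappa=1/2$ if $r=1$ and $\kappa=1$ otherwise.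
   Context: **Model.** $(X_i,Y_i)_{i=1}^n$ are i.i.d. copies of $(X,Y)$, where $X\in\mathbb{R}^p$, $Y\in\mathbb{R}^q$ are centered sub-Gaussian random vectors (sub-Gaussian norms bounded by a fixed constant); $p,q$ may vary with $n$ and asymptotics are as $n\to\infty$. The joint covariance is $\Sigma=\begin{bmatrix}\Sigma_x&\Sigma_{xy}\\ \Sigma_{yx}&\Sigma_y\end{bmatrix}$. $\Sigma_{xy}$ has fixed rank $r\ge1$ and $\Sigma_{xy}=\Sigma_xU\Lambda V^T\Sigma_y$ with $U=[u_1\ldots u_r]$, $V=[v_1\ldots v_r]$, $U^T\Sigma_xU=V^T\Sigma_yV=I_r$, $\Lambda=\mathrm{diag}(\Lambda_1\ge\cdots\ge\Lambda_r>0)$. Put $\rho_0=\Lambda_1$, $\alpha_0=u_1$, $\beta_0=v_1$; $\Lambda_2=0$ if $r=1$. $s_U,s_V$ are the numbers of nonzero rows of $U,V$; $\lambda=(\log(p\vee q)/n)^{1/2}$. **Modified COLAR estimator.** Split the data into two equal halves indexed by $0,1$; $\hat\Sigma_x^{(k)},\hat\Sigma_y^{(k)},\hat\Sigma_{xy}^{(k)}=(\hat\Sigma_{yx}^{(k)})^T$ are the empirical covariance matrices of half $k$, and $\hat\Sigma_x,\hat\Sigma_y$ those of the full sample. *Stage 1:* let $\hat F_n$ be a maximizer of $\mathrm{tr}(\hat\Sigma_{yx}^{(0)}F)-\lambda_1\|F\|_1$ over $$\mathcal G=\{F\in\mathbb{R}^{p\times q}:\ \|(\hat\Sigma_x^{(0)})^{1/2}F(\hat\Sigma_y^{(0)})^{1/2}\|_*\le1,\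 \|(\hat\Sigma_x^{(0)})^{1/2}F(\hat\Sigma_y^{(0)})^{1/2}\|_{op}\le1\},$$ where $\|F\|_1=\sum_{i,j}|F_{ij}|$, $\|\cdot\|_*$ is the nuclear norm and $\|\cdot\|_{op}$ the operator norm; let $\hat\alpha_n^0\in\mathbb{R}^p$, $\hat\beta_n^0\in\mathbb{R}^q$ be the first pair of (left, right) singular vectors of $\hat F_n$. *Stage 2:* let $\tilde x$ minimize $x^T\hat\Sigma_x^{(1)}x-2x^T\hat\Sigma_{xy}^{(1)}\hat\beta_n^0+\lambda_2\|x\|_1$ over $x\in\mathbb{R}^p$. *Stage 3:* $\hat\alpha_n=\tilde x(\tilde x^T\hat\Sigma_x\tilde x)^{-1/2}$ if $\tilde x^T\hat\Sigma_x\tilde x>0$ and $\hat\alpha_n=0$ otherwise. $\hat\beta_n$ is obtained analogously with the roles of $X$ and $Y$ interchanged in Stages 2 and 3 (minimizing $y^T\hat\Sigma_y^{(1)}y-2y^T\hat\Sigma_{yx}^{(1)}\hat\alpha_n^0+\lambda_2\|y\|_1$ and normalizing with $\hat\Sigma_y$). *)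

theory Defs
  imports
    "HOL-Probability.Probability"
    "HOL-Library.Landau_Symbols"
    "Jordan_Normal_Form.DL_Rank"
    "Jordan_Normal_Form.Char_Poly"
begin

(* The notations $ and \<bullet> are reserved for the vectors of Jordan_Normal_Form, whose dimension
   is a value and may therefore vary with the sample size. *)
no_notation vec_nth (infixl \<open>$\<close> 90)
no_notation inner (infix \<open>\<bullet>\<close> 70)

definition l2_norm :: "real Matrix.vec \<Rightarrow> real" where
  "l2_norm v = sqrt (v \<bullet> v)"

definition l1_norm :: "real Matrix.vec \<Rightarrow> real" where
  "l1_norm v = (\<Sum>i<dim_vec v. \<bar>v $ i\<bar>)"

definition mat_l1_norm :: "real mat \<Rightarrow> real" where
  "mat_l1_norm F = (\<Sum>i<dim_row F. \<Sum>j<dim_col F. \<bar>F $$ (i, j)\<bar>)"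

definition mat_trace :: "real mat \<Rightarrow> real" where
  "mat_trace A = (\<Sum>i<dim_row A. A $$ (i, i))"

definition psd :: "real mat \<Rightarrow> bool" where
  "psd A \<longleftrightarrow> square_mat A \<and> A\<^sup>T = A \<and> (\<forall>v\<in>carrier_vec (dim_row A). 0 \<le> v \<bullet> (A *\<^sub>v v))"

definition psd_sqrt :: "real mat \<Rightarrow> real mat" where
  "psd_sqrt A = (THE B. B \<in> carrier_mat (dim_row A) (dim_row A) \<and> psd B \<and> B * B = A)"

(* The trace of (A^T A)^(1/2), i.e. the sum of the singular values of A. *)
definition nuclear_norm :: "real mat \<Rightarrow> real" where
  "nuclear_norm A = mat_trace (psd_sqrt (A\<^sup>T * A))"

definition op_norm :: "real mat \<Rightarrow> real" where
  "op_norm A = (SUP v\<in>{v \<in> carrier_vec (dim_col A). l2_norm v \<le> 1}. l2_norm (A *\<^sub>v v))"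

definition singular_triple :: "real mat \<Rightarrow> real \<Rightarrow> real Matrix.vec \<Rightarrow> real Matrix.vec \<Rightarrow> bool" where
  "singular_triple F \<sigma> a b \<longleftrightarrow>
     a \<in> carrier_vec (dim_row F) \<and> b \<in> carrier_vec (dim_col F) \<and>
     l2_norm a = 1 \<and> l2_norm b = 1 \<and> 0 \<le> \<sigma> \<and>
     F *\<^sub>v b = \<sigma> \<cdot>\<^sub>v a \<and> F\<^sup>T *\<^sub>v a = \<sigma> \<cdot>\<^sub>v b"

definition first_singular_vectors :: "real mat \<Rightarrow> real Matrix.vec \<Rightarrow> real Matrix.vec \<Rightarrow> bool" where
  "first_singular_vectors F a b \<longleftrightarrow>
     (\<exists>\<sigma>. singular_triple F \<sigma> a b \<and> (\<forall>\<tau> a' b'. singular_triple F \<tau> a' b' \<longrightarrow> \<tau> \<le> \<sigma>))"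

definition row_sparsity :: "real mat \<Rightarrow> nat" where
  "row_sparsity U = card {i. i < dim_row U \<and> Matrix.row U i \<noteq> 0\<^sub>v (dim_col U)}"

definition sign_dist ::
  "(real Matrix.vec \<Rightarrow> real) \<Rightarrow> real Matrix.vec \<Rightarrow> real Matrix.vec \<Rightarrow> real" where
  "sign_dist N a b = (INF w\<in>{-1, 1}. N (w \<cdot>\<^sub>v a - b))"

(* The Borel sigma-algebra of R^p, carried over to carrier_vec p. *)
definition vec_borel :: "nat \<Rightarrow> real Matrix.vec measure" where
  "vec_borel p = vimage_algebra (carrier_vec p) (\<lambda>v. \<lambda>i\<in>{..<p}. v $ i) (PiM {..<p} (\<lambda>_. borel))"

abbreviation pair_borel :: "nat \<Rightarrow> nat \<Rightarrow> (real Matrix.vec \<times> real Matrix.vec) measure" where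
  "pair_borel p q \<equiv> vec_borel p \<Otimes>\<^sub>M vec_borel q"

(* psi_2 (Orlicz) norm; it is infinite if no t qualifies. *)
definition psi2_norm :: "'a measure \<Rightarrow> ('a \<Rightarrow> real) \<Rightarrow> ennreal" where
  "psi2_norm M f = (INF t\<in>{t::real. 0 < t \<and> (\<integral>\<^sup>+\<omega>. ennreal (exp ((f \<omega>)\<^sup>2 / t\<^sup>2)) \<partial>M) \<le> 2}. ennreal t)"

definition subgaussian_norm :: "'a measure \<Rightarrow> nat \<Rightarrow> ('a \<Rightarrow> real Matrix.vec) \<Rightarrow> ennreal" where
  "subgaussian_norm M p X = (SUP v\<in>{v \<in> carrier_vec p. l2_norm v = 1}. psi2_norm M (\<lambda>\<omega>. X \<omega> \<bullet> v))"

definition centered :: "'a measure \<Rightarrow> nat \<Rightarrow> ('a \<Rightarrow> real Matrix.vec) \<Rightarrow> bool" where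
  "centered M p X \<longleftrightarrow> (\<forall>i<p. integrable M (\<lambda>\<omega>. X \<omega> $ i) \<and> (\<integral>\<omega>. X \<omega> $ i \<partial>M) = 0)"

definition cov_mat :: "'a measure \<Rightarrow> nat \<Rightarrow> nat \<Rightarrow>
    ('a \<Rightarrow> real Matrix.vec) \<Rightarrow> ('a \<Rightarrow> real Matrix.vec) \<Rightarrow> real mat" where
  "cov_mat M p q X Y = Matrix.mat p q (\<lambda>(i, j).
     \<integral>\<omega>. (X \<omega> $ i - (\<integral>\<omega>'. X \<omega>' $ i \<partial>M)) * (Y \<omega> $ j - (\<integral>\<omega>'. Y \<omega>' $ j \<partial>M)) \<partial>M)"

(* No mean is subtracted: the underlying vectors are centered. *)
definition emp_cov :: "nat set \<Rightarrow> nat \<Rightarrow> nat \<Rightarrow>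
    (nat \<Rightarrow> real Matrix.vec) \<Rightarrow> (nat \<Rightarrow> real Matrix.vec) \<Rightarrow> real mat" where
  "emp_cov I p q x y = Matrix.mat p q (\<lambda>(j, k). (\<Sum>i\<in>I. x i $ j * y i $ k) / real (card I))"

(* W n = O_p(a n), where W n lives on the probability space M n. The covering event A makes this
   meaningful for functions W n that are not known to be measurable (outer probability); for
   measurable W n one may take A to be the exceedance event itself. *)
definition bounded_in_prob ::
  "(nat \<Rightarrow> 'a measure) \<Rightarrow> (nat \<Rightarrow> 'a \<Rightarrow> real) \<Rightarrow> (nat \<Rightarrow> real) \<Rightarrow> bool" where
  "bounded_in_prob M W a \<longleftrightarrow>
     (\<forall>\<delta>>0. \<exists>K>0. \<forall>\<^sub>F n in sequentially.
        \<exists>A\<in>sets (M n). {\<omega>\<in>space (M n). \<bar>W n \<omega>\<bar> > K * a n} \<subseteq> A \<and> measure (M n) A < \<delta>)"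

(* For odd n the second half has one more observation than the first. *)
definition half0 :: "nat \<Rightarrow> nat set" where
  "half0 n = {..<n div 2}"

definition half1 :: "nat \<Rightarrow> nat set" where
  "half1 n = {n div 2..<n}"

definition lam :: "nat \<Rightarrow> nat \<Rightarrow> nat \<Rightarrow> real" where
  "lam p q n = sqrt (ln (real (max p q)) / real n)"

definition colar_feasible :: "real mat \<Rightarrow> real mat \<Rightarrow> real mat set" where
  "colar_feasible Sx Sy = {F \<in> carrier_mat (dim_row Sx) (dim_row Sy).
     nuclear_norm (psd_sqrt Sx * F * psd_sqrt Sy) \<le> 1 \<and>
     op_norm (psd_sqrt Sx * F * psd_sqrt Sy) \<le> 1}"

definition colar_stage1 :: "real mat \<Rightarrow> real mat \<Rightarrow> real mat \<Rightarrow> real \<Rightarrow> real mat \<Rightarrow> bool" where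
  "colar_stage1 Sx Sy Sxy l1 F \<longleftrightarrow>
     is_arg_max (\<lambda>F. mat_trace (Sxy\<^sup>T * F) - l1 * mat_l1_norm F) (\<lambda>F. F \<in> colar_feasible Sx Sy) F"

definition colar_stage2 ::
  "real mat \<Rightarrow> real mat \<Rightarrow> real \<Rightarrow> real Matrix.vec \<Rightarrow> real Matrix.vec \<Rightarrow> bool" where
  "colar_stage2 Sx Sxy l2 b x \<longleftrightarrow>
     is_arg_min (\<lambda>x. x \<bullet> (Sx *\<^sub>v x) - 2 * (x \<bullet> (Sxy *\<^sub>v b)) + l2 * l1_norm x)
       (\<lambda>x. x \<in> carrier_vec (dim_row Sx)) x"

definition colar_stage3 :: "real mat \<Rightarrow> real Matrix.vec \<Rightarrow> real Matrix.vec" where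
  "colar_stage3 S x =
     (if 0 < x \<bullet> (S *\<^sub>v x) then (1 / sqrt (x \<bullet> (S *\<^sub>v x))) \<cdot>\<^sub>v x else 0\<^sub>v (dim_row S))"

(* The sigma-algebra generated by the observations with index in I. *)
definition sample_algebra :: "'a measure \<Rightarrow> nat \<Rightarrow> nat \<Rightarrow> nat set \<Rightarrow>
    (nat \<Rightarrow> 'a \<Rightarrow> real Matrix.vec) \<Rightarrow> (nat \<Rightarrow> 'a \<Rightarrow> real Matrix.vec) \<Rightarrow> 'a measure" where
  "sample_algebra M p q I X Y =
     vimage_algebra (space M) (\<lambda>\<omega>. \<lambda>i\<in>I. (X i \<omega>, Y i \<omega>)) (PiM I (\<lambda>_. pair_borel p q))"

(* a, b are COLAR estimators from the observations (X i, Y i), i < n. Maximizers, minimizers and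
   singular vectors need not be unique, and any choice is admitted. The choices of the first stage
   are measurable functions of the first half alone, hence independent of the second half; without
   this the sample splitting would be void. *)
definition modified_colar :: "'a measure \<Rightarrow> nat \<Rightarrow> nat \<Rightarrow> nat \<Rightarrow>
    (nat \<Rightarrow> 'a \<Rightarrow> real Matrix.vec) \<Rightarrow> (nat \<Rightarrow> 'a \<Rightarrow> real Matrix.vec) \<Rightarrow> real \<Rightarrow> real \<Rightarrow>
    ('a \<Rightarrow> real Matrix.vec) \<Rightarrow> ('a \<Rightarrow> real Matrix.vec) \<Rightarrow> bool" where
  "modified_colar M p q n X Y l1 l2 a b \<longleftrightarrow>
     (\<exists>F a0 b0.
        (\<forall>i<p. \<forall>j<q. (\<lambda>\<omega>. F \<omega> $$ (i, j)) \<in> borel_measurable (sample_algebra M p q (half0 n) X Y)) \<and>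
        a0 \<in> sample_algebra M p q (half0 n) X Y \<rightarrow>\<^sub>M vec_borel p \<and>
        b0 \<in> sample_algebra M p q (half0 n) X Y \<rightarrow>\<^sub>M vec_borel q \<and>
        (\<forall>\<omega>\<in>space M.
           let x = (\<lambda>i. X i \<omega>); y = (\<lambda>i. Y i \<omega>);
               Sx0 = emp_cov (half0 n) p p x x; Sy0 = emp_cov (half0 n) q q y y;
               Sxy0 = emp_cov (half0 n) p q x y;
               Sx1 = emp_cov (half1 n) p p x x; Sy1 = emp_cov (half1 n) q q y y;
               Sxy1 = emp_cov (half1 n) p q x y;
               Sx = emp_cov {..<n} p p x x; Sy = emp_cov {..<n} q q y y
           in colar_stage1 Sx0 Sy0 Sxy0 l1 (F \<omega>) \<and>
              first_singular_vectors (F \<omega>) (a0 \<omega>) (b0 \<omega>) \<and>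
              (\<exists>xt. colar_stage2 Sx1 Sxy1 l2 (b0 \<omega>) xt \<and> a \<omega> = colar_stage3 Sx xt) \<and>
              (\<exists>yt. colar_stage2 Sy1 (Sxy1\<^sup>T) l2 (a0 \<omega>) yt \<and> b \<omega> = colar_stage3 Sy yt)))"

end

theory Submission
  imports Defs
begin

text \<open>
  All randomness is confined to an event of probability tending to one on which entries and the
  normalization \<open>U\<^sup>T \<Sigma>\<^sub>x U = V\<^sup>T \<Sigma>\<^sub>y V = 1\<close> are reproduced by the empirical covariances up to order
  \<open>\<lambda>\<close>, and a restricted eigenvalue inequality \<open>x\<^sup>T A x \<ge> c |x|\<^sub>2\<^sup>2 - \<nu> |x|\<^sub>1\<^sup>2\<close> with \<open>\<nu>\<close> of order \<open>\<lambda>\<^sup>2\<close>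
  holds. By Maurey's argument the latter needs only lower tails at the \<open>(2 p)\<^sup>m\<close> sums of \<open>m\<close> signed unit
  vectors.

  Stage 1 maximizes a linear functional over an intersection of a nuclear and an operator norm ball.
  Duality of these norms and the spectral gap give quadratic growth in the Frobenius norm around the
  rank one matrix \<open>\<alpha>\<^sub>0 \<beta>\<^sub>0\<^sup>T\<close>, normalized by the empirical covariances. Compared with the entrywise noise
  on a support of at most \<open>s\<^sup>2\<close> entries, this bounds the error of \<open>F\<close>, hence of its first singular vectors,
  by a multiple of \<open>s \<lambda>\<close>.

  Stage 2 is a Lasso for \<open>\<Sum>\<^sub>k \<Lambda>\<^sub>k (v\<^sub>k\<^sup>T \<Sigma>\<^sub>y b) u\<^sub>k\<close>, where \<open>b\<close> is the first stage vector; its noise is entrywise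
  of order \<open>\<lambda>\<close> because \<open>b\<close> is independent of the second half. The components with \<open>k > 1\<close> are a bias,
  controlled by the error of the first stage. They are absent for \<open>r = 1\<close>, where the rate is therefore the
  Lasso rate \<open>\<surd>s \<lambda>\<close> instead of \<open>s \<lambda>\<close>.
\<close>

section \<open>Symmetric matrices and matrix norms\<close>

text \<open>The penalty thresholds are chosen before the tolerance \<delta> of the O_p statement. So
  at one fixed deviation level \<open>t * \<theta>\<close> the failure probability must tend to 0,
  not merely be small. The union bounds leave a term of order 1 / \<open>max p q\<close>; it
  vanishes because the normalization forces \<open>1 \<le> s\<close>, and then s = o(p) makes p tend
  to infinity. Entrywise accuracy \<lambda> of the covariances is too weak for curvature: the l1
  norm of the first stage error may be s times its Frobenius norm, and the relative loss s^2
  \<lambda> need not be small. Sampling sums of m vectors, with m of order 1 / \<lambda>^2, lowers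
  the loss to the order (s \<lambda>)^2. The constraint set of the first stage is random, so the
  population maximizer need not be feasible; hence the empirical normalization of the comparison
  matrix. Dimensions vary with n. Vectors are therefore functions on the natural numbers of which
  only the first coordinates count, and every form takes the dimension as an argument.\<close>

definition ip :: "nat \<Rightarrow> (nat \<Rightarrow> real) \<Rightarrow> (nat \<Rightarrow> real) \<Rightarrow> real" where
  "ip n x y = (\<Sum>i<n. x i * y i)"

definition mv :: "nat \<Rightarrow> (nat \<Rightarrow> nat \<Rightarrow> real) \<Rightarrow> (nat \<Rightarrow> real) \<Rightarrow> nat \<Rightarrow> real" where
  "mv n A x = (\<lambda>i. \<Sum>j<n. A i j * x j)"

lemma ip_commute: "ip n x y = ip n y x"
  by (simp add: ip_def mult.commute)

lemma ip_add_left: "ip n (\<lambda>i. x i + y i) z = ip n x z + ip n y z"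
  and ip_add_right: "ip n z (\<lambda>i. x i + y i) = ip n z x + ip n z y"
  and ip_diff_left: "ip n (\<lambda>i. x i - y i) z = ip n x z - ip n y z"
  and ip_diff_right: "ip n z (\<lambda>i. x i - y i) = ip n z x - ip n z y"
  and ip_scale_left: "ip n (\<lambda>i. c * x i) z = c * ip n x z"
  and ip_scale_right: "ip n z (\<lambda>i. c * x i) = c * ip n z x"
  by (simp_all add: ip_def algebra_simps sum.distrib sum_subtractf sum_distrib_left)

lemma ip_sum_left: "ip n (\<lambda>i. \<Sum>k\<in>K. f k i) z = (\<Sum>k\<in>K. ip n (f k) z)"
  unfolding ip_def by (simp add: sum_distrib_right) (rule sum.swap)

lemma ip_sum_right: "ip n z (\<lambda>i. \<Sum>k\<in>K. f k i) = (\<Sum>k\<in>K. ip n z (f k))"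
  by (simp add: ip_commute[of n z] ip_sum_left)

lemmas ip_bilinear = ip_add_left ip_add_right ip_diff_left ip_diff_right ip_scale_left
  ip_scale_right ip_sum_left ip_sum_right

lemma ip_cong: "(\<And>i. i < n \<Longrightarrow> x i = x' i) \<Longrightarrow> (\<And>i. i < n \<Longrightarrow> y i = y' i) \<Longrightarrow> ip n x y = ip n x' y'"
  by (simp add: ip_def)

lemma ip_nonneg [simp]: "0 \<le> ip n x x"
  by (simp add: ip_def sum_nonneg)

lemma ip_eq_0_iff: "ip n x x = 0 \<longleftrightarrow> (\<forall>i<n. x i = 0)"
  by (auto simp: ip_def sum_nonneg_eq_0_iff)

lemma ip_cauchy_schwarz: "\<bar>ip n x y\<bar> \<le> sqrt (ip n x x) * sqrt (ip n y y)"
proof -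
  have "(ip n x y)\<^sup>2 \<le> ip n x x * ip n y y"
    using Cauchy_Schwarz_ineq_sum[of x y "{..<n}"] by (simp add: ip_def power2_eq_square)
  then have "sqrt ((ip n x y)\<^sup>2) \<le> sqrt (ip n x x * ip n y y)" by (rule real_sqrt_le_mono)
  then show ?thesis by (simp add: real_sqrt_mult)
qed

lemma mv_add: "mv n A (\<lambda>i. x i + y i) = (\<lambda>i. mv n A x i + mv n A y i)"
  and mv_diff: "mv n A (\<lambda>i. x i - y i) = (\<lambda>i. mv n A x i - mv n A y i)"
  and mv_scale: "mv n A (\<lambda>i. c * x i) = (\<lambda>i. c * mv n A x i)"
  by (auto simp: mv_def algebra_simps sum.distrib sum_subtractf sum_distrib_left)

lemma mv_sum: "mv n A (\<lambda>i. \<Sum>k\<in>K. f k i) = (\<lambda>i. \<Sum>k\<in>K. mv n A (f k) i)"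
  unfolding mv_def by (rule ext, simp add: sum_distrib_left) (rule sum.swap)

lemma mv_diff_mat: "mv n (\<lambda>i j. A i j - B i j) x = (\<lambda>i. mv n A x i - mv n B x i)"
  by (auto simp: mv_def algebra_simps sum_subtractf)

lemma mv_cong: "(\<And>i. i < n \<Longrightarrow> x i = y i) \<Longrightarrow> mv n A x = mv n A y"
  by (simp add: mv_def)

lemma ip_mv_transpose: "ip p x (mv q A y) = ip q (mv p (\<lambda>i j. A j i) x) y"
  unfolding ip_def mv_def
  by (simp add: sum_distrib_left sum_distrib_right mult_ac) (rule sum.swap)

lemma ip_mv_symmetric:
  assumes "\<And>i j. i < n \<Longrightarrow> j < n \<Longrightarrow> A i j = A j i"
  shows "ip n x (mv n A y) = ip n (mv n A x) y"
  unfolding ip_mv_transpose by (rule ip_cong) (auto simp: mv_def assms)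

definition unitv :: "nat \<Rightarrow> nat \<Rightarrow> real" where
  "unitv i = (\<lambda>j. of_bool (j = i))"

lemma ip_unitv: "i < n \<Longrightarrow> ip n (unitv i) x = x i" "i < n \<Longrightarrow> ip n x (unitv i) = x i"
  by (simp_all add: ip_def unitv_def of_bool_def if_distrib if_distribR cong: if_cong)

lemma mv_unitv: "i < n \<Longrightarrow> mv n A (unitv i) = (\<lambda>k. A k i)"
  by (rule ext) (simp add: mv_def unitv_def of_bool_def if_distrib if_distribR cong: if_cong)

section \<open>Orthonormal systems in coordinates\<close>

definition orthonormal :: "nat \<Rightarrow> nat \<Rightarrow> (nat \<Rightarrow> nat \<Rightarrow> real) \<Rightarrow> bool" where
  "orthonormal n k v \<longleftrightarrow> (\<forall>i<k. \<forall>j<k. ip n (v i) (v j) = of_bool (i = j))"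

text \<open>Pythagoras. As the left side is nonnegative, Bessel's inequality follows, and equality
  in it forces the residual to vanish.\<close>

lemma orthonormal_residual:
  assumes "orthonormal n k v"
  shows "ip n (\<lambda>i. x i - (\<Sum>j<k. ip n x (v j) * v j i)) (\<lambda>i. x i - (\<Sum>j<k. ip n x (v j) * v j i))
    = ip n x x - (\<Sum>j<k. (ip n x (v j))\<^sup>2)"
proof -
  define y where "y = (\<lambda>i. \<Sum>j<k. ip n x (v j) * v j i)"
  have xy: "ip n x y = (\<Sum>j<k. (ip n x (v j))\<^sup>2)"
    by (simp add: y_def ip_sum_right ip_scale_right power2_eq_square)
  have vy: "ip n (v l) y = ip n x (v l)" if "l < k" for l
  proof -
    have "ip n (v l) y = (\<Sum>j<k. ip n x (v j) * of_bool (l = j))"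
      unfolding y_def using assms that by (simp add: ip_sum_right ip_scale_right orthonormal_def)
    also have "\<dots> = ip n x (v l)"
      using that by (simp add: of_bool_def if_distrib if_distribR cong: if_cong)
    finally show ?thesis .
  qed
  have "ip n y y = (\<Sum>j<k. ip n x (v j) * ip n (v j) y)"
    by (subst (1) y_def) (simp add: ip_sum_left ip_scale_left)
  also have "\<dots> = (\<Sum>j<k. (ip n x (v j))\<^sup>2)"
    by (simp add: vy power2_eq_square)
  finally have yy: "ip n y y = (\<Sum>j<k. (ip n x (v j))\<^sup>2)" .
  have "ip n (\<lambda>i. x i - y i) (\<lambda>i. x i - y i) = ip n x x - 2 * ip n x y + ip n y y"
    by (simp add: ip_diff_left ip_diff_right ip_commute[of n y x])
  with xy yy show ?thesis by (simp add: y_def)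
qed

text \<open>This count, the trace of the projection onto the span, takes the place of dimension
  theory: it gives completeness for \<open>k = n\<close> and a vector outside the span for
  \<open>k < n\<close>.\<close>

lemma sum_orthonormal_coordinates:
  assumes "orthonormal n k v"
  shows "(\<Sum>i<n. \<Sum>j<k. (ip n (unitv i) (v j))\<^sup>2) = real k"
proof -
  have "(\<Sum>i<n. \<Sum>j<k. (ip n (unitv i) (v j))\<^sup>2) = (\<Sum>i<n. \<Sum>j<k. v j i * v j i)"
    by (simp add: ip_unitv power2_eq_square)
  also have "\<dots> = (\<Sum>j<k. ip n (v j) (v j))" unfolding ip_def by (rule sum.swap)
  also have "\<dots> = real k" using assms by (simp add: orthonormal_def)
  finally show ?thesis .
qed

text \<open>The residuals of the \<open>n\<close> unit vectors have nonnegative squared lengths with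
  sum \<open>n - n = 0\<close>, so each unit vector lies in the span; expanding \<open>x\<close> in
  unit vectors finishes the argument.\<close>

lemma orthonormal_complete:
  assumes v: "orthonormal n n v" and i: "i < n"
  shows "x i = (\<Sum>j<n. ip n x (v j) * v j i)"
proof -
  define e where "e l = ip n (unitv l) (unitv l) - (\<Sum>j<n. (ip n (unitv l) (v j))\<^sup>2)" for l
  have e0: "e l \<ge> 0" for l
    unfolding e_def orthonormal_residual[OF v, symmetric] by simp
  have "(\<Sum>l<n. e l) = 0"
    unfolding e_def sum_subtractf using sum_orthonormal_coordinates[OF v]
    by (simp add: ip_unitv) (simp add: unitv_def)
  then have el: "e l = 0" if "l < n" for l
    using e0 that by (simp add: sum_nonneg_eq_0_iff)
  have key: "unitv l i = (\<Sum>j<n. v j l * v j i)" if l: "l < n" for l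
  proof -
    have "ip n (\<lambda>i. unitv l i - (\<Sum>j<n. ip n (unitv l) (v j) * v j i))
        (\<lambda>i. unitv l i - (\<Sum>j<n. ip n (unitv l) (v j) * v j i)) = 0"
      using el[OF l] unfolding e_def orthonormal_residual[OF v] .
    with i show ?thesis unfolding ip_eq_0_iff by (simp add: ip_unitv(1)[OF l])
  qed
  have "(\<Sum>j<n. ip n x (v j) * v j i) = (\<Sum>j<n. \<Sum>l<n. x l * (v j l * v j i))"
    by (simp add: ip_def sum_distrib_right sum_distrib_left mult_ac)
  also have "\<dots> = (\<Sum>l<n. \<Sum>j<n. x l * (v j l * v j i))" by (rule sum.swap)
  also have "\<dots> = (\<Sum>l<n. x l * unitv l i)"
    by (simp add: key sum_distrib_left)
  also have "\<dots> = x i"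
    using i by (simp add: unitv_def of_bool_def if_distrib if_distribR cong: if_cong)
  finally show ?thesis by simp
qed

lemma orthonormal_parseval:
  assumes "orthonormal n n v"
  shows "ip n x y = (\<Sum>j<n. ip n x (v j) * ip n y (v j))"
proof -
  have "ip n x y = ip n (\<lambda>i. \<Sum>j<n. ip n x (v j) * v j i) y"
    by (rule ip_cong) (simp_all add: orthonormal_complete[OF assms, of _ x, symmetric])
  then show ?thesis by (simp add: ip_sum_left ip_scale_left ip_commute[of n y])
qed

text \<open>If no unit vector left a residual, the count would give \<open>n \<le> k\<close>. A
  nonzero residual, normalized, is the required vector.\<close>

lemma exists_unit_orthogonal:
  assumes v: "orthonormal n k v" and k: "k < n"
  shows "\<exists>x. ip n x x = 1 \<and> (\<forall>j<k. ip n x (v j) = 0)"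
proof -
  have "\<exists>l<n. (\<Sum>j<k. (ip n (unitv l) (v j))\<^sup>2) < 1"
  proof (rule ccontr)
    assume "\<not> ?thesis"
    then have "(\<Sum>l<n. 1) \<le> (\<Sum>l<n. \<Sum>j<k. (ip n (unitv l) (v j))\<^sup>2)"
      by (intro sum_mono) (metis lessThan_iff not_less)
    with sum_orthonormal_coordinates[OF v] k show False by simp
  qed
  then obtain l where l: "l < n" "(\<Sum>j<k. (ip n (unitv l) (v j))\<^sup>2) < 1" by blast
  define y where "y = (\<lambda>i. unitv l i - (\<Sum>j<k. ip n (unitv l) (v j) * v j i))"
  have yy: "ip n y y > 0"
    unfolding y_def orthonormal_residual[OF v] using l by (simp add: ip_unitv) (simp add: unitv_def)
  have yv: "ip n y (v j) = 0" if "j < k" for j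
  proof -
    have "ip n y (v j) = ip n (unitv l) (v j) - (\<Sum>m<k. ip n (unitv l) (v m) * of_bool (m = j))"
      unfolding y_def using v that
      by (simp add: ip_diff_left ip_sum_left ip_scale_left orthonormal_def)
    then show ?thesis using that by (simp add: of_bool_def if_distrib if_distribR cong: if_cong)
  qed
  show ?thesis
    by (rule exI[of _ "\<lambda>i. (1 / sqrt (ip n y y)) * y i"])
      (use yy yv in \<open>simp only: ip_scale_left ip_scale_right, simp\<close>)
qed

section \<open>Spectral theorem through Rayleigh quotients\<close>

lemma compact_unit_box: "compact {x::nat \<Rightarrow> real. \<forall>i. x i \<in> (if i < n then {-1..1} else {0})}"
proof -
  \<comment> \<open>Tychonoff in the product topology. The coordinates from \<open>n\<close> on do
    not enter \<open>ip\<close>, so they are fixed at 0; left free, they would destroy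
    compactness.\<close>
  have "compactin (product_topology (\<lambda>i. euclidean) UNIV)
      (PiE UNIV (\<lambda>i. if i < n then {-1..1::real} else {0}))"
    by (subst compactin_PiE) auto
  then show ?thesis
    by (simp only: euclidean_product_topology compactin_euclidean_iff PiE_def Pi_def extensional_UNIV
        UNIV_I simp_thms Int_UNIV_right mem_Collect_eq)
qed

text \<open>The Rayleigh quotient attains its maximum on the unit sphere of the orthogonal
  complement. The inequality is homogeneous in \<open>y\<close>, so that it can be tested at
  unnormalized perturbations of \<open>x\<close>.\<close>

lemma exists_constrained_maximizer:
  assumes v: "orthonormal n k v" and k: "k < n"
  shows "\<exists>x. ip n x x = 1 \<and> (\<forall>j<k. ip n x (v j) = 0) \<and>
    (\<forall>y. (\<forall>j<k. ip n y (v j) = 0) \<longrightarrow> ip n y (mv n A y) \<le> ip n x (mv n A x) * ip n y y)"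
proof -
  let ?B = "{x::nat \<Rightarrow> real. \<forall>i. x i \<in> (if i < n then {-1..1} else {0})}"
  define K where "K = ?B \<inter> ({x. ip n x x = 1} \<inter> (\<Inter>j<k. {x. ip n x (v j) = 0}))"
  have cont: "continuous_on UNIV (\<lambda>x. ip n (f x) (g x))"
    if "\<And>i. continuous_on UNIV (\<lambda>x. f x i)" "\<And>i. continuous_on UNIV (\<lambda>x. g x i)"
    for f g :: "(nat \<Rightarrow> real) \<Rightarrow> nat \<Rightarrow> real"
    unfolding ip_def by (intro continuous_intros that)
  have c1: "continuous_on UNIV (\<lambda>x. ip n x x)" and c2: "continuous_on UNIV (\<lambda>x. ip n x w)"
    and c3: "continuous_on UNIV (\<lambda>x. ip n x (mv n A x))" for w
    by (rule cont; (simp add: mv_def)?; intro continuous_intros; simp)+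
  have comp: "compact K" unfolding K_def
    by (intro compact_Int_closed compact_unit_box closed_Int closed_INT ballI
        closed_Collect_eq c1 c2 continuous_on_const)
  \<comment> \<open>Truncation to the first \<open>n\<close> coordinates changes no inner product
    and moves an admissible unit vector into the compact set.\<close>
  have restr: "(\<lambda>i. if i < n then y i else 0) \<in> K"
    if "ip n y y = 1" "\<forall>j<k. ip n y (v j) = 0" for y
  proof -
    have "\<bar>y i\<bar> \<le> 1" if "i < n" for i
    proof -
      have "(y i)\<^sup>2 \<le> ip n y y"
        unfolding ip_def power2_eq_square using that by (intro member_le_sum) auto
      with \<open>ip n y y = 1\<close> show ?thesis by (simp add: abs_square_le_1)
    qed
    moreover have "ip n (\<lambda>i. if i < n then y i else 0) (\<lambda>i. if i < n then y i else 0) = ip n y y"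
      "ip n (\<lambda>i. if i < n then y i else 0) w = ip n y w" for w
      by (simp_all add: ip_def)
    ultimately show ?thesis using that by (auto simp: K_def abs_le_iff) 
  qed
  obtain x0 where "ip n x0 x0 = 1" "\<forall>j<k. ip n x0 (v j) = 0"
    using exists_unit_orthogonal[OF v k] by blast
  then have "K \<noteq> {}" using restr[of x0] by (metis empty_iff)
  with comp have "\<exists>x\<in>K. \<forall>y\<in>K. ip n y (mv n A y) \<le> ip n x (mv n A x)"
    by (rule continuous_attains_sup) (rule continuous_on_subset[OF c3 subset_UNIV])
  then obtain x where x: "x \<in> K" "\<And>y. y \<in> K \<Longrightarrow> ip n y (mv n A y) \<le> ip n x (mv n A x)"
    by metis
  have "ip n y (mv n A y) \<le> ip n x (mv n A x) * ip n y y" if y: "\<forall>j<k. ip n y (v j) = 0" for y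
  proof (cases "ip n y y = 0")
    case True
    then have "\<forall>i<n. y i = 0" by (simp add: ip_eq_0_iff)
    then have "ip n y (mv n A y) = 0" by (simp add: ip_def)
    with True show ?thesis by simp
  next
    case False
    then have pos: "ip n y y > 0" by (metis ip_nonneg less_eq_real_def)
    define z where "z = (\<lambda>i. (1 / sqrt (ip n y y)) * y i)"
    have zz: "ip n z z = 1" and zv: "\<forall>j<k. ip n z (v j) = 0"
      using pos y unfolding z_def by (simp_all only: ip_scale_left ip_scale_right, simp_all)
    define z' where "z' = (\<lambda>i. if i < n then z i else 0)"
    have "mv n A z' = mv n A z" by (rule mv_cong) (simp add: z'_def)
    then have "ip n z' (mv n A z') = ip n z (mv n A z)"
      by (auto intro!: ip_cong simp: z'_def)
    moreover have "z' \<in> K" unfolding z'_def by (rule restr[OF zz zv])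
    ultimately have "ip n z (mv n A z) \<le> ip n x (mv n A x)" using x(2) by metis
    moreover have "ip n z (mv n A z) = ip n y (mv n A y) / ip n y y"
      using pos unfolding z_def mv_scale by (simp only: ip_scale_left ip_scale_right, simp)
    ultimately show ?thesis using pos by (simp add: pos_divide_le_eq)
  qed
  with x(1) show ?thesis by (auto simp: K_def)
qed

text \<open>Eigenvectors are produced one at a time: the maximizer of the Rayleigh quotient
  orthogonal to those already found is a further eigenvector, since the residual \<open>w\<close> of
  its eigenvalue equation vanishes by a first order condition.\<close>

lemma spectral_theorem:
  assumes sym: "\<And>i j. i < n \<Longrightarrow> j < n \<Longrightarrow> A i j = A j i"
  obtains v d where "orthonormal n n v" "\<And>k i. k < n \<Longrightarrow> i < n \<Longrightarrow> mv n A (v k) i = d k * v k i"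
proof -
  have "\<exists>v d. orthonormal n k v \<and> (\<forall>j<k. \<forall>i<n. mv n A (v j) i = d j * v j i)" if "k \<le> n" for k
    using that
  proof (induction k)
    case 0
    then show ?case by (simp add: orthonormal_def)
  next
    case (Suc k)
    then obtain v d where v: "orthonormal n k v" and
      ev: "\<And>j i. j < k \<Longrightarrow> i < n \<Longrightarrow> mv n A (v j) i = d j * v j i" by auto
    obtain x where xx: "ip n x x = 1" and xv: "\<forall>j<k. ip n x (v j) = 0" and
      mx: "\<And>y. (\<forall>j<k. ip n y (v j) = 0) \<Longrightarrow> ip n y (mv n A y) \<le> ip n x (mv n A x) * ip n y y"
      using exists_constrained_maximizer[OF v, of A] Suc.prems by auto
    define \<mu> where "\<mu> = ip n x (mv n A x)"
    \<comment> \<open>\<open>h\<close> is the form of \<open>\<mu> - A\<close>: nonnegative on the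
      complement and zero at the maximizer \<open>x\<close>.\<close>
    define h where "h y z = \<mu> * ip n y z - ip n y (mv n A z)" for y z
    define w where "w = (\<lambda>i. \<mu> * x i - mv n A x i)"
    have wv: "\<forall>j<k. ip n w (v j) = 0"
    proof (intro allI impI)
      fix j assume j: "j < k"
      have "ip n (mv n A x) (v j) = ip n x (mv n A (v j))"
        using ip_mv_symmetric[of n A, OF sym] by simp
      also have "\<dots> = ip n x (\<lambda>i. d j * v j i)" by (rule ip_cong) (simp_all add: ev j)
      finally show "ip n w (v j) = 0" using xv j by (simp add: w_def ip_bilinear)
    qed
    have hnn: "0 \<le> h y y" if "\<forall>j<k. ip n y (v j) = 0" for y
      using mx[OF that] by (simp add: h_def \<mu>_def)
    have hxx: "h x x = 0" using xx by (simp add: h_def \<mu>_def)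
    have ww: "h x w = ip n w w"
    proof -
      have "ip n x (mv n A w) = ip n (mv n A x) w" using ip_mv_symmetric[of n A, OF sym] by simp
      then have "h x w = \<mu> * ip n x w - ip n (mv n A x) w" by (simp add: h_def)
      also have "\<dots> = ip n w w" by (subst (3) w_def) (simp add: ip_bilinear)
      finally show ?thesis .
    qed
    have sym_h: "h w x = h x w"
      unfolding h_def using ip_mv_symmetric[of n A, OF sym] by (simp add: ip_commute)
    \<comment> \<open>\<open>w\<close> is orthogonal to the earlier eigenvectors, so
      \<open>x + t w\<close> is admissible for every \<open>t\<close>.\<close>
    have poly: "0 \<le> 2 * t * ip n w w + t\<^sup>2 * h w w" for t
    proof -
      have "0 \<le> h (\<lambda>i. x i + t * w i) (\<lambda>i. x i + t * w i)"
        by (rule hnn) (use wv xv in \<open>simp add: ip_bilinear\<close>)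
      also have "\<dots> = h x x + t * h x w + t * h w x + t\<^sup>2 * h w w"
        by (simp add: h_def mv_add mv_scale ip_bilinear power2_eq_square algebra_simps)
      finally show ?thesis by (simp add: hxx sym_h ww)
    qed
    have "ip n w w = 0"
    proof (rule ccontr)
      assume "ip n w w \<noteq> 0"
      then have pos: "ip n w w > 0" by (metis ip_nonneg less_eq_real_def)
      have hw: "h w w \<ge> 0" by (rule hnn[OF wv])
      \<comment> \<open>A negative \<open>t\<close> so small that the linear term outweighs the
        quadratic one; the added 1 avoids a division by 0.\<close>
      define t where "t = - ip n w w / (h w w + 1)"
      have t: "t < 0" using pos hw by (simp add: t_def divide_neg_pos)
      have "2 * t * ip n w w + t\<^sup>2 * h w w = t * (2 * ip n w w + t * h w w)"
        by (simp add: power2_eq_square algebra_simps)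
      moreover have "t * h w w \<ge> - ip n w w"
        using pos hw by (simp add: t_def field_simps)
      ultimately have "2 * t * ip n w w + t\<^sup>2 * h w w < 0"
        using t pos by (simp add: mult_neg_pos)
      with poly[of t] show False by simp
    qed
    then have ex: "mv n A x i = \<mu> * x i" if "i < n" for i
      using that by (simp add: ip_eq_0_iff w_def)
    define v' where "v' = v(k := x)"
    have "orthonormal n (Suc k) v'"
      unfolding orthonormal_def v'_def using v xv xx
      by (auto simp: orthonormal_def less_Suc_eq ip_commute)
    moreover have "\<forall>j<Suc k. \<forall>i<n. mv n A (v' j) i = (d(k := \<mu>)) j * v' j i"
      using ev ex by (auto simp: v'_def less_Suc_eq)
    ultimately show ?case by blast
  qed
  from this[of n] that show ?thesis by auto
qed

lemma spectral_expansion: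
  assumes v: "orthonormal n n v" and ev: "\<And>k i. k < n \<Longrightarrow> i < n \<Longrightarrow> mv n A (v k) i = d k * v k i"
    and i: "i < n" and j: "j < n"
  shows "A i j = (\<Sum>k<n. d k * v k i * v k j)"
proof -
  have "A i j = mv n A (unitv j) i" using j by (simp add: mv_unitv)
  also have "mv n A (unitv j) = mv n A (\<lambda>i. \<Sum>k<n. ip n (unitv j) (v k) * v k i)"
    by (rule mv_cong) (rule orthonormal_complete[OF v])
  also have "\<dots> i = (\<Sum>k<n. d k * v k i * v k j)"
    using i j by (simp add: mv_sum mv_scale ip_unitv ev) (simp add: mult_ac)
  finally show ?thesis .
qed

lemma spectral_quadratic_form:
  assumes v: "orthonormal n n v" and ev: "\<And>k i. k < n \<Longrightarrow> i < n \<Longrightarrow> mv n A (v k) i = d k * v k i"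
  shows "ip n x (mv n A y) = (\<Sum>k<n. d k * ip n x (v k) * ip n y (v k))"
proof -
  have "mv n A y = mv n A (\<lambda>i. \<Sum>k<n. ip n y (v k) * v k i)"
    by (rule mv_cong) (rule orthonormal_complete[OF v])
  also have "\<dots> = (\<lambda>i. \<Sum>k<n. ip n y (v k) * mv n A (v k) i)"
    by (simp add: mv_sum mv_scale)
  finally have "ip n x (mv n A y) = ip n x (\<lambda>i. \<Sum>k<n. (d k * ip n y (v k)) * v k i)"
    by (auto intro!: ip_cong sum.cong simp: ev)
  then show ?thesis by (simp add: ip_sum_right ip_scale_right) (simp add: mult_ac)
qed

section \<open>Matrices as coordinate functions\<close>

abbreviation ent :: "real mat \<Rightarrow> nat \<Rightarrow> nat \<Rightarrow> real" where
  "ent A \<equiv> \<lambda>i j. A $$ (i, j)"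

lemma scalar_prod_ip: "dim_vec y = n \<Longrightarrow> x \<bullet> y = ip n (($) x) (($) y)"
  by (simp add: scalar_prod_def ip_def atLeast0LessThan)

lemma mult_mat_vec_mv:
  "A \<in> carrier_mat p q \<Longrightarrow> x \<in> carrier_vec q \<Longrightarrow> i < p \<Longrightarrow> (A *\<^sub>v x) $ i = mv q (ent A) (($) x) i"
  by (auto simp: scalar_prod_def mv_def atLeast0LessThan intro!: sum.cong)

lemma mult_mat_entry:
  "A \<in> carrier_mat p q \<Longrightarrow> C \<in> carrier_mat q m \<Longrightarrow> i < p \<Longrightarrow> j < m \<Longrightarrow>
    (A * C) $$ (i, j) = (\<Sum>k<q. A $$ (i, k) * C $$ (k, j))"
  by (auto simp: scalar_prod_def atLeast0LessThan intro!: sum.cong)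

lemma mv_mult_mat:
  "A \<in> carrier_mat p q \<Longrightarrow> C \<in> carrier_mat q m \<Longrightarrow> i < p \<Longrightarrow>
    mv m (ent (A * C)) x i = mv q (ent A) (mv m (ent C) x) i"
proof -
  assume a: "A \<in> carrier_mat p q" "C \<in> carrier_mat q m" "i < p"
  then have "mv m (ent (A * C)) x i = (\<Sum>j<m. \<Sum>k<q. A $$ (i, k) * C $$ (k, j) * x j)"
    unfolding mv_def by (intro sum.cong) (simp_all add: mult_mat_entry sum_distrib_right del: index_mult_mat)
  also have "\<dots> = (\<Sum>k<q. \<Sum>j<m. A $$ (i, k) * C $$ (k, j) * x j)" by (rule sum.swap)
  finally show ?thesis by (simp add: mv_def sum_distrib_left mult_ac)
qed

lemma quadratic_form_ip:
  assumes "A \<in> carrier_mat p q" "x \<in> carrier_vec p" "y \<in> carrier_vec q"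
  shows "x \<bullet> (A *\<^sub>v y) = ip p (($) x) (mv q (ent A) (($) y))"
proof -
  have "x \<bullet> (A *\<^sub>v y) = ip p (($) x) (($) (A *\<^sub>v y))" using assms by (intro scalar_prod_ip) simp
  also have "\<dots> = ip p (($) x) (mv q (ent A) (($) y))"
    by (rule ip_cong) (simp_all add: mult_mat_vec_mv[OF assms(1,3)] del: index_mult_mat_vec)
  finally show ?thesis .
qed

section \<open>Positive semidefinite matrices and square roots\<close>

lemma psd_iff:
  assumes A: "A \<in> carrier_mat n n"
  shows "psd A \<longleftrightarrow> (\<forall>i<n. \<forall>j<n. A $$ (i, j) = A $$ (j, i)) \<and> (\<forall>x. 0 \<le> ip n x (mv n (ent A) x))"
    (is "_ \<longleftrightarrow> ?s \<and> ?q")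
proof -
  have "A\<^sup>T = A \<longleftrightarrow> ?s"
  proof
    assume t: "A\<^sup>T = A"
    show ?s
    proof (intro allI impI)
      fix i j assume "i < n" "j < n"
      then have "A\<^sup>T $$ (i, j) = A $$ (j, i)" using A by simp
      with t show "A $$ (i, j) = A $$ (j, i)" by simp
    qed
  qed (use A in \<open>auto intro!: eq_matI\<close>)
  moreover have "(\<forall>v\<in>carrier_vec n. 0 \<le> v \<bullet> (A *\<^sub>v v)) \<longleftrightarrow> ?q"
  proof
    assume h: "\<forall>v\<in>carrier_vec n. 0 \<le> v \<bullet> (A *\<^sub>v v)"
    show ?q
    proof
      fix x
      have "0 \<le> Matrix.vec n x \<bullet> (A *\<^sub>v Matrix.vec n x)" using h by simp
      also have "\<dots> = ip n (($) (Matrix.vec n x)) (mv n (ent A) (($) (Matrix.vec n x)))"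
        by (rule quadratic_form_ip[OF A]) auto
      also have "mv n (ent A) (($) (Matrix.vec n x)) = mv n (ent A) x" by (rule mv_cong) simp
      also have "ip n (($) (Matrix.vec n x)) (mv n (ent A) x) = ip n x (mv n (ent A) x)"
        by (rule ip_cong) simp_all
      finally show "0 \<le> ip n x (mv n (ent A) x)" .
    qed
  qed (simp add: quadratic_form_ip[OF A])
  ultimately show ?thesis using A by (simp add: psd_def)
qed

text \<open>On a unit eigenvector v of \<open>X - Z\<close> with eigenvalue d, equality of the
  squares gives 0 = |Xv|^2 - |Zv|^2 = d ((v, Xv) + (v, Zv)). If d were nonzero, both nonnegative
  forms would vanish, and so would d, their difference.\<close>

lemma psd_square_unique:
  assumes X: "X \<in> carrier_mat n n" "psd X" and Z: "Z \<in> carrier_mat n n" "psd Z" and eq: "X * X = Z * Z"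
  shows "X = Z"
proof -
  define D where "D = (\<lambda>i j. X $$ (i, j) - Z $$ (i, j))"
  have sX: "\<And>i j. i < n \<Longrightarrow> j < n \<Longrightarrow> ent X i j = ent X j i" and pX: "\<And>x. 0 \<le> ip n x (mv n (ent X) x)"
    using X(2) unfolding psd_iff[OF X(1)] by auto
  have sZ: "\<And>i j. i < n \<Longrightarrow> j < n \<Longrightarrow> ent Z i j = ent Z j i" and pZ: "\<And>x. 0 \<le> ip n x (mv n (ent Z) x)"
    using Z(2) unfolding psd_iff[OF Z(1)] by auto
  obtain v d where v: "orthonormal n n v" and ev: "\<And>k i. k < n \<Longrightarrow> i < n \<Longrightarrow> mv n D (v k) i = d k * v k i"
    using spectral_theorem[of n D] sX sZ by (auto simp: D_def)
  have sq: "ip n (mv n (ent W) x) (mv n (ent W) x) = ip n x (mv n (ent (W * W)) x)"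
    if "W \<in> carrier_mat n n" "\<And>i j. i < n \<Longrightarrow> j < n \<Longrightarrow> ent W i j = ent W j i" for W x
  proof -
    have "ip n x (mv n (ent (W * W)) x) = ip n x (mv n (ent W) (mv n (ent W) x))"
      by (rule ip_cong) (simp_all add: mv_mult_mat[OF that(1) that(1)] del: index_mult_mat)
    also have "\<dots> = ip n (mv n (ent W) x) (mv n (ent W) x)" by (rule ip_mv_symmetric[OF that(2)])
    finally show ?thesis by simp
  qed
  have "d k = 0" if k: "k < n" for k
  proof (rule ccontr)
    assume dk: "d k \<noteq> 0"
    let ?x = "mv n (ent X) (v k)" and ?z = "mv n (ent Z) (v k)"
    have diff: "?x i - ?z i = d k * v k i" if "i < n" for i
      using ev[OF k that] by (simp add: D_def mv_diff_mat)
    have "ip n ?x ?x = ip n (v k) (mv n (ent (X * X)) (v k))" by (rule sq[OF X(1) sX])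
    also have "\<dots> = ip n ?z ?z" unfolding eq by (rule sq[OF Z(1) sZ, symmetric])
    finally have "0 = ip n ?x ?x - ip n ?z ?z" by simp
    also have "\<dots> = ip n (\<lambda>i. ?x i - ?z i) (\<lambda>i. ?x i + ?z i)"
      by (simp add: ip_bilinear ip_commute)
    also have "\<dots> = ip n (\<lambda>i. d k * v k i) (\<lambda>i. ?x i + ?z i)"
      by (rule ip_cong) (simp_all add: diff)
    also have "\<dots> = d k * (ip n (v k) ?x + ip n (v k) ?z)" by (simp add: ip_bilinear distrib_left)
    finally have "ip n (v k) ?x + ip n (v k) ?z = 0" using dk by simp
    then have "ip n (v k) ?x = 0" "ip n (v k) ?z = 0" using pX[of "v k"] pZ[of "v k"] by linarith+
    then have "0 = ip n (v k) (\<lambda>i. ?x i - ?z i)" by (simp add: ip_bilinear)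
    also have "\<dots> = ip n (v k) (\<lambda>i. d k * v k i)" by (rule ip_cong) (simp_all add: diff)
    also have "\<dots> = d k" using v k by (simp add: ip_bilinear orthonormal_def)
    finally show False using dk by simp
  qed
  then have "D i j = 0" if "i < n" "j < n" for i j
    using spectral_expansion[OF v ev that] by simp
  then show ?thesis using X Z by (intro eq_matI) (auto simp: D_def)
qed

lemma psd_sqrt_exists:
  assumes A: "A \<in> carrier_mat n n" "psd A"
  shows "\<exists>S. S \<in> carrier_mat n n \<and> psd S \<and> S * S = A"
proof -
  have sA: "\<And>i j. i < n \<Longrightarrow> j < n \<Longrightarrow> ent A i j = ent A j i" and pA: "\<And>x. 0 \<le> ip n x (mv n (ent A) x)"
    using A(2) unfolding psd_iff[OF A(1)] by auto
  obtain v d where v: "orthonormal n n v" and ev: "\<And>k i. k < n \<Longrightarrow> i < n \<Longrightarrow> mv n (ent A) (v k) i = d k * v k i"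
    using spectral_theorem[of n "ent A", OF sA] by blast
  have d: "0 \<le> d k" if "k < n" for k
  proof -
    have "ip n (v k) (mv n (ent A) (v k)) = ip n (v k) (\<lambda>i. d k * v k i)"
      by (rule ip_cong) (simp_all add: ev that)
    with pA[of "v k"] v that show ?thesis by (simp add: ip_bilinear orthonormal_def)
  qed
  define S where "S = Matrix.mat n n (\<lambda>(i, j). \<Sum>k<n. sqrt (d k) * v k i * v k j)"
  have S: "S \<in> carrier_mat n n" by (simp add: S_def)
  have mvS: "mv n (ent S) x i = (\<Sum>k<n. sqrt (d k) * ip n x (v k) * v k i)" if "i < n" for x i
  proof -
    have "mv n (ent S) x i = (\<Sum>j<n. \<Sum>k<n. sqrt (d k) * v k i * v k j * x j)"
      using that by (simp add: mv_def S_def sum_distrib_right)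
    also have "\<dots> = (\<Sum>k<n. \<Sum>j<n. sqrt (d k) * v k i * v k j * x j)" by (rule sum.swap)
    finally show ?thesis by (simp add: ip_def sum_distrib_left sum_distrib_right mult_ac)
  qed
  have "0 \<le> ip n x (mv n (ent S) x)" for x
  proof -
    have "ip n x (mv n (ent S) x) = ip n x (\<lambda>i. \<Sum>k<n. sqrt (d k) * ip n x (v k) * v k i)"
      by (rule ip_cong) (simp_all add: mvS)
    also have "\<dots> = (\<Sum>k<n. sqrt (d k) * (ip n x (v k) * ip n x (v k)))"
      by (simp add: ip_sum_right ip_scale_right) (simp add: mult_ac)
    also have "\<dots> \<ge> 0" by (intro sum_nonneg mult_nonneg_nonneg zero_le_square) (auto simp: d)
    finally show ?thesis .
  qed
  moreover have "ent S i j = ent S j i" if "i < n" "j < n" for i j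
    using that by (simp add: S_def mult_ac)
  ultimately have "psd S" unfolding psd_iff[OF S] by auto
  moreover have "S * S = A"
  proof (rule eq_matI)
    fix i j assume "i < dim_row A" "j < dim_col A"
    then have ij: "i < n" "j < n" using A by auto
    have col: "S $$ (k, j) = (\<Sum>m<n. sqrt (d m) * v m j * v m k)" if "k < n" for k
      using that ij by (simp add: S_def mult_ac)
    have "(S * S) $$ (i, j) = mv n (ent S) (\<lambda>k. S $$ (k, j)) i"
      using ij by (simp add: mult_mat_entry[OF S S] mv_def del: index_mult_mat)
    also have "\<dots> = (\<Sum>k<n. sqrt (d k) * ip n (\<lambda>k. S $$ (k, j)) (v k) * v k i)" by (rule mvS[OF ij(1)])
    also have "\<dots> = (\<Sum>k<n. sqrt (d k) * (sqrt (d k) * v k j) * v k i)"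
    proof (rule sum.cong)
      fix k assume "k \<in> {..<n}"
      then have k: "k < n" by simp
      have "ip n (\<lambda>k. S $$ (k, j)) (v k) = ip n (\<lambda>i. \<Sum>m<n. (sqrt (d m) * v m j) * v m i) (v k)"
        by (rule ip_cong) (simp_all add: col)
      also have "\<dots> = (\<Sum>m<n. (sqrt (d m) * v m j) * of_bool (m = k))"
        using v k by (simp add: ip_sum_left ip_scale_left orthonormal_def)
      also have "\<dots> = sqrt (d k) * v k j"
        using k by (simp add: of_bool_def if_distrib if_distribR cong: if_cong)
      finally show "sqrt (d k) * ip n (\<lambda>k. S $$ (k, j)) (v k) * v k i = sqrt (d k) * (sqrt (d k) * v k j) * v k i"
        by simp
    qed simp
    also have "\<dots> = (\<Sum>k<n. d k * v k i * v k j)"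
      by (intro sum.cong refl, simp only: mult.assoc[symmetric] real_sqrt_mult_self) (simp add: d)
    also have "\<dots> = A $$ (i, j)" by (rule spectral_expansion[OF v ev ij, symmetric])
    finally show "(S * S) $$ (i, j) = A $$ (i, j)" .
  qed (use A S in auto)
  ultimately show ?thesis using S by blast
qed

text \<open>Existence and uniqueness together make the definite description in
  \<open>psd_sqrt\<close> denote the root.\<close>

lemma psd_sqrt:
  assumes A: "A \<in> carrier_mat n n" "psd A"
  shows "psd_sqrt A \<in> carrier_mat n n" "psd (psd_sqrt A)" "psd_sqrt A * psd_sqrt A = A"
proof -
  have "\<exists>!S. S \<in> carrier_mat n n \<and> psd S \<and> S * S = A"
    using psd_sqrt_exists[OF A] psd_square_unique by metis
  from theI'[OF this] A(1)
  show "psd_sqrt A \<in> carrier_mat n n" "psd (psd_sqrt A)" "psd_sqrt A * psd_sqrt A = A"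
    by (simp_all add: psd_sqrt_def)
qed

lemma psd_sqrt_eqI:
  assumes S: "S \<in> carrier_mat n n" "psd S" and A: "A \<in> carrier_mat n n" "psd A" and "S * S = A"
  shows "psd_sqrt A = S"
  using psd_square_unique[OF psd_sqrt(1,2)[OF A] S] psd_sqrt(3)[OF A] assms(5) by simp

lemma ip_psd_sqrt:
  assumes A: "A \<in> carrier_mat n n" "psd A"
  shows "ip n (mv n (ent (psd_sqrt A)) x) (mv n (ent (psd_sqrt A)) y) = ip n x (mv n (ent A) y)"
proof -
  note S = psd_sqrt[OF A]
  have sS: "\<And>i j. i < n \<Longrightarrow> j < n \<Longrightarrow> ent (psd_sqrt A) i j = ent (psd_sqrt A) j i"
    using S(2) unfolding psd_iff[OF S(1)] by auto
  have "ip n x (mv n (ent A) y) = ip n x (mv n (ent (psd_sqrt A)) (mv n (ent (psd_sqrt A)) y))"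
    by (subst S(3)[symmetric], rule ip_cong) (simp_all add: mv_mult_mat[OF S(1) S(1)])
  then show ?thesis by (simp add: ip_mv_symmetric[of n "ent (psd_sqrt A)", OF sS])
qed

section \<open>Nuclear norm, operator norm and singular vectors\<close>

lemma gram_psd:
  assumes G: "G \<in> carrier_mat p q"
  shows "G\<^sup>T * G \<in> carrier_mat q q" "psd (G\<^sup>T * G)"
    "ip q x (mv q (ent (G\<^sup>T * G)) y) = ip p (mv q (ent G) x) (mv q (ent G) y)"
proof -
  show c: "G\<^sup>T * G \<in> carrier_mat q q" using G by simp
  have e: "(G\<^sup>T * G) $$ (i, j) = (\<Sum>k<p. G $$ (k, i) * G $$ (k, j))" if "i < q" "j < q" for i j
    using mult_mat_entry[of "G\<^sup>T" q p G q] that G by (auto intro!: sum.cong)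
  show qf: "ip q x (mv q (ent (G\<^sup>T * G)) y) = ip p (mv q (ent G) x) (mv q (ent G) y)" for x y
  proof -
    have "ip q x (mv q (ent (G\<^sup>T * G)) y) = ip q x (mv p (\<lambda>i j. ent G j i) (mv q (ent G) y))"
    proof (rule ip_cong)
      fix i assume "i < q"
      then have "mv q (ent (G\<^sup>T * G)) y i = mv p (ent (G\<^sup>T)) (mv q (ent G) y) i"
        using mv_mult_mat[of "G\<^sup>T" q p G q] G by auto
      also have "\<dots> = mv p (\<lambda>i j. ent G j i) (mv q (ent G) y) i"
        unfolding mv_def[of p] using G \<open>i < q\<close> by (auto intro!: sum.cong)
      finally show "mv q (ent (G\<^sup>T * G)) y i = mv p (\<lambda>i j. ent G j i) (mv q (ent G) y) i" .
    qed simp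
    then show ?thesis by (simp add: ip_mv_transpose[of p "mv q (ent G) x" q] ip_mv_transpose[of q x p])
  qed
  show "psd (G\<^sup>T * G)" unfolding psd_iff[OF c] by (auto simp: qf e mult_ac simp del: index_mult_mat)
qed

text \<open>The pairing is computed in an eigenbasis of the root of \<open>G\<^sup>T * G\<close>:
  the term of \<open>v k\<close> is at most \<open>\<rho>\<close> times |G v k| =
  \<open>d k\<close>, and the \<open>d k\<close> add up to the trace of the root. The bound on
  \<open>R\<close> is an inequality, so that \<open>R\<close> may be a coordinate function for which
  no \<open>op_norm\<close> is formed.\<close>

lemma nuclear_norm_duality:
  assumes G: "G \<in> carrier_mat p q"
    and R: "\<And>x. sqrt (ip p (mv q R x) (mv q R x)) \<le> \<rho> * sqrt (ip q x x)"
  shows "(\<Sum>i<p. \<Sum>j<q. R i j * G $$ (i, j)) \<le> \<rho> * nuclear_norm G"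
proof -
  define S where "S = psd_sqrt (G\<^sup>T * G)"
  note S = psd_sqrt[OF gram_psd(1,2)[OF G], folded S_def]
  have sS: "\<And>i j. i < q \<Longrightarrow> j < q \<Longrightarrow> ent S i j = ent S j i" and pS: "\<And>x. 0 \<le> ip q x (mv q (ent S) x)"
    using S(2) unfolding psd_iff[OF S(1)] by auto
  obtain v d where v: "orthonormal q q v" and ev: "\<And>k i. k < q \<Longrightarrow> i < q \<Longrightarrow> mv q (ent S) (v k) i = d k * v k i"
    using spectral_theorem[of q "ent S", OF sS] by blast
  have vk: "ip q (v k) (v k) = 1" if "k < q" for k using v that by (simp add: orthonormal_def)
  have d: "0 \<le> d k" if "k < q" for k
  proof -
    have "ip q (v k) (mv q (ent S) (v k)) = ip q (v k) (\<lambda>i. d k * v k i)"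
      by (rule ip_cong) (simp_all add: ev that)
    with pS[of "v k"] vk[OF that] show ?thesis by (simp add: ip_bilinear)
  qed
  have Gv: "sqrt (ip p (mv q (ent G) (v k)) (mv q (ent G) (v k))) = d k" if k: "k < q" for k
  proof -
    have "ip p (mv q (ent G) (v k)) (mv q (ent G) (v k)) = ip q (mv q (ent S) (v k)) (mv q (ent S) (v k))"
      unfolding S_def ip_psd_sqrt[OF gram_psd(1,2)[OF G]] gram_psd(3)[OF G] ..
    also have "\<dots> = ip q (\<lambda>i. d k * v k i) (\<lambda>i. d k * v k i)"
      by (rule ip_cong) (simp_all add: ev k)
    also have "\<dots> = (d k)\<^sup>2" by (simp add: ip_bilinear vk k power2_eq_square)
    finally show ?thesis using d[OF k] by simp
  qed
  have "nuclear_norm G = (\<Sum>i<q. S $$ (i, i))"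
    using S(1) by (simp add: nuclear_norm_def mat_trace_def S_def)
  also have "\<dots> = (\<Sum>i<q. \<Sum>k<q. d k * v k i * v k i)"
    by (intro sum.cong) (simp_all add: spectral_expansion[OF v ev])
  also have "\<dots> = (\<Sum>k<q. \<Sum>i<q. d k * v k i * v k i)" by (rule sum.swap)
  also have "\<dots> = (\<Sum>k<q. d k * ip q (v k) (v k))" by (simp add: ip_def sum_distrib_left mult_ac)
  finally have nuc: "nuclear_norm G = (\<Sum>k<q. d k)" by (simp add: vk)
  have "(\<Sum>i<p. \<Sum>j<q. R i j * G $$ (i, j)) = (\<Sum>i<p. ip q (R i) (ent G i))" by (simp add: ip_def)
  also have "\<dots> = (\<Sum>i<p. \<Sum>k<q. ip q (R i) (v k) * ip q (ent G i) (v k))"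
    by (intro sum.cong refl orthonormal_parseval[OF v])
  also have "\<dots> = (\<Sum>k<q. \<Sum>i<p. ip q (R i) (v k) * ip q (ent G i) (v k))" by (rule sum.swap)
  also have "\<dots> = (\<Sum>k<q. ip p (mv q R (v k)) (mv q (ent G) (v k)))" by (simp add: ip_def mv_def)
  also have "\<dots> \<le> (\<Sum>k<q. \<rho> * d k)"
  proof (rule sum_mono)
    fix k assume "k \<in> {..<q}"
    then have k: "k < q" by simp
    have "ip p (mv q R (v k)) (mv q (ent G) (v k)) \<le> sqrt (ip p (mv q R (v k)) (mv q R (v k))) * d k"
      using ip_cauchy_schwarz[of p "mv q R (v k)" "mv q (ent G) (v k)"] by (simp add: Gv[OF k])
    also have "\<dots> \<le> \<rho> * d k"
      using R[of "v k"] d[OF k] by (intro mult_right_mono) (simp_all add: vk[OF k])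
    finally show "ip p (mv q R (v k)) (mv q (ent G) (v k)) \<le> \<rho> * d k" .
  qed
  finally show ?thesis by (simp add: nuc sum_distrib_left)
qed

lemma l2_norm_ip: "x \<in> carrier_vec n \<Longrightarrow> l2_norm x = sqrt (ip n (($) x) (($) x))"
  by (simp add: l2_norm_def scalar_prod_ip)

lemma l2_norm_vec: "l2_norm (Matrix.vec n x) = sqrt (ip n x x)"
  by (subst l2_norm_ip[of _ n]) (auto intro!: ip_cong arg_cong[where f = sqrt])

lemma l2_norm_mult_mat_vec:
  assumes G: "G \<in> carrier_mat p q"
  shows "l2_norm (G *\<^sub>v Matrix.vec q x) = sqrt (ip p (mv q (ent G) x) (mv q (ent G) x))"
proof -
  have "(G *\<^sub>v Matrix.vec q x) $ i = mv q (ent G) x i" if "i < p" for i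
    using mult_mat_vec_mv[OF G, of "Matrix.vec q x" i] that
    by (simp del: index_mult_mat_vec) (rule arg_cong[where f = "\<lambda>f. f i"], rule mv_cong, simp)
  then show ?thesis using G
    by (subst l2_norm_ip[of _ p]) (auto intro!: ip_cong arg_cong[where f = sqrt] simp del: index_mult_mat_vec)
qed

lemma mv_frobenius_bound: "ip p (mv q A x) (mv q A x) \<le> (\<Sum>i<p. ip q (A i) (A i)) * ip q x x"
proof -
  have "ip p (mv q A x) (mv q A x) = (\<Sum>i<p. (ip q (A i) x)\<^sup>2)"
    by (simp add: ip_def[of p] mv_def ip_def[of q] power2_eq_square)
  also have "\<dots> \<le> (\<Sum>i<p. ip q (A i) (A i) * ip q x x)"
    by (rule sum_mono) (use Cauchy_Schwarz_ineq_sum in \<open>simp add: ip_def power2_eq_square\<close>)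
  finally show ?thesis by (simp add: sum_distrib_right)
qed

text \<open>\<open>op_norm\<close> is a supremum of reals and dominates its members only if they are
  bounded above; the Frobenius norm supplies a bound.\<close>

lemma op_norm_bound:
  assumes G: "G \<in> carrier_mat p q"
  shows "sqrt (ip p (mv q (ent G) x) (mv q (ent G) x)) \<le> op_norm G * sqrt (ip q x x)"
proof -
  define c where "c = (\<Sum>i<p. ip q (ent G i) (ent G i))"
  have bdd: "bdd_above ((\<lambda>v. l2_norm (G *\<^sub>v v)) ` {v \<in> carrier_vec q. l2_norm v \<le> 1})"
  proof (rule bdd_aboveI2)
    fix v assume v: "v \<in> {v \<in> carrier_vec q. l2_norm v \<le> 1}"
    then have "v = Matrix.vec q (($) v)" by auto
    then have "l2_norm (G *\<^sub>v v) = sqrt (ip p (mv q (ent G) (($) v)) (mv q (ent G) (($) v)))"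
      using l2_norm_mult_mat_vec[OF G] by metis
    also have "\<dots> \<le> sqrt (c * ip q (($) v) (($) v))"
      unfolding c_def by (intro real_sqrt_le_mono mv_frobenius_bound)
    also have "\<dots> \<le> sqrt (c * 1)"
      using v l2_norm_ip[of v q] by (intro real_sqrt_le_mono mult_left_mono) (auto simp: c_def sum_nonneg)
    finally show "l2_norm (G *\<^sub>v v) \<le> sqrt (c * 1)" .
  qed
  show ?thesis
  proof (cases "ip q x x = 0")
    case True
    then have "mv q (ent G) x = (\<lambda>i. 0)" by (auto simp: ip_eq_0_iff mv_def)
    with True show ?thesis by (simp add: ip_def)
  next
    case False
    define t where "t = sqrt (ip q x x)"
    have t: "t > 0" using False by (simp add: t_def less_le)
    define y where "y = (\<lambda>i. (1 / t) * x i)"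
    have "ip q y y = 1" using t by (simp only: y_def ip_scale_left ip_scale_right) (simp add: t_def)
    then have "l2_norm (Matrix.vec q y) \<le> 1" by (simp add: l2_norm_vec)
    then have "l2_norm (G *\<^sub>v Matrix.vec q y) \<le> op_norm G"
      unfolding op_norm_def using G bdd by (intro cSUP_upper) auto
    also have "l2_norm (G *\<^sub>v Matrix.vec q y) = sqrt (ip p (mv q (ent G) x) (mv q (ent G) x)) / t"
      unfolding l2_norm_mult_mat_vec[OF G] y_def mv_scale ip_scale_left ip_scale_right
      using t by (simp add: real_sqrt_mult real_sqrt_divide)
    finally show ?thesis using t by (simp add: t_def pos_divide_le_eq)
  qed
qed

lemma op_norm_leI:
  assumes G: "G \<in> carrier_mat p q" and "\<And>x. sqrt (ip p (mv q (ent G) x) (mv q (ent G) x)) \<le> sqrt (ip q x x)"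
  shows "op_norm G \<le> 1"
  unfolding op_norm_def
proof (rule cSUP_least)
  show "{v \<in> carrier_vec (dim_col G). l2_norm v \<le> 1} \<noteq> {}"
    by (rule ccontr) (auto simp: l2_norm_def dest!: spec[of _ "0\<^sub>v (dim_col G)"])
next
  fix v assume v: "v \<in> {v \<in> carrier_vec (dim_col G). l2_norm v \<le> 1}"
  then have v': "v \<in> carrier_vec q" "l2_norm v \<le> 1" using G by auto
  then have "v = Matrix.vec q (($) v)" by auto
  then have "l2_norm (G *\<^sub>v v) = sqrt (ip p (mv q (ent G) (($) v)) (mv q (ent G) (($) v)))"
    using l2_norm_mult_mat_vec[OF G] by metis
  also have "\<dots> \<le> l2_norm v" using assms(2) l2_norm_ip[OF v'(1)] by metis
  finally show "l2_norm (G *\<^sub>v v) \<le> 1" using v' by simp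
qed

text \<open>The top eigenvector of \<open>F\<^sup>T * F\<close> is the right vector and its image
  divided by \<open>\<tau>\<close> the left one; positivity of the form keeps \<open>\<tau>\<close>
  away from 0. Hence maximality among singular triples, as in \<open>first_singular_vectors\<close>,
  becomes maximality of the bilinear form over unit vectors.\<close>

lemma exists_singular_triple_ge:
  assumes F: "F \<in> carrier_mat p q" and x: "ip p x x = 1" and y: "ip q y y = 1"
    and pos: "0 < ip p x (mv q (ent F) y)"
  shows "\<exists>\<tau> a b. singular_triple F \<tau> a b \<and> ip p x (mv q (ent F) y) \<le> \<tau>"
proof -
  note N = gram_psd[OF F]
  let ?N = "ent (F\<^sup>T * F)"
  have sN: "\<And>i j. i < q \<Longrightarrow> j < q \<Longrightarrow> ?N i j = ?N j i" 
    using N(2) psd_iff[OF N(1)] by blast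
  obtain v d where v: "orthonormal q q v" and ev: "\<And>k i. k < q \<Longrightarrow> i < q \<Longrightarrow> mv q ?N (v k) i = d k * v k i"
    using spectral_theorem[of q ?N, OF sN] by blast
  have "q \<noteq> 0" using y by (cases q) (auto simp: ip_def)
  then have "\<exists>k\<in>{..<q}. \<forall>j\<in>{..<q}. d j \<le> d k"
    using Max_in[of "d ` {..<q}"] Max_ge[of "d ` {..<q}"] by fastforce
  then obtain k where k: "k < q" "\<And>j. j < q \<Longrightarrow> d j \<le> d k" by auto
  let ?Fy = "mv q (ent F) y"
  have "ip p ?Fy ?Fy = ip q y (mv q ?N y)" by (simp only: N(3))
  also have "\<dots> = (\<Sum>j<q. d j * (ip q y (v j) * ip q y (v j)))"
    by (simp add: spectral_quadratic_form[OF v ev] mult_ac)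
  also have "\<dots> \<le> (\<Sum>j<q. d k * (ip q y (v j) * ip q y (v j)))"
    by (intro sum_mono mult_right_mono) (auto simp: k)
  also have "\<dots> = d k" using orthonormal_parseval[OF v, of y y] y by (simp flip: sum_distrib_left)
  finally have Fy: "ip p ?Fy ?Fy \<le> d k" .
  define \<tau> where "\<tau> = sqrt (d k)"
  have le: "ip p x ?Fy \<le> \<tau>"
    using order_trans[OF abs_le_D1[OF ip_cauchy_schwarz[of p x ?Fy]]] real_sqrt_le_mono[OF Fy] x
    by (simp only: \<tau>_def real_sqrt_one mult_1)
  then have \<tau>: "\<tau> > 0" "\<tau> * \<tau> = d k"
    using pos by (linarith, smt (verit) \<tau>_def real_sqrt_le_0_iff real_sqrt_mult_self)
  define b where "b = Matrix.vec q (v k)"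
  define a where "a = Matrix.vec p (\<lambda>i. mv q (ent F) (v k) i / \<tau>)"
  have vk: "ip q (v k) (v k) = 1" using v k by (simp add: orthonormal_def)
  have Fb: "F *\<^sub>v b = \<tau> \<cdot>\<^sub>v a"
  proof (rule eq_vecI)
    fix i assume "i < dim_vec (\<tau> \<cdot>\<^sub>v a)"
    then have i: "i < p" by (simp add: a_def)
    have "(F *\<^sub>v b) $ i = mv q (ent F) (($) b) i"
      using i by (intro mult_mat_vec_mv[OF F]) (auto simp: b_def)
    also have "mv q (ent F) (($) b) = mv q (ent F) (v k)" by (rule mv_cong) (simp add: b_def)
    finally show "(F *\<^sub>v b) $ i = (\<tau> \<cdot>\<^sub>v a) $ i" using i \<tau> by (simp add: a_def)
  qed (use F in \<open>simp add: a_def\<close>)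
  have Fa: "F\<^sup>T *\<^sub>v a = \<tau> \<cdot>\<^sub>v b"
  proof (rule eq_vecI)
    fix i assume "i < dim_vec (\<tau> \<cdot>\<^sub>v b)"
    then have i: "i < q" by (simp add: b_def)
    have "(F\<^sup>T *\<^sub>v a) $ i = mv p (ent (F\<^sup>T)) (($) a) i"
      using i F by (intro mult_mat_vec_mv) (auto simp: a_def)
    also have "mv p (ent (F\<^sup>T)) (($) a) = mv p (ent (F\<^sup>T)) (\<lambda>i. (1 / \<tau>) * mv q (ent F) (v k) i)"
      by (rule mv_cong) (simp add: a_def)
    also have "\<dots> i = (1 / \<tau>) * mv q ?N (v k) i"
      unfolding mv_scale using mv_mult_mat[of "F\<^sup>T" q p F q i] F i by simp
    also have "\<dots> = \<tau> * v k i" using \<tau> by (simp add: ev k i field_simps)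
    finally show "(F\<^sup>T *\<^sub>v a) $ i = (\<tau> \<cdot>\<^sub>v b) $ i" using i by (simp add: b_def)
  qed (use F in \<open>simp add: b_def\<close>)
  have "ip p (mv q (ent F) (v k)) (mv q (ent F) (v k)) = ip q (v k) (mv q ?N (v k))" by (simp only: N(3))
  also have "\<dots> = ip q (v k) (\<lambda>i. d k * v k i)" by (rule ip_cong) (simp_all add: ev k)
  finally have "ip p (mv q (ent F) (v k)) (mv q (ent F) (v k)) = \<tau> * \<tau>"
    by (simp add: ip_bilinear vk \<tau>)
  moreover have "l2_norm a = sqrt (ip p (\<lambda>i. (1/\<tau>) * mv q (ent F) (v k) i) (\<lambda>i. (1/\<tau>) * mv q (ent F) (v k) i))"
    unfolding a_def l2_norm_vec by simp
  ultimately have "l2_norm a = 1" using \<tau>(1) by (simp only: ip_scale_left ip_scale_right) simp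
  then have "singular_triple F \<tau> a b"
    using F \<tau> vk Fa Fb by (auto simp: singular_triple_def a_def b_def l2_norm_vec)
  with le show ?thesis by blast
qed

lemma eigenvalue_bounds_quadratic_form:
  assumes A: "A \<in> carrier_mat n n" and sym: "\<And>i j. i < n \<Longrightarrow> j < n \<Longrightarrow> A $$ (i, j) = A $$ (j, i)"
    and ev: "\<And>k. eigenvalue A k \<Longrightarrow> k \<in> {l..u}"
  shows "l * ip n x x \<le> ip n x (mv n (ent A) x)" "ip n x (mv n (ent A) x) \<le> u * ip n x x"
proof -
  obtain v d where v: "orthonormal n n v" and evd: "\<And>k i. k < n \<Longrightarrow> i < n \<Longrightarrow> mv n (ent A) (v k) i = d k * v k i"
    using spectral_theorem[of n "ent A", OF sym] by blast
  have d: "d k \<in> {l..u}" if k: "k < n" for k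
  proof (rule ev)
    let ?w = "Matrix.vec n (v k)"
    have "ip n (v k) (v k) = 1" using v k by (simp add: orthonormal_def)
    then have "\<not> (\<forall>i<n. v k i = 0)" using ip_eq_0_iff[of n "v k"] by simp
    then have "?w \<noteq> 0\<^sub>v n" by (metis index_vec index_zero_vec(1))
    moreover have "A *\<^sub>v ?w = d k \<cdot>\<^sub>v ?w"
    proof (rule eq_vecI)
      fix i assume "i < dim_vec (d k \<cdot>\<^sub>v ?w)"
      then have i: "i < n" by simp
      have "(A *\<^sub>v ?w) $ i = mv n (ent A) (($) ?w) i" by (rule mult_mat_vec_mv[OF A]) (use i in auto)
      also have "mv n (ent A) (($) ?w) = mv n (ent A) (v k)" by (rule mv_cong) simp
      finally show "(A *\<^sub>v ?w) $ i = (d k \<cdot>\<^sub>v ?w) $ i" using i k by (simp add: evd)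
    qed (use A in simp)
    ultimately show "eigenvalue A (d k)"
      unfolding eigenvalue_def eigenvector_def using A by (intro exI[of _ ?w]) auto
  qed
  have q: "ip n x (mv n (ent A) x) = (\<Sum>k<n. d k * (ip n x (v k) * ip n x (v k)))"
    by (simp add: spectral_quadratic_form[OF v evd] mult_ac)
  show "l * ip n x x \<le> ip n x (mv n (ent A) x)" "ip n x (mv n (ent A) x) \<le> u * ip n x x"
    unfolding q orthonormal_parseval[OF v, of x x] sum_distrib_left
    using d by (auto intro!: sum_mono mult_right_mono)
qed

section \<open>Restricted eigenvalues\<close>

definition l1 :: "nat \<Rightarrow> (nat \<Rightarrow> real) \<Rightarrow> real" where
  "l1 n x = (\<Sum>i<n. \<bar>x i\<bar>)"

definition bf :: "nat \<Rightarrow> nat \<Rightarrow> (nat \<Rightarrow> real) \<Rightarrow> (nat \<Rightarrow> nat \<Rightarrow> real) \<Rightarrow> (nat \<Rightarrow> real) \<Rightarrow> real" where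
  "bf p q x A y = ip p x (mv q A y)"

lemma bf_add_left: "bf p q (\<lambda>i. x i + x' i) A y = bf p q x A y + bf p q x' A y"
  and bf_add_right: "bf p q x A (\<lambda>i. y i + y' i) = bf p q x A y + bf p q x A y'"
  and bf_diff_left: "bf p q (\<lambda>i. x i - x' i) A y = bf p q x A y - bf p q x' A y"
  and bf_diff_right: "bf p q x A (\<lambda>i. y i - y' i) = bf p q x A y - bf p q x A y'"
  and bf_scale_left: "bf p q (\<lambda>i. c * x i) A y = c * bf p q x A y"
  and bf_scale_right: "bf p q x A (\<lambda>i. c * y i) = c * bf p q x A y"
  and bf_sum_left: "bf p q (\<lambda>i. \<Sum>k\<in>K. f k i) A y = (\<Sum>k\<in>K. bf p q (f k) A y)"
  and bf_sum_right: "bf p q x A (\<lambda>i. \<Sum>k\<in>K. f k i) = (\<Sum>k\<in>K. bf p q x A (f k))"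
  by (simp_all add: bf_def ip_bilinear mv_add mv_diff mv_scale mv_sum)

lemmas bf_bilinear = bf_add_left bf_add_right bf_diff_left bf_diff_right bf_scale_left
  bf_scale_right bf_sum_left bf_sum_right

lemma bf_sum: "bf p q x A y = (\<Sum>i<p. \<Sum>j<q. x i * A i j * y j)"
  by (simp add: bf_def ip_def mv_def sum_distrib_left mult_ac)

lemma bf_symmetric:
  "(\<And>i j. i < n \<Longrightarrow> j < n \<Longrightarrow> A i j = A j i) \<Longrightarrow> bf n n x A y = bf n n y A x"
  by (metis bf_def ip_commute ip_mv_symmetric)

lemma bf_unitv: "i < n \<Longrightarrow> j < n \<Longrightarrow> bf n n (unitv i) A (unitv j) = A i j"
  by (simp add: bf_def ip_unitv mv_unitv)

lemma bf_minus_identity: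
  "bf n n x (\<lambda>i j. A i j - c * of_bool (i = j)) y = bf n n x A y - c * ip n x y"
  by (simp add: bf_sum ip_def algebra_simps sum_subtractf sum_distrib_left)
     (simp add: of_bool_def if_distrib if_distribR mult_ac cong: if_cong)

text \<open>The deterministic substitute for drawing an index at random.\<close>

lemma exists_le_weighted_average:
  fixes w g :: "nat \<Rightarrow> real"
  assumes w: "\<And>i. i < n \<Longrightarrow> 0 \<le> w i" "(\<Sum>i<n. w i) = 1"
  shows "\<exists>i<n. g i \<le> (\<Sum>i<n. w i * g i)"
proof (rule ccontr)
  assume neg: "\<not> ?thesis"
  define c where "c = (\<Sum>i<n. w i * g i)"
  have g: "c < g i" if "i < n" for i using neg that by (auto simp: c_def)
  have "(\<Sum>i<n. w i * (g i - c)) = 0"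
    using w(2) by (simp add: right_diff_distrib sum_subtractf c_def flip: sum_distrib_right)
  then have z: "\<forall>i<n. w i * (g i - c) = 0"
    by (subst (asm) sum_nonneg_eq_0_iff) (use w(1) g in \<open>auto simp: less_imp_le\<close>)
  then have "w i = 0" if "i < n" for i using g[OF that] that by auto
  then show False using w(2) by simp
qed

text \<open>Maurey's empirical method, derandomised: a sum of \<open>m\<close> of the vectors \<open>t i\<close>, drawn independently
  with probabilities \<open>w i\<close>, has expected quadratic form \<open>m (m - 1) Q(\<mu>) + m d\<close>; conditional
  expectations select a sum that does not exceed this value.\<close>

lemma maurey:
  fixes t :: "nat \<Rightarrow> nat \<Rightarrow> real"
  assumes sym: "\<And>i j. i < n \<Longrightarrow> j < n \<Longrightarrow> A i j = A j i"
    and w: "\<And>i. i < k \<Longrightarrow> 0 \<le> w i" "(\<Sum>i<k. w i) = 1"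
    and \<mu>: "\<mu> = (\<lambda>l. \<Sum>i<k. w i * t i l)"
    and d: "(\<Sum>i<k. w i * bf n n (t i) A (t i)) \<le> d"
  shows "\<exists>ls. length ls = m \<and> set ls \<subseteq> {..<k} \<and>
    bf n n (\<lambda>l. y l + (\<Sum>i\<leftarrow>ls. t i l)) A (\<lambda>l. y l + (\<Sum>i\<leftarrow>ls. t i l)) \<le>
      bf n n y A y + 2 * real m * bf n n y A \<mu> + real m * (real m - 1) * bf n n \<mu> A \<mu> + real m * d"
proof (induction m arbitrary: y)
  case 0
  then show ?case by simp
next
  case (Suc m)
  let ?Q = "bf n n"
  \<comment> \<open>The value of the form after \<open>t i\<close> is drawn, plus its interaction
    with the mean of the \<open>m\<close> draws still to come. An index at or below the average of
    \<open>g\<close> preserves the bound.\<close>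
  define g where "g i = ?Q (\<lambda>l. y l + t i l) A (\<lambda>l. y l + t i l) + 2 * real m * ?Q (\<lambda>l. y l + t i l) A \<mu>" for i
  have Qs: "?Q x A z = ?Q z A x" for x z by (rule bf_symmetric[OF sym])
  have y\<mu>: "(\<Sum>i<k. w i * ?Q x A (t i)) = ?Q x A \<mu>" for x
    unfolding \<mu> by (simp add: bf_bilinear)
  have "(\<Sum>i<k. w i * g i) = (\<Sum>i<k. w i * (?Q y A y + 2 * real m * ?Q y A \<mu>))
      + 2 * (\<Sum>i<k. w i * ?Q y A (t i)) + 2 * real m * (\<Sum>i<k. w i * ?Q \<mu> A (t i))
      + (\<Sum>i<k. w i * ?Q (t i) A (t i))"
    unfolding g_def by (simp add: bf_bilinear Qs[of "t _" y] Qs[of "t _" \<mu>] algebra_simps sum.distrib sum_distrib_left)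
  also have "\<dots> = ?Q y A y + 2 * real m * ?Q y A \<mu> + 2 * ?Q y A \<mu> + 2 * real m * ?Q \<mu> A \<mu>
      + (\<Sum>i<k. w i * ?Q (t i) A (t i))"
    unfolding y\<mu> sum_distrib_right[symmetric] w(2) by simp
  also have "\<dots> \<le> ?Q y A y + 2 * real m * ?Q y A \<mu> + 2 * ?Q y A \<mu> + 2 * real m * ?Q \<mu> A \<mu> + d"
    using d by simp
  finally have avg: "(\<Sum>i<k. w i * g i) \<le> \<dots>" .
  obtain i where i: "i < k" "g i \<le> (\<Sum>i<k. w i * g i)"
    using exists_le_weighted_average[of k w g] w by blast
  from Suc.IH[of "\<lambda>l. y l + t i l"] obtain ls where ls: "length ls = m" "set ls \<subseteq> {..<k}"
    "?Q (\<lambda>l. y l + t i l + (\<Sum>i\<leftarrow>ls. t i l)) A (\<lambda>l. y l + t i l + (\<Sum>i\<leftarrow>ls. t i l)) \<le>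
      g i + real m * (real m - 1) * ?Q \<mu> A \<mu> + real m * d"
    by (auto simp: g_def)
  have "?Q (\<lambda>l. y l + (\<Sum>i\<leftarrow>i # ls. t i l)) A (\<lambda>l. y l + (\<Sum>i\<leftarrow>i # ls. t i l)) \<le>
      g i + real m * (real m - 1) * ?Q \<mu> A \<mu> + real m * d"
    using ls(3) by (simp add: add.assoc)
  also have "\<dots> \<le> ?Q y A y + 2 * real (Suc m) * ?Q y A \<mu>
      + real (Suc m) * (real (Suc m) - 1) * ?Q \<mu> A \<mu> + real (Suc m) * d"
    using i(2) avg by (simp add: algebra_simps)
  finally show ?case using ls(1,2) i(1) by (intro exI[of _ "i # ls"]) auto
qed

text \<open>Up to the factor 1 / \<open>length ls\<close>, an average of extreme points of the l1
  unit ball. Repetitions and cancellations are allowed, hence lists rather than sets.\<close>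

definition signed_sum :: "(nat \<times> bool) list \<Rightarrow> nat \<Rightarrow> real" where
  "signed_sum ls i = (\<Sum>(j, s)\<leftarrow>ls. (if s then 1 else - 1) * unitv j i)"

text \<open>\<open>x\<close> divided by its l1 norm is a convex combination of signed unit vectors.
  Maurey's argument yields a sum of \<open>m\<close> of them whose form is nonnegative by
  \<open>sparse\<close> and at most m (m - 1) Q + m K, where Q is the form at the scaled
  \<open>x\<close>. Dividing by m (m - 1) leaves the loss K / (m - 1).\<close>

lemma restricted_eigenvalue:
  assumes sym: "\<And>i j. i < n \<Longrightarrow> j < n \<Longrightarrow> A i j = A j i"
    and m: "2 \<le> m" and c: "0 \<le> c" and K: "\<And>i. i < n \<Longrightarrow> A i i \<le> K"
    and sparse: "\<And>ls. length ls = m \<Longrightarrow> set ls \<subseteq> {..<n} \<times> UNIV \<Longrightarrow>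
      c * ip n (signed_sum ls) (signed_sum ls) \<le> bf n n (signed_sum ls) A (signed_sum ls)"
  shows "c * ip n x x - K / (real m - 1) * (l1 n x)\<^sup>2 \<le> bf n n x A x"
proof (cases "l1 n x = 0")
  case True
  then have "\<forall>i<n. x i = 0" by (auto simp: l1_def sum_nonneg_eq_0_iff)
  then have "ip n x x = 0" "bf n n x A x = 0" by (simp_all add: ip_def bf_sum)
  with True show ?thesis by simp
next
  case False
  define R where "R = l1 n x"
  have "R \<ge> 0" by (simp add: R_def l1_def sum_nonneg)
  with False have R: "R > 0" by (simp add: R_def)
  \<comment> \<open>Subtracting \<open>c\<close> times the identity turns \<open>sparse\<close> into
    nonnegativity on signed sums.\<close>
  define A' where "A' = (\<lambda>i j. A i j - c * of_bool (i = j))"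
  define w where "w i = \<bar>x i\<bar> / R" for i
  define s where "s i = (0 \<le> x i)" for i
  define t where "t i = (\<lambda>l. (if s i then 1 else - 1) * unitv i l)" for i
  define \<mu> where "\<mu> = (\<lambda>l. \<Sum>i<n. w i * t i l)"
  have A': "bf n n u A' v = bf n n u A v - c * ip n u v" for u v
    unfolding A'_def by (rule bf_minus_identity)
  have w: "0 \<le> w i" for i using R by (simp add: w_def)
  have w1: "(\<Sum>i<n. w i) = 1" using R by (simp add: w_def R_def l1_def flip: sum_divide_distrib)
  have "\<mu> l = x l / R" if "l < n" for l
  proof -
    have "\<mu> l = (\<Sum>i<n. if i = l then w i * (if s i then 1 else - 1) else 0)"
      unfolding \<mu>_def t_def unitv_def by (intro sum.cong) auto
    also have "\<dots> = x l / R" using that by (auto simp: w_def s_def)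
    finally show ?thesis .
  qed
  then have \<mu>x: "bf n n \<mu> A' \<mu> = bf n n x A' x / R\<^sup>2"
    by (simp add: bf_sum power2_eq_square sum_divide_distrib)
  have "(\<Sum>i<n. w i * bf n n (t i) A' (t i)) \<le> (\<Sum>i<n. w i * K)"
  proof (intro sum_mono mult_left_mono w)
    fix i assume "i \<in> {..<n}"
    then have "i < n" by simp
    have "bf n n (t i) A' (t i) = A i i - c"
      unfolding t_def bf_scale_left bf_scale_right using \<open>i < n\<close> by (simp add: bf_unitv A'_def)
    also have "\<dots> \<le> K" using K[OF \<open>i < n\<close>] c by simp
    finally show "bf n n (t i) A' (t i) \<le> K" .
  qed
  also have "\<dots> = K" using w1 by (simp flip: sum_distrib_right)
  finally have dK: "(\<Sum>i<n. w i * bf n n (t i) A' (t i)) \<le> K" .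
  have symA': "A' i j = A' j i" if "i < n" "j < n" for i j
    using sym[OF that] by (simp add: A'_def eq_commute)
  obtain ls where ls: "length ls = m" "set ls \<subseteq> {..<n}"
    and le: "bf n n (\<lambda>l. 0 + (\<Sum>i\<leftarrow>ls. t i l)) A' (\<lambda>l. 0 + (\<Sum>i\<leftarrow>ls. t i l)) \<le>
      bf n n (\<lambda>l. 0) A' (\<lambda>l. 0) + 2 * real m * bf n n (\<lambda>l. 0) A' \<mu>
      + real m * (real m - 1) * bf n n \<mu> A' \<mu> + real m * K"
    using maurey[OF symA' w w1 \<mu>_def dK, of m "\<lambda>l. 0"] by blast
  define ls' where "ls' = map (\<lambda>i. (i, s i)) ls"
  have ss: "(\<lambda>l. 0 + (\<Sum>i\<leftarrow>ls. t i l)) = signed_sum ls'"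
    by (rule ext) (simp add: signed_sum_def ls'_def t_def comp_def)
  have "0 \<le> bf n n (signed_sum ls') A' (signed_sum ls')"
    using sparse[of ls'] ls by (auto simp: A' ls'_def)
  also have "\<dots> \<le> real m * (real m - 1) * bf n n \<mu> A' \<mu> + real m * K"
    using le unfolding ss by (simp add: bf_sum)
  also have "\<dots> = real m * ((real m - 1) * (bf n n x A' x / R\<^sup>2) + K)"
    by (simp add: \<mu>x algebra_simps)
  finally have "0 \<le> (real m - 1) * (bf n n x A' x / R\<^sup>2) + K"
    using m by (simp add: zero_le_mult_iff)
  then have "- K / (real m - 1) * R\<^sup>2 \<le> bf n n x A' x"
    using m R by (simp add: field_simps)
  then show ?thesis by (simp add: A' R_def)
qed

lemma bf_max_bound:
  assumes "\<And>i j. i < p \<Longrightarrow> j < q \<Longrightarrow> \<bar>A i j\<bar> \<le> C"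
  shows "\<bar>bf p q x A y\<bar> \<le> C * l1 p x * l1 q y"
proof -
  have "\<bar>bf p q x A y\<bar> \<le> (\<Sum>i<p. \<Sum>j<q. \<bar>x i * A i j * y j\<bar>)"
    unfolding bf_sum by (intro order_trans[OF sum_abs] sum_mono sum_abs)
  also have "\<dots> \<le> (\<Sum>i<p. \<Sum>j<q. \<bar>x i\<bar> * C * \<bar>y j\<bar>)"
    unfolding abs_mult by (intro sum_mono mult_right_mono mult_left_mono assms) auto
  also have "\<dots> = C * l1 p x * l1 q y"
    by (simp add: l1_def sum_distrib_left sum_distrib_right mult_ac)
  finally show ?thesis .
qed

section \<open>Tensor forms and almost orthonormal systems\<close>

lemma sum_power2_le_power2_sum:
  fixes f :: "nat \<Rightarrow> real"
  assumes "\<And>i. i < n \<Longrightarrow> 0 \<le> f i"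
  shows "(\<Sum>i<n. (f i)\<^sup>2) \<le> (\<Sum>i<n. f i)\<^sup>2"
proof -
  have "(\<Sum>i<n. (f i)\<^sup>2) \<le> (\<Sum>i<n. f i * (\<Sum>j<n. f j))"
    unfolding power2_eq_square using assms
    by (intro sum_mono mult_left_mono member_le_sum) auto
  then show ?thesis by (simp add: power2_eq_square sum_distrib_right)
qed

text \<open>The triangle inequality in l2 for the vectors of absolute values of the
  \<open>f i\<close>.\<close>

lemma minkowski_sum:
  fixes f :: "nat \<Rightarrow> nat \<Rightarrow> real"
  shows "(\<Sum>k<q. (\<Sum>i<p. \<bar>f i k\<bar>)\<^sup>2) \<le> (\<Sum>i<p. sqrt (ip q (f i) (f i)))\<^sup>2"
proof -
  have "(\<Sum>k<q. (\<Sum>i<p. \<bar>f i k\<bar>)\<^sup>2) = (\<Sum>k<q. \<Sum>i<p. \<Sum>j<p. \<bar>f i k\<bar> * \<bar>f j k\<bar>)"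
    by (simp add: power2_eq_square sum_product)
  also have "\<dots> = (\<Sum>i<p. \<Sum>k<q. \<Sum>j<p. \<bar>f i k\<bar> * \<bar>f j k\<bar>)" by (rule sum.swap)
  also have "\<dots> = (\<Sum>i<p. \<Sum>j<p. \<Sum>k<q. \<bar>f i k\<bar> * \<bar>f j k\<bar>)" by (intro sum.cong refl sum.swap)
  also have "\<dots> \<le> (\<Sum>i<p. \<Sum>j<p. sqrt (ip q (f i) (f i)) * sqrt (ip q (f j) (f j)))"
  proof (intro sum_mono)
    fix i j
    have "(\<Sum>k<q. \<bar>f i k\<bar> * \<bar>f j k\<bar>) = ip q (\<lambda>k. \<bar>f i k\<bar>) (\<lambda>k. \<bar>f j k\<bar>)" by (simp add: ip_def)
    also have "\<dots> \<le> sqrt (ip q (f i) (f i)) * sqrt (ip q (f j) (f j))"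
      using ip_cauchy_schwarz[of q "\<lambda>k. \<bar>f i k\<bar>" "\<lambda>k. \<bar>f j k\<bar>"] by (simp add: ip_def)
    finally show "(\<Sum>k<q. \<bar>f i k\<bar> * \<bar>f j k\<bar>) \<le> sqrt (ip q (f i) (f i)) * sqrt (ip q (f j) (f j))" .
  qed
  also have "\<dots> = (\<Sum>i<p. sqrt (ip q (f i) (f i)))\<^sup>2" by (simp add: power2_eq_square sum_product)
  finally show ?thesis .
qed

text \<open>\<open>T\<close> stands for a square root of \<open>Sy\<close>. \<open>REy\<close> is
  applied to the rows of \<open>H\<close> and \<open>REx\<close> to the columns of the matrix with
  rows \<open>mv q T (H i)\<close>, whence the square of \<open>c\<close>. The second use loses the
  l1 norms of those columns, which \<open>minkowski_sum\<close> and the entry bound \<open>C\<close>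
  reduce to the entrywise l1 norm of \<open>H\<close>.\<close>

lemma tensor_restricted_eigenvalue:
  assumes T: "\<And>x y. ip q (mv q T x) (mv q T y) = bf q q x Sy y"
    and REx: "\<And>x. c * ip p x x - \<nu> * (l1 p x)\<^sup>2 \<le> bf p p x Sx x"
    and REy: "\<And>y. c * ip q y y - \<nu> * (l1 q y)\<^sup>2 \<le> bf q q y Sy y"
    and C: "\<And>i j. i < q \<Longrightarrow> j < q \<Longrightarrow> \<bar>Sy i j\<bar> \<le> C" and c: "0 \<le> c" and \<nu>: "0 \<le> \<nu>" and C0: "0 \<le> C"
  shows "c\<^sup>2 * (\<Sum>i<p. ip q (H i) (H i)) - \<nu> * (c + C) * (\<Sum>i<p. l1 q (H i))\<^sup>2
    \<le> (\<Sum>k<q. bf p p (\<lambda>i. mv q T (H i) k) Sx (\<lambda>i. mv q T (H i) k))"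
proof -
  define h where "h = (\<Sum>i<p. l1 q (H i))"
  have l1nn: "0 \<le> l1 q y" for y by (simp add: l1_def sum_nonneg)
  have "(\<Sum>k<q. ip p (\<lambda>i. mv q T (H i) k) (\<lambda>i. mv q T (H i) k)) = (\<Sum>i<p. bf q q (H i) Sy (H i))"
    unfolding T[symmetric] ip_def[of p] ip_def[of q] by (rule sum.swap)
  also have "\<dots> \<ge> (\<Sum>i<p. c * ip q (H i) (H i) - \<nu> * (l1 q (H i))\<^sup>2)"
    by (intro sum_mono REy)
  also have "(\<Sum>i<p. c * ip q (H i) (H i) - \<nu> * (l1 q (H i))\<^sup>2) =
      c * (\<Sum>i<p. ip q (H i) (H i)) - \<nu> * (\<Sum>i<p. (l1 q (H i))\<^sup>2)"
    by (simp add: sum_subtractf sum_distrib_left)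
  also have "\<dots> \<ge> c * (\<Sum>i<p. ip q (H i) (H i)) - \<nu> * h\<^sup>2"
    unfolding h_def using \<nu> by (intro diff_left_mono mult_left_mono sum_power2_le_power2_sum l1nn)
  finally have a: "c * (\<Sum>i<p. ip q (H i) (H i)) - \<nu> * h\<^sup>2
    \<le> (\<Sum>k<q. ip p (\<lambda>i. mv q T (H i) k) (\<lambda>i. mv q T (H i) k))" .
  have "(\<Sum>k<q. (l1 p (\<lambda>i. mv q T (H i) k))\<^sup>2) \<le> (\<Sum>i<p. sqrt (ip q (mv q T (H i)) (mv q T (H i))))\<^sup>2"
    unfolding l1_def[of p] by (rule minkowski_sum)
  also have "\<dots> \<le> (\<Sum>i<p. sqrt C * l1 q (H i))\<^sup>2"
  proof (intro power_mono sum_mono sum_nonneg)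
    fix i
    have "ip q (mv q T (H i)) (mv q T (H i)) \<le> C * l1 q (H i) * l1 q (H i)"
      using bf_max_bound[where p = q and q = q and A = Sy and x = "H i" and y = "H i", OF C]
      unfolding T by linarith
    then have "sqrt (ip q (mv q T (H i)) (mv q T (H i))) \<le> sqrt (C * (l1 q (H i))\<^sup>2)"
      by (simp add: power2_eq_square)
    then show "sqrt (ip q (mv q T (H i)) (mv q T (H i))) \<le> sqrt C * l1 q (H i)"
      by (simp add: real_sqrt_mult l1nn)
  qed auto
  also have "\<dots> = C * h\<^sup>2" using C0 by (simp add: h_def power_mult_distrib flip: sum_distrib_left)
  finally have b: "(\<Sum>k<q. (l1 p (\<lambda>i. mv q T (H i) k))\<^sup>2) \<le> C * h\<^sup>2" .
  have "c\<^sup>2 * (\<Sum>i<p. ip q (H i) (H i)) - \<nu> * (c + C) * h\<^sup>2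
      = c * (c * (\<Sum>i<p. ip q (H i) (H i)) - \<nu> * h\<^sup>2) - \<nu> * (C * h\<^sup>2)"
    by (simp add: algebra_simps power2_eq_square)
  also have "\<dots> \<le> c * (\<Sum>k<q. ip p (\<lambda>i. mv q T (H i) k) (\<lambda>i. mv q T (H i) k))
      - \<nu> * (\<Sum>k<q. (l1 p (\<lambda>i. mv q T (H i) k))\<^sup>2)"
    by (intro diff_mono mult_left_mono a b c \<nu>)
  also have "\<dots> = (\<Sum>k<q. c * ip p (\<lambda>i. mv q T (H i) k) (\<lambda>i. mv q T (H i) k)
      - \<nu> * (l1 p (\<lambda>i. mv q T (H i) k))\<^sup>2)"
    by (simp add: sum_subtractf sum_distrib_left)
  also have "\<dots> \<le> (\<Sum>k<q. bf p p (\<lambda>i. mv q T (H i) k) Sx (\<lambda>i. mv q T (H i) k))"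
    by (intro sum_mono REx)
  finally show ?thesis by (simp add: h_def)
qed

text \<open>Let y be the combination of the \<open>c k\<close> with coefficients
  \<open>ip n x (c k)\<close>, and C the sum of squares. Then C = (x, y), and |y|^2 \<le> (1 + r e)
  C because the Gram errors are weighted by products of coefficients. Cauchy-Schwarz gives C^2 \<le>
  |x|^2 (1 + r e) C.\<close>

lemma bessel_almost_orthonormal:
  assumes "\<And>i j. i \<in> K \<Longrightarrow> j \<in> K \<Longrightarrow> \<bar>ip n (c i) (c j) - of_bool (i = j)\<bar> \<le> e"
    and K: "finite K" "real (card K) \<le> r" and e: "0 \<le> e"
  shows "(\<Sum>k\<in>K. (ip n x (c k))\<^sup>2) \<le> (1 + r * e) * ip n x x"
proof -
  define C where "C = (\<Sum>k\<in>K. (ip n x (c k))\<^sup>2)"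
  define y where "y = (\<lambda>i. \<Sum>k\<in>K. ip n x (c k) * c k i)"
  have C0: "0 \<le> C" by (simp add: C_def sum_nonneg)
  have xy: "ip n x y = C" by (simp add: y_def C_def ip_bilinear power2_eq_square)
  have "ip n y y = (\<Sum>i\<in>K. \<Sum>j\<in>K. ip n x (c i) * ip n x (c j) * ip n (c i) (c j))"
    by (simp add: y_def ip_bilinear sum_distrib_left) (simp add: mult_ac)
  also have "\<dots> \<le> (\<Sum>i\<in>K. \<Sum>j\<in>K. ip n x (c i) * ip n x (c j) * of_bool (i = j)
      + e * (\<bar>ip n x (c i)\<bar> * \<bar>ip n x (c j)\<bar>))"
  proof (intro sum_mono)
    fix i j assume "i \<in> K" "j \<in> K"
    have "ip n x (c i) * ip n x (c j) * (ip n (c i) (c j) - of_bool (i = j))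
        \<le> \<bar>ip n x (c i) * ip n x (c j)\<bar> * \<bar>ip n (c i) (c j) - of_bool (i = j)\<bar>"
      by (metis abs_ge_self abs_mult)
    also have "\<dots> \<le> \<bar>ip n x (c i) * ip n x (c j)\<bar> * e"
      using assms(1)[OF \<open>i \<in> K\<close> \<open>j \<in> K\<close>] by (intro mult_left_mono) auto
    finally show "ip n x (c i) * ip n x (c j) * ip n (c i) (c j)
        \<le> ip n x (c i) * ip n x (c j) * of_bool (i = j) + e * (\<bar>ip n x (c i)\<bar> * \<bar>ip n x (c j)\<bar>)"
      by (simp add: abs_mult algebra_simps)
  qed
  also have "\<dots> = C + e * (\<Sum>i\<in>K. \<bar>ip n x (c i)\<bar>)\<^sup>2"
    unfolding sum.distrib
  proof (rule arg_cong2[where f = "(+)"])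
    show "(\<Sum>i\<in>K. \<Sum>j\<in>K. ip n x (c i) * ip n x (c j) * of_bool (i = j)) = C"
      using K(1) by (simp add: C_def power2_eq_square of_bool_def if_distrib if_distribR cong: if_cong)
    show "(\<Sum>i\<in>K. \<Sum>j\<in>K. e * (\<bar>ip n x (c i)\<bar> * \<bar>ip n x (c j)\<bar>)) = e * (\<Sum>i\<in>K. \<bar>ip n x (c i)\<bar>)\<^sup>2"
      by (simp add: power2_eq_square sum_product flip: sum_distrib_left)
  qed
  also have "\<dots> \<le> C + e * (r * C)"
  proof -
    have "(\<Sum>i\<in>K. 1 * \<bar>ip n x (c i)\<bar>)\<^sup>2 \<le> (\<Sum>i\<in>K. 1\<^sup>2) * (\<Sum>i\<in>K. \<bar>ip n x (c i)\<bar>\<^sup>2)"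
      by (rule Cauchy_Schwarz_ineq_sum)
    also have "\<dots> \<le> r * C" using K C0 by (simp add: C_def mult_right_mono sum_nonneg)
    finally show ?thesis using e by (simp add: mult_left_mono)
  qed
  finally have yy: "ip n y y \<le> (1 + r * e) * C" by (simp add: algebra_simps)
  have "C\<^sup>2 \<le> ip n x x * ip n y y"
    unfolding xy[symmetric] ip_def using Cauchy_Schwarz_ineq_sum[of x y "{..<n}"] by (simp add: power2_eq_square)
  also have "\<dots> \<le> ip n x x * ((1 + r * e) * C)" by (intro mult_left_mono yy) simp
  finally have "C * C \<le> ((1 + r * e) * ip n x x) * C" by (simp add: power2_eq_square mult_ac)
  moreover have "0 \<le> (1 + r * e) * ip n x x"
    using K e by (intro mult_nonneg_nonneg) (auto intro: order_trans)
  ultimately show ?thesis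
    using C0 unfolding C_def[symmetric] by (cases "C = 0") auto
qed

text \<open>The form is tested at \<open>x = R y\<close>.\<close>

lemma op_bound_bilinear:
  assumes "\<And>x y. bf p q x R y \<le> \<rho> * (sqrt (ip p x x) * sqrt (ip q y y))" and "0 \<le> \<rho>"
  shows "sqrt (ip p (mv q R y) (mv q R y)) \<le> \<rho> * sqrt (ip q y y)"
proof -
  define t where "t = sqrt (ip p (mv q R y) (mv q R y))"
  have t0: "t \<ge> 0" by (simp add: t_def)
  have "t * t = bf p q (mv q R y) R y" by (simp add: t_def bf_def)
  also have "\<dots> \<le> \<rho> * (t * sqrt (ip q y y))" unfolding t_def by (rule assms)
  finally have "t * t \<le> (\<rho> * sqrt (ip q y y)) * t" by (simp add: mult_ac)
  then show ?thesis using t0 assms(2) unfolding t_def[symmetric] by (cases "t = 0") auto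
qed

section \<open>Curvature of the first stage and rates\<close>

definition fro2 :: "nat \<Rightarrow> nat \<Rightarrow> (nat \<Rightarrow> nat \<Rightarrow> real) \<Rightarrow> real" where
  "fro2 p q A = (\<Sum>i<p. ip q (A i) (A i))"

lemma fro2_nonneg [simp]: "0 \<le> fro2 p q A"
  by (simp add: fro2_def sum_nonneg)

lemma bf_frobenius: "\<bar>bf p q x A y\<bar> \<le> sqrt (ip p x x) * sqrt (fro2 p q A) * sqrt (ip q y y)"
proof -
  have "\<bar>bf p q x A y\<bar> \<le> sqrt (ip p x x) * sqrt (ip p (mv q A y) (mv q A y))"
    unfolding bf_def by (rule ip_cauchy_schwarz)
  also have "\<dots> \<le> sqrt (ip p x x) * sqrt (fro2 p q A * ip q y y)"
    unfolding fro2_def by (intro mult_left_mono real_sqrt_le_mono mv_frobenius_bound) simp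
  finally show ?thesis by (simp add: real_sqrt_mult mult_ac)
qed

lemma bf_outer: "bf p q x (\<lambda>i j. u i * v j) y = ip p x u * ip q v y"
  by (simp add: bf_sum ip_def sum_product mult_ac)

lemma bf_add_mat: "bf p q x (\<lambda>i j. A i j + B i j) y = bf p q x A y + bf p q x B y"
  and bf_diff_mat: "bf p q x (\<lambda>i j. A i j - B i j) y = bf p q x A y - bf p q x B y"
  and bf_scale_mat: "bf p q x (\<lambda>i j. c * A i j) y = c * bf p q x A y"
  by (simp_all add: bf_sum algebra_simps sum.distrib sum_subtractf sum_distrib_left)

lemma bf_sum_mat: "bf p q x (\<lambda>i j. \<Sum>k\<in>K. f k i j) y = (\<Sum>k\<in>K. bf p q x (f k) y)"
proof (cases "finite K")
  case True
  then show ?thesis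
  proof induction
    case empty
    show ?case by (simp add: bf_sum)
  qed (simp add: bf_add_mat)
qed (simp add: bf_sum)

lemma sum_outer_mult: "(\<Sum>i<p. \<Sum>j<q. (u i * v j) * G i j) = bf p q u G v"
  by (simp add: bf_sum mult_ac)

text \<open>Cauchy-Schwarz for the plane vectors (a, sqrt c) and (b, sqrt d).\<close>

lemma two_dim_cauchy_schwarz:
  fixes a b c d :: real
  assumes "0 \<le> a" "0 \<le> b" "0 \<le> c" "0 \<le> d" "a\<^sup>2 + c \<le> s" "b\<^sup>2 + d \<le> t"
  shows "a * b + sqrt c * sqrt d \<le> sqrt s * sqrt t"
proof -
  have "(a * b + sqrt c * sqrt d)\<^sup>2 \<le> (a\<^sup>2 + (sqrt c)\<^sup>2) * (b\<^sup>2 + (sqrt d)\<^sup>2)"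
  proof -
    have "(a\<^sup>2 + (sqrt c)\<^sup>2) * (b\<^sup>2 + (sqrt d)\<^sup>2) - (a * b + sqrt c * sqrt d)\<^sup>2 = (a * sqrt d - b * sqrt c)\<^sup>2"
      by (simp add: power2_eq_square algebra_simps)
    then show ?thesis by (metis diff_ge_0_iff_ge zero_le_power2)
  qed
  also have "\<dots> \<le> s * t"
    using assms by (intro mult_mono) (auto intro: order_trans[of 0 "a\<^sup>2 + c"])
  finally have "sqrt ((a * b + sqrt c * sqrt d)\<^sup>2) \<le> sqrt (s * t)" by (rule real_sqrt_le_mono)
  then show ?thesis using assms by (simp add: real_sqrt_mult)
qed

text \<open>The deflated vectors \<open>a' k\<close>, \<open>b' k\<close> are orthogonal to \<open>w\<close> and \<open>z\<close>, so the matrix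
  \<open>\<rho> w z\<^sup>T + \<Sum>\<^sub>k \<kappa> k a' k b' k\<^sup>T\<close> still has operator norm at most \<open>\<rho>\<close>; this keeps the full spectral gap.\<close>

lemma deflated_operator_bound:
  assumes w: "ip p w w = 1" and z: "ip q z z = 1"
    and orth: "\<And>k. k \<in> K \<Longrightarrow> ip p (a k) w = 0" "\<And>k. k \<in> K \<Longrightarrow> ip q (b k) z = 0"
    and gram: "\<And>i j. i \<in> K \<Longrightarrow> j \<in> K \<Longrightarrow> \<bar>ip p (a i) (a j) - of_bool (i = j)\<bar> \<le> e"
      "\<And>i j. i \<in> K \<Longrightarrow> j \<in> K \<Longrightarrow> \<bar>ip q (b i) (b j) - of_bool (i = j)\<bar> \<le> e"
    and K: "finite K" "real (card K) \<le> r" and e: "0 \<le> e"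
    and \<kappa>: "\<And>k. k \<in> K \<Longrightarrow> \<bar>\<kappa> k\<bar> \<le> L" and L: "0 \<le> L" and \<rho>: "\<rho> = L * (1 + r * e)"
  shows "bf p q x (\<lambda>i j. \<rho> * (w i * z j) + (\<Sum>k\<in>K. \<kappa> k * (a k i * b k j))) y
    \<le> \<rho> * (sqrt (ip p x x) * sqrt (ip q y y))"
proof -
  have r: "0 \<le> r" using K by linarith
  \<comment> \<open>The deflated vectors see only the component of \<open>t\<close> orthogonal to
    \<open>v\<close>; the remaining \<open>(ip m t v)\<^sup>2\<close> is the room for the rank one
    term.\<close>
  have bessel: "(\<Sum>k\<in>K. (ip m t (c k))\<^sup>2) \<le> (1 + r * e) * (ip m t t - (ip m t v)\<^sup>2)"
    if v: "ip m v v = 1" and cv: "\<And>k. k \<in> K \<Longrightarrow> ip m (c k) v = 0"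
      and c: "\<And>i j. i \<in> K \<Longrightarrow> j \<in> K \<Longrightarrow> \<bar>ip m (c i) (c j) - of_bool (i = j)\<bar> \<le> e" for m t v c
  proof -
    define t' where "t' = (\<lambda>i. t i - ip m t v * v i)"
    have "ip m t' (c k) = ip m t (c k)" if "k \<in> K" for k
      using cv[OF that] by (simp add: t'_def ip_bilinear ip_commute[of m v])
    then have "(\<Sum>k\<in>K. (ip m t (c k))\<^sup>2) = (\<Sum>k\<in>K. (ip m t' (c k))\<^sup>2)" by simp
    also have "\<dots> \<le> (1 + r * e) * ip m t' t'" by (rule bessel_almost_orthonormal[OF c K e])
    also have "ip m t' t' = ip m t t - (ip m t v)\<^sup>2"
      using v by (simp add: t'_def ip_bilinear ip_commute[of m v t] power2_eq_square)
    finally show ?thesis .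
  qed
  define \<alpha> \<beta> where "\<alpha> = \<bar>ip p x w\<bar>" and "\<beta> = \<bar>ip q z y\<bar>"
  define X Y where "X = (\<Sum>k\<in>K. (ip p x (a k))\<^sup>2)" and "Y = (\<Sum>k\<in>K. (ip q y (b k))\<^sup>2)"
  have X: "X \<le> (1 + r * e) * (ip p x x - \<alpha>\<^sup>2)"
    unfolding X_def \<alpha>_def power2_abs by (rule bessel[OF w orth(1) gram(1)])
  have Y: "Y \<le> (1 + r * e) * (ip q y y - \<beta>\<^sup>2)"
    unfolding Y_def \<beta>_def power2_abs ip_commute[of q z y] by (rule bessel[OF z orth(2) gram(2)])
  define g where "g = 1 + r * e"
  have g: "g \<ge> 1" using r e by (simp add: g_def)
  have X0: "0 \<le> X" and Y0: "0 \<le> Y" by (simp_all add: X_def Y_def sum_nonneg)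
  have "bf p q x (\<lambda>i j. \<rho> * (w i * z j) + (\<Sum>k\<in>K. \<kappa> k * (a k i * b k j))) y
      = \<rho> * (ip p x w * ip q z y) + (\<Sum>k\<in>K. \<kappa> k * (ip p x (a k) * ip q (b k) y))"
    by (simp add: bf_add_mat bf_scale_mat bf_sum_mat bf_outer)
  also have "\<dots> \<le> \<rho> * (\<alpha> * \<beta>) + (\<Sum>k\<in>K. L * (\<bar>ip p x (a k)\<bar> * \<bar>ip q y (b k)\<bar>))"
  proof (intro add_mono sum_mono)
    show "\<rho> * (ip p x w * ip q z y) \<le> \<rho> * (\<alpha> * \<beta>)"
      using g L unfolding \<rho> g_def \<alpha>_def \<beta>_def abs_mult[symmetric]
      by (intro mult_left_mono mult_nonneg_nonneg) auto
    fix k assume "k \<in> K"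
    have "\<kappa> k * (ip p x (a k) * ip q (b k) y) \<le> \<bar>\<kappa> k\<bar> * \<bar>ip p x (a k) * ip q (b k) y\<bar>"
      by (metis abs_ge_self abs_mult)
    also have "\<dots> \<le> L * \<bar>ip p x (a k) * ip q (b k) y\<bar>"
      using \<kappa>[OF \<open>k \<in> K\<close>] by (intro mult_right_mono) auto
    finally show "\<kappa> k * (ip p x (a k) * ip q (b k) y) \<le> L * (\<bar>ip p x (a k)\<bar> * \<bar>ip q y (b k)\<bar>)"
      by (simp add: abs_mult ip_commute[of q "b k"])
  qed
  also have "(\<Sum>k\<in>K. L * (\<bar>ip p x (a k)\<bar> * \<bar>ip q y (b k)\<bar>)) \<le> L * (sqrt X * sqrt Y)"
  proof -
    have "(\<Sum>k\<in>K. \<bar>ip p x (a k)\<bar> * \<bar>ip q y (b k)\<bar>)\<^sup>2 \<le> X * Y"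
      unfolding X_def Y_def
      using Cauchy_Schwarz_ineq_sum[of "\<lambda>k. \<bar>ip p x (a k)\<bar>" "\<lambda>k. \<bar>ip q y (b k)\<bar>" K] by simp
    then have "(\<Sum>k\<in>K. \<bar>ip p x (a k)\<bar> * \<bar>ip q y (b k)\<bar>) \<le> sqrt (X * Y)"
      by (rule real_le_rsqrt)
    then show ?thesis
      using L by (simp add: real_sqrt_mult mult_left_mono flip: sum_distrib_left)
  qed
  \<comment> \<open>As \<open>\<rho>\<close> is \<open>L * g\<close>, the Bessel factor
    \<open>g\<close> can be moved under the roots, and the bracket becomes a scalar product in the
    plane.\<close>
  also have "\<rho> * (\<alpha> * \<beta>) + L * (sqrt X * sqrt Y) = \<rho> * (\<alpha> * \<beta> + sqrt (X / g) * sqrt (Y / g))"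
    using g \<rho>[folded g_def] by (simp add: real_sqrt_divide field_simps)
  also have "\<dots> \<le> \<rho> * (sqrt (ip p x x) * sqrt (ip q y y))"
  proof (intro mult_left_mono two_dim_cauchy_schwarz)
    show "0 \<le> \<rho>" using L g by (simp add: \<rho> g_def)
    show "\<alpha>\<^sup>2 + X / g \<le> ip p x x" "\<beta>\<^sup>2 + Y / g \<le> ip q y y"
      using X[folded g_def] Y[folded g_def] g by (simp_all add: field_simps)
  qed (use g X0 Y0 in \<open>simp_all add: \<alpha>_def \<beta>_def\<close>)
  finally show ?thesis by simp
qed

text \<open>Projecting away \<open>w\<close> changes the Gram matrix by products of two coefficients
  of size at most \<open>2 * \<epsilon>\<close>; for \<open>\<epsilon>\<close> \<le> 1 / 4 this adds
  at most another \<open>\<epsilon>\<close>.\<close>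

lemma gram_deflate:
  fixes a :: "nat \<Rightarrow> nat \<Rightarrow> real" and r :: nat
  assumes gram: "\<And>i j. i < r \<Longrightarrow> j < r \<Longrightarrow> \<bar>ip p (a i) (a j) - of_bool (i = j)\<bar> \<le> \<epsilon>"
    and \<epsilon>: "0 \<le> \<epsilon>" "\<epsilon> \<le> 1 / 4" and r: "1 \<le> r"
    and w_def: "w = (\<lambda>i. (1 / sqrt (ip p (a 0) (a 0))) * a 0 i)"
    and a'_def: "a' = (\<lambda>k i. a k i - ip p (a k) w * w i)"
  shows "ip p w w = 1" "ip p (a k) w = ip p (a k) (a 0) / sqrt (ip p (a 0) (a 0))"
    "ip p (a 0) w = sqrt (ip p (a 0) (a 0))"
    "1 - \<epsilon> \<le> ip p (a 0) (a 0)" "ip p (a' k) w = 0"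
    "k < r \<Longrightarrow> k \<noteq> 0 \<Longrightarrow> \<bar>ip p (a k) w\<bar> \<le> 2 * \<epsilon>"
    "k < r \<Longrightarrow> l < r \<Longrightarrow> k \<noteq> 0 \<Longrightarrow> l \<noteq> 0 \<Longrightarrow> \<bar>ip p (a' k) (a' l) - of_bool (k = l)\<bar> \<le> 2 * \<epsilon>"
proof -
  let ?s = "ip p (a 0) (a 0)"
  have "0 < r" using r by simp
  then have "\<bar>?s - 1\<bar> \<le> \<epsilon>" using gram[of 0 0] by simp
  then show s: "1 - \<epsilon> \<le> ?s" by linarith
  then have s0: "?s > 0" and s4: "1 / 4 \<le> ?s" using \<epsilon> by linarith+
  show aw: "ip p (a k) w = ip p (a k) (a 0) / sqrt ?s" for k
    unfolding w_def ip_scale_right by simp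
  show "ip p (a 0) w = sqrt ?s" unfolding aw using s0 by (simp add: real_div_sqrt)
  show ww: "ip p w w = 1"
    using s0 unfolding w_def ip_scale_right ip_scale_left by simp
  show "ip p (a' k) w = 0" by (simp add: a'_def ip_bilinear ww)
  have half: "1 / 2 \<le> sqrt ?s" using real_sqrt_le_mono[OF s4] by (simp add: real_sqrt_divide)
  have small: "\<bar>ip p (a k) w\<bar> \<le> 2 * \<epsilon>" if "k < r" "k \<noteq> 0" for k
  proof -
    have "\<bar>ip p (a k) w\<bar> = \<bar>ip p (a k) (a 0)\<bar> / sqrt ?s" using s0 by (simp add: aw)
    also have "\<dots> \<le> \<epsilon> / (1 / 2)"
      using gram[of k 0] that r half \<epsilon> by (intro frac_le) auto
    finally show ?thesis by simp
  qed
  then show "k < r \<Longrightarrow> k \<noteq> 0 \<Longrightarrow> \<bar>ip p (a k) w\<bar> \<le> 2 * \<epsilon>" .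
  assume kl: "k < r" "l < r" "k \<noteq> 0" "l \<noteq> 0"
  have "ip p (a' k) (a' l) = ip p (a k) (a l) - ip p (a k) w * ip p (a l) w"
    by (simp add: a'_def ip_bilinear ww ip_commute[of p w "a _"])
  moreover have "\<bar>ip p (a k) w * ip p (a l) w\<bar> \<le> (2 * \<epsilon>) * (2 * \<epsilon>)"
    unfolding abs_mult using small kl \<epsilon> by (intro mult_mono) auto
  moreover have "(2 * \<epsilon>) * (2 * \<epsilon>) \<le> \<epsilon>" using \<epsilon> mult_right_mono[of "4 * \<epsilon>" 1 \<epsilon>] by simp
  ultimately show "\<bar>ip p (a' k) (a' l) - of_bool (k = l)\<bar> \<le> 2 * \<epsilon>"
    using gram[OF kl(1,2)] by linarith
qed

lemma contraction_lower_bound: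
  fixes c l v :: real
  assumes "- c \<le> v" "0 \<le> c" "0 \<le> l" "l \<le> 1"
  shows "- c \<le> l * v"
  using mult_left_mono[OF assms(1,3)] mult_right_mono[OF assms(4,2)] by simp

text \<open>\<open>h = 1 - w\<^sup>T G z\<close> measures misalignment, and the squared Frobenius
  norm of \<open>H\<close> is at most \<open>2 * h\<close> because that of \<open>G\<close> is at
  most 1. Duality against a test matrix of operator norm close to \<open>L1\<close> limits what the
  components \<open>k \<ge> 1\<close> of \<open>G\<close> can gain to about \<open>L1 * h\<close>,
  while the leading one loses about \<open>Lm 0 * h\<close>; the gap remains, up to the Gram error
  \<open>\<epsilon>\<close>. Taking the duality as a hypothesis keeps square roots and nuclear norms
  out.\<close>

lemma colar_curvature:
  fixes a b :: "nat \<Rightarrow> nat \<Rightarrow> real" and r :: nat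
  assumes dual: "\<And>R \<rho>. 0 \<le> \<rho> \<Longrightarrow> (\<And>x. sqrt (ip p (mv q R x) (mv q R x)) \<le> \<rho> * sqrt (ip q x x)) \<Longrightarrow>
      (\<Sum>i<p. \<Sum>j<q. R i j * G i j) \<le> \<rho>"
    and frob: "fro2 p q G \<le> 1"
    and grama: "\<And>i j. i < r \<Longrightarrow> j < r \<Longrightarrow> \<bar>ip p (a i) (a j) - of_bool (i = j)\<bar> \<le> \<epsilon>"
    and gramb: "\<And>i j. i < r \<Longrightarrow> j < r \<Longrightarrow> \<bar>ip q (b i) (b j) - of_bool (i = j)\<bar> \<le> \<epsilon>"
    and \<epsilon>: "0 \<le> \<epsilon>" "\<epsilon> \<le> 1 / 4" and r: "1 \<le> r"
    and L: "\<And>k. k < r \<Longrightarrow> 0 \<le> Lm k" "\<And>k. k < r \<Longrightarrow> Lm k \<le> 1"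
      "0 \<le> L1" "L1 \<le> 1" "\<And>k. 1 \<le> k \<Longrightarrow> k < r \<Longrightarrow> Lm k \<le> L1"
    and gap: "8 * real r * \<epsilon> \<le> Lm 0 - L1"
    and w_def: "w = (\<lambda>i. (1 / sqrt (ip p (a 0) (a 0))) * a 0 i)"
    and z_def: "z = (\<lambda>i. (1 / sqrt (ip q (b 0) (b 0))) * b 0 i)"
    and H_def: "H = (\<lambda>i j. w i * z j - G i j)"
  shows "(Lm 0 - L1) / 4 * fro2 p q H - 8 * real r * \<epsilon> * sqrt (fro2 p q H)
    \<le> (\<Sum>k<r. Lm k * bf p q (a k) H (b k))"
proof -
  define a' where "a' = (\<lambda>k i. a k i - ip p (a k) w * w i)"
  define b' where "b' = (\<lambda>k i. b k i - ip q (b k) z * z i)"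
  note A = gram_deflate[OF grama \<epsilon> r w_def a'_def] and B = gram_deflate[OF gramb \<epsilon> r z_def b'_def]
  define D where "D = sqrt (fro2 p q H)"
  define N where "N = {1..<r}"
  define h where "h = bf p q w H z"
  have N: "finite N" "real (card N) \<le> real r" "\<And>k. k \<in> N \<Longrightarrow> k < r \<and> k \<noteq> 0 \<and> 1 \<le> k"
    by (auto simp: N_def)
  have D0: "0 \<le> D" by (simp add: D_def)
  have DD: "D * D = fro2 p q H" by (simp add: D_def)
  have h_eq: "h = 1 - bf p q w G z"
    by (simp add: h_def H_def bf_diff_mat bf_outer A(1) B(1))
  have "fro2 p q H = 1 - 2 * bf p q w G z + fro2 p q G"
  proof -
    have "fro2 p q H = (\<Sum>i<p. \<Sum>j<q. (w i * z j) * (w i * z j)) - 2 * (\<Sum>i<p. \<Sum>j<q. (w i * z j) * G i j) + fro2 p q G"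
      by (simp add: fro2_def ip_def H_def algebra_simps sum.distrib sum_subtractf sum_distrib_left)
    moreover have "(\<Sum>i<p. \<Sum>j<q. (w i * z j) * (w i * z j)) = ip p w w * ip q z z"
      by (simp add: ip_def sum_product mult_ac)
    ultimately show ?thesis by (simp add: sum_outer_mult A(1) B(1))
  qed
  then have hD: "fro2 p q H \<le> 2 * h" using frob h_eq by simp
  have h0: "0 \<le> h" using hD fro2_nonneg[of p q H] by linarith
  have ba: "\<bar>bf p q x H y\<bar> \<le> 2 * D" if "ip p x x = 1" "ip q y y \<le> 4" for x y
  proof -
    have "\<bar>bf p q x H y\<bar> \<le> D * sqrt (ip q y y)" using bf_frobenius[of p q x H y] that by (simp add: D_def)
    also have "\<dots> \<le> D * 2" using real_sqrt_le_mono[OF that(2)] D0 by (intro mult_left_mono) auto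
    finally show ?thesis by simp
  qed
  have bb: "\<bar>bf p q x H y\<bar> \<le> 2 * D" if "ip p x x \<le> 4" "ip q y y = 1" for x y
  proof -
    have "\<bar>bf p q x H y\<bar> \<le> sqrt (ip p x x) * D" using bf_frobenius[of p q x H y] that by (simp add: D_def)
    also have "\<dots> \<le> 2 * D" using real_sqrt_le_mono[OF that(1)] D0 by (intro mult_right_mono) auto
    finally show ?thesis by simp
  qed
  define \<rho> where "\<rho> = L1 * (1 + real r * (2 * \<epsilon>))"
  have rho0: "0 \<le> \<rho>" using L(3) \<epsilon> by (simp add: \<rho>_def)
  \<comment> \<open>The functional itself with its leading weight lowered to \<open>\<rho>\<close>,
    so that the operator norm is at most \<open>\<rho>\<close>. What has been taken off is the gap,
    up to terms of order \<open>\<epsilon>\<close>.\<close>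
  define R where "R = (\<lambda>i j. \<rho> * (w i * z j) + (\<Sum>k\<in>N. Lm k * (a' k i * b' k j)))"
  have "bf p q x R y \<le> \<rho> * (sqrt (ip p x x) * sqrt (ip q y y))" for x y
    unfolding R_def
    by (rule deflated_operator_bound[where e = "2 * \<epsilon>" and r = "real r" and L = L1])
       (use A B N L \<epsilon> in \<open>auto simp: \<rho>_def\<close>)
  from dual[OF rho0 op_bound_bilinear[OF this rho0]]
  have "(\<Sum>i<p. \<Sum>j<q. R i j * G i j) \<le> \<rho>" .
  moreover have "(\<Sum>i<p. \<Sum>j<q. R i j * G i j) = \<rho> * bf p q w G z + (\<Sum>k\<in>N. Lm k * bf p q (a' k) G (b' k))"
  proof -
    have "(\<Sum>i<p. \<Sum>j<q. R i j * G i j) = (\<Sum>i<p. \<Sum>j<q. \<rho> * (w i * z j * G i j))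
        + (\<Sum>i<p. \<Sum>j<q. \<Sum>k\<in>N. Lm k * (a' k i * b' k j * G i j))"
      by (simp only: R_def distrib_right sum.distrib sum_distrib_right mult.assoc)
    also have "(\<Sum>i<p. \<Sum>j<q. \<Sum>k\<in>N. Lm k * (a' k i * b' k j * G i j)) =
        (\<Sum>i<p. \<Sum>k\<in>N. \<Sum>j<q. Lm k * (a' k i * b' k j * G i j))"
      by (intro sum.cong refl sum.swap)
    also have "\<dots> = (\<Sum>k\<in>N. \<Sum>i<p. \<Sum>j<q. Lm k * (a' k i * b' k j * G i j))" by (rule sum.swap)
    finally show ?thesis by (simp add: sum_outer_mult flip: sum_distrib_left)
  qed
  ultimately have T: "- (\<rho> * h) \<le> - (\<Sum>k\<in>N. Lm k * bf p q (a' k) G (b' k))"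
    unfolding h_eq by (simp add: algebra_simps)
  \<comment> \<open>\<open>a k\<close> and \<open>b k\<close> are decomposed along \<open>w\<close>,
    \<open>z\<close> and the deflated remainders. On a pair of remainders the rank one part of
    \<open>H\<close> vanishes, leaving only \<open>- G\<close>.\<close>
  have split: "bf p q (a k) H (b k) = ip p (a k) w * ip q (b k) z * h + ip p (a k) w * bf p q w H (b' k)
      + ip q (b k) z * bf p q (a' k) H z - bf p q (a' k) G (b' k)" if k: "k < r" for k
  proof -
    have "a k = (\<lambda>i. ip p (a k) w * w i + a' k i)" "b k = (\<lambda>i. ip q (b k) z * z i + b' k i)"
      by (simp_all add: a'_def b'_def)
    then have "bf p q (a k) H (b k) = bf p q (\<lambda>i. ip p (a k) w * w i + a' k i) H (\<lambda>i. ip q (b k) z * z i + b' k i)"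
      by metis
    also have "\<dots> = ip p (a k) w * ip q (b k) z * h + ip p (a k) w * bf p q w H (b' k)
      + ip q (b k) z * bf p q (a' k) H z + bf p q (a' k) H (b' k)"
      by (simp add: bf_bilinear h_def distrib_left mult.assoc)
    also have "bf p q (a' k) H (b' k) = - bf p q (a' k) G (b' k)"
      by (simp add: H_def bf_diff_mat bf_outer A(5))
    finally show ?thesis by simp
  qed
  \<comment> \<open>Both coefficients are at most \<open>2 * \<epsilon>\<close>, and remainders of
    squared length at most 4 contribute at most \<open>2 * D\<close> to each cross term.\<close>
  have summand: "- (4 * \<epsilon>\<^sup>2 * h) - 8 * \<epsilon> * D - Lm k * bf p q (a' k) G (b' k) \<le> Lm k * bf p q (a k) H (b k)"
    if k: "k \<in> N" for k
  proof -
    note kk = N(3)[OF k]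
    let ?\<alpha> = "ip p (a k) w" and ?\<beta> = "ip q (b k) z"
    have \<alpha>: "\<bar>?\<alpha>\<bar> \<le> 2 * \<epsilon>" and \<beta>: "\<bar>?\<beta>\<bar> \<le> 2 * \<epsilon>" using A(6) B(6) kk by auto
    have "ip p (a' k) (a' k) \<le> 4" "ip q (b' k) (b' k) \<le> 4"
      using A(7)[of k k] B(7)[of k k] kk \<epsilon> by auto
    then have 2: "\<bar>bf p q w H (b' k)\<bar> \<le> 2 * D" and 3: "\<bar>bf p q (a' k) H z\<bar> \<le> 2 * D"
      using ba[OF A(1)] bb[OF _ B(1)] by auto
    have "\<bar>?\<alpha> * ?\<beta> * h\<bar> \<le> (2 * \<epsilon>) * (2 * \<epsilon>) * h"
      unfolding abs_mult using \<alpha> \<beta> \<epsilon> h0 by (intro mult_mono) auto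
    moreover have "\<bar>?\<alpha> * bf p q w H (b' k)\<bar> \<le> (2 * \<epsilon>) * (2 * D)"
      unfolding abs_mult using \<alpha> 2 \<epsilon> by (intro mult_mono) auto
    moreover have "\<bar>?\<beta> * bf p q (a' k) H z\<bar> \<le> (2 * \<epsilon>) * (2 * D)"
      unfolding abs_mult using \<beta> 3 \<epsilon> by (intro mult_mono) auto
    ultimately have "- (4 * \<epsilon>\<^sup>2 * h + 8 * \<epsilon> * D) \<le> bf p q (a k) H (b k) + bf p q (a' k) G (b' k)"
      using split[of k] kk by (simp add: power2_eq_square)
    moreover have "0 \<le> 4 * \<epsilon>\<^sup>2 * h + 8 * \<epsilon> * D" using \<epsilon> h0 D0 by simp
    ultimately have "- (4 * \<epsilon>\<^sup>2 * h + 8 * \<epsilon> * D) \<le> Lm k * (bf p q (a k) H (b k) + bf p q (a' k) G (b' k))"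
      using L(1,2)[of k] kk by (intro contraction_lower_bound) auto
    then show ?thesis by (simp add: algebra_simps)
  qed
  \<comment> \<open>The leading term has no remainder, so \<open>h\<close> enters with the product
    of the two norms, which is at least \<open>1 - \<epsilon>\<close>.\<close>
  have zero: "(1 - \<epsilon>) * Lm 0 * h \<le> Lm 0 * bf p q (a 0) H (b 0)"
  proof -
    have a0: "a' 0 = (\<lambda>i. 0)"
    proof
      fix i
      have "a 0 i = sqrt (ip p (a 0) (a 0)) * w i"
        using A(4) \<epsilon> unfolding w_def by simp
      then show "a' 0 i = 0" by (simp add: a'_def A(3))
    qed
    have b0: "b' 0 = (\<lambda>i. 0)"
    proof
      fix i
      have "b 0 i = sqrt (ip q (b 0) (b 0)) * z i"
        using B(4) \<epsilon> unfolding z_def by simp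
      then show "b' 0 i = 0" by (simp add: b'_def B(3))
    qed
    have "bf p q (a 0) H (b 0) = sqrt (ip p (a 0) (a 0)) * sqrt (ip q (b 0) (b 0)) * h"
      using split[of 0] r by (simp add: a0 b0 A(3) B(3)) (simp add: bf_sum)
    moreover have "1 - \<epsilon> \<le> sqrt (ip p (a 0) (a 0)) * sqrt (ip q (b 0) (b 0))"
    proof -
      have "sqrt (1 - \<epsilon>) * sqrt (1 - \<epsilon>) \<le> sqrt (ip p (a 0) (a 0)) * sqrt (ip q (b 0) (b 0))"
        using A(4) B(4) \<epsilon> by (intro mult_mono real_sqrt_le_mono) auto
      then show ?thesis using \<epsilon> by simp
    qed
    ultimately show ?thesis
      using L(1)[of 0] r h0 by (simp add: mult_left_mono mult_right_mono mult_ac)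
  qed
  have set: "{..<r} = insert 0 N" "0 \<notin> N" using r by (auto simp: N_def)
  have "(\<Sum>k<r. Lm k * bf p q (a k) H (b k)) = Lm 0 * bf p q (a 0) H (b 0) + (\<Sum>k\<in>N. Lm k * bf p q (a k) H (b k))"
    unfolding set(1) using N(1) set(2) by simp
  also have "\<dots> \<ge> (1 - \<epsilon>) * Lm 0 * h + (\<Sum>k\<in>N. - (4 * \<epsilon>\<^sup>2 * h) - 8 * \<epsilon> * D - Lm k * bf p q (a' k) G (b' k))"
    by (intro add_mono zero sum_mono summand)
  also have "(\<Sum>k\<in>N. - (4 * \<epsilon>\<^sup>2 * h) - 8 * \<epsilon> * D - Lm k * bf p q (a' k) G (b' k)) =
      - (real (card N) * (4 * \<epsilon>\<^sup>2 * h + 8 * \<epsilon> * D)) - (\<Sum>k\<in>N. Lm k * bf p q (a' k) G (b' k))"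
    by (simp add: sum_subtractf algebra_simps)
  finally have main: "(1 - \<epsilon>) * Lm 0 * h - real (card N) * (4 * \<epsilon>\<^sup>2 * h + 8 * \<epsilon> * D) - \<rho> * h
      \<le> (\<Sum>k<r. Lm k * bf p q (a k) H (b k))"
    using T by linarith
  have "real (card N) * (4 * \<epsilon>\<^sup>2 * h + 8 * \<epsilon> * D) \<le> real r * (4 * \<epsilon>\<^sup>2 * h + 8 * \<epsilon> * D)"
    using N(2) \<epsilon> h0 D0 by (intro mult_right_mono) auto
  also have "\<dots> \<le> real r * (\<epsilon> * h + 8 * \<epsilon> * D)"
  proof -
    have "4 * \<epsilon>\<^sup>2 \<le> \<epsilon>" using \<epsilon> mult_right_mono[of "4 * \<epsilon>" 1 \<epsilon>] by (simp add: power2_eq_square)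
    then show ?thesis using h0 \<epsilon> by (intro mult_left_mono add_mono mult_right_mono) auto
  qed
  finally have n1: "real (card N) * (4 * \<epsilon>\<^sup>2 * h + 8 * \<epsilon> * D) \<le> real r * \<epsilon> * h + 8 * real r * \<epsilon> * D"
    by (simp add: algebra_simps)
  have n2: "\<epsilon> * Lm 0 \<le> real r * \<epsilon>" 
    using L(2)[of 0] r \<epsilon> mult_left_mono[of "Lm 0" "real r" \<epsilon>] by (simp add: mult_ac)
  have n3: "\<rho> \<le> L1 + 2 * (real r * \<epsilon>)"
  proof -
    have "L1 * (2 * (real r * \<epsilon>)) \<le> 1 * (2 * (real r * \<epsilon>))"
      using L(4) \<epsilon> by (intro mult_right_mono) auto
    then show ?thesis by (simp add: \<rho>_def algebra_simps)
  qed
  \<comment> \<open>The three losses total at most \<open>4 * real r * \<epsilon>\<close>, which is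
    at most half of the difference \<open>Lm 0 - L1\<close>.\<close>
  have "(Lm 0 - L1) / 2 \<le> (1 - \<epsilon>) * Lm 0 - real r * \<epsilon> - \<rho>"
  proof -
    define x y where "x = real r * \<epsilon>" and "y = \<epsilon> * Lm 0"
    have "(1 - \<epsilon>) * Lm 0 = Lm 0 - y" "8 * x \<le> Lm 0 - L1" "y \<le> x" "\<rho> \<le> L1 + 2 * x"
      using n2 n3 gap by (simp_all add: x_def y_def left_diff_distrib)
    then show ?thesis unfolding x_def[symmetric] by (simp add: field_simps)
  qed
  then have "(Lm 0 - L1) / 2 * h \<le> ((1 - \<epsilon>) * Lm 0 - real r * \<epsilon> - \<rho>) * h"
    using h0 by (rule mult_right_mono)
  moreover have "(Lm 0 - L1) / 4 * fro2 p q H \<le> (Lm 0 - L1) / 2 * h"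
  proof -
    have "0 \<le> Lm 0 - L1" using gap \<epsilon> by (smt (verit) mult_nonneg_nonneg of_nat_0_le_iff)
    then have "(Lm 0 - L1) / 4 * fro2 p q H \<le> (Lm 0 - L1) / 4 * (2 * h)"
      using hD by (intro mult_left_mono) auto
    then show ?thesis by (simp add: mult_ac)
  qed
  ultimately show ?thesis
    using main n1 unfolding D_def[symmetric] left_diff_distrib[of _ _ h] by linarith
qed

section \<open>Cone inequalities and rates\<close>

lemma l1_cone:
  fixes A F :: "'b \<Rightarrow> real"
  assumes "finite P" "S \<subseteq> P" "\<And>i. i \<in> P - S \<Longrightarrow> A i = 0"
  shows "(\<Sum>i\<in>P. \<bar>A i\<bar>) - (\<Sum>i\<in>P. \<bar>F i\<bar>) \<le> (\<Sum>i\<in>S. \<bar>A i - F i\<bar>) - (\<Sum>i\<in>P - S. \<bar>A i - F i\<bar>)"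
proof -
  have "(\<Sum>i\<in>P. \<bar>A i\<bar>) - (\<Sum>i\<in>P. \<bar>F i\<bar>) = (\<Sum>i\<in>P - S. \<bar>A i\<bar> - \<bar>F i\<bar>) + (\<Sum>i\<in>S. \<bar>A i\<bar> - \<bar>F i\<bar>)"
    unfolding sum_subtractf[symmetric] by (rule sum.subset_diff[OF assms(2,1)])
  \<comment> \<open>Off \<open>S\<close> the values of \<open>A\<close> vanish, so the difference is
    exactly \<open>- \<bar>A i - F i\<bar>\<close>; on \<open>S\<close> it is bounded by the
    triangle inequality.\<close>
  also have "\<dots> \<le> (\<Sum>i\<in>P - S. - \<bar>A i - F i\<bar>) + (\<Sum>i\<in>S. \<bar>A i - F i\<bar>)"
    using assms(3) by (intro add_mono sum_mono) auto
  finally show ?thesis by (simp add: sum_negf)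
qed

lemma sum_abs_le_sqrt_card:
  fixes h :: "'b \<Rightarrow> real"
  assumes "finite P" "S \<subseteq> P" "real (card S) \<le> m"
  shows "(\<Sum>i\<in>S. \<bar>h i\<bar>) \<le> sqrt m * sqrt (\<Sum>i\<in>P. (h i)\<^sup>2)"
proof -
  have "(\<Sum>i\<in>S. 1 * \<bar>h i\<bar>)\<^sup>2 \<le> (\<Sum>i\<in>S. 1\<^sup>2) * (\<Sum>i\<in>S. \<bar>h i\<bar>\<^sup>2)"
    by (rule Cauchy_Schwarz_ineq_sum)
  also have "\<dots> \<le> m * (\<Sum>i\<in>P. (h i)\<^sup>2)"
    using assms by (intro mult_mono sum_nonneg) (auto intro: sum_mono2 order_trans)
  finally have "(\<Sum>i\<in>S. \<bar>h i\<bar>) \<le> sqrt (m * (\<Sum>i\<in>P. (h i)\<^sup>2))"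
    by (simp add: real_le_rsqrt)
  then show ?thesis by (simp add: real_sqrt_mult)
qed

text \<open>\<open>D\<close> is the error in the weighted and \<open>N\<close> in the plain
  Frobenius norm; \<open>hS\<close> and \<open>hc\<close> are its l1 masses on and off the support.
  The linear term coming from the Gram errors spoils the pure cone condition: \<open>hc\<close> is
  bounded by a multiple of \<open>hS\<close> plus a multiple of \<open>D\<close>. The first
  condition of \<open>small\<close> absorbs the \<open>N\<close> part of the restricted eigenvalue
  loss, the second its \<open>D\<close> part.\<close>

lemma colar_rate_arithmetic:
  fixes g D rr \<epsilon> lm hS hc \<eta> s N e0 c \<nu> :: real
  assumes main: "g / 4 * D\<^sup>2 - 8 * rr * \<epsilon> * D \<le> lm * (hS - hc) + \<eta> * (hS + hc)"
    and \<eta>: "\<eta> \<le> lm / 2" and hS: "hS \<le> s * N" and \<epsilon>: "\<epsilon> \<le> e0 * lm"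
    and RE: "c * N\<^sup>2 - \<nu> * (hS + hc)\<^sup>2 \<le> D\<^sup>2"
    and small: "32 * \<nu> * s\<^sup>2 \<le> c / 2" "2 * \<nu> * (16 * rr * e0)\<^sup>2 \<le> 1"
    and pos: "0 < g" "0 \<le> D" "0 \<le> rr" "0 \<le> e0" "0 < lm" "0 \<le> hS" "0 \<le> hc" "1 \<le> s" "0 \<le> N" "0 < c" "0 \<le> \<nu>"
  shows "N \<le> 2 / sqrt c * (4 / g) * (8 * rr * e0 + 3 / sqrt c) * (s * lm)"
proof -
  have gD: "0 \<le> g / 4 * D\<^sup>2" using pos by simp
  have eD: "8 * rr * \<epsilon> * D \<le> 8 * rr * (e0 * lm) * D"
    using \<epsilon> pos by (intro mult_right_mono mult_left_mono) auto
  have hD: "\<eta> * (hS + hc) \<le> lm / 2 * (hS + hc)" using \<eta> pos by (intro mult_right_mono) auto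
  have "lm * (hc / 2) \<le> lm * (3 / 2 * hS + 8 * rr * e0 * D)"
    using main gD eD hD by (simp add: algebra_simps)
  then have hc: "hc \<le> 3 * hS + 16 * rr * e0 * D" using pos by simp
  have h: "hS + hc \<le> 4 * s * N + 16 * rr * e0 * D" using hc hS by simp
  have sq: "(a + b)\<^sup>2 \<le> 2 * a\<^sup>2 + 2 * b\<^sup>2" for a b :: real
    using zero_le_power2[of "a - b"] by (simp add: power2_eq_square algebra_simps)
  have "(hS + hc)\<^sup>2 \<le> (4 * s * N + 16 * rr * e0 * D)\<^sup>2" using h pos by (intro power_mono) auto
  also have "\<dots> \<le> 2 * (4 * s * N)\<^sup>2 + 2 * (16 * rr * e0 * D)\<^sup>2" by (rule sq)
  finally have "\<nu> * (hS + hc)\<^sup>2 \<le> \<nu> * (2 * (4 * s * N)\<^sup>2 + 2 * (16 * rr * e0 * D)\<^sup>2)"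
    using pos by (intro mult_left_mono) auto
  also have "\<dots> = 32 * \<nu> * s\<^sup>2 * N\<^sup>2 + 2 * \<nu> * (16 * rr * e0)\<^sup>2 * D\<^sup>2"
    by (simp add: power_mult_distrib algebra_simps)
  also have "\<dots> \<le> c / 2 * N\<^sup>2 + 1 * D\<^sup>2"
    using small by (intro add_mono mult_right_mono) auto
  finally have "c / 2 * N\<^sup>2 \<le> 2 * D\<^sup>2" using RE by simp
  then have "N\<^sup>2 \<le> (2 / sqrt c * D)\<^sup>2" using pos by (simp add: power_mult_distrib power_divide field_simps)
  then have ND: "N \<le> 2 / sqrt c * D" by (rule power2_le_imp_le) (use pos in auto)
  have sN: "s * N \<le> s * (2 / sqrt c * D)" using ND pos by (intro mult_left_mono) auto
  have "g / 4 * D\<^sup>2 \<le> lm * (hS - hc) + lm / 2 * (hS + hc) + 8 * rr * (e0 * lm) * D"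
    using main eD hD by simp
  also have "\<dots> \<le> 3 / 2 * lm * hS + 8 * rr * (e0 * lm) * D"
  proof -
    have "0 \<le> lm * hc" using pos by simp
    then show ?thesis by (simp add: field_simps)
  qed
  also have "\<dots> \<le> 3 / 2 * lm * (s * (2 / sqrt c * D)) + 8 * rr * (e0 * lm) * D"
    using hS sN pos by (intro add_mono mult_left_mono) auto
  also have "\<dots> = (8 * rr * e0 + 3 / sqrt c * s) * lm * D" by (simp add: algebra_simps)
  also have "\<dots> \<le> (8 * rr * e0 * s + 3 / sqrt c * s) * lm * D"
    using pos mult_left_mono[of 1 s "8 * rr * e0"] by (intro mult_right_mono add_mono) auto
  finally have "g / 4 * D * D \<le> (8 * rr * e0 + 3 / sqrt c) * (s * lm) * D"
    by (simp add: power2_eq_square algebra_simps)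
  moreover have K: "0 \<le> (8 * rr * e0 + 3 / sqrt c) * (s * lm)"
    using pos by (intro mult_nonneg_nonneg add_nonneg_nonneg) auto
  ultimately have "g / 4 * D \<le> (8 * rr * e0 + 3 / sqrt c) * (s * lm)"
    using pos by (cases "D = 0") auto
  then have "D \<le> 4 / g * ((8 * rr * e0 + 3 / sqrt c) * (s * lm))" using pos by (simp add: field_simps)
  then have "2 / sqrt c * D \<le> 2 / sqrt c * (4 / g * ((8 * rr * e0 + 3 / sqrt c) * (s * lm)))"
    using pos by (intro mult_left_mono) auto
  with ND show ?thesis by (simp add: mult_ac)
qed

text \<open>Working with the equation \<open>F\<^sup>T a = \<sigma> b\<close> rather than with the inner product of \<open>b\<close> and \<open>\<beta>\<close>
  makes the bound linear in \<open>e\<close>.\<close>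

lemma singular_vector_perturbation:
  fixes Bf :: "(nat \<Rightarrow> real) \<Rightarrow> (nat \<Rightarrow> real) \<Rightarrow> real"
  assumes near: "\<And>x y. \<bar>Bf x y - ip p x \<alpha> * ip q \<beta> y\<bar> \<le> e * (sqrt (ip p x x) * sqrt (ip q y y))"
    and a: "ip p a a = 1" and b: "ip q b b = 1" and Fa: "\<And>t. Bf a t = \<sigma> * ip q b t"
    and max: "\<And>x y. ip p x x = 1 \<Longrightarrow> ip q y y = 1 \<Longrightarrow> 0 < Bf x y \<Longrightarrow> Bf x y \<le> \<sigma>"
    and \<tau>: "\<tau> = sqrt (ip p \<alpha> \<alpha>) * sqrt (ip q \<beta> \<beta>)" "0 < \<tau>" and e: "0 \<le> e" "4 * e \<le> \<tau>"
  shows "ip q \<beta> t = 0 \<Longrightarrow> \<bar>ip q b t\<bar> \<le> 4 / 3 * (e / \<tau>) * sqrt (ip q t t)"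
    "2 / 5 * (\<bar>ip q \<beta> t\<bar> / sqrt (ip q \<beta> \<beta>)) - 4 / 3 * (e / \<tau>) * sqrt (ip q t t) \<le> \<bar>ip q b t\<bar>"
proof -
  define A B where "A = sqrt (ip p \<alpha> \<alpha>)" and "B = sqrt (ip q \<beta> \<beta>)"
  have "0 \<le> A" "0 \<le> B" by (simp_all add: A_def B_def)
  moreover have "A * B = \<tau>" using \<tau> by (simp add: A_def B_def)
  ultimately have AB: "0 < A" "0 < B" "A * B = \<tau>" using \<tau>(2) zero_less_mult_iff[of A B] by auto
  have sq: "ip p \<alpha> \<alpha> = A * A" "ip q \<beta> \<beta> = B * B" by (simp_all add: A_def B_def)
  \<comment> \<open>At the normalized \<open>\<alpha>\<close> and \<open>\<beta>\<close> the form is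
    at least \<open>\<tau> - e\<close>, which maximality turns into a lower bound for
    \<open>\<sigma>\<close>.\<close>
  define x y where "x = (\<lambda>i. (1 / A) * \<alpha> i)" and "y = (\<lambda>i. (1 / B) * \<beta> i)"
  have x: "ip p x x = 1" and y: "ip q y y = 1"
    unfolding x_def y_def ip_scale_left ip_scale_right using AB by (simp_all add: sq)
  have "ip p x \<alpha> * ip q \<beta> y = \<tau>"
    unfolding x_def y_def ip_scale_left ip_scale_right using AB by (simp add: sq)
  then have "\<tau> - e \<le> Bf x y" using near[of x y] x y by simp
  then have \<sigma>: "\<tau> - e \<le> \<sigma>" using max[OF x y] e \<tau> by linarith
  have Fab: "Bf a b = \<sigma>" using Fa[of b] b by simp
  have \<beta>b: "\<bar>ip q \<beta> b\<bar> \<le> B" using ip_cauchy_schwarz[of q \<beta> b] b by (simp add: B_def)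
  have \<alpha>a: "\<bar>ip p a \<alpha>\<bar> \<le> A" using ip_cauchy_schwarz[of p a \<alpha>] a by (simp add: A_def)
  have "\<sigma> \<le> \<bar>ip p a \<alpha> * ip q \<beta> b\<bar> + e" using near[of a b] Fab a b by simp
  moreover have "\<bar>ip p a \<alpha> * ip q \<beta> b\<bar> \<le> \<bar>ip p a \<alpha>\<bar> * B"
    unfolding abs_mult using \<beta>b by (intro mult_left_mono) auto
  moreover have "\<bar>ip p a \<alpha>\<bar> * B \<le> A * B" using \<alpha>a AB by (intro mult_right_mono) auto
  ultimately have s1: "\<sigma> \<le> \<tau> + e" and s2: "\<tau> - 2 * e \<le> \<bar>ip p a \<alpha>\<bar> * B" using \<sigma> AB by auto
  have \<sigma>0: "3 / 4 * \<tau> \<le> \<sigma>" "\<sigma> \<le> 5 / 4 * \<tau>" "0 < \<sigma>" using \<sigma> s1 e \<tau> by linarith+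
  have t1: "\<bar>\<sigma> * ip q b t - ip p a \<alpha> * ip q \<beta> t\<bar> \<le> e * sqrt (ip q t t)"
    using near[of a t] a by (simp add: Fa)
  have div: "e * sqrt (ip q t t) / \<sigma> \<le> 4 / 3 * (e / \<tau>) * sqrt (ip q t t)"
  proof -
    have "e * sqrt (ip q t t) / \<sigma> \<le> e * sqrt (ip q t t) / (3 / 4 * \<tau>)"
      using \<sigma>0 \<tau> e by (intro divide_left_mono) auto
    then show ?thesis by simp
  qed
  have \<sigma>abs: "\<bar>\<sigma> * ip q b t\<bar> = \<sigma> * \<bar>ip q b t\<bar>" using \<sigma>0 by (simp add: abs_mult)
  { assume "ip q \<beta> t = 0"
    then have "\<sigma> * \<bar>ip q b t\<bar> \<le> e * sqrt (ip q t t)" using t1 \<sigma>abs by simp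
    then have "\<bar>ip q b t\<bar> \<le> e * sqrt (ip q t t) / \<sigma>" using \<sigma>0 by (simp add: field_simps)
    with div show "\<bar>ip q b t\<bar> \<le> 4 / 3 * (e / \<tau>) * sqrt (ip q t t)" by linarith }
  have "\<bar>ip p a \<alpha> * ip q \<beta> t\<bar> - e * sqrt (ip q t t) \<le> \<sigma> * \<bar>ip q b t\<bar>"
    using t1 \<sigma>abs by linarith
  then have low: "\<bar>ip p a \<alpha> * ip q \<beta> t\<bar> / \<sigma> - e * sqrt (ip q t t) / \<sigma> \<le> \<bar>ip q b t\<bar>"
    using \<sigma>0 by (simp add: field_simps)
  \<comment> \<open>The constant 2 / 5 is (1 / 2) / (5 / 4): half of \<open>\<tau>\<close> survives
    in the numerator, and \<open>\<sigma>\<close> in the denominator is at most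
    \<open>5 / 4 * \<tau>\<close>.\<close>
  have "\<tau> / (2 * B) \<le> \<bar>ip p a \<alpha>\<bar>" using s2 e AB by (simp add: field_simps)
  then have "\<tau> / (2 * B) * \<bar>ip q \<beta> t\<bar> \<le> \<bar>ip p a \<alpha> * ip q \<beta> t\<bar>"
    unfolding abs_mult by (intro mult_right_mono) auto
  then have "\<tau> / (2 * B) * \<bar>ip q \<beta> t\<bar> / (5 / 4 * \<tau>) \<le> \<bar>ip p a \<alpha> * ip q \<beta> t\<bar> / \<sigma>"
    using \<sigma>0 \<tau> by (intro frac_le) auto
  moreover have "\<tau> / (2 * B) * \<bar>ip q \<beta> t\<bar> / (5 / 4 * \<tau>) = 2 / 5 * (\<bar>ip q \<beta> t\<bar> / B)"
    using \<tau>(2) AB(1,2) by (simp add: field_simps)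
  ultimately show "2 / 5 * (\<bar>ip q \<beta> t\<bar> / sqrt (ip q \<beta> \<beta>)) - 4 / 3 * (e / \<tau>) * sqrt (ip q t t) \<le> \<bar>ip q b t\<bar>"
    using low div unfolding B_def[symmetric] by linarith
qed

text \<open>Noise of at most \<open>lm / 4\<close> enters the basic inequality doubled and so
  consumes half of the penalty; semidefiniteness alone then puts the error into the cone
  \<open>dc \<le> 3 * dS\<close>. There the l1 norm is at most 4 sqrt s times the l2 norm, and
  \<open>small\<close> limits the restricted eigenvalue loss to half of the curvature.\<close>

lemma lasso_rate:
  assumes sym: "\<And>i j. i < n \<Longrightarrow> j < n \<Longrightarrow> A i j = A j i"
    and psd: "\<And>x. 0 \<le> bf n n x A x"
    and RE: "\<And>x. c * ip n x x - \<nu> * (l1 n x)\<^sup>2 \<le> bf n n x A x"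
    and S: "S \<subseteq> {..<n}" "real (card S) \<le> s" "\<And>i. i < n \<Longrightarrow> i \<notin> S \<Longrightarrow> xs i = 0"
    and noise: "\<And>i. i < n \<Longrightarrow> \<bar>h i - mv n A xs i\<bar> \<le> lm / 4"
    and min: "bf n n xt A xt - 2 * ip n xt h + lm * l1 n xt \<le> bf n n xs A xs - 2 * ip n xs h + lm * l1 n xs"
    and small: "32 * \<nu> * s \<le> c" and pos: "0 < c" "0 < lm" "0 \<le> \<nu>" "0 \<le> s"
    and \<delta>_def: "\<delta> = (\<lambda>i. xt i - xs i)"
  shows "sqrt (ip n \<delta> \<delta>) \<le> 3 * lm * sqrt s / c" "l1 n \<delta> \<le> 4 * (sqrt s * sqrt (ip n \<delta> \<delta>))"
proof -
  define dS dc where "dS = (\<Sum>i\<in>S. \<bar>\<delta> i\<bar>)" and "dc = (\<Sum>i\<in>{..<n} - S. \<bar>\<delta> i\<bar>)"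
  have d0: "0 \<le> dS" "0 \<le> dc" by (simp_all add: dS_def dc_def sum_nonneg)
  have l1d: "l1 n \<delta> = dS + dc"
    unfolding l1_def dS_def dc_def using sum.subset_diff[OF S(1), of "\<lambda>i. \<bar>\<delta> i\<bar>"] by simp
  have cone: "l1 n xs - l1 n xt \<le> dS - dc"
    using l1_cone[OF _ S(1), of xs xt] S(3)
    by (simp add: l1_def dS_def dc_def \<delta>_def abs_minus_commute[of "xs _"])
  have "bf n n xs A xt = bf n n xt A xs" by (rule bf_symmetric[OF sym])
  then have "bf n n \<delta> A \<delta> = bf n n xt A xt - bf n n xs A xs - 2 * bf n n \<delta> A xs"
    by (simp add: \<delta>_def bf_bilinear)
  also have "\<dots> \<le> 2 * ip n \<delta> (\<lambda>i. h i - mv n A xs i) + lm * (l1 n xs - l1 n xt)"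
    using min by (simp add: \<delta>_def ip_bilinear bf_def right_diff_distrib)
  also have "\<dots> \<le> 2 * (lm / 4 * l1 n \<delta>) + lm * (dS - dc)"
  proof -
    have "ip n \<delta> (\<lambda>i. h i - mv n A xs i) \<le> (\<Sum>i<n. \<bar>\<delta> i\<bar> * (lm / 4))"
      unfolding ip_def
    proof (rule sum_mono)
      fix i assume "i \<in> {..<n}"
      then have "\<bar>\<delta> i\<bar> * \<bar>h i - mv n A xs i\<bar> \<le> \<bar>\<delta> i\<bar> * (lm / 4)"
        using noise by (intro mult_left_mono) auto
      then show "\<delta> i * (h i - mv n A xs i) \<le> \<bar>\<delta> i\<bar> * (lm / 4)"
        by (metis abs_ge_self abs_mult order_trans)
    qed
    also have "\<dots> = lm / 4 * l1 n \<delta>" by (simp add: l1_def sum_distrib_left mult_ac)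
    finally show ?thesis using cone pos by (intro add_mono mult_left_mono) auto
  qed
  also have "\<dots> = lm * (3 / 2 * dS - dc / 2)" by (simp add: l1d algebra_simps)
  finally have main: "bf n n \<delta> A \<delta> \<le> lm * (3 / 2 * dS - dc / 2)" .
  then have "0 \<le> lm * (3 / 2 * dS - dc / 2)" using psd[of \<delta>] by linarith
  then have dc: "dc \<le> 3 * dS" using pos by (simp add: zero_le_mult_iff)
  define N where "N = sqrt (ip n \<delta> \<delta>)"
  have N0: "0 \<le> N" and NN: "N * N = ip n \<delta> \<delta>" by (simp_all add: N_def)
  have dSN: "dS \<le> sqrt s * N"
    using sum_abs_le_sqrt_card[OF _ S(1,2), of \<delta>] by (simp add: dS_def N_def ip_def power2_eq_square)
  then show l1le: "l1 n \<delta> \<le> 4 * (sqrt s * sqrt (ip n \<delta> \<delta>))"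
    using dc by (simp add: l1d N_def)
  have l1nn: "0 \<le> l1 n \<delta>" using d0 by (simp add: l1d)
  have "\<nu> * (l1 n \<delta>)\<^sup>2 \<le> \<nu> * (4 * (sqrt s * N))\<^sup>2"
    using l1le l1nn pos by (intro mult_left_mono power_mono) (auto simp: N_def)
  also have "\<dots> = 16 * \<nu> * s * (N * N)"
    using pos by (simp add: power2_eq_square algebra_simps)
  also have "\<dots> \<le> c / 2 * (N * N)"
    using small by (intro mult_right_mono) auto
  finally have "c / 2 * (N * N) \<le> bf n n \<delta> A \<delta>" using RE[of \<delta>] by (simp add: NN)
  also have "\<dots> \<le> lm * (3 / 2 * dS)" 
    using main d0 pos mult_left_mono[of "3 / 2 * dS - dc / 2" "3 / 2 * dS" lm] by linarith
  also have "\<dots> \<le> lm * (3 / 2 * (sqrt s * N))" using dSN pos by (intro mult_left_mono) auto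
  finally have "c * N * N \<le> 3 * lm * sqrt s * N" by (simp add: mult_ac)
  then have "c * N \<le> 3 * lm * sqrt s" using N0 pos by (cases "N = 0") auto
  then show "sqrt (ip n \<delta> \<delta>) \<le> 3 * lm * sqrt s / c" using pos by (simp add: N_def field_simps)
qed

section \<open>Normalization in a semidefinite seminorm\<close>

lemma psd_cauchy_schwarz:
  assumes sym: "\<And>i j. i < n \<Longrightarrow> j < n \<Longrightarrow> A i j = A j i" and psd: "\<And>x. 0 \<le> bf n n x A x"
  shows "bf n n x A y \<le> sqrt (bf n n x A x) * sqrt (bf n n y A y)"
proof -
  let ?x = "bf n n x A x" and ?y = "bf n n y A y" and ?c = "bf n n x A y"
  have yx: "bf n n y A x = ?c" by (rule bf_symmetric[OF sym])
  have q: "0 \<le> s\<^sup>2 * ?x - 2 * s * t * ?c + t\<^sup>2 * ?y" for s t :: real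
    using psd[of "\<lambda>i. s * x i - t * y i"] by (simp add: bf_bilinear yx power2_eq_square algebra_simps)
  have "?c\<^sup>2 \<le> ?x * ?y"
  proof (cases "?y = 0")
    case True
    have "?c = 0"
    proof (rule ccontr)
      assume "?c \<noteq> 0"
      \<comment> \<open>For \<open>?y = 0\<close> the quadratic is affine in \<open>t\<close>, and
        at this \<open>t\<close> its value is -1.\<close>
      with q[of 1 "(?x + 1) / (2 * ?c)"] True show False by simp
    qed
    with True show ?thesis by simp
  next
    case False
    then have "?y > 0" using psd[of y] by linarith
    moreover have "0 \<le> ?y * (?x * ?y - ?c\<^sup>2)"
      using q[of ?y ?c] by (simp add: power2_eq_square algebra_simps)
    ultimately show ?thesis by (simp add: zero_le_mult_iff)
  qed
  then have "?c \<le> sqrt (?x * ?y)" by (rule real_le_rsqrt)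
  then show ?thesis by (simp add: real_sqrt_mult)
qed

lemma psd_seminorm_triangle:
  assumes sym: "\<And>i j. i < n \<Longrightarrow> j < n \<Longrightarrow> A i j = A j i" and psd: "\<And>x. 0 \<le> bf n n x A x"
  shows "sqrt (bf n n (\<lambda>i. x i + y i) A (\<lambda>i. x i + y i)) \<le> sqrt (bf n n x A x) + sqrt (bf n n y A y)"
proof (rule real_le_lsqrt)
  have "bf n n y A x = bf n n x A y" by (rule bf_symmetric[OF sym])
  then have "bf n n (\<lambda>i. x i + y i) A (\<lambda>i. x i + y i) = bf n n x A x + 2 * bf n n x A y + bf n n y A y"
    by (simp add: bf_bilinear)
  also have "\<dots> \<le> bf n n x A x + 2 * (sqrt (bf n n x A x) * sqrt (bf n n y A y)) + bf n n y A y"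
    using psd_cauchy_schwarz[OF sym psd, of x y] by simp
  also have "\<dots> = (sqrt (bf n n x A x) + sqrt (bf n n y A y))\<^sup>2"
    by (simp add: power2_sum psd)
  finally show "bf n n (\<lambda>i. x i + y i) A (\<lambda>i. x i + y i) \<le> (sqrt (bf n n x A x) + sqrt (bf n n y A y))\<^sup>2" .
qed (simp add: psd)

lemma norm_combination_le:
  fixes nrm :: "(nat \<Rightarrow> real) \<Rightarrow> real"
  assumes add: "\<And>x y. nrm (\<lambda>i. x i + y i) \<le> nrm x + nrm y" and scale: "\<And>c x. nrm (\<lambda>i. c * x i) = \<bar>c\<bar> * nrm x"
    and K: "finite K" and T: "\<And>k. k \<in> K \<Longrightarrow> nrm (u k) \<le> T"
  shows "nrm (\<lambda>i. \<Sum>k\<in>K. g k * u k i) \<le> (\<Sum>k\<in>K. \<bar>g k\<bar>) * T"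
  using K T
proof (induction K)
  case empty
  show ?case using scale[of 0 "\<lambda>i. 0"] by simp
next
  case (insert k K)
  have "nrm (\<lambda>i. g k * u k i + (\<Sum>k\<in>K. g k * u k i)) \<le> \<bar>g k\<bar> * nrm (u k) + (\<Sum>k\<in>K. \<bar>g k\<bar>) * T"
    using add[of "\<lambda>i. g k * u k i" "\<lambda>i. \<Sum>k\<in>K. g k * u k i"] insert scale[of "g k" "u k"] by fastforce
  also have "\<dots> \<le> \<bar>g k\<bar> * T + (\<Sum>k\<in>K. \<bar>g k\<bar>) * T"
    using insert.prems[of k] by (intro add_mono mult_left_mono) auto
  finally show ?case using insert.hyps by (simp add: distrib_right)
qed

text \<open>The normalization \<open>N\<close> is close to \<bar>g 0\<bar>, since \<open>u 0\<close>
  has seminorm near 1 and the other components and \<open>\<delta>\<close> are small; dividing by it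
  leaves \<open>sgn (g 0) * u 0\<close> up to error. The norm \<open>nrm\<close> is arbitrary, so
  that one argument serves l1 and l2. Its congruence property expresses that only the first
  \<open>n\<close> coordinates count.\<close>

lemma normalization_rate:
  fixes u :: "nat \<Rightarrow> nat \<Rightarrow> real" and g :: "nat \<Rightarrow> real"
  assumes sym: "\<And>i j. i < n \<Longrightarrow> j < n \<Longrightarrow> A i j = A j i" and psd: "\<And>x. 0 \<le> bf n n x A x"
    and r: "1 \<le> r"
    and u0: "\<bar>bf n n (u 0) A (u 0) - 1\<bar> \<le> \<epsilon>" and uk: "\<And>k. k < r \<Longrightarrow> bf n n (u k) A (u k) \<le> 4"
    and \<delta>: "sqrt (bf n n \<delta> A \<delta>) \<le> d"
    and x: "\<And>i. i < n \<Longrightarrow> x i = (\<Sum>k<r. g k * u k i) + \<delta> i"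
    and E: "E = \<bar>g 0\<bar> * \<epsilon> + d + 2 * (\<Sum>k\<in>{1..<r}. \<bar>g k\<bar>)" and g0: "0 < \<gamma>" "\<gamma> \<le> \<bar>g 0\<bar>" "2 * E \<le> \<gamma>"
    and nrm: "\<And>x y. nrm (\<lambda>i. x i + y i) \<le> nrm x + nrm y" "\<And>c x. nrm (\<lambda>i. c * x i) = \<bar>c\<bar> * nrm x"
      "\<And>x y. (\<And>i. i < n \<Longrightarrow> x i = y i) \<Longrightarrow> nrm x = nrm y"
    and T: "\<And>k. k < r \<Longrightarrow> nrm (u k) \<le> T"
    and N_def: "N = sqrt (bf n n x A x)"
  shows "0 < N"
    "nrm (\<lambda>i. sgn (g 0) * (1 / N * x i) - u 0 i) \<le> 2 / \<gamma> * (nrm \<delta> + T * ((\<Sum>k\<in>{1..<r}. \<bar>g k\<bar>) + E))"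
proof -
  let ?S = "\<lambda>x. sqrt (bf n n x A x)"
  define R where "R = (\<Sum>k\<in>{1..<r}. \<bar>g k\<bar>)"
  define rest where "rest = (\<lambda>i. (\<Sum>k\<in>{1..<r}. g k * u k i) + \<delta> i)"
  have S_add: "?S (\<lambda>i. x i + y i) \<le> ?S x + ?S y" for x y by (rule psd_seminorm_triangle[OF sym psd])
  have S_scale: "?S (\<lambda>i. c * x i) = \<bar>c\<bar> * ?S x" for c x
  proof -
    have "bf n n (\<lambda>i. c * x i) A (\<lambda>i. c * x i) = c\<^sup>2 * bf n n x A x"
      by (simp add: bf_bilinear power2_eq_square)
    then show ?thesis by (simp add: real_sqrt_mult)
  qed
  have S_cong: "?S x = ?S y" if "\<And>i. i < n \<Longrightarrow> x i = y i" for x y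
    using that by (simp add: bf_sum)
  have R0: "0 \<le> R" by (simp add: R_def sum_nonneg)
  have set: "{..<r} = insert 0 {1..<r}" using r by auto
  have x_eq: "x i = g 0 * u 0 i + rest i" if "i < n" for i
    unfolding x[OF that] rest_def set by simp
  have uk2: "?S (u k) \<le> 2" if "k < r" for k using real_sqrt_le_mono[OF uk[OF that]] by simp
  have rest: "?S rest \<le> R * 2 + d"
  proof -
    have "?S rest \<le> ?S (\<lambda>i. \<Sum>k\<in>{1..<r}. g k * u k i) + ?S \<delta>" unfolding rest_def by (rule S_add)
    also have "?S (\<lambda>i. \<Sum>k\<in>{1..<r}. g k * u k i) \<le> R * 2"
      unfolding R_def by (rule norm_combination_le[where nrm = ?S, OF S_add S_scale]) (use uk2 in auto)
    finally show ?thesis using \<delta> by linarith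
  qed
  have u0S: "\<bar>?S (u 0) - 1\<bar> \<le> \<epsilon>"
  proof -
    have "(?S (u 0) - 1) * (?S (u 0) + 1) = bf n n (u 0) A (u 0) - 1"
      using psd[of "u 0"] by (simp add: algebra_simps)
    then have "\<bar>?S (u 0) - 1\<bar> * \<bar>?S (u 0) + 1\<bar> \<le> \<epsilon>" using u0 by (simp flip: abs_mult)
    moreover have "\<bar>?S (u 0) - 1\<bar> * 1 \<le> \<bar>?S (u 0) - 1\<bar> * \<bar>?S (u 0) + 1\<bar>"
      using psd[of "u 0"] by (intro mult_left_mono) auto
    ultimately show ?thesis by (simp only: mult_1_right)
  qed
  have "\<bar>N - \<bar>g 0\<bar> * ?S (u 0)\<bar> \<le> ?S rest"
  proof -
    have "N = ?S (\<lambda>i. g 0 * u 0 i + rest i)" unfolding N_def by (rule S_cong) (rule x_eq)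
    also have "\<dots> \<le> \<bar>g 0\<bar> * ?S (u 0) + ?S rest" using S_add[of "\<lambda>i. g 0 * u 0 i" rest] S_scale[of "g 0" "u 0"] by simp
    finally have 1: "N \<le> \<bar>g 0\<bar> * ?S (u 0) + ?S rest" .
    have "\<bar>g 0\<bar> * ?S (u 0) = ?S (\<lambda>i. x i + (- 1) * rest i)"
      unfolding S_scale[symmetric] by (rule S_cong) (simp add: x_eq)
    also have "\<dots> \<le> N + ?S rest"
      using S_add[of x "\<lambda>i. (- 1) * rest i"] S_scale[of "- 1" rest] by (simp add: N_def)
    finally show ?thesis using 1 by linarith
  qed
  moreover have "\<bar>\<bar>g 0\<bar> * ?S (u 0) - \<bar>g 0\<bar>\<bar> \<le> \<bar>g 0\<bar> * \<epsilon>"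
    using mult_left_mono[OF u0S, of "\<bar>g 0\<bar>"] by (simp add: right_diff_distrib flip: abs_mult)
  ultimately have NE: "\<bar>N - \<bar>g 0\<bar>\<bar> \<le> E" using rest by (simp add: E R_def)
  then have N: "\<gamma> / 2 \<le> N" using g0 by linarith
  then show N0: "0 < N" using g0 by linarith
  define w where "w = sgn (g 0)"
  have w: "w * w = 1" "w * \<bar>g 0\<bar> = g 0" "\<bar>w\<bar> = 1" using g0 by (auto simp: w_def sgn_if)
  \<comment> \<open>On the first \<open>n\<close> coordinates \<open>err\<close> is
    \<open>x - w * N * u 0\<close>. Multiplied by \<open>w / N\<close> it is the error of the
    normalized vector, because \<open>w * w = 1\<close>.\<close>
  define err where "err = (\<lambda>i. (\<delta> i + (\<Sum>k\<in>{1..<r}. g k * u k i)) + (g 0 - w * N) * u 0 i)"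
  have gw: "\<bar>g 0 - w * N\<bar> \<le> E"
  proof -
    have "g 0 - w * N = w * (\<bar>g 0\<bar> - N)" by (simp add: right_diff_distrib w(2))
    then have "\<bar>g 0 - w * N\<bar> = \<bar>\<bar>g 0\<bar> - N\<bar>" using w(3) by (simp only: abs_mult mult_1)
    also have "\<dots> = \<bar>N - \<bar>g 0\<bar>\<bar>" by (rule abs_minus_commute)
    finally show ?thesis using NE by (simp only:)
  qed
  have T0: "0 \<le> T"
  proof -
    have "0 \<le> nrm (u 0)" using nrm(1)[of "u 0" "\<lambda>i. (- 1) * u 0 i"] nrm(2)[of "- 1" "u 0"] nrm(2)[of 0 "u 0"] by simp
    then show ?thesis using T[of 0] r by simp
  qed
  have "nrm err \<le> nrm \<delta> + R * T + E * T"
  proof -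
    have "nrm err \<le> nrm (\<lambda>i. \<delta> i + (\<Sum>k\<in>{1..<r}. g k * u k i)) + \<bar>g 0 - w * N\<bar> * nrm (u 0)"
      unfolding err_def by (rule order_trans[OF nrm(1)]) (simp add: nrm(2))
    also have "\<dots> \<le> (nrm \<delta> + R * T) + E * T"
    proof (intro add_mono order_trans[OF nrm(1)] order_refl)
      show "nrm (\<lambda>i. \<Sum>k\<in>{1..<r}. g k * u k i) \<le> R * T"
        unfolding R_def by (rule norm_combination_le[where nrm = nrm, OF nrm(1,2)]) (use T in auto)
      show "\<bar>g 0 - w * N\<bar> * nrm (u 0) \<le> E * T"
      proof -
        have "\<bar>g 0 - w * N\<bar> * nrm (u 0) \<le> \<bar>g 0 - w * N\<bar> * T" using T[of 0] r by (intro mult_left_mono) auto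
        also have "\<dots> \<le> E * T" using gw T0 by (intro mult_right_mono)
        finally show ?thesis .
      qed
    qed
    finally show ?thesis by simp
  qed
  moreover have "nrm (\<lambda>i. w * (1 / N * x i) - u 0 i) = 1 / N * nrm err"
  proof -
    have "nrm (\<lambda>i. w * (1 / N * x i) - u 0 i) = nrm (\<lambda>i. (w / N) * err i)"
    proof (rule nrm(3))
      fix i assume "i < n"
      have "w * (1 / N * x i) - u 0 i = w / N * (x i - w * N * u 0 i)"
      proof -
        have "w / N * (w * N * u 0 i) = (w * w) * u 0 i" using N0 by simp
        then show ?thesis by (simp only: w(1) right_diff_distrib) simp
      qed
      then show "w * (1 / N * x i) - u 0 i = w / N * err i"
        by (simp add: x_eq[OF \<open>i < n\<close>] err_def rest_def algebra_simps)
    qed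
    also have "\<dots> = \<bar>w / N\<bar> * nrm err" by (rule nrm(2))
    finally show ?thesis using w N0 by simp
  qed
  moreover have "0 \<le> nrm err" using nrm(1)[of err "\<lambda>i. (- 1) * err i"] nrm(2)[of "- 1" err] nrm(2)[of 0 err] by simp
  moreover have "1 / N \<le> 2 / \<gamma>" using N N0 g0 by (simp add: field_simps)
  ultimately have "nrm (\<lambda>i. w * (1 / N * x i) - u 0 i) \<le> 2 / \<gamma> * (nrm \<delta> + R * T + E * T)"
    using mult_mono[of "1 / N" "2 / \<gamma>" "nrm err" "nrm \<delta> + R * T + E * T"] g0 by simp
  then show "nrm (\<lambda>i. sgn (g 0) * (1 / N * x i) - u 0 i) \<le> 2 / \<gamma> * (nrm \<delta> + T * ((\<Sum>k\<in>{1..<r}. \<bar>g k\<bar>) + E))"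
    by (simp add: w_def R_def algebra_simps)
qed

section \<open>Concentration\<close>

lemma exp_le_quadratic: "exp x \<le> 1 + x + x\<^sup>2 * exp \<bar>x\<bar> / 2" for x :: real
proof -
  obtain t where t: "\<bar>t\<bar> \<le> \<bar>x\<bar>" "exp x = (\<Sum>m<2. x ^ m / fact m) + exp t / fact 2 * x ^ 2"
    using Maclaurin_exp_le[of x 2] by blast
  have "exp t * x\<^sup>2 \<le> exp \<bar>x\<bar> * x\<^sup>2" using t(1) by (intro mult_right_mono) auto
  then show ?thesis using t(2) by (simp add: numeral_2_eq_2 mult_ac)
qed

lemma power2_le_exp: "0 \<le> x \<Longrightarrow> x\<^sup>2 \<le> 8 * exp (x / 2)" for x :: real
  using exp_lower_Taylor_quadratic[of "x / 2"] by (simp add: power_divide)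

lemma exp_mean_le: "exp ((a + b) / 2) \<le> (exp a + exp b) / 2" for a b :: real
proof -
  have "0 \<le> (exp (a / 2) - exp (b / 2))\<^sup>2" by simp
  also have "\<dots> = exp a + exp b - 2 * exp ((a + b) / 2)"
    by (simp add: power2_diff add_divide_distrib exp_add flip: exp_double)
  finally show ?thesis by simp
qed

text \<open>The class of squares and products of sub-Gaussian variables.\<close>

definition subexp :: "'a measure \<Rightarrow> real \<Rightarrow> ('a \<Rightarrow> real) \<Rightarrow> bool" where
  "subexp P L h \<longleftrightarrow> h \<in> borel_measurable P \<and> (\<integral>\<^sup>+z. ennreal (exp (\<bar>h z\<bar> / L)) \<partial>P) \<le> 2"

lemma subexp_mono:
  assumes "subexp P L h" "0 < L" "L \<le> L'"
  shows "subexp P L' h"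
proof -
  have "(\<integral>\<^sup>+z. ennreal (exp (\<bar>h z\<bar> / L')) \<partial>P) \<le> (\<integral>\<^sup>+z. ennreal (exp (\<bar>h z\<bar> / L)) \<partial>P)"
    using assms by (intro nn_integral_mono ennreal_leI) (simp add: frac_le)
  then show ?thesis using assms by (auto simp: subexp_def)
qed

text \<open>The inequality of arithmetic and geometric mean and the convexity of \<open>exp\<close>
  bound the exponential of the product by the average of the exponentials of the squares, so the
  scale \<open>L\<close> is kept.\<close>

lemma subexp_product:
  assumes f: "subexp P L (\<lambda>z. (f z)\<^sup>2)" and g: "subexp P L (\<lambda>z. (g z)\<^sup>2)" and L: "0 < L"
    and m[measurable]: "f \<in> borel_measurable P" "g \<in> borel_measurable P"
  shows "subexp P L (\<lambda>z. f z * g z)"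
proof -
  have "(\<integral>\<^sup>+z. ennreal (exp (\<bar>f z * g z\<bar> / L)) \<partial>P)
      \<le> (\<integral>\<^sup>+z. ennreal (1 / 2) * ennreal (exp (\<bar>(f z)\<^sup>2\<bar> / L)) + ennreal (1 / 2) * ennreal (exp (\<bar>(g z)\<^sup>2\<bar> / L)) \<partial>P)"
  proof (intro nn_integral_mono)
    fix z
    have "0 \<le> (\<bar>f z\<bar> - \<bar>g z\<bar>)\<^sup>2" by simp
    then have "\<bar>f z * g z\<bar> \<le> ((f z)\<^sup>2 + (g z)\<^sup>2) / 2" by (simp add: power2_diff abs_mult)
    then have "exp (\<bar>f z * g z\<bar> / L) \<le> exp (((f z)\<^sup>2 / L + (g z)\<^sup>2 / L) / 2)"
      using L by (simp add: field_simps)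
    also have "\<dots> \<le> (exp ((f z)\<^sup>2 / L) + exp ((g z)\<^sup>2 / L)) / 2" by (rule exp_mean_le)
    finally have "exp (\<bar>f z * g z\<bar> / L) \<le> (exp ((f z)\<^sup>2 / L) + exp ((g z)\<^sup>2 / L)) / 2" .
    then show "ennreal (exp (\<bar>f z * g z\<bar> / L))
      \<le> ennreal (1 / 2) * ennreal (exp (\<bar>(f z)\<^sup>2\<bar> / L)) + ennreal (1 / 2) * ennreal (exp (\<bar>(g z)\<^sup>2\<bar> / L))"
    proof -
      assume "exp (\<bar>f z * g z\<bar> / L) \<le> (exp ((f z)\<^sup>2 / L) + exp ((g z)\<^sup>2 / L)) / 2"
      then have "ennreal (exp (\<bar>f z * g z\<bar> / L))
          \<le> ennreal (1 / 2 * exp (\<bar>(f z)\<^sup>2\<bar> / L) + 1 / 2 * exp (\<bar>(g z)\<^sup>2\<bar> / L))"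
        by (intro ennreal_leI) simp
      also have "\<dots> = ennreal (1 / 2) * ennreal (exp (\<bar>(f z)\<^sup>2\<bar> / L)) + ennreal (1 / 2) * ennreal (exp (\<bar>(g z)\<^sup>2\<bar> / L))"
        by (subst ennreal_plus, simp, simp, subst ennreal_mult, simp, simp, subst ennreal_mult, simp, simp, rule refl)
      finally show ?thesis .
    qed
  qed
  also have "\<dots> = ennreal (1 / 2) * (\<integral>\<^sup>+z. ennreal (exp (\<bar>(f z)\<^sup>2\<bar> / L)) \<partial>P)
      + ennreal (1 / 2) * (\<integral>\<^sup>+z. ennreal (exp (\<bar>(g z)\<^sup>2\<bar> / L)) \<partial>P)"
    by (subst nn_integral_add) (auto simp: nn_integral_cmult)
  also have "\<dots> \<le> ennreal (1 / 2) * 2 + ennreal (1 / 2) * 2"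
    using f g unfolding subexp_def by (intro add_mono mult_left_mono) auto
  also have "\<dots> = 2"
    using ennreal_mult[of "1/2" 2] by (simp flip: ennreal_numeral)
  finally show ?thesis by (simp add: subexp_def)
qed

lemma (in prob_space) subexp_moments:
  assumes h: "subexp M L h" and L: "0 < L"
  shows "integrable M h" "integrable M (\<lambda>z. (h z)\<^sup>2)" "integrable M (\<lambda>z. exp (\<bar>h z\<bar> / L))"
    "expectation (\<lambda>z. exp (\<bar>h z\<bar> / L)) \<le> 2" "\<bar>expectation h\<bar> \<le> 2 * L"
proof -
  have [measurable]: "h \<in> borel_measurable M" using h by (simp add: subexp_def)
  have fin: "(\<integral>\<^sup>+z. ennreal (exp (\<bar>h z\<bar> / L)) \<partial>M) \<le> 2" using h by (simp add: subexp_def)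
  show e: "integrable M (\<lambda>z. exp (\<bar>h z\<bar> / L))"
    by (rule integrableI_bounded) (use fin in \<open>auto intro: le_less_trans simp: less_top[symmetric] top_unique\<close>)
  have "ennreal (expectation (\<lambda>z. exp (\<bar>h z\<bar> / L))) \<le> ennreal 2"
    using fin by (subst nn_integral_eq_integral[symmetric, OF e]) auto
  then show e2: "expectation (\<lambda>z. exp (\<bar>h z\<bar> / L)) \<le> 2" by (subst (asm) ennreal_le_iff) auto
  have lin: "\<bar>h z\<bar> \<le> L * exp (\<bar>h z\<bar> / L)" for z
    using exp_ge_add_one_self[of "\<bar>h z\<bar> / L"] L by (simp add: field_simps)
  show i: "integrable M h"
    by (rule Bochner_Integration.integrable_bound[OF integrable_mult_right[OF e, of L]]) (use lin L in auto)
  have "\<bar>expectation h\<bar> \<le> expectation (\<lambda>z. L * exp (\<bar>h z\<bar> / L))"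
    by (rule order_trans[OF integral_abs_bound integral_mono]) (use i e lin in auto)
  also have "\<dots> \<le> 2 * L" using e2 L by simp
  finally show "\<bar>expectation h\<bar> \<le> 2 * L" .
  have quad: "(h z)\<^sup>2 \<le> 8 * L\<^sup>2 * exp (\<bar>h z\<bar> / L)" for z
  proof -
    have "(\<bar>h z\<bar> / L)\<^sup>2 \<le> 8 * exp (\<bar>h z\<bar> / L / 2)" using L by (intro power2_le_exp) auto
    also have "\<dots> \<le> 8 * exp (\<bar>h z\<bar> / L)"
    proof -
      have "y / 2 \<le> y" if "0 \<le> y" for y :: real using that by simp
      from this[of "\<bar>h z\<bar> / L"] L show ?thesis by (simp only: exp_le_cancel_iff mult_le_cancel_left) simp
    qed
    finally show ?thesis using L by (simp add: power_divide field_simps)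
  qed
  show "integrable M (\<lambda>z. (h z)\<^sup>2)"
    by (rule Bochner_Integration.integrable_bound[OF integrable_mult_right[OF e, of "8 * L\<^sup>2"]]) (use quad in auto)
qed

text \<open>Half of the exponential moment pays for \<open>(h z)\<^sup>2\<close> and half for
  \<open>exp \<bar>t * h z\<bar>\<close>. The constant is the 8 of \<open>power2_le_exp\<close>,
  halved by the Taylor remainder and doubled by the bound 2 on the exponential moment.\<close>

lemma (in prob_space) subexp_mgf:
  assumes h: "subexp M L h" and L: "0 < L" and t: "\<bar>t\<bar> \<le> 1 / (2 * L)"
  shows "(\<integral>\<^sup>+z. ennreal (exp (t * h z)) \<partial>M) \<le> ennreal (exp (t * expectation h + 8 * L\<^sup>2 * t\<^sup>2))"
proof -
  have [measurable]: "h \<in> borel_measurable M" using h by (simp add: subexp_def)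
  note mom = subexp_moments[OF h L]
  have pt: "exp (t * h z) \<le> 1 + t * h z + 4 * L\<^sup>2 * t\<^sup>2 * exp (\<bar>h z\<bar> / L)" for z
  proof -
    have th: "\<bar>t * h z\<bar> \<le> \<bar>h z\<bar> / L / 2"
      using mult_right_mono[OF t, of "\<bar>h z\<bar>"] by (simp add: abs_mult mult_ac)
    have "(\<bar>h z\<bar> / L)\<^sup>2 \<le> 8 * exp (\<bar>h z\<bar> / L / 2)" using L by (intro power2_le_exp) auto
    then have h2: "(h z)\<^sup>2 \<le> 8 * L\<^sup>2 * exp (\<bar>h z\<bar> / L / 2)" using L by (simp add: power_divide field_simps)
    have "(t * h z)\<^sup>2 * exp \<bar>t * h z\<bar> \<le> (t\<^sup>2 * (8 * L\<^sup>2 * exp (\<bar>h z\<bar> / L / 2))) * exp (\<bar>h z\<bar> / L / 2)"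
      unfolding power_mult_distrib using th h2 by (intro mult_mono) auto
    also have "\<dots> = 8 * L\<^sup>2 * t\<^sup>2 * exp (\<bar>h z\<bar> / L)"
      by (simp add: mult_ac flip: exp_add)
    finally show ?thesis using exp_le_quadratic[of "t * h z"] by simp
  qed
  have int: "integrable M (\<lambda>z. 1 + t * h z + 4 * L\<^sup>2 * t\<^sup>2 * exp (\<bar>h z\<bar> / L))"
    using mom by auto
  have "(\<integral>\<^sup>+z. ennreal (exp (t * h z)) \<partial>M) \<le> (\<integral>\<^sup>+z. ennreal (1 + t * h z + 4 * L\<^sup>2 * t\<^sup>2 * exp (\<bar>h z\<bar> / L)) \<partial>M)"
    using pt by (intro nn_integral_mono ennreal_leI)
  also have "\<dots> = ennreal (expectation (\<lambda>z. 1 + t * h z + 4 * L\<^sup>2 * t\<^sup>2 * exp (\<bar>h z\<bar> / L)))"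
    by (rule nn_integral_eq_integral[OF int]) (use pt in \<open>auto intro: order_trans[OF less_imp_le[OF exp_gt_zero]]\<close>)
  also have "expectation (\<lambda>z. 1 + t * h z + 4 * L\<^sup>2 * t\<^sup>2 * exp (\<bar>h z\<bar> / L))
      = 1 + t * expectation h + 4 * L\<^sup>2 * t\<^sup>2 * expectation (\<lambda>z. exp (\<bar>h z\<bar> / L))"
    using mom by (simp add: prob_space)
  also have "\<dots> \<le> 1 + t * expectation h + 4 * L\<^sup>2 * t\<^sup>2 * 2"
    using mom by (intro add_left_mono mult_left_mono) auto
  also have "\<dots> \<le> exp (t * expectation h + 8 * L\<^sup>2 * t\<^sup>2)"
    by (rule order_trans[OF _ exp_ge_add_one_self]) simp
  finally show ?thesis by (simp add: ennreal_leI)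
qed

text \<open>As an identity of nonnegative integrals it requires no integrability.\<close>

lemma (in prob_space) iid_mgf:
  assumes ind: "indep_vars (\<lambda>_. N) Z I" and I: "finite I"
    and law: "\<And>i. i \<in> I \<Longrightarrow> distr M N (Z i) = P" and h: "h \<in> borel_measurable N"
  shows "(\<integral>\<^sup>+\<omega>. ennreal (exp (t * (\<Sum>i\<in>I. h (Z i \<omega>)))) \<partial>M) = (\<integral>\<^sup>+z. ennreal (exp (t * h z)) \<partial>P) ^ card I"
proof -
  have Z: "Z i \<in> M \<rightarrow>\<^sub>M N" if "i \<in> I" for i using ind that by (auto simp: indep_vars_def)
  have "(\<integral>\<^sup>+\<omega>. ennreal (exp (t * (\<Sum>i\<in>I. h (Z i \<omega>)))) \<partial>M) = (\<integral>\<^sup>+\<omega>. (\<Prod>i\<in>I. ennreal (exp (t * h (Z i \<omega>)))) \<partial>M)"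
    by (simp add: sum_distrib_left exp_sum[OF I] prod_ennreal)
  also have "\<dots> = (\<Prod>i\<in>I. \<integral>\<^sup>+\<omega>. ennreal (exp (t * h (Z i \<omega>))) \<partial>M)"
    by (rule indep_vars_nn_integral[OF I])
       (use h in \<open>auto intro!: indep_vars_compose2[OF ind]\<close>)
  also have "\<dots> = (\<Prod>i\<in>I. \<integral>\<^sup>+z. ennreal (exp (t * h z)) \<partial>P)"
  proof (rule prod.cong)
    fix i assume i: "i \<in> I"
    have "(\<integral>\<^sup>+z. ennreal (exp (t * h z)) \<partial>distr M N (Z i)) = (\<integral>\<^sup>+\<omega>. ennreal (exp (t * h (Z i \<omega>))) \<partial>M)"
      using h by (intro nn_integral_distr Z i) auto
    then show "(\<integral>\<^sup>+\<omega>. ennreal (exp (t * h (Z i \<omega>))) \<partial>M) = (\<integral>\<^sup>+z. ennreal (exp (t * h z)) \<partial>P)"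
      by (simp add: law[OF i])
  qed simp
  finally show ?thesis by simp
qed

lemma (in prob_space) iid_upper_tail:
  assumes ind: "indep_vars (\<lambda>_. N) Z I" and I: "finite I"
    and law: "\<And>i. i \<in> I \<Longrightarrow> distr M N (Z i) = P" and P: "prob_space P" and sets: "sets P = sets N"
    and h: "subexp P L h" and L: "0 < L" and \<tau>: "0 < \<tau>" "\<tau> \<le> 8 * L"
  shows "prob {\<omega> \<in> space M. real (card I) * (integral\<^sup>L P h + \<tau>) \<le> (\<Sum>i\<in>I. h (Z i \<omega>))}
    \<le> exp (- (real (card I) * \<tau>\<^sup>2 / (32 * L\<^sup>2)))"
proof -
  interpret P: prob_space P by (rule P)
  have hm: "h \<in> borel_measurable N" using h sets by (auto simp: subexp_def cong: measurable_cong_sets)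
  have Z: "Z i \<in> M \<rightarrow>\<^sub>M N" if "i \<in> I" for i using ind that by (auto simp: indep_vars_def)
  have meas: "(\<lambda>\<omega>. \<Sum>i\<in>I. h (Z i \<omega>)) \<in> borel_measurable M"
    by (intro borel_measurable_sum measurable_compose[OF Z hm])
  \<comment> \<open>The minimizer of the exponent
    \<open>8 * L\<^sup>2 * t\<^sup>2 - t * \<tau>\<close>; the restriction
    \<open>\<tau> \<le> 8 * L\<close> keeps it in the range of the moment bound.\<close>
  define t where "t = \<tau> / (16 * L\<^sup>2)"
  have t0: "0 < t" using \<tau> L by (simp add: t_def)
  have "t \<le> 8 * L / (16 * L\<^sup>2)" unfolding t_def using \<tau> L by (intro divide_right_mono) auto
  then have t: "\<bar>t\<bar> \<le> 1 / (2 * L)" using t0 L by (simp add: power2_eq_square)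
  let ?n = "real (card I)" and ?\<mu> = "integral\<^sup>L P h"
  let ?E = "{\<omega> \<in> space M. ?n * (?\<mu> + \<tau>) \<le> (\<Sum>i\<in>I. h (Z i \<omega>))}"
  have E: "?E \<in> sets M" using meas by measurable
  have "emeasure M ?E = (\<integral>\<^sup>+\<omega>. indicator ?E \<omega> \<partial>M)" using E by simp
  also have "\<dots> \<le> (\<integral>\<^sup>+\<omega>. ennreal (exp (- t * (?n * (?\<mu> + \<tau>)))) * ennreal (exp (t * (\<Sum>i\<in>I. h (Z i \<omega>)))) \<partial>M)"
  proof (rule nn_integral_mono)
    fix \<omega>
    show "indicator ?E \<omega> \<le> ennreal (exp (- t * (?n * (?\<mu> + \<tau>)))) * ennreal (exp (t * (\<Sum>i\<in>I. h (Z i \<omega>))))"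
    proof (cases "\<omega> \<in> ?E")
      case True
      then have "0 \<le> t * ((\<Sum>i\<in>I. h (Z i \<omega>)) - ?n * (?\<mu> + \<tau>))" using t0 by simp
      then have "1 \<le> exp (- t * (?n * (?\<mu> + \<tau>)) + t * (\<Sum>i\<in>I. h (Z i \<omega>)))"
        by (simp add: right_diff_distrib)
      then have "1 \<le> ennreal (exp (- t * (?n * (?\<mu> + \<tau>)) + t * (\<Sum>i\<in>I. h (Z i \<omega>))))"
        by (metis ennreal_1 ennreal_leI)
      then have "1 \<le> ennreal (exp (- t * (?n * (?\<mu> + \<tau>)))) * ennreal (exp (t * (\<Sum>i\<in>I. h (Z i \<omega>))))"
        by (simp only: exp_add ennreal_mult exp_ge_zero)
      then show ?thesis using True by (simp only: indicator_simps)
    qed simp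
  qed
  also have "\<dots> = ennreal (exp (- t * (?n * (?\<mu> + \<tau>)))) * (\<integral>\<^sup>+\<omega>. ennreal (exp (t * (\<Sum>i\<in>I. h (Z i \<omega>)))) \<partial>M)"
    using meas by (intro nn_integral_cmult) simp
  also have "(\<integral>\<^sup>+\<omega>. ennreal (exp (t * (\<Sum>i\<in>I. h (Z i \<omega>)))) \<partial>M) = (\<integral>\<^sup>+z. ennreal (exp (t * h z)) \<partial>P) ^ card I"
    by (rule iid_mgf[OF ind I law hm])
  also have "\<dots> \<le> ennreal (exp (t * ?\<mu> + 8 * L\<^sup>2 * t\<^sup>2)) ^ card I"
    by (intro power_mono P.subexp_mgf[OF h L t]) simp
  also have "\<dots> = ennreal (exp (?n * (t * ?\<mu> + 8 * L\<^sup>2 * t\<^sup>2)))"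
    by (simp add: ennreal_power exp_of_nat_mult)
  also have "ennreal (exp (- t * (?n * (?\<mu> + \<tau>)))) * ennreal (exp (?n * (t * ?\<mu> + 8 * L\<^sup>2 * t\<^sup>2)))
      = ennreal (exp (- t * (?n * (?\<mu> + \<tau>)) + ?n * (t * ?\<mu> + 8 * L\<^sup>2 * t\<^sup>2)))"
    by (simp only: exp_add ennreal_mult exp_ge_zero)
  also have "- t * (?n * (?\<mu> + \<tau>)) + ?n * (t * ?\<mu> + 8 * L\<^sup>2 * t\<^sup>2) = ?n * (8 * L\<^sup>2 * t\<^sup>2 - t * \<tau>)"
    by (simp add: algebra_simps)
  also have "8 * L\<^sup>2 * t\<^sup>2 - t * \<tau> = - (\<tau>\<^sup>2 / (32 * L\<^sup>2))"
    using L by (simp add: t_def field_simps power2_eq_square)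
  finally have "emeasure M ?E \<le> ennreal (exp (?n * - (\<tau>\<^sup>2 / (32 * L\<^sup>2))))"
    by (simp add: mult_left_mono)
  then show ?thesis by (simp add: emeasure_eq_measure)
qed

lemma (in prob_space) iid_concentration:
  assumes ind: "indep_vars (\<lambda>_. N) Z I" and I: "finite I" "I \<noteq> {}"
    and law: "\<And>i. i \<in> I \<Longrightarrow> distr M N (Z i) = P" and P: "prob_space P" and sets: "sets P = sets N"
    and h: "subexp P L h" and L: "0 < L" and \<tau>: "0 < \<tau>" "\<tau> \<le> 8 * L"
  defines "E \<equiv> {\<omega> \<in> space M. \<tau> < \<bar>(\<Sum>i\<in>I. h (Z i \<omega>)) / real (card I) - integral\<^sup>L P h\<bar>}"
  shows "E \<in> events" "prob E \<le> 2 * exp (- (real (card I) * \<tau>\<^sup>2 / (32 * L\<^sup>2)))"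
proof -
  have hm: "h \<in> borel_measurable N" using h sets by (auto simp: subexp_def cong: measurable_cong_sets)
  have Z: "Z i \<in> M \<rightarrow>\<^sub>M N" if "i \<in> I" for i using ind that by (auto simp: indep_vars_def)
  have [measurable]: "(\<lambda>\<omega>. \<Sum>i\<in>I. h (Z i \<omega>)) \<in> borel_measurable M"
    by (intro borel_measurable_sum measurable_compose[OF Z hm])
  show E: "E \<in> events" unfolding E_def by measurable
  have h': "subexp P L (\<lambda>z. - h z)" using h by (simp add: subexp_def)
  let ?U = "\<lambda>h. {\<omega> \<in> space M. real (card I) * (integral\<^sup>L P h + \<tau>) \<le> (\<Sum>i\<in>I. h (Z i \<omega>))}"
  have n: "0 < real (card I)" using I by (simp add: card_gt_0_iff)
  have "E \<subseteq> ?U h \<union> ?U (\<lambda>z. - h z)"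
  proof
    fix \<omega> assume "\<omega> \<in> E"
    then have w: "\<omega> \<in> space M" and "\<tau> < \<bar>(\<Sum>i\<in>I. h (Z i \<omega>)) / real (card I) - integral\<^sup>L P h\<bar>"
      by (auto simp: E_def)
    then consider "integral\<^sup>L P h + \<tau> \<le> (\<Sum>i\<in>I. h (Z i \<omega>)) / real (card I)"
      | "- integral\<^sup>L P h + \<tau> \<le> - ((\<Sum>i\<in>I. h (Z i \<omega>)) / real (card I))" by linarith
    then show "\<omega> \<in> ?U h \<union> ?U (\<lambda>z. - h z)"
    proof cases
      case 1
      then show ?thesis using w n by (simp add: field_simps)
    next
      case 2
      then show ?thesis using w n by (simp add: field_simps sum_negf)
    qed
  qed
  then have "prob E \<le> prob (?U h \<union> ?U (\<lambda>z. - h z))"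
    by (intro finite_measure_mono) (auto simp: sum_negf)
  also have "\<dots> \<le> prob (?U h) + prob (?U (\<lambda>z. - h z))"
    by (intro measure_Un_le) (auto simp: sum_negf)
  also have "\<dots> \<le> exp (- (real (card I) * \<tau>\<^sup>2 / (32 * L\<^sup>2))) + exp (- (real (card I) * \<tau>\<^sup>2 / (32 * L\<^sup>2)))"
    by (intro add_mono iid_upper_tail[OF ind I(1) law P sets h L \<tau>] iid_upper_tail[OF ind I(1) law P sets h' L \<tau>])
  finally show "prob E \<le> 2 * exp (- (real (card I) * \<tau>\<^sup>2 / (32 * L\<^sup>2)))" by simp
qed

section \<open>Sub-Gaussian vectors and independence of subsamples\<close>

lemma measurable_vec_coordinate [measurable]:
  "i < p \<Longrightarrow> (\<lambda>v. v $ i) \<in> borel_measurable (vec_borel p)"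
proof -
  assume i: "i < p"
  have "(\<lambda>v. \<lambda>i\<in>{..<p}. v $ i) \<in> vec_borel p \<rightarrow>\<^sub>M PiM {..<p} (\<lambda>_. borel)"
    unfolding vec_borel_def by (rule measurable_vimage_algebra1) (auto simp: space_PiM)
  from measurable_compose[OF this measurable_component_singleton[of i]] i show ?thesis by simp
qed

lemma space_vec_borel [simp]: "space (vec_borel p) = carrier_vec p"
  by (simp add: vec_borel_def)

lemma measurable_ip_vec [measurable]:
  "(\<lambda>v. ip p (($) v) c) \<in> borel_measurable (vec_borel p)"
  unfolding ip_def by measurable

text \<open>An infimum at most \<open>K\<close> yields an admissible \<open>t\<close> only below a
  strictly larger number; adding 1 to \<open>max K 0\<close> provides one that is also
  positive.\<close>

lemma psi2_norm_le_imp: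
  assumes "psi2_norm P f \<le> ennreal K"
  shows "(\<integral>\<^sup>+z. ennreal (exp ((f z)\<^sup>2 / (max K 0 + 1)\<^sup>2)) \<partial>P) \<le> 2"
proof -
  have "psi2_norm P f < ennreal (max K 0 + 1)"
    using assms by (rule le_less_trans) (auto intro!: ennreal_lessI)
  then obtain t where t: "0 < t" "(\<integral>\<^sup>+z. ennreal (exp ((f z)\<^sup>2 / t\<^sup>2)) \<partial>P) \<le> 2" "ennreal t < ennreal (max K 0 + 1)"
    unfolding psi2_norm_def INF_less_iff by blast
  have "t \<le> max K 0 + 1" using t(3) unfolding ennreal_less_iff[OF less_imp_le[OF t(1)]] by simp
  then have "(\<integral>\<^sup>+z. ennreal (exp ((f z)\<^sup>2 / (max K 0 + 1)\<^sup>2)) \<partial>P) \<le> (\<integral>\<^sup>+z. ennreal (exp ((f z)\<^sup>2 / t\<^sup>2)) \<partial>P)"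
    using t(1) by (intro nn_integral_mono ennreal_leI) (simp add: frac_le power_mono)
  with t(2) show ?thesis by simp
qed

text \<open>\<open>subgaussian_norm\<close> concerns unit vectors, hence the rescaling and the
  separate case of the zero vector. A bound \<open>b\<close> instead of the exact squared length
  gives whole families of directions a common scale.\<close>

lemma subgaussian_square_subexp:
  assumes P: "prob_space P" and X: "X \<in> P \<rightarrow>\<^sub>M vec_borel p"
    and sg: "subgaussian_norm P p X \<le> ennreal K" and v: "ip p v v \<le> b" "0 < b"
  shows "subexp P ((max K 0 + 1)\<^sup>2 * b) (\<lambda>z. (ip p (($) (X z)) v)\<^sup>2)"
proof (cases "ip p v v = 0")
  interpret prob_space P by (rule P)
  have m: "(\<lambda>z. (ip p (($) (X z)) v)\<^sup>2) \<in> borel_measurable P"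
    using measurable_compose[OF X measurable_ip_vec] by measurable
  {
    case True
    then have "ip p x v = 0" for x by (auto simp: ip_eq_0_iff) (auto simp: ip_def)
    then show ?thesis using m by (simp add: subexp_def emeasure_space_1)
  next
    case False
    define c where "c = sqrt (ip p v v)"
    have c: "0 < c" "c * c = ip p v v" using False by (auto simp: c_def less_le)
    define w where "w = Matrix.vec p (\<lambda>i. 1 / c * v i)"
    have "l2_norm w = 1"
      using c unfolding w_def l2_norm_vec ip_scale_left ip_scale_right
      by (simp flip: c(2))
    then have "psi2_norm P (\<lambda>z. X z \<bullet> w) \<le> ennreal K"
      by (intro order_trans[OF _ sg]) (auto simp: subgaussian_norm_def w_def intro!: SUP_upper)
    then have le: "(\<integral>\<^sup>+z. ennreal (exp ((X z \<bullet> w)\<^sup>2 / (max K 0 + 1)\<^sup>2)) \<partial>P) \<le> 2" by (rule psi2_norm_le_imp)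
    have Xw: "(X z \<bullet> w)\<^sup>2 = (ip p (($) (X z)) v)\<^sup>2 / ip p v v" for z
    proof -
      have "X z \<bullet> w = ip p (($) (X z)) (\<lambda>i. 1 / c * v i)"
        unfolding w_def by (subst scalar_prod_ip[of _ p]) (auto intro: ip_cong)
      then show ?thesis unfolding ip_scale_right by (simp add: power_divide power2_eq_square c(2))
    qed
    have "(\<integral>\<^sup>+z. ennreal (exp (\<bar>(ip p (($) (X z)) v)\<^sup>2\<bar> / ((max K 0 + 1)\<^sup>2 * b))) \<partial>P)
        \<le> (\<integral>\<^sup>+z. ennreal (exp ((X z \<bullet> w)\<^sup>2 / (max K 0 + 1)\<^sup>2)) \<partial>P)"
    proof (intro nn_integral_mono ennreal_leI)
      fix z
      have "(ip p (($) (X z)) v)\<^sup>2 / ((max K 0 + 1)\<^sup>2 * b) \<le> (ip p (($) (X z)) v)\<^sup>2 / ((max K 0 + 1)\<^sup>2 * ip p v v)"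
        using v c(2) mult_pos_pos[OF c(1) c(1)] by (intro divide_left_mono mult_left_mono mult_pos_pos) auto
      then show "exp (\<bar>(ip p (($) (X z)) v)\<^sup>2\<bar> / ((max K 0 + 1)\<^sup>2 * b)) \<le> exp ((X z \<bullet> w)\<^sup>2 / (max K 0 + 1)\<^sup>2)"
        by (simp add: Xw mult.commute)
    qed
    also note le
    finally show ?thesis using m by (simp add: subexp_def)
  }
qed

text \<open>The joint law is a product measure, so the probability is an average of section
  probabilities.\<close>

lemma (in prob_space) indep_section_bound:
  assumes ind: "indep_var S W T D" and E: "E \<in> sets (S \<Otimes>\<^sub>M T)"
    and bound: "\<And>w. w \<in> space S \<Longrightarrow> prob {\<omega> \<in> space M. (w, D \<omega>) \<in> E} \<le> \<epsilon>" and "0 \<le> \<epsilon>"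
  shows "prob {\<omega> \<in> space M. (W \<omega>, D \<omega>) \<in> E} \<le> \<epsilon>"
proof -
  have W: "W \<in> M \<rightarrow>\<^sub>M S" and D: "D \<in> M \<rightarrow>\<^sub>M T" and prod: "distr M S W \<Otimes>\<^sub>M distr M T D = distr M (S \<Otimes>\<^sub>M T) (\<lambda>\<omega>. (W \<omega>, D \<omega>))"
    using ind unfolding indep_var_distribution_eq by auto
  interpret S: prob_space "distr M S W" by (rule prob_space_distr[OF W])
  interpret T: prob_space "distr M T D" by (rule prob_space_distr[OF D])
  have WD: "(\<lambda>\<omega>. (W \<omega>, D \<omega>)) \<in> M \<rightarrow>\<^sub>M S \<Otimes>\<^sub>M T" using W D by measurable
  have E': "E \<in> sets (distr M S W \<Otimes>\<^sub>M distr M T D)" unfolding prod using E by simp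
  have "emeasure M {\<omega> \<in> space M. (W \<omega>, D \<omega>) \<in> E} = emeasure (distr M (S \<Otimes>\<^sub>M T) (\<lambda>\<omega>. (W \<omega>, D \<omega>))) E"
    by (subst emeasure_distr[OF WD E]) (auto intro!: arg_cong2[where f = emeasure])
  also have "\<dots> = (\<integral>\<^sup>+w. emeasure (distr M T D) (Pair w -` E) \<partial>distr M S W)"
    unfolding prod[symmetric] by (rule T.emeasure_pair_measure_alt[OF E'])
  also have "\<dots> \<le> (\<integral>\<^sup>+w. ennreal \<epsilon> \<partial>distr M S W)"
  proof (rule nn_integral_mono)
    fix w assume "w \<in> space (distr M S W)"
    then have w: "w \<in> space S" by simp
    have "emeasure (distr M T D) (Pair w -` E) = emeasure M {\<omega> \<in> space M. (w, D \<omega>) \<in> E}"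
      by (subst emeasure_distr[OF D sets_Pair1[OF E]]) (auto intro!: arg_cong2[where f = emeasure])
    also have "\<dots> \<le> ennreal \<epsilon>" using bound[OF w] by (simp add: emeasure_eq_measure ennreal_leI)
    finally show "emeasure (distr M T D) (Pair w -` E) \<le> ennreal \<epsilon>" .
  qed
  also have "\<dots> = ennreal \<epsilon>" using S.emeasure_space_1 by simp
  finally show ?thesis using \<open>0 \<le> \<epsilon>\<close> by (simp add: emeasure_eq_measure)
qed

text \<open>Events generated by \<open>W\<close> are already generated by \<open>C\<close>, and
  independence passes to smaller classes of events.\<close>

lemma (in prob_space) indep_var_sub_algebra:
  assumes ind: "indep_var S C T D"
    and W: "W \<in> vimage_algebra (space M) C S \<rightarrow>\<^sub>M R"
  shows "indep_var R W T D"
proof -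
  have C: "C \<in> M \<rightarrow>\<^sub>M S" and D: "D \<in> M \<rightarrow>\<^sub>M T"
    and i: "indep_set (sigma_sets (space M) {C -` A \<inter> space M |A. A \<in> sets S})
      (sigma_sets (space M) {D -` A \<inter> space M |A. A \<in> sets T})"
    using ind unfolding indep_var_eq by auto
  have Csp: "C \<in> space M \<rightarrow> space S" using C by (auto simp: measurable_space)
  have WM: "W \<in> M \<rightarrow>\<^sub>M R"
  proof (rule measurableI)
    show "W x \<in> space R" if "x \<in> space M" for x using measurable_space[OF W, of x] that by simp
    fix A assume "A \<in> sets R"
    from measurable_sets[OF W this] have "W -` A \<inter> space M \<in> sets (vimage_algebra (space M) C S)" by simp
    then obtain B where "W -` A \<inter> space M = C -` B \<inter> space M" "B \<in> sets S"
      unfolding sets_vimage_algebra2[OF Csp] by blast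
    then show "W -` A \<inter> space M \<in> sets M" using measurable_sets[OF C] by simp
  qed
  have "{W -` A \<inter> space M |A. A \<in> sets R} \<subseteq> {C -` A \<inter> space M |A. A \<in> sets S}"
  proof safe
    fix A assume "A \<in> sets R"
    from measurable_sets[OF W this] have "W -` A \<inter> space M \<in> sets (vimage_algebra (space M) C S)" by simp
    then show "\<exists>B. W -` A \<inter> space M = C -` B \<inter> space M \<and> B \<in> sets S"
      unfolding sets_vimage_algebra2[OF Csp] by blast
  qed
  then have "sigma_sets (space M) {W -` A \<inter> space M |A. A \<in> sets R}
      \<subseteq> sigma_sets (space M) {C -` A \<inter> space M |A. A \<in> sets S}" by (rule sigma_sets_mono')
  with i have "indep_set (sigma_sets (space M) {W -` A \<inter> space M |A. A \<in> sets R})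
      (sigma_sets (space M) {D -` A \<inter> space M |A. A \<in> sets T})"
    unfolding indep_sets2_eq by blast
  with WM D show ?thesis unfolding indep_var_eq by simp
qed

section \<open>The three stages on the good event\<close>

text \<open>The last two clauses do not follow from the first at the level \<open>\<tau>\<close>:
  summing entrywise errors against \<open>u k\<close> costs its l1 norm, which may grow with the
  sparsity. Images of the directions and their Gram matrix are therefore controlled
  separately.\<close>

definition near :: "nat \<Rightarrow> nat \<Rightarrow> real \<Rightarrow> (nat \<Rightarrow> nat \<Rightarrow> real) \<Rightarrow> (nat \<Rightarrow> nat \<Rightarrow> real) \<Rightarrow> (nat \<Rightarrow> nat \<Rightarrow> real) \<Rightarrow> bool" where
  "near n r \<tau> A S u \<longleftrightarrow> (\<forall>i<n. \<forall>j<n. \<bar>A i j - S i j\<bar> \<le> \<tau>) \<and>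
     (\<forall>i<n. \<forall>k<r. \<bar>mv n A (u k) i - mv n S (u k) i\<bar> \<le> \<tau>) \<and>
     (\<forall>k<r. \<forall>l<r. \<bar>bf n n (u k) A (u l) - of_bool (k = l)\<bar> \<le> \<tau>)"

text \<open>One side of the model, interpreted once for each of X and Y. \<open>B\<close> controls
  the spectrum of \<open>S\<close> from both sides, and \<open>J\<close> contains the supports of
  all directions.\<close>

locale population =
  fixes n r :: nat and S :: "nat \<Rightarrow> nat \<Rightarrow> real" and u :: "nat \<Rightarrow> nat \<Rightarrow> real" and B :: real and J :: "nat set"
  assumes S_sym: "\<And>i j. i < n \<Longrightarrow> j < n \<Longrightarrow> S i j = S j i"
    and B: "1 \<le> B"
    and S_lower: "\<And>x. ip n x x \<le> B * bf n n x S x"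
    and S_upper: "\<And>x. bf n n x S x \<le> B * ip n x x"
    and u_orth: "\<And>k l. k < r \<Longrightarrow> l < r \<Longrightarrow> bf n n (u k) S (u l) = of_bool (k = l)"
    and J: "J \<subseteq> {..<n}" and u_supp: "\<And>k i. k < r \<Longrightarrow> i < n \<Longrightarrow> i \<notin> J \<Longrightarrow> u k i = 0"
    and r: "1 \<le> r"
begin

lemma S_psd: "0 \<le> bf n n x S x"
proof -
  have "0 \<le> B * bf n n x S x" using S_lower[of x] ip_nonneg[of n x] by linarith
  then show ?thesis using B by (simp add: zero_le_mult_iff)
qed

lemma S_cauchy_schwarz: "\<bar>bf n n x S y\<bar> \<le> sqrt (bf n n x S x) * sqrt (bf n n y S y)"
proof -
  have cs: "bf n n x S y \<le> sqrt (bf n n x S x) * sqrt (bf n n y S y)" for x y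
    by (rule psd_cauchy_schwarz) (use S_sym S_psd in blast)+
  have "bf n n (\<lambda>i. (- 1) * x i) S y = - bf n n x S y"
    "bf n n (\<lambda>i. (- 1) * x i) S (\<lambda>i. (- 1) * x i) = bf n n x S x"
    unfolding bf_scale_left bf_scale_right by simp_all
  then show ?thesis using cs[of x y] cs[of "\<lambda>i. (- 1) * x i" y] by simp
qed

lemma sqrt_S_upper: "sqrt (bf n n x S x) \<le> sqrt B * sqrt (ip n x x)"
  using real_sqrt_le_mono[OF S_upper[of x]] by (simp add: real_sqrt_mult)

lemma S_entry: "i < n \<Longrightarrow> j < n \<Longrightarrow> \<bar>S i j\<bar> \<le> B"
proof -
  assume ij: "i < n" "j < n"
  have e: "sqrt (bf n n (unitv i) S (unitv i)) \<le> sqrt B" if "i < n" for i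
    using sqrt_S_upper[of "unitv i"] that by (simp add: ip_unitv) (simp add: unitv_def)
  have "\<bar>S i j\<bar> \<le> sqrt (bf n n (unitv i) S (unitv i)) * sqrt (bf n n (unitv j) S (unitv j))"
    using S_cauchy_schwarz[of "unitv i" "unitv j"] ij by (simp add: bf_unitv)
  also have "\<dots> \<le> sqrt B * sqrt B" using e ij S_psd B by (intro mult_mono) auto
  finally show ?thesis using B by simp
qed

lemma Su_entry: "i < n \<Longrightarrow> k < r \<Longrightarrow> \<bar>mv n S (u k) i\<bar> \<le> sqrt B"
proof -
  assume ik: "i < n" "k < r"
  have "\<bar>mv n S (u k) i\<bar> = \<bar>bf n n (unitv i) S (u k)\<bar>" using ik by (simp add: bf_def ip_unitv)
  also have "\<dots> \<le> sqrt (bf n n (unitv i) S (unitv i)) * 1"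
    using S_cauchy_schwarz[of "unitv i" "u k"] ik by (simp add: u_orth)
  also have "\<dots> \<le> sqrt B"
    using sqrt_S_upper[of "unitv i"] ik by (simp add: ip_unitv) (simp add: unitv_def)
  finally show ?thesis .
qed

text \<open>For w = S u the square |w|^2 = (w, S u) is at most the seminorm of w under
  \<open>S\<close>, hence at most sqrt B |w|.\<close>

lemma Su_norm: "k < r \<Longrightarrow> sqrt (ip n (mv n S (u k)) (mv n S (u k))) \<le> sqrt B"
proof -
  assume k: "k < r"
  define w where "w = mv n S (u k)"
  have "ip n w w = bf n n w S (u k)" by (simp add: w_def bf_def)
  also have "\<dots> \<le> sqrt (bf n n w S w)" using S_cauchy_schwarz[of w "u k"] k by (simp add: u_orth)
  also have "\<dots> \<le> sqrt B * sqrt (ip n w w)" by (rule sqrt_S_upper)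
  finally have "sqrt (ip n w w) * sqrt (ip n w w) \<le> sqrt B * sqrt (ip n w w)" by simp
  then have "sqrt (ip n w w) \<le> sqrt B"
    using B by (cases "ip n w w = 0") (simp, metis ip_nonneg mult_le_cancel_right not_less real_sqrt_gt_0_iff less_eq_real_def)
  then show ?thesis by (simp add: w_def)
qed

lemma u_norm: "k < r \<Longrightarrow> sqrt (ip n (u k) (u k)) \<le> sqrt B"
  using S_lower[of "u k"] by (simp add: u_orth)

lemma u_l1: "k < r \<Longrightarrow> real (card J) \<le> s \<Longrightarrow> l1 n (u k) \<le> sqrt s * sqrt B"
proof -
  assume k: "k < r" and s: "real (card J) \<le> s"
  have "l1 n (u k) = (\<Sum>i\<in>J. \<bar>u k i\<bar>)"
    unfolding l1_def using J u_supp[OF k] by (intro sum.mono_neutral_right) auto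
  also have "\<dots> \<le> sqrt s * sqrt (ip n (u k) (u k))"
    using sum_abs_le_sqrt_card[OF _ J s, of "u k"] by (simp add: ip_def power2_eq_square)
  also have "\<dots> \<le> sqrt s * sqrt B" using u_norm[OF k] s by (intro mult_left_mono) auto
  finally show ?thesis .
qed

lemma near_bf:
  assumes "near n r \<tau> A S u"
  shows "bf n n x A x \<le> B * ip n x x + \<tau> * (l1 n x)\<^sup>2"
proof -
  have "\<bar>bf n n x (\<lambda>i j. A i j - S i j) x\<bar> \<le> \<tau> * l1 n x * l1 n x"
    using assms by (intro bf_max_bound) (auto simp: near_def)
  then show ?thesis using S_upper[of x] by (simp add: bf_diff_mat power2_eq_square)
qed

text \<open>Stages 2 and 3 in terms of the coefficients \<open>g\<close> of the regression target \<open>\<Sum>\<^sub>k g k u k\<close>;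
  all components but the first are bias.\<close>

lemma lasso_normalized_rate:
  fixes g :: "nat \<Rightarrow> real" and \<theta> t C' c \<nu> s \<gamma> :: real
  defines "R \<equiv> (\<Sum>k\<in>{1..<r}. \<bar>g k\<bar>)" and "a \<equiv> 3 * C' / c"
  defines "Kc \<equiv> 2 / \<gamma> * (a + B * t + sqrt B * sqrt (B + 1) * a + 3 * sqrt B)"
  assumes A1: "\<And>i j. i < n \<Longrightarrow> j < n \<Longrightarrow> A1 i j = A1 j i" "\<And>x. 0 \<le> bf n n x A1 x"
      "near n r (t * \<theta>) A1 S u" "\<And>x. c * ip n x x - \<nu> * (l1 n x)\<^sup>2 \<le> bf n n x A1 x"
    and Af: "\<And>i j. i < n \<Longrightarrow> j < n \<Longrightarrow> Af i j = Af j i" "\<And>x. 0 \<le> bf n n x Af x" "near n r (t * \<theta>) Af S u"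
    and h: "\<And>i. i < n \<Longrightarrow> \<bar>h i - (\<Sum>k<r. g k * mv n S (u k) i)\<bar> \<le> t * \<theta>"
    and min: "\<And>y. bf n n xt A1 xt - 2 * ip n xt h + C' * \<theta> * l1 n xt \<le> bf n n y A1 y - 2 * ip n y h + C' * \<theta> * l1 n y"
    and s: "real (card J) \<le> s" "1 \<le> s"
    and gb: "\<And>k. k < r \<Longrightarrow> \<bar>g k\<bar> \<le> sqrt B" and g0: "0 < \<gamma>" "\<gamma> \<le> \<bar>g 0\<bar>"
    and C': "4 * t * (1 + real r * sqrt B) \<le> C'"
    and pos: "0 < \<theta>" "0 < t" "0 < c" "0 \<le> \<nu>"
    and small: "32 * \<nu> * s \<le> c" "16 * s * (t * \<theta>) \<le> 1" "t * \<theta> \<le> 1"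
      "2 * (sqrt B * (t * \<theta>) + sqrt (B + 1) * (a * (sqrt s * \<theta>)) + 2 * R) \<le> \<gamma>"
  defines "xh \<equiv> (\<lambda>i. sgn (g 0) * (1 / sqrt (bf n n xt Af xt) * xt i) - u 0 i)"
  shows "0 < bf n n xt Af xt" "sqrt (ip n xh xh) \<le> Kc * (sqrt s * \<theta> + R)"
    "l1 n xh \<le> 4 * sqrt s * (Kc * (sqrt s * \<theta> + R))"
proof -
  define xs where "xs = (\<lambda>i. \<Sum>k<r. g k * u k i)"
  define \<delta> where "\<delta> = (\<lambda>i. xt i - xs i)"
  have C'0: "0 < C'"
    using C' pos B by (smt (verit) mult_pos_pos mult_nonneg_nonneg of_nat_0_le_iff real_sqrt_ge_zero)
  have a0: "0 < a" using C'0 pos by (simp add: a_def)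
  have R0: "0 \<le> R" by (simp add: R_def sum_nonneg)
  have xs0: "xs i = 0" if "i < n" "i \<notin> J" for i using u_supp[OF _ that] by (simp add: xs_def)
  \<comment> \<open>Two sources of order \<open>t * \<theta>\<close>: the deviation of
    \<open>h\<close> from its population value and, weighted by the \<open>g k\<close>, that of the
    images of the directions.\<close>
  have noise: "\<bar>h i - mv n A1 xs i\<bar> \<le> C' * \<theta> / 4" if i: "i < n" for i
  proof -
    have "mv n A1 xs i = (\<Sum>k<r. g k * mv n A1 (u k) i)" by (simp add: xs_def mv_sum mv_scale)
    then have "(\<Sum>k<r. g k * mv n S (u k) i) - mv n A1 xs i = (\<Sum>k<r. g k * (mv n S (u k) i - mv n A1 (u k) i))"
      by (simp add: right_diff_distrib sum_subtractf)
    also have "\<bar>\<dots>\<bar> \<le> (\<Sum>k<r. sqrt B * (t * \<theta>))"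
    proof (rule order_trans[OF sum_abs], rule sum_mono)
      fix k assume "k \<in> {..<r}"
      then have k: "k < r" by simp
      then have "\<bar>mv n S (u k) i - mv n A1 (u k) i\<bar> \<le> t * \<theta>"
        using A1(3) i by (auto simp: near_def abs_minus_commute)
      then show "\<bar>g k * (mv n S (u k) i - mv n A1 (u k) i)\<bar> \<le> sqrt B * (t * \<theta>)"
        unfolding abs_mult using gb[OF k] B by (intro mult_mono) auto
    qed
    also have "\<dots> = real r * sqrt B * (t * \<theta>)" by simp
    finally have "\<bar>h i - mv n A1 xs i\<bar> \<le> t * \<theta> + real r * sqrt B * (t * \<theta>)" using h[OF i] by linarith
    also have "\<dots> = t * (1 + real r * sqrt B) * \<theta>" by (simp add: algebra_simps)
    also have "\<dots> \<le> C' / 4 * \<theta>" using C' pos by (intro mult_right_mono) auto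
    finally show ?thesis by simp
  qed
  note lasso = lasso_rate[OF A1(1,2,4) J s(1) xs0 noise min[of xs] small(1) pos(3) _ pos(4) _ \<delta>_def]
  define N where "N = sqrt (ip n \<delta> \<delta>)"
  have N0: "0 \<le> N" by (simp add: N_def)
  have Na: "N \<le> a * (sqrt s * \<theta>)"
    using lasso(1) C'0 pos s by (simp add: N_def a_def mult_ac)
  have l1\<delta>: "l1 n \<delta> \<le> 4 * (sqrt s * N)" using lasso(2) C'0 pos s by (simp add: N_def)
  \<comment> \<open>The Lasso controls the error through \<open>A1\<close>, but the normalization
    uses \<open>Af\<close>. On the cone the passage from \<open>S\<close> to \<open>Af\<close> costs
    only a multiple of \<open>s * (t * \<theta>)\<close>.\<close>
  have "bf n n \<delta> Af \<delta> \<le> B * (N * N) + (t * \<theta>) * (4 * (sqrt s * N))\<^sup>2"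
  proof (rule order_trans[OF near_bf[OF Af(3)]], rule add_mono)
    show "t * \<theta> * (l1 n \<delta>)\<^sup>2 \<le> t * \<theta> * (4 * (sqrt s * N))\<^sup>2"
      using l1\<delta> pos by (intro mult_left_mono power_mono) (auto simp: l1_def sum_nonneg)
  qed (simp add: N_def)
  also have "\<dots> = B * (N * N) + 16 * s * (t * \<theta>) * (N * N)"
    using s by (simp add: power2_eq_square algebra_simps)
  also have "\<dots> \<le> B * (N * N) + 1 * (N * N)" using small(2) by (intro add_left_mono mult_right_mono) auto
  also have "\<dots> = (B + 1) * (N * N)" by (simp add: algebra_simps)
  finally have "sqrt (bf n n \<delta> Af \<delta>) \<le> sqrt ((B + 1) * (N * N))" by (rule real_sqrt_le_mono)
  then have d: "sqrt (bf n n \<delta> Af \<delta>) \<le> sqrt (B + 1) * N" using N0 by (simp add: real_sqrt_mult)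
  have af: "\<bar>bf n n (u k) Af (u k) - 1\<bar> \<le> t * \<theta>" if "k < r" for k
  proof -
    have "\<bar>bf n n (u k) Af (u k) - of_bool (k = k)\<bar> \<le> t * \<theta>" using Af(3) that unfolding near_def by blast
    then show ?thesis by simp
  qed
  have uk4: "bf n n (u k) Af (u k) \<le> 4" if "k < r" for k using af[OF that] small(3) by linarith
  define E where "E = \<bar>g 0\<bar> * (t * \<theta>) + sqrt (B + 1) * N + 2 * (\<Sum>k\<in>{1..<r}. \<bar>g k\<bar>)"
  have EE: "E \<le> sqrt B * (t * \<theta>) + sqrt (B + 1) * (a * (sqrt s * \<theta>)) + 2 * R"
    unfolding E_def R_def using gb[of 0] r pos Na B
    by (intro add_mono mult_left_mono mult_right_mono) auto
  have E2: "2 * E \<le> \<gamma>" by (rule order_trans[OF mult_left_mono[OF EE] small(4)]) simp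
  have r0: "0 < r" using r by simp
  have xt: "xt i = (\<Sum>k<r. g k * u k i) + \<delta> i" for i by (simp add: \<delta>_def xs_def)
  note nrm = normalization_rate[OF Af(1,2) r af[OF r0] uk4 d xt E_def g0 E2]
  have l2add: "sqrt (ip n (\<lambda>i. x i + y i) (\<lambda>i. x i + y i)) \<le> sqrt (ip n x x) + sqrt (ip n y y)" for x y
  proof (rule real_le_lsqrt)
    have "ip n (\<lambda>i. x i + y i) (\<lambda>i. x i + y i) = ip n x x + 2 * ip n x y + ip n y y"
      by (simp add: ip_bilinear ip_commute[of n y x])
    also have "\<dots> \<le> ip n x x + 2 * (sqrt (ip n x x) * sqrt (ip n y y)) + ip n y y"
      using ip_cauchy_schwarz[of n x y] by simp
    finally show "ip n (\<lambda>i. x i + y i) (\<lambda>i. x i + y i) \<le> (sqrt (ip n x x) + sqrt (ip n y y))\<^sup>2"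
      by (simp add: power2_sum)
  qed simp_all
  have l2scale: "sqrt (ip n (\<lambda>i. c * x i) (\<lambda>i. c * x i)) = \<bar>c\<bar> * sqrt (ip n x x)" for c x
  proof -
    have "ip n (\<lambda>i. c * x i) (\<lambda>i. c * x i) = c\<^sup>2 * ip n x x" by (simp add: ip_bilinear power2_eq_square)
    then show ?thesis by (simp add: real_sqrt_mult)
  qed
  have l2cong: "sqrt (ip n x x) = sqrt (ip n y y)" if "\<And>i. i < n \<Longrightarrow> x i = y i" for x y
    using that by (simp add: ip_def)
  have l1add: "l1 n (\<lambda>i. x i + y i) \<le> l1 n x + l1 n y" for x y
    unfolding l1_def sum.distrib[symmetric] by (intro sum_mono abs_triangle_ineq)
  have l1scale: "l1 n (\<lambda>i. c * x i) = \<bar>c\<bar> * l1 n x" for c x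
    by (simp add: l1_def abs_mult sum_distrib_left)
  have l1cong: "l1 n x = l1 n y" if "\<And>i. i < n \<Longrightarrow> x i = y i" for x y using that by (simp add: l1_def)
  show "0 < bf n n xt Af xt"
  proof -
    have "0 < sqrt (bf n n xt Af xt)"
      by (rule nrm(1)[where nrm = "\<lambda>x. sqrt (ip n x x)" and T = "sqrt B"];
          (assumption | rule refl | rule l2add | rule l2scale | (rule l2cong, simp) | (rule u_norm, assumption)))
    then show ?thesis by simp
  qed
  have step2: "sqrt (ip n xh xh) \<le> 2 / \<gamma> * (sqrt (ip n \<delta> \<delta>) + sqrt B * (R + E))"
    unfolding xh_def R_def
    by (rule nrm(2)[where nrm = "\<lambda>x. sqrt (ip n x x)" and T = "sqrt B"];
        (assumption | rule refl | rule l2add | rule l2scale | (rule l2cong, simp) | (rule u_norm, assumption)))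
  have step1: "l1 n xh \<le> 2 / \<gamma> * (l1 n \<delta> + (sqrt s * sqrt B) * (R + E))"
    unfolding xh_def R_def
    by (rule nrm(2)[where nrm = "l1 n" and T = "sqrt s * sqrt B"];
        (assumption | rule refl | rule l1add | rule l1scale | (rule l1cong, simp) | (rule u_l1, assumption, rule s(1))))
  have sl: "\<theta> \<le> sqrt s * \<theta>" using s pos by simp
  \<comment> \<open>Nonnegative cross terms are added so that the bound factors into a constant and
    the rate.\<close>
  have key: "a * (sqrt s * \<theta>) + sqrt B * (R + E) \<le>
      (a + B * t + sqrt B * sqrt (B + 1) * a + 3 * sqrt B) * (sqrt s * \<theta> + R)"
  proof -
    define q where "q = sqrt s * \<theta>"
    have q: "0 \<le> q" "\<theta> \<le> q" using s pos sl by (auto simp: q_def)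
    have "sqrt B * (R + E) \<le> sqrt B * (R + (sqrt B * (t * \<theta>) + sqrt (B + 1) * (a * q) + 2 * R))"
      using EE B by (intro mult_left_mono) (auto simp: q_def)
    also have "\<dots> = 3 * sqrt B * R + B * (t * \<theta>) + sqrt B * sqrt (B + 1) * a * q"
    proof -
      have "b * (R + (b * x + e * y + 2 * R)) = 3 * b * R + (b * b) * x + b * e * y" for b e x y :: real
        by (simp add: algebra_simps)
      from this[of "sqrt B" "t * \<theta>" "sqrt (B + 1)" "a * q"] B show ?thesis
        by (simp only: real_sqrt_mult_self mult.assoc)
    qed
    also have "\<dots> \<le> 3 * sqrt B * R + B * (t * q) + sqrt B * sqrt (B + 1) * a * q"
      using q pos B by (intro add_mono order_refl mult_left_mono) auto
    finally have "a * q + sqrt B * (R + E) \<le> a * q + (3 * sqrt B * R + B * (t * q) + sqrt B * sqrt (B + 1) * a * q)"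
      by simp
    also have "\<dots> \<le> a * q + (3 * sqrt B * R + B * (t * q) + sqrt B * sqrt (B + 1) * a * q)
        + (3 * sqrt B * q + (a + B * t + sqrt B * sqrt (B + 1) * a) * R)"
      using q pos B R0 a0 by simp
    also have "\<dots> = (a + B * t + sqrt B * sqrt (B + 1) * a + 3 * sqrt B) * (q + R)"
      by (simp add: algebra_simps)
    finally show ?thesis by (simp add: q_def)
  qed
  have "sqrt (ip n \<delta> \<delta>) + sqrt B * (R + E) \<le> a * (sqrt s * \<theta>) + sqrt B * (R + E)"
    using Na by (simp add: N_def)
  with key have "sqrt (ip n \<delta> \<delta>) + sqrt B * (R + E) \<le>
      (a + B * t + sqrt B * sqrt (B + 1) * a + 3 * sqrt B) * (sqrt s * \<theta> + R)" by linarith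
  then have "2 / \<gamma> * (sqrt (ip n \<delta> \<delta>) + sqrt B * (R + E)) \<le> Kc * (sqrt s * \<theta> + R)"
    unfolding Kc_def mult.assoc using g0 by (intro mult_left_mono) auto
  with step2 show "sqrt (ip n xh xh) \<le> Kc * (sqrt s * \<theta> + R)" by linarith
  have E0: "0 \<le> E" using pos N0 B by (simp add: E_def sum_nonneg)
  have "l1 n \<delta> + (sqrt s * sqrt B) * (R + E) \<le> 4 * sqrt s * (a * (sqrt s * \<theta>) + sqrt B * (R + E))"
  proof -
    have "l1 n \<delta> \<le> 4 * (sqrt s * (a * (sqrt s * \<theta>)))"
    proof -
      have "sqrt s * N \<le> sqrt s * (a * (sqrt s * \<theta>))" using Na s by (intro mult_left_mono) auto
      with l1\<delta> show ?thesis by linarith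
    qed
    moreover have "0 \<le> sqrt s * sqrt B * (R + E)" using R0 E0 s B by simp
    moreover have split: "4 * sqrt s * (x + sqrt B * y) = 4 * (sqrt s * x) + 4 * (sqrt s * sqrt B * y)" for x y
      by (simp add: algebra_simps)
    ultimately show ?thesis unfolding split[of "a * (sqrt s * \<theta>)" "R + E"] by linarith
  qed
  also have "\<dots> \<le> 4 * sqrt s * ((a + B * t + sqrt B * sqrt (B + 1) * a + 3 * sqrt B) * (sqrt s * \<theta> + R))"
    using key s by (intro mult_left_mono) auto
  finally have "2 / \<gamma> * (l1 n \<delta> + (sqrt s * sqrt B) * (R + E)) \<le>
      2 / \<gamma> * (4 * sqrt s * ((a + B * t + sqrt B * sqrt (B + 1) * a + 3 * sqrt B) * (sqrt s * \<theta> + R)))"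
    using g0 by (intro mult_left_mono) auto
  also have "\<dots> = 4 * sqrt s * (Kc * (sqrt s * \<theta> + R))" by (simp add: Kc_def mult_ac)
  finally show "l1 n xh \<le> 4 * sqrt s * (Kc * (sqrt s * \<theta> + R))" using step1 by linarith
qed

end

section \<open>First stage: feasible matrices and the error of the maximizer\<close>

definition sandwich :: "nat \<Rightarrow> nat \<Rightarrow> (nat \<Rightarrow> nat \<Rightarrow> real) \<Rightarrow> (nat \<Rightarrow> nat \<Rightarrow> real) \<Rightarrow> (nat \<Rightarrow> nat \<Rightarrow> real) \<Rightarrow> nat \<Rightarrow> nat \<Rightarrow> real" where
  "sandwich p q T H W = (\<lambda>i j. bf p q (T i) H (W j))"

text \<open>\<open>sandwich\<close> pairs rows of \<open>T\<close> with rows of \<open>W\<close>, so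
  it is \<open>T H W\<^sup>T\<close>; symmetry of \<open>W\<close> turns this into the product that
  occurs in the constraints.\<close>

lemma sandwich_mult_mat:
  assumes T: "T \<in> carrier_mat p p" and F: "F \<in> carrier_mat p q" and W: "W \<in> carrier_mat q q"
    and W_sym: "\<And>i j. i < q \<Longrightarrow> j < q \<Longrightarrow> W $$ (i, j) = W $$ (j, i)" and ij: "i < p" "j < q"
  shows "(T * F * W) $$ (i, j) = sandwich p q (ent T) (ent F) (ent W) i j"
proof -
  have "(T * F * W) $$ (i, j) = (\<Sum>l<q. (\<Sum>k<p. T $$ (i, k) * F $$ (k, l)) * W $$ (l, j))"
    using mult_mat_entry[of "T * F" p q W q i j] mult_mat_entry[OF T F ij(1)] T F W ij by simp
  also have "\<dots> = (\<Sum>l<q. \<Sum>k<p. T $$ (i, k) * F $$ (k, l) * W $$ (j, l))"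
    using W_sym ij by (simp add: sum_distrib_right)
  also have "\<dots> = (\<Sum>k<p. \<Sum>l<q. T $$ (i, k) * F $$ (k, l) * W $$ (j, l))" by (rule sum.swap)
  finally show ?thesis by (simp add: sandwich_def bf_sum)
qed

lemma sandwich_diff: "sandwich p q T (\<lambda>i j. H i j - G i j) W = (\<lambda>i j. sandwich p q T H W i j - sandwich p q T G W i j)"
  by (simp add: sandwich_def bf_diff_mat)

lemma sandwich_outer: "sandwich p q T (\<lambda>i j. x i * y j) W i j = mv p T x i * mv q W y j"
  by (simp add: sandwich_def bf_outer ip_def mv_def mult.commute)

lemma bf_sandwich:
  assumes "\<And>i j. i < p \<Longrightarrow> j < p \<Longrightarrow> T i j = T j i" "\<And>i j. i < q \<Longrightarrow> j < q \<Longrightarrow> W i j = W j i"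
  shows "bf p q x (sandwich p q T H W) y = bf p q (mv p T x) H (mv q W y)"
proof -
  have "bf p q x (sandwich p q T H W) y = (\<Sum>i<p. \<Sum>j<q. x i * bf p q (T i) H (W j) * y j)"
    by (simp add: bf_sum[of p q x] sandwich_def)
  also have "\<dots> = bf p q (\<lambda>k. \<Sum>i<p. x i * T i k) H (\<lambda>l. \<Sum>j<q. y j * W j l)"
    unfolding bf_sum_left bf_sum_right bf_scale_left bf_scale_right
    by (simp add: sum_distrib_left mult_ac)
  also have "\<dots> = bf p q (mv p T x) H (mv q W y)"
    unfolding bf_sum using assms by (intro sum.cong) (auto simp: mv_def mult.commute)
  finally show ?thesis .
qed

text \<open>Brings the weighted Frobenius norm into the shape that
  \<open>tensor_restricted_eigenvalue\<close> bounds from below.\<close>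

lemma fro2_sandwich:
  assumes T: "\<And>x y. ip p (mv p T x) (mv p T y) = bf p p x A y"
  shows "fro2 p q (sandwich p q T H W) = (\<Sum>k<q. bf p p (\<lambda>i. mv q W (H i) k) A (\<lambda>i. mv q W (H i) k))"
proof -
  have "sandwich p q T H W i k = mv p T (\<lambda>i. mv q W (H i) k) i" for i k
    by (simp add: sandwich_def bf_sum mv_def sum_distrib_left mult_ac)
  then have "fro2 p q (sandwich p q T H W) =
      (\<Sum>i<p. \<Sum>k<q. mv p T (\<lambda>i. mv q W (H i) k) i * mv p T (\<lambda>i. mv q W (H i) k) i)"
    by (simp add: fro2_def ip_def)
  also have "\<dots> = (\<Sum>k<q. \<Sum>i<p. mv p T (\<lambda>i. mv q W (H i) k) i * mv p T (\<lambda>i. mv q W (H i) k) i)"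
    by (rule sum.swap)
  also have "\<dots> = (\<Sum>k<q. bf p p (\<lambda>i. mv q W (H i) k) A (\<lambda>i. mv q W (H i) k))"
    by (simp add: T[symmetric] ip_def)
  finally show ?thesis .
qed

text \<open>\<open>G\<^sup>T * G\<close> is the projection onto \<open>z\<close>, hence its own
  square root, and has trace 1. This makes the comparison matrix feasible.\<close>

lemma rank_one_norms:
  assumes w: "ip p w w = 1" and z: "ip q z z = 1"
    and G: "G = Matrix.mat p q (\<lambda>(i, j). w i * z j)"
  shows "nuclear_norm G \<le> 1" "op_norm G \<le> 1"
proof -
  have Gc: "G \<in> carrier_mat p q" by (simp add: G)
  define Z where "Z = Matrix.mat q q (\<lambda>(i, j). z i * z j)"
  have Zc: "Z \<in> carrier_mat q q" by (simp add: Z_def)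
  have zz: "(\<Sum>k<q. z k * z k) = 1" and ww: "(\<Sum>k<p. w k * w k) = 1" using z w by (simp_all add: ip_def)
  have Zx: "mv q (ent Z) x i = z i * ip q z x" if "i < q" for x i
    using that by (simp add: Z_def mv_def ip_def sum_distrib_left mult_ac)
  have GG: "G\<^sup>T * G = Z"
  proof (rule eq_matI)
    fix i j assume "i < dim_row Z" "j < dim_col Z"
    then have ij: "i < q" "j < q" by (simp_all add: Z_def)
    have "(G\<^sup>T * G) $$ (i, j) = (\<Sum>k<p. (w k * z i) * (w k * z j))"
      using mult_mat_entry[of "G\<^sup>T" q p G q i j] Gc ij by (simp add: G)
    also have "\<dots> = (\<Sum>k<p. w k * w k) * (z i * z j)" unfolding sum_distrib_right by (simp add: mult_ac)
    finally show "(G\<^sup>T * G) $$ (i, j) = Z $$ (i, j)" using ij by (simp add: ww Z_def)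
  qed (use Gc Zc in auto)
  have "psd Z"
    unfolding psd_iff[OF Zc]
  proof (intro conjI allI impI)
    fix x
    have "ip q x (mv q (ent Z) x) = ip q x (\<lambda>i. ip q z x * z i)"
      by (rule ip_cong) (simp_all add: Zx)
    then show "0 \<le> ip q x (mv q (ent Z) x)" by (simp add: ip_scale_right ip_commute[of q z x])
  qed (simp add: Z_def mult.commute)
  moreover have "Z * Z = Z"
  proof (rule eq_matI)
    fix i j assume "i < dim_row Z" "j < dim_col Z"
    then have ij: "i < q" "j < q" by (simp_all add: Z_def)
    have "(Z * Z) $$ (i, j) = (\<Sum>k<q. (z i * z k) * (z k * z j))"
      using mult_mat_entry[OF Zc Zc ij] ij by (simp add: Z_def)
    also have "\<dots> = (\<Sum>k<q. z k * z k) * (z i * z j)" unfolding sum_distrib_right by (simp add: mult_ac)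
    finally show "(Z * Z) $$ (i, j) = Z $$ (i, j)" using ij by (simp add: zz Z_def)
  qed (use Zc in auto)
  ultimately have "psd_sqrt Z = Z" by (intro psd_sqrt_eqI[OF Zc _ Zc])
  then have "nuclear_norm G = (\<Sum>k<q. z k * z k)"
    by (simp add: nuclear_norm_def GG mat_trace_def) (simp add: Z_def)
  then show "nuclear_norm G \<le> 1" by (simp add: zz)
  show "op_norm G \<le> 1"
  proof (rule op_norm_leI[OF Gc])
    fix x
    have "ip p (mv q (ent G) x) (mv q (ent G) x) = ip p (\<lambda>i. ip q z x * w i) (\<lambda>i. ip q z x * w i)"
      by (rule ip_cong) (simp_all add: G mv_def ip_def sum_distrib_left sum_distrib_right mult_ac)
    also have "\<dots> = (ip q z x)\<^sup>2" by (simp add: ip_scale_left ip_scale_right w power2_eq_square)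
    finally show "sqrt (ip p (mv q (ent G) x) (mv q (ent G) x)) \<le> sqrt (ip q x x)"
      using ip_cauchy_schwarz[of q z x] by (simp add: z)
  qed
qed

text \<open>Duality of \<open>G\<close> with itself: the squared Frobenius norm is at most the
  product of the nuclear and the operator norm.\<close>

lemma frobenius_le_one:
  assumes G: "G \<in> carrier_mat p q" and "nuclear_norm G \<le> 1" "op_norm G \<le> 1"
  shows "fro2 p q (ent G) \<le> 1"
proof -
  have "sqrt (ip p (mv q (ent G) x) (mv q (ent G) x)) \<le> 1 * sqrt (ip q x x)" for x
    by (rule order_trans[OF op_norm_bound[OF G] mult_right_mono[OF assms(3)]]) simp
  from nuclear_norm_duality[OF G this]
  show ?thesis using assms(2) by (simp add: fro2_def ip_def)
qed

lemma mat_trace_transpose_mult: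
  assumes "A \<in> carrier_mat p q" "F \<in> carrier_mat p q"
  shows "mat_trace (A\<^sup>T * F) = (\<Sum>i<p. \<Sum>j<q. A $$ (i, j) * F $$ (i, j))"
proof -
  have "mat_trace (A\<^sup>T * F) = (\<Sum>j<q. \<Sum>i<p. A $$ (i, j) * F $$ (i, j))"
    unfolding mat_trace_def using assms
    by (auto intro!: sum.cong simp: scalar_prod_def atLeast0LessThan)
  then show ?thesis by (simp add: sum.swap[of _ "{..<p}"])
qed

text \<open>\<open>L1\<close> plays the part of the second canonical correlation; as a separate
  parameter it can be 0 when there is only one.\<close>

locale two_populations = X: population p r Sx u B Jx + Y: population q r Sy v B Jy
  for p q r :: nat and Sx Sy :: "nat \<Rightarrow> nat \<Rightarrow> real" and u v :: "nat \<Rightarrow> nat \<Rightarrow> real" and B :: real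
    and Jx Jy :: "nat set" +
  fixes Lm :: "nat \<Rightarrow> real" and L1 :: real
  assumes Lm: "\<And>k. k < r \<Longrightarrow> 0 \<le> Lm k" "\<And>k. k < r \<Longrightarrow> Lm k \<le> 1" "0 \<le> L1" "L1 \<le> 1"
    "\<And>k. 1 \<le> k \<Longrightarrow> k < r \<Longrightarrow> Lm k \<le> L1"
begin

definition Sxy :: "nat \<Rightarrow> nat \<Rightarrow> real" where
  "Sxy i j = (\<Sum>k<r. Lm k * (mv p Sx (u k) i * mv q Sy (v k) j))"

text \<open>The curvature bound sees the cross covariance through the empirical square roots, that
  is with \<open>Ax\<close> and \<open>Ay\<close> in place of the population matrices. The
  replacement changes only \<open>r\<close> products of images, so its entrywise cost stays of order
  \<open>\<tau>\<close>; the constant is the product rule with factors bounded by sqrt B.\<close>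

lemma cross_noise:
  assumes x: "near p r \<tau> Ax Sx u" and y: "near q r \<tau> Ay Sy v"
    and xy: "\<bar>Axy - Sxy i j\<bar> \<le> \<tau>" and ij: "i < p" "j < q" and \<tau>: "0 \<le> \<tau>" "\<tau> \<le> 1"
  shows "\<bar>Axy - (\<Sum>k<r. Lm k * (mv p Ax (u k) i * mv q Ay (v k) j))\<bar> \<le> \<tau> * (1 + real r * (2 * sqrt B + 1))"
proof -
  have B0: "0 \<le> sqrt B" using X.B by simp
  have "Sxy i j - (\<Sum>k<r. Lm k * (mv p Ax (u k) i * mv q Ay (v k) j))
      = (\<Sum>k<r. Lm k * (mv p Sx (u k) i * mv q Sy (v k) j - mv p Ax (u k) i * mv q Ay (v k) j))"
    by (simp add: Sxy_def right_diff_distrib sum_subtractf)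
  also have "\<bar>\<dots>\<bar> \<le> (\<Sum>k<r. \<tau> * (2 * sqrt B + 1))"
  proof (rule order_trans[OF sum_abs], rule sum_mono)
    fix k assume "k \<in> {..<r}"
    then have k: "k < r" by simp
    let ?a = "mv p Sx (u k) i" and ?b = "mv q Sy (v k) j" and ?a' = "mv p Ax (u k) i" and ?b' = "mv q Ay (v k) j"
    have da: "\<bar>?a' - ?a\<bar> \<le> \<tau>" and db: "\<bar>?b' - ?b\<bar> \<le> \<tau>" using x y k ij by (auto simp: near_def)
    have "?a * ?b - ?a' * ?b' = - (?a * (?b' - ?b)) - (?a' - ?a) * ?b - (?a' - ?a) * (?b' - ?b)"
      by (simp add: algebra_simps)
    moreover have "\<bar>?a * (?b' - ?b)\<bar> \<le> sqrt B * \<tau>"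
      unfolding abs_mult using X.Su_entry[OF ij(1) k] db B0 by (intro mult_mono) auto
    moreover have "\<bar>(?a' - ?a) * ?b\<bar> \<le> \<tau> * sqrt B"
      unfolding abs_mult using Y.Su_entry[OF ij(2) k] da \<tau> by (intro mult_mono) auto
    moreover have "\<bar>(?a' - ?a) * (?b' - ?b)\<bar> \<le> \<tau> * 1"
      unfolding abs_mult using da db \<tau> by (intro mult_mono) auto
    ultimately have "\<bar>?a * ?b - ?a' * ?b'\<bar> \<le> \<tau> * (2 * sqrt B + 1)" by (simp add: algebra_simps)
    moreover have "\<bar>Lm k\<bar> \<le> 1" using Lm(1,2)[OF k] by simp
    ultimately show "\<bar>Lm k * (?a * ?b - ?a' * ?b')\<bar> \<le> \<tau> * (2 * sqrt B + 1)"
      unfolding abs_mult using mult_mono[of "\<bar>Lm k\<bar>" 1 "\<bar>?a * ?b - ?a' * ?b'\<bar>" "\<tau> * (2 * sqrt B + 1)"] by simp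
  qed
  also have "\<dots> = real r * (\<tau> * (2 * sqrt B + 1))" by simp
  finally show ?thesis using xy by (simp add: algebra_simps)
qed

text \<open>Under the empirical square roots \<open>At\<close> becomes \<open>w z\<^sup>T\<close>
  with unit vectors \<open>w\<close> and \<open>z\<close>, so it competes with \<open>F\<close>.
  Optimality of \<open>F\<close> bounds the curvature term by noise and penalty difference; the
  tensor restricted eigenvalue then converts the weighted error into the plain one.\<close>

lemma stage1_rate:
  fixes Ax Ay Axy F :: "real mat" and \<tau> \<eta> lm e0 c \<nu> s g :: real
  assumes Ax: "Ax \<in> carrier_mat p p" "psd Ax" and Ay: "Ay \<in> carrier_mat q q" "psd Ay" and Axy: "Axy \<in> carrier_mat p q"
    and x: "near p r \<tau> (ent Ax) Sx u" and y: "near q r \<tau> (ent Ay) Sy v"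
    and xy: "\<And>i j. i < p \<Longrightarrow> j < q \<Longrightarrow> \<bar>Axy $$ (i, j) - Sxy i j\<bar> \<le> \<tau>"
    and REx: "\<And>x. c * ip p x x - \<nu> * (l1 p x)\<^sup>2 \<le> bf p p x (ent Ax) x"
    and REy: "\<And>x. c * ip q x x - \<nu> * (l1 q x)\<^sup>2 \<le> bf q q x (ent Ay) x"
    and F: "colar_stage1 Ax Ay Axy lm F"
    and card: "real (card Jx) \<le> s" "real (card Jy) \<le> s"
    and \<eta>: "2 * (\<tau> * (1 + real r * (2 * sqrt B + 1))) \<le> lm" and e0: "\<tau> \<le> e0 * lm" "0 \<le> e0"
    and \<tau>: "0 \<le> \<tau>" "\<tau> \<le> 1 / 4" and gap: "0 < g" "g \<le> Lm 0 - L1" "8 * real r * \<tau> \<le> g"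
    and pos: "0 < lm" "0 < c" "0 \<le> \<nu>" "1 \<le> s"
    and small: "32 * (\<nu> * (c + (B + 1))) * s\<^sup>2 \<le> c\<^sup>2 / 2" "2 * (\<nu> * (c + (B + 1))) * (16 * real r * e0)\<^sup>2 \<le> 1"
  defines "At \<equiv> (\<lambda>i j. (1 / sqrt (bf p p (u 0) (ent Ax) (u 0)) * u 0 i) * (1 / sqrt (bf q q (v 0) (ent Ay) (v 0)) * v 0 j))"
  shows "F \<in> carrier_mat p q"
    "sqrt (fro2 p q (\<lambda>i j. At i j - F $$ (i, j))) \<le> 2 / c * (4 / g) * (8 * real r * e0 + 3 / c) * (s * lm)"
proof -
  define \<alpha> where "\<alpha> = (\<lambda>i. 1 / sqrt (bf p p (u 0) (ent Ax) (u 0)) * u 0 i)"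
  define \<beta> where "\<beta> = (\<lambda>i. 1 / sqrt (bf q q (v 0) (ent Ay) (v 0)) * v 0 i)"
  have At: "At = (\<lambda>i j. \<alpha> i * \<beta> j)" by (simp add: At_def \<alpha>_def \<beta>_def)
  define T W where "T = psd_sqrt Ax" and "W = psd_sqrt Ay"
  note Tp = psd_sqrt[OF Ax, folded T_def] and Wp = psd_sqrt[OF Ay, folded W_def]
  have T_sym: "\<And>i j. i < p \<Longrightarrow> j < p \<Longrightarrow> ent T i j = ent T j i" using Tp(2) psd_iff[OF Tp(1)] by blast
  have W_sym: "\<And>i j. i < q \<Longrightarrow> j < q \<Longrightarrow> ent W i j = ent W j i" using Wp(2) psd_iff[OF Wp(1)] by blast
  have Tip: "ip p (mv p (ent T) x) (mv p (ent T) y) = bf p p x (ent Ax) y" for x y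
    unfolding bf_def T_def by (rule ip_psd_sqrt[OF Ax])
  have Wip: "ip q (mv q (ent W) x) (mv q (ent W) y) = bf q q x (ent Ay) y" for x y
    unfolding bf_def W_def by (rule ip_psd_sqrt[OF Ay])
  have dims: "dim_row Ax = p" "dim_row Ay = q" using Ax Ay by auto
  from F have feas: "F \<in> colar_feasible Ax Ay"
    and opt: "\<And>F'. F' \<in> colar_feasible Ax Ay \<Longrightarrow>
      mat_trace (Axy\<^sup>T * F') - lm * mat_l1_norm F' \<le> mat_trace (Axy\<^sup>T * F) - lm * mat_l1_norm F"
    unfolding colar_stage1_def is_arg_max_def by (auto simp: not_less)
  then show Fc: "F \<in> carrier_mat p q" by (simp add: colar_feasible_def dims)
  define G where "G = T * F * W"
  have Gc: "G \<in> carrier_mat p q" using Tp(1) Wp(1) Fc by (simp add: G_def)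
  have Gn: "nuclear_norm G \<le> 1" "op_norm G \<le> 1"
    using feas by (auto simp: colar_feasible_def G_def T_def W_def)
  have Gs: "G $$ (i, j) = sandwich p q (ent T) (ent F) (ent W) i j" if "i < p" "j < q" for i j
    unfolding G_def by (rule sandwich_mult_mat[OF Tp(1) Fc Wp(1) W_sym that])
  have r0: "0 < r" using X.r by simp
  define a b where "a = (\<lambda>k. mv p (ent T) (u k))" and "b = (\<lambda>k. mv q (ent W) (v k))"
  have grama: "\<bar>ip p (a i) (a j) - of_bool (i = j)\<bar> \<le> \<tau>" if "i < r" "j < r" for i j
    using x that unfolding a_def Tip near_def by blast
  have gramb: "\<bar>ip q (b i) (b j) - of_bool (i = j)\<bar> \<le> \<tau>" if "i < r" "j < r" for i j
    using y that unfolding b_def Wip near_def by blast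
  have au: "mv p (ent T) \<alpha> = (\<lambda>i. (1 / sqrt (ip p (a 0) (a 0))) * a 0 i)"
    unfolding \<alpha>_def mv_scale by (simp add: a_def Tip)
  have bv: "mv q (ent W) \<beta> = (\<lambda>i. (1 / sqrt (ip q (b 0) (b 0))) * b 0 i)"
    unfolding \<beta>_def mv_scale by (simp add: b_def Wip)
  define w z where "w = mv p (ent T) \<alpha>" and "z = mv q (ent W) \<beta>"
  have "ip p w w = 1" "ip q z z = 1"
    using gram_deflate(1)[OF grama \<tau> X.r w_def[unfolded au] refl]
      gram_deflate(1)[OF gramb \<tau> X.r z_def[unfolded bv] refl] by blast+
  define Am where "Am = Matrix.mat p q (\<lambda>(i, j). At i j)"
  have Amc: "Am \<in> carrier_mat p q" by (simp add: Am_def)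
  have AmG: "T * Am * W = Matrix.mat p q (\<lambda>(i, j). w i * z j)"
  proof (rule eq_matI)
    fix i j assume "i < dim_row (Matrix.mat p q (\<lambda>(i, j). w i * z j))" "j < dim_col (Matrix.mat p q (\<lambda>(i, j). w i * z j))"
    then have ij: "i < p" "j < q" by auto
    have "(T * Am * W) $$ (i, j) = sandwich p q (ent T) (ent Am) (ent W) i j"
      by (rule sandwich_mult_mat[OF Tp(1) Amc Wp(1) W_sym ij])
    also have "\<dots> = sandwich p q (ent T) At (ent W) i j"
      by (simp add: sandwich_def bf_sum Am_def)
    finally show "(T * Am * W) $$ (i, j) = Matrix.mat p q (\<lambda>(i, j). w i * z j) $$ (i, j)"
      using ij by (simp add: At sandwich_outer w_def z_def)
  qed (use Tp(1) Wp(1) Amc in auto)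
  have "Am \<in> colar_feasible Ax Ay"
    using rank_one_norms[OF \<open>ip p w w = 1\<close> \<open>ip q z z = 1\<close> AmG[symmetric, THEN sym]] Amc
    by (simp add: colar_feasible_def dims T_def W_def AmG)
  from opt[OF this]
  have opt': "(\<Sum>i<p. \<Sum>j<q. Axy $$ (i, j) * At i j) - lm * (\<Sum>i<p. \<Sum>j<q. \<bar>At i j\<bar>)
      \<le> (\<Sum>i<p. \<Sum>j<q. Axy $$ (i, j) * F $$ (i, j)) - lm * (\<Sum>i<p. \<Sum>j<q. \<bar>F $$ (i, j)\<bar>)"
    using Fc Amc by (simp add: mat_trace_transpose_mult[OF Axy] mat_l1_norm_def) (simp add: Am_def)
  define H where "H = (\<lambda>i j. At i j - F $$ (i, j))"
  define D where "D = sqrt (fro2 p q (sandwich p q (ent T) H (ent W)))"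
  \<comment> \<open>The cross covariance rebuilt from the empirical images of the directions; it is
    the linear functional to which the curvature bound applies.\<close>
  define St where "St = (\<lambda>i j. \<Sum>k<r. Lm k * (mv p (ent Ax) (u k) i * mv q (ent Ay) (v k) j))"
  have HG: "(\<lambda>i j. w i * z j - ent G' i j) = (\<lambda>i j. w i * z j - G' $$ (i, j))" for G' by simp
  have fro_cong: "fro2 p q A = fro2 p q A'" if "\<And>i j. i < p \<Longrightarrow> j < q \<Longrightarrow> A i j = A' i j" for A A'
    using that by (simp add: fro2_def ip_def)
  have sH: "w i * z j - G $$ (i, j) = sandwich p q (ent T) H (ent W) i j" if "i < p" "j < q" for i j
    using Gs[OF that] unfolding H_def sandwich_diff by (simp add: At sandwich_outer w_def z_def)
  have dual: "(\<Sum>i<p. \<Sum>j<q. R i j * ent G i j) \<le> \<rho>"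
    if "0 \<le> \<rho>" "\<And>x. sqrt (ip p (mv q R x) (mv q R x)) \<le> \<rho> * sqrt (ip q x x)" for R \<rho>
    using nuclear_norm_duality[OF Gc that(2)] mult_left_mono[OF Gn(1) that(1)] by simp
  have "(Lm 0 - L1) / 4 * fro2 p q (\<lambda>i j. w i * z j - ent G i j)
      - 8 * real r * \<tau> * sqrt (fro2 p q (\<lambda>i j. w i * z j - ent G i j))
    \<le> (\<Sum>k<r. Lm k * bf p q (a k) (\<lambda>i j. w i * z j - ent G i j) (b k))"
    by (rule colar_curvature[OF dual frobenius_le_one[OF Gc Gn] grama gramb \<tau> X.r Lm _ w_def[unfolded au] z_def[unfolded bv] refl])
       (use gap in auto)
  also have "(\<Sum>k<r. Lm k * bf p q (a k) (\<lambda>i j. w i * z j - ent G i j) (b k)) = (\<Sum>i<p. \<Sum>j<q. St i j * H i j)"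
  proof -
    have "bf p q (a k) (\<lambda>i j. w i * z j - ent G i j) (b k) = bf p q (mv p (ent Ax) (u k)) H (mv q (ent Ay) (v k))" for k
    proof -
      have TT: "mv p (ent T) (a k) i = mv p (ent Ax) (u k) i" if "i < p" for i
        unfolding a_def Tp(3)[symmetric] by (rule mv_mult_mat[OF Tp(1) Tp(1) that, symmetric])
      have WW: "mv q (ent W) (b k) i = mv q (ent Ay) (v k) i" if "i < q" for i
        unfolding b_def Wp(3)[symmetric] by (rule mv_mult_mat[OF Wp(1) Wp(1) that, symmetric])
      have "bf p q (a k) (\<lambda>i j. w i * z j - ent G i j) (b k) = bf p q (a k) (sandwich p q (ent T) H (ent W)) (b k)"
        unfolding bf_sum using sH by simp
      also have "\<dots> = bf p q (mv p (ent T) (a k)) H (mv q (ent W) (b k))"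
        by (rule bf_sandwich[OF T_sym W_sym])
      finally show ?thesis unfolding bf_sum by (simp add: TT WW)
    qed
    then have "(\<Sum>k<r. Lm k * bf p q (a k) (\<lambda>i j. w i * z j - ent G i j) (b k))
        = (\<Sum>k<r. \<Sum>i<p. \<Sum>j<q. Lm k * (mv p (ent Ax) (u k) i * mv q (ent Ay) (v k) j) * H i j)"
      by (simp add: bf_sum sum_distrib_left mult_ac)
    also have "\<dots> = (\<Sum>i<p. \<Sum>k<r. \<Sum>j<q. Lm k * (mv p (ent Ax) (u k) i * mv q (ent Ay) (v k) j) * H i j)"
      by (rule sum.swap)
    also have "\<dots> = (\<Sum>i<p. \<Sum>j<q. \<Sum>k<r. Lm k * (mv p (ent Ax) (u k) i * mv q (ent Ay) (v k) j) * H i j)"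
      by (intro sum.cong refl sum.swap)
    finally show ?thesis by (simp add: St_def sum_distrib_right)
  qed
  also have "fro2 p q (\<lambda>i j. w i * z j - ent G i j) = fro2 p q (sandwich p q (ent T) H (ent W))"
    by (rule fro_cong) (rule sH)
  finally have "(Lm 0 - L1) / 4 * D\<^sup>2 - 8 * real r * \<tau> * D \<le> (\<Sum>i<p. \<Sum>j<q. St i j * H i j)"
    by (simp add: D_def)
  moreover have "g / 4 * D\<^sup>2 \<le> (Lm 0 - L1) / 4 * D\<^sup>2" using gap by (intro mult_right_mono) auto
  ultimately have curv: "g / 4 * D\<^sup>2 - 8 * real r * \<tau> * D \<le> (\<Sum>i<p. \<Sum>j<q. St i j * H i j)" by linarith
  define \<eta>' where "\<eta>' = \<tau> * (1 + real r * (2 * sqrt B + 1))"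
  let ?P = "{..<p} \<times> {..<q}"
  define Sp where "Sp = Jx \<times> Jy"
  have Sp: "Sp \<subseteq> ?P" using X.J Y.J by (auto simp: Sp_def)
  define h where "h = (\<lambda>(i, j). H i j)"
  define hS hc where "hS = (\<Sum>x\<in>Sp. \<bar>h x\<bar>)" and "hc = (\<Sum>x\<in>?P - Sp. \<bar>h x\<bar>)"
  have total: "(\<Sum>i<p. \<Sum>j<q. \<bar>H i j\<bar>) = hS + hc"
    unfolding hS_def hc_def sum.cartesian_product
    using sum.subset_diff[OF Sp, of "\<lambda>x. \<bar>h x\<bar>"] by (simp add: h_def case_prod_unfold)
  have noise: "(\<Sum>i<p. \<Sum>j<q. St i j * H i j) \<le> (\<Sum>i<p. \<Sum>j<q. Axy $$ (i, j) * H i j) + \<eta>' * (hS + hc)"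
  proof -
    have "(\<Sum>i<p. \<Sum>j<q. St i j * H i j) \<le> (\<Sum>i<p. \<Sum>j<q. Axy $$ (i, j) * H i j + \<eta>' * \<bar>H i j\<bar>)"
    proof (intro sum_mono)
      fix i j assume "i \<in> {..<p}" "j \<in> {..<q}"
      then have ij: "i < p" "j < q" by auto
      have "\<bar>Axy $$ (i, j) - St i j\<bar> \<le> \<eta>'"
        unfolding St_def \<eta>'_def using \<tau> by (intro cross_noise[OF x y xy[OF ij] ij]) auto
      then have "\<bar>(St i j - Axy $$ (i, j)) * H i j\<bar> \<le> \<eta>' * \<bar>H i j\<bar>"
        unfolding abs_mult by (intro mult_right_mono) (auto simp: abs_minus_commute)
      then show "St i j * H i j \<le> Axy $$ (i, j) * H i j + \<eta>' * \<bar>H i j\<bar>"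
        by (simp add: left_diff_distrib)
    qed
    also have "\<dots> = (\<Sum>i<p. \<Sum>j<q. Axy $$ (i, j) * H i j) + \<eta>' * (hS + hc)"
      unfolding total[symmetric] by (simp add: sum.distrib sum_distrib_left)
    finally show ?thesis .
  qed
  have opt2: "(\<Sum>i<p. \<Sum>j<q. Axy $$ (i, j) * H i j) \<le> lm * (hS - hc)"
  proof -
    have "(\<Sum>i<p. \<Sum>j<q. Axy $$ (i, j) * H i j) \<le>
        lm * ((\<Sum>i<p. \<Sum>j<q. \<bar>At i j\<bar>) - (\<Sum>i<p. \<Sum>j<q. \<bar>F $$ (i, j)\<bar>))"
      using opt' by (simp add: H_def right_diff_distrib sum_subtractf)
    also have "(\<Sum>i<p. \<Sum>j<q. \<bar>At i j\<bar>) - (\<Sum>i<p. \<Sum>j<q. \<bar>F $$ (i, j)\<bar>) \<le> hS - hc"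
    proof -
      have "At i j = 0" if "(i, j) \<in> ?P - Sp" for i j
      proof -
        from that have "i < p" "j < q" "i \<notin> Jx \<or> j \<notin> Jy" by (auto simp: Sp_def)
        then show ?thesis using X.u_supp[OF r0, of i] Y.u_supp[OF r0, of j] by (auto simp: At_def)
      qed
      then have "(\<Sum>x\<in>?P. \<bar>case x of (i, j) \<Rightarrow> At i j\<bar>) - (\<Sum>x\<in>?P. \<bar>case x of (i, j) \<Rightarrow> F $$ (i, j)\<bar>) \<le>
          (\<Sum>x\<in>Sp. \<bar>(case x of (i, j) \<Rightarrow> At i j) - (case x of (i, j) \<Rightarrow> F $$ (i, j))\<bar>)
          - (\<Sum>x\<in>?P - Sp. \<bar>(case x of (i, j) \<Rightarrow> At i j) - (case x of (i, j) \<Rightarrow> F $$ (i, j))\<bar>)"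
        by (intro l1_cone[OF _ Sp]) auto
      then show ?thesis
        by (simp add: sum.cartesian_product hS_def hc_def h_def H_def case_prod_unfold)
    qed
    finally show ?thesis using pos by (simp add: mult_left_mono)
  qed
  have main: "g / 4 * D\<^sup>2 - 8 * real r * \<tau> * D \<le> lm * (hS - hc) + \<eta>' * (hS + hc)"
    using curv noise opt2 by linarith
  define N where "N = sqrt (fro2 p q H)"
  have NN: "N\<^sup>2 = fro2 p q H" by (simp add: N_def)
  have hSN: "hS \<le> s * N"
  proof -
    have "real (card Sp) \<le> s * s"
      unfolding Sp_def card_cartesian_product of_nat_mult using card by (intro mult_mono) auto
    then have "hS \<le> sqrt (s * s) * sqrt (\<Sum>x\<in>?P. (h x)\<^sup>2)"
      unfolding hS_def by (intro sum_abs_le_sqrt_card[OF _ Sp]) auto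
    moreover have "(\<Sum>x\<in>?P. (h x)\<^sup>2) = fro2 p q H"
      by (simp add: fro2_def ip_def h_def power2_eq_square sum.cartesian_product case_prod_unfold)
    ultimately show ?thesis using pos by (simp add: N_def)
  qed
  \<comment> \<open>The entries of \<open>Ay\<close> exceed the bound \<open>B\<close> for those of
    \<open>Sy\<close> by at most \<open>\<tau>\<close>, whence the constant
    \<open>B + 1\<close>.\<close>
  have RE: "c\<^sup>2 * N\<^sup>2 - \<nu> * (c + (B + 1)) * (hS + hc)\<^sup>2 \<le> D\<^sup>2"
  proof -
    have Ay_entry: "\<bar>ent Ay i j\<bar> \<le> B + 1" if "i < q" "j < q" for i j
    proof -
      have "\<bar>ent Ay i j - Sy i j\<bar> \<le> \<tau>" using y that by (auto simp: near_def)
      then show ?thesis using Y.S_entry[OF that] \<tau> by linarith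
    qed
    have "c\<^sup>2 * (\<Sum>i<p. ip q (H i) (H i)) - \<nu> * (c + (B + 1)) * (\<Sum>i<p. l1 q (H i))\<^sup>2
      \<le> (\<Sum>k<q. bf p p (\<lambda>i. mv q (ent W) (H i) k) (ent Ax) (\<lambda>i. mv q (ent W) (H i) k))"
      using pos X.B by (intro tensor_restricted_eigenvalue[OF Wip REx REy Ay_entry]) auto
    also have "\<dots> = fro2 p q (sandwich p q (ent T) H (ent W))" by (rule fro2_sandwich[OF Tip, symmetric])
    also have "\<dots> = D\<^sup>2" by (simp add: D_def)
    also have "(\<Sum>i<p. l1 q (H i)) = hS + hc" using total by (simp add: l1_def)
    finally show ?thesis by (simp add: NN fro2_def)
  qed
  have "N \<le> 2 / sqrt (c\<^sup>2) * (4 / g) * (8 * real r * e0 + 3 / sqrt (c\<^sup>2)) * (s * lm)"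
    by (rule colar_rate_arithmetic[OF main _ hSN e0(1) RE small])
       (use gap pos e0 \<eta> X.B in \<open>auto simp: \<eta>'_def D_def N_def hS_def hc_def sum_nonneg\<close>)
  then show "sqrt (fro2 p q (\<lambda>i j. At i j - F $$ (i, j))) \<le> 2 / c * (4 / g) * (8 * real r * e0 + 3 / c) * (s * lm)"
    using pos by (simp add: N_def H_def)
qed

end

section \<open>Singular vectors as regression weights\<close>

lemma sign_dist_le:
  assumes "w \<in> {- 1, 1}"
  shows "sign_dist N a b \<le> N (w \<cdot>\<^sub>v a - b)"
  unfolding sign_dist_def using assms by (intro cINF_lower bdd_below_finite) auto

lemma l1_norm_l1: "x \<in> carrier_vec n \<Longrightarrow> l1_norm x = l1 n (($) x)"
  by (simp add: l1_norm_def l1_def)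

lemma sign_dist_nonneg:
  assumes "\<And>x. 0 \<le> N x"
  shows "0 \<le> sign_dist N a b"
  unfolding sign_dist_def using assms by (intro cINF_greatest) auto

lemma l2_norm_nonneg: "0 \<le> l2_norm x"
  unfolding l2_norm_def by (simp add: scalar_prod_ip[OF refl])

lemma l1_norm_nonneg: "0 \<le> l1_norm x"
  by (simp add: l1_norm_def sum_nonneg)

context population
begin

text \<open>The lower bound on the length keeps the singular value of the comparison matrix away
  from 0.\<close>

lemma u_normalized_lower:
  assumes "near n r \<tau> A S u" "\<tau> \<le> 1 / 4"
  defines "\<kappa> \<equiv> bf n n (u 0) A (u 0)"
  shows "3 / 4 \<le> \<kappa>" "\<kappa> \<le> 5 / 4"
    "1 / sqrt (2 * B) \<le> sqrt (ip n (\<lambda>i. 1 / sqrt \<kappa> * u 0 i) (\<lambda>i. 1 / sqrt \<kappa> * u 0 i))"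
proof -
  have r0: "0 < r" using r by simp
  have "\<bar>\<kappa> - of_bool ((0::nat) = 0)\<bar> \<le> \<tau>" using assms(1) r0 unfolding near_def \<kappa>_def by blast
  then show k: "3 / 4 \<le> \<kappa>" "\<kappa> \<le> 5 / 4" using assms(2) by simp_all
  have "1 \<le> B * ip n (u 0) (u 0)" using S_upper[of "u 0"] u_orth[OF r0 r0] by simp
  then have "1 / B \<le> ip n (u 0) (u 0)" using B by (simp add: field_simps)
  then have "1 / B / (5 / 4) \<le> ip n (u 0) (u 0) / \<kappa>" using k B by (intro frac_le) auto
  moreover have "1 / (2 * B) \<le> 1 / B / (5 / 4)" using B by (simp add: field_simps)
  ultimately have "1 / (2 * B) \<le> ip n (u 0) (u 0) / \<kappa>" by linarith
  moreover have "ip n (\<lambda>i. 1 / sqrt \<kappa> * u 0 i) (\<lambda>i. 1 / sqrt \<kappa> * u 0 i) = ip n (u 0) (u 0) / \<kappa>"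
    unfolding ip_scale_left ip_scale_right using k by simp
  ultimately have "sqrt (1 / (2 * B)) \<le> sqrt (ip n (\<lambda>i. 1 / sqrt \<kappa> * u 0 i) (\<lambda>i. 1 / sqrt \<kappa> * u 0 i))"
    by (simp only: real_sqrt_le_mono)
  then show "1 / sqrt (2 * B) \<le> sqrt (ip n (\<lambda>i. 1 / sqrt \<kappa> * u 0 i) (\<lambda>i. 1 / sqrt \<kappa> * u 0 i))"
    by (simp only: real_sqrt_divide real_sqrt_one)
qed

text \<open>The inner products with \<open>mv n S (u k)\<close> determine the weights of the
  directions in the second stage. For \<open>k \<ge> 1\<close> they vanish at \<open>\<beta>\<close>
  by the normalization, so only the perturbation remains. The abstract form \<open>Bf\<close> covers
  \<open>F\<close> and its transpose alike.\<close>

lemma singular_vector_coefficients: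
  assumes A: "near n r \<tau> A S u" "\<tau> \<le> 1 / 4"
    and \<beta>_def: "\<beta> = (\<lambda>i. 1 / sqrt (bf n n (u 0) A (u 0)) * u 0 i)"
    and close: "\<And>x y. \<bar>Bf x y - ip m x \<alpha> * ip n \<beta> y\<bar> \<le> e * (sqrt (ip m x x) * sqrt (ip n y y))"
    and \<alpha>: "1 / sqrt (2 * B) \<le> sqrt (ip m \<alpha> \<alpha>)"
    and a: "ip m a a = 1" and b: "ip n b b = 1" and Fa: "\<And>t. Bf a t = \<sigma> * ip n b t"
    and max: "\<And>x y. ip m x x = 1 \<Longrightarrow> ip n y y = 1 \<Longrightarrow> 0 < Bf x y \<Longrightarrow> Bf x y \<le> \<sigma>"
    and e: "0 \<le> e" "8 * B * e \<le> 1"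
  shows "1 \<le> k \<Longrightarrow> k < r \<Longrightarrow> \<bar>ip n b (mv n S (u k))\<bar> \<le> 3 * B * sqrt B * e"
    "2 / (5 * sqrt B) - 3 * B * sqrt B * e \<le> \<bar>ip n b (mv n S (u 0))\<bar>"
    "k < r \<Longrightarrow> \<bar>ip n b (mv n S (u k))\<bar> \<le> sqrt B"
proof -
  have r0: "0 < r" using r by simp
  note \<kappa> = u_normalized_lower[OF A, folded \<beta>_def]
  let ?\<kappa> = "bf n n (u 0) A (u 0)"
  define \<tau>' where "\<tau>' = sqrt (ip m \<alpha> \<alpha>) * sqrt (ip n \<beta> \<beta>)"
  have "1 / sqrt (2 * B) * (1 / sqrt (2 * B)) \<le> \<tau>'"
    unfolding \<tau>'_def using \<alpha> \<kappa>(3) B by (intro mult_mono) auto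
  then have \<tau>': "1 / (2 * B) \<le> \<tau>'" using B by simp
  have \<tau>'0: "0 < \<tau>'" by (rule less_le_trans[OF _ \<tau>']) (use B in simp)
  have "4 * e \<le> 1 / (2 * B)" using e B by (simp add: field_simps)
  then have e4: "4 * e \<le> \<tau>'" using \<tau>' by linarith
  have max': "\<And>x y. ip m x x = 1 \<Longrightarrow> ip n y y = 1 \<Longrightarrow> 0 < Bf x y \<Longrightarrow> Bf x y \<le> \<sigma>" by (rule max)
  note svp = singular_vector_perturbation[of Bf m \<alpha> n \<beta> e a b \<sigma> \<tau>', OF close a b Fa max' \<tau>'_def \<tau>'0 e(1) e4]
  have "e / \<tau>' \<le> e / (1 / (2 * B))" using e \<tau>' \<tau>'0 B by (intro divide_left_mono) auto
  then have e\<tau>: "e / \<tau>' \<le> 2 * B * e" by (simp add: mult_ac)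
  have err: "4 / 3 * (e / \<tau>') * sqrt (ip n (mv n S (u k)) (mv n S (u k))) \<le> 3 * B * sqrt B * e" if "k < r" for k
  proof -
    have "4 / 3 * (e / \<tau>') * sqrt (ip n (mv n S (u k)) (mv n S (u k))) \<le> 4 / 3 * (2 * B * e) * sqrt B"
      using e\<tau> Su_norm[OF that] e B by (intro mult_mono mult_left_mono) auto
    also have "\<dots> = 8 / 3 * (B * sqrt B * e)" by simp
    also have "\<dots> \<le> 3 * (B * sqrt B * e)" using e B by (intro mult_right_mono) auto
    finally show ?thesis by (simp add: mult_ac)
  qed
  have bS: "ip n \<beta> (mv n S (u k)) = 1 / sqrt ?\<kappa> * of_bool (0 = k)" if "k < r" for k
    unfolding \<beta>_def ip_scale_left using u_orth[OF r0 that] by (simp add: bf_def)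
  show "1 \<le> k \<Longrightarrow> k < r \<Longrightarrow> \<bar>ip n b (mv n S (u k))\<bar> \<le> 3 * B * sqrt B * e"
    using svp(1)[of "mv n S (u k)"] bS[of k] err[of k] by simp
  show "k < r \<Longrightarrow> \<bar>ip n b (mv n S (u k))\<bar> \<le> sqrt B"
    using order_trans[OF ip_cauchy_schwarz[of n b "mv n S (u k)"]] Su_norm[of k] b by simp
  have "1 / sqrt B \<le> \<bar>ip n \<beta> (mv n S (u 0))\<bar> / sqrt (ip n \<beta> \<beta>)"
  proof -
    have "sqrt (ip n \<beta> \<beta>) = sqrt (ip n (u 0) (u 0)) / sqrt ?\<kappa>"
      unfolding \<beta>_def ip_scale_left ip_scale_right using \<kappa> by (simp add: real_sqrt_divide)
    then have "\<bar>ip n \<beta> (mv n S (u 0))\<bar> / sqrt (ip n \<beta> \<beta>) = 1 / sqrt (ip n (u 0) (u 0))"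
      using bS[OF r0] \<kappa> by simp
    moreover have "1 / sqrt B \<le> 1 / sqrt (ip n (u 0) (u 0))"
    proof (rule divide_left_mono)
      have "1 \<le> B * ip n (u 0) (u 0)" using S_upper[of "u 0"] u_orth[OF r0 r0] by simp
      then have "0 < ip n (u 0) (u 0)" using B by (smt (verit) ip_nonneg mult_eq_0_iff)
      then show "0 < sqrt B * sqrt (ip n (u 0) (u 0))" using B by simp
    qed (use u_norm[OF r0] in auto)
    ultimately show ?thesis by simp
  qed
  then show "2 / (5 * sqrt B) - 3 * B * sqrt B * e \<le> \<bar>ip n b (mv n S (u 0))\<bar>"
    using svp(2)[of "mv n S (u 0)"] err[OF r0] by simp
qed

lemma stage23_sign_dist:
  fixes g :: "nat \<Rightarrow> real" and \<theta> t C' c \<nu> s \<gamma> :: real and A1 Af Axy :: "real mat"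
  defines "R \<equiv> (\<Sum>k\<in>{1..<r}. \<bar>g k\<bar>)" and "a \<equiv> 3 * C' / c"
  defines "Kc \<equiv> 2 / \<gamma> * (a + B * t + sqrt B * sqrt (B + 1) * a + 3 * sqrt B)"
  assumes A1: "A1 \<in> carrier_mat n n" "psd A1"
      "near n r (t * \<theta>) (ent A1) S u" "\<And>x. c * ip n x x - \<nu> * (l1 n x)\<^sup>2 \<le> bf n n x (ent A1) x"
    and Af: "Af \<in> carrier_mat n n" "psd Af" "near n r (t * \<theta>) (ent Af) S u"
    and Axy: "Axy \<in> carrier_mat n m" and b: "b \<in> carrier_vec m"
    and h: "\<And>i. i < n \<Longrightarrow> \<bar>(Axy *\<^sub>v b) $ i - (\<Sum>k<r. g k * mv n S (u k) i)\<bar> \<le> t * \<theta>"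
    and stage2: "colar_stage2 A1 Axy (C' * \<theta>) b xt"
    and u0: "uv \<in> carrier_vec n" "\<And>i. i < n \<Longrightarrow> uv $ i = u 0 i"
    and s: "real (card J) \<le> s" "1 \<le> s"
    and gb: "\<And>k. k < r \<Longrightarrow> \<bar>g k\<bar> \<le> sqrt B" and g0: "0 < \<gamma>" "\<gamma> \<le> \<bar>g 0\<bar>"
    and C': "4 * t * (1 + real r * sqrt B) \<le> C'"
    and pos: "0 < \<theta>" "0 < t" "0 < c" "0 \<le> \<nu>"
    and small: "32 * \<nu> * s \<le> c" "16 * s * (t * \<theta>) \<le> 1" "t * \<theta> \<le> 1"
      "2 * (sqrt B * (t * \<theta>) + sqrt (B + 1) * (a * (sqrt s * \<theta>)) + 2 * R) \<le> \<gamma>"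
  shows "sign_dist l2_norm (colar_stage3 Af xt) uv \<le> Kc * (sqrt s * \<theta> + R)"
    "sign_dist l1_norm (colar_stage3 Af xt) uv \<le> 4 * sqrt s * (Kc * (sqrt s * \<theta> + R))"
proof -
  have A1s: "\<And>i j. i < n \<Longrightarrow> j < n \<Longrightarrow> ent A1 i j = ent A1 j i" and A1p: "\<And>x. 0 \<le> bf n n x (ent A1) x"
    using A1(2) unfolding psd_iff[OF A1(1)] bf_def by auto
  have Afs: "\<And>i j. i < n \<Longrightarrow> j < n \<Longrightarrow> ent Af i j = ent Af j i" and Afp: "\<And>x. 0 \<le> bf n n x (ent Af) x"
    using Af(2) unfolding psd_iff[OF Af(1)] bf_def by auto
  have dim: "dim_row A1 = n" using A1 by simp
  have xt: "xt \<in> carrier_vec n" and opt: "\<And>y. y \<in> carrier_vec n \<Longrightarrow>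
      xt \<bullet> (A1 *\<^sub>v xt) - 2 * (xt \<bullet> (Axy *\<^sub>v b)) + C' * \<theta> * l1_norm xt
      \<le> y \<bullet> (A1 *\<^sub>v y) - 2 * (y \<bullet> (Axy *\<^sub>v b)) + C' * \<theta> * l1_norm y"
    using stage2 unfolding colar_stage2_def is_arg_min_def dim by (auto simp: not_less)
  let ?h = "($) (Axy *\<^sub>v b)"
  have obj: "y \<bullet> (A1 *\<^sub>v y) - 2 * (y \<bullet> (Axy *\<^sub>v b)) + C' * \<theta> * l1_norm y
    = bf n n (($) y) (ent A1) (($) y) - 2 * ip n (($) y) ?h + C' * \<theta> * l1 n (($) y)" if "y \<in> carrier_vec n" for y
  proof -
    have "y \<bullet> (Axy *\<^sub>v b) = ip n (($) y) ?h" by (rule scalar_prod_ip) (use Axy in simp)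
    then show ?thesis unfolding quadratic_form_ip[OF A1(1) that that] l1_norm_l1[OF that] bf_def by simp
  qed
  have min: "bf n n (($) xt) (ent A1) (($) xt) - 2 * ip n (($) xt) ?h + C' * \<theta> * l1 n (($) xt)
      \<le> bf n n y (ent A1) y - 2 * ip n y ?h + C' * \<theta> * l1 n y" for y
  proof -
    let ?y = "Matrix.vec n y"
    have "bf n n (($) xt) (ent A1) (($) xt) - 2 * ip n (($) xt) ?h + C' * \<theta> * l1 n (($) xt)
      \<le> bf n n (($) ?y) (ent A1) (($) ?y) - 2 * ip n (($) ?y) ?h + C' * \<theta> * l1 n (($) ?y)"
      using opt[of ?y] obj[OF xt] obj[of ?y] by (simp del: index_mult_mat_vec)
    also have "\<dots> = bf n n y (ent A1) y - 2 * ip n y ?h + C' * \<theta> * l1 n y"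
      by (simp add: bf_sum ip_def l1_def del: index_mult_mat_vec)
    finally show ?thesis .
  qed
  define xh where "xh = (\<lambda>i. sgn (g 0) * (1 / sqrt (bf n n (($) xt) (ent Af) (($) xt)) * xt $ i) - u 0 i)"
  note rate = lasso_normalized_rate[OF A1s A1p A1(3,4) Afs Afp Af(3) h min s gb g0 C' pos
      small(1-3) small(4)[unfolded R_def a_def], folded R_def a_def, folded Kc_def, folded xh_def]
  \<comment> \<open>The sign of the leading weight is the witness in the sign distance.\<close>
  let ?w = "sgn (g 0)" and ?a = "colar_stage3 Af xt"
  have w: "?w \<in> {- 1, 1}" using g0 by (auto simp: sgn_if)
  \<comment> \<open>\<open>rate(1)\<close> rules out the default value 0 of the third stage.\<close>
  have a3: "?a = (1 / sqrt (bf n n (($) xt) (ent Af) (($) xt))) \<cdot>\<^sub>v xt"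
    using rate(1) xt by (simp add: colar_stage3_def quadratic_form_ip[OF Af(1)] bf_def)
  have wc: "?w \<cdot>\<^sub>v ?a - uv \<in> carrier_vec n" using xt u0 by (simp add: a3)
  have we: "(?w \<cdot>\<^sub>v ?a - uv) $ i = xh i" if "i < n" for i
    using that xt u0 by (simp add: a3 xh_def)
  have "l2_norm (?w \<cdot>\<^sub>v ?a - uv) = sqrt (ip n xh xh)"
    unfolding l2_norm_ip[OF wc] by (intro arg_cong[where f = sqrt] ip_cong we)
  then show "sign_dist l2_norm ?a uv \<le> Kc * (sqrt s * \<theta> + R)"
    using sign_dist_le[OF w, of l2_norm ?a uv] rate(2) by linarith
  have "l1_norm (?w \<cdot>\<^sub>v ?a - uv) = l1 n xh"
    unfolding l1_norm_l1[OF wc] l1_def by (intro sum.cong) (auto simp: we)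
  then show "sign_dist l1_norm ?a uv \<le> 4 * sqrt s * (Kc * (sqrt s * \<theta> + R))"
    using sign_dist_le[OF w, of l1_norm ?a uv] rate(3) by linarith
qed

end

context two_populations
begin

lemma first_singular_vector_coefficients:
  assumes x: "near p r \<tau> Ax Sx u" and y: "near q r \<tau> Ay Sy v" and \<tau>: "\<tau> \<le> 1 / 4"
  defines "At \<equiv> (\<lambda>i j. (1 / sqrt (bf p p (u 0) Ax (u 0)) * u 0 i) * (1 / sqrt (bf q q (v 0) Ay (v 0)) * v 0 j))"
  assumes F: "F \<in> carrier_mat p q" and e: "sqrt (fro2 p q (\<lambda>i j. At i j - F $$ (i, j))) \<le> e" "8 * B * e \<le> 1"
    and sv: "first_singular_vectors F a b"
  shows "a \<in> carrier_vec p" "b \<in> carrier_vec q" "l2_norm a = 1" "l2_norm b = 1"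
    "1 \<le> k \<Longrightarrow> k < r \<Longrightarrow> \<bar>ip p (($) a) (mv p Sx (u k))\<bar> \<le> 3 * B * sqrt B * e"
    "2 / (5 * sqrt B) - 3 * B * sqrt B * e \<le> \<bar>ip p (($) a) (mv p Sx (u 0))\<bar>"
    "k < r \<Longrightarrow> \<bar>ip p (($) a) (mv p Sx (u k))\<bar> \<le> sqrt B"
    "1 \<le> k \<Longrightarrow> k < r \<Longrightarrow> \<bar>ip q (($) b) (mv q Sy (v k))\<bar> \<le> 3 * B * sqrt B * e"
    "2 / (5 * sqrt B) - 3 * B * sqrt B * e \<le> \<bar>ip q (($) b) (mv q Sy (v 0))\<bar>"
    "k < r \<Longrightarrow> \<bar>ip q (($) b) (mv q Sy (v k))\<bar> \<le> sqrt B"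
proof -
  from sv obtain \<sigma> where st: "singular_triple F \<sigma> a b"
    and mx: "\<And>\<tau> a' b'. singular_triple F \<tau> a' b' \<Longrightarrow> \<tau> \<le> \<sigma>"
    unfolding first_singular_vectors_def by blast
  have dims: "dim_row F = p" "dim_col F = q" using F by auto
  show a: "a \<in> carrier_vec p" and b: "b \<in> carrier_vec q" and na: "l2_norm a = 1" and nb: "l2_norm b = 1"
    using st by (auto simp: singular_triple_def dims)
  have Fb: "F *\<^sub>v b = \<sigma> \<cdot>\<^sub>v a" and Fa: "F\<^sup>T *\<^sub>v a = \<sigma> \<cdot>\<^sub>v b" using st by (auto simp: singular_triple_def)
  have ia: "ip p (($) a) (($) a) = 1" and ib: "ip q (($) b) (($) b) = 1"
    using na nb l2_norm_ip[OF a] l2_norm_ip[OF b] by simp_all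
  have Fbt: "bf p q t (ent F) (($) b) = \<sigma> * ip p (($) a) t" for t
  proof -
    have "bf p q t (ent F) (($) b) = ip p t (\<lambda>i. \<sigma> * a $ i)"
      unfolding bf_def
    proof (rule ip_cong)
      fix i assume "i < p"
      then have "(\<sigma> \<cdot>\<^sub>v a) $ i = \<sigma> * a $ i" using a by simp
      then show "mv q (ent F) (($) b) i = \<sigma> * a $ i"
        using mult_mat_vec_mv[OF F b \<open>i < p\<close>] by (simp add: Fb del: index_mult_mat_vec)
    qed simp
    then show ?thesis by (simp add: ip_scale_right ip_commute[of p t])
  qed
  have Fat: "bf p q (($) a) (ent F) t = \<sigma> * ip q (($) b) t" for t
  proof -
    have FT: "F\<^sup>T \<in> carrier_mat q p" using F by simp
    have "bf p q (($) a) (ent F) t = ip q (mv p (\<lambda>i j. ent F j i) (($) a)) t"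
      unfolding bf_def by (rule ip_mv_transpose)
    also have "\<dots> = ip q (\<lambda>i. \<sigma> * b $ i) t"
    proof (rule ip_cong)
      fix i assume i: "i < q"
      then have "(\<sigma> \<cdot>\<^sub>v b) $ i = \<sigma> * b $ i" using b by simp
      then have "mv p (ent (F\<^sup>T)) (($) a) i = \<sigma> * b $ i"
        using mult_mat_vec_mv[OF FT a i] by (simp add: Fa del: index_mult_mat_vec)
      moreover have "mv p (ent (F\<^sup>T)) (($) a) i = mv p (\<lambda>i j. ent F j i) (($) a) i"
        unfolding mv_def using F i by (intro sum.cong) auto
      ultimately show "mv p (\<lambda>i j. ent F j i) (($) a) i = \<sigma> * b $ i" by simp
    qed simp
    finally show ?thesis by (simp add: ip_scale_left)
  qed
  have max: "bf p q x (ent F) y \<le> \<sigma>" if "ip p x x = 1" "ip q y y = 1" "0 < bf p q x (ent F) y" for x y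
    using exists_singular_triple_ge[OF F that(1,2)] that(3) mx unfolding bf_def by (meson order_trans)
  define \<alpha> where "\<alpha> = (\<lambda>i. 1 / sqrt (bf p p (u 0) Ax (u 0)) * u 0 i)"
  define \<beta> where "\<beta> = (\<lambda>i. 1 / sqrt (bf q q (v 0) Ay (v 0)) * v 0 i)"
  have e0: "0 \<le> e" using e(1) by (meson fro2_nonneg order_trans real_sqrt_ge_zero)
  have close: "\<bar>bf p q x (ent F) y - ip p x \<alpha> * ip q \<beta> y\<bar> \<le> e * (sqrt (ip p x x) * sqrt (ip q y y))" for x y
  proof -
    have "bf p q x (ent F) y - ip p x \<alpha> * ip q \<beta> y = - bf p q x (\<lambda>i j. At i j - F $$ (i, j)) y"
      by (simp add: bf_diff_mat At_def \<alpha>_def[symmetric] \<beta>_def[symmetric]) (simp add: \<alpha>_def \<beta>_def flip: bf_outer)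
    then have "\<bar>bf p q x (ent F) y - ip p x \<alpha> * ip q \<beta> y\<bar> \<le>
        sqrt (ip p x x) * sqrt (fro2 p q (\<lambda>i j. At i j - F $$ (i, j))) * sqrt (ip q y y)"
      using bf_frobenius by simp
    also have "\<dots> \<le> sqrt (ip p x x) * e * sqrt (ip q y y)"
      using e(1) by (intro mult_right_mono mult_left_mono) auto
    finally show ?thesis by (simp add: mult_ac)
  qed
  have close': "\<bar>bf p q x (ent F) y - ip q y \<beta> * ip p \<alpha> x\<bar> \<le> e * (sqrt (ip q y y) * sqrt (ip p x x))" for x y
    using close[of x y] by (simp add: ip_commute mult.commute)
  note nx = X.u_normalized_lower(3)[OF x \<tau>, folded \<alpha>_def] and ny = Y.u_normalized_lower(3)[OF y \<tau>, folded \<beta>_def]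
  note cy = Y.singular_vector_coefficients[where Bf = "\<lambda>x y. bf p q x (ent F) y",
      OF y \<tau> \<beta>_def close nx ia ib Fat max e0 e(2)]
  note cx = X.singular_vector_coefficients[where Bf = "\<lambda>y x. bf p q x (ent F) y",
      OF x \<tau> \<alpha>_def close' ny ib ia Fbt max e0 e(2)]
  show "1 \<le> k \<Longrightarrow> k < r \<Longrightarrow> \<bar>ip p (($) a) (mv p Sx (u k))\<bar> \<le> 3 * B * sqrt B * e" by (rule cx(1))
  show "2 / (5 * sqrt B) - 3 * B * sqrt B * e \<le> \<bar>ip p (($) a) (mv p Sx (u 0))\<bar>" by (rule cx(2))
  show "k < r \<Longrightarrow> \<bar>ip p (($) a) (mv p Sx (u k))\<bar> \<le> sqrt B" by (rule cx(3))
  show "1 \<le> k \<Longrightarrow> k < r \<Longrightarrow> \<bar>ip q (($) b) (mv q Sy (v k))\<bar> \<le> 3 * B * sqrt B * e" by (rule cy(1))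
  show "2 / (5 * sqrt B) - 3 * B * sqrt B * e \<le> \<bar>ip q (($) b) (mv q Sy (v 0))\<bar>" by (rule cy(2))
  show "k < r \<Longrightarrow> \<bar>ip q (($) b) (mv q Sy (v k))\<bar> \<le> sqrt B" by (rule cy(3))
qed

lemma Sxy_mult_right: "mv q Sxy y i = (\<Sum>k<r. Lm k * ip q y (mv q Sy (v k)) * mv p Sx (u k) i)"
proof -
  have "mv q Sxy y i = (\<Sum>j<q. \<Sum>k<r. Lm k * (mv p Sx (u k) i * mv q Sy (v k) j) * y j)"
    by (simp add: mv_def[of q Sxy] Sxy_def sum_distrib_right)
  also have "\<dots> = (\<Sum>k<r. \<Sum>j<q. Lm k * (mv p Sx (u k) i * mv q Sy (v k) j) * y j)" by (rule sum.swap)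
  finally show ?thesis by (simp add: ip_def sum_distrib_left sum_distrib_right mult_ac)
qed

lemma Sxy_mult_left: "mv p (\<lambda>j i. Sxy i j) x j = (\<Sum>k<r. Lm k * ip p x (mv p Sx (u k)) * mv q Sy (v k) j)"
proof -
  have "mv p (\<lambda>j i. Sxy i j) x j = (\<Sum>i<p. \<Sum>k<r. Lm k * (mv p Sx (u k) i * mv q Sy (v k) j) * x i)"
    unfolding mv_def[of p "\<lambda>j i. Sxy i j"] unfolding Sxy_def by (simp add: sum_distrib_right)
  also have "\<dots> = (\<Sum>k<r. \<Sum>i<p. Lm k * (mv p Sx (u k) i * mv q Sy (v k) j) * x i)" by (rule sum.swap)
  finally show ?thesis by (simp add: ip_def sum_distrib_left sum_distrib_right mult_ac)
qed

text \<open>Half of the leading inner product \<open>2 / (5 * sqrt B)\<close> is given up to the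
  perturbation, and \<open>Lm 0\<close> is at least the gap.\<close>

lemma target_coefficients:
  fixes x :: "nat \<Rightarrow> real"
  assumes k1: "\<And>k. 1 \<le> k \<Longrightarrow> k < r \<Longrightarrow> \<bar>x k\<bar> \<le> 3 * B * sqrt B * e"
    and k0: "2 / (5 * sqrt B) - 3 * B * sqrt B * e \<le> \<bar>x 0\<bar>"
    and kb: "\<And>k. k < r \<Longrightarrow> \<bar>x k\<bar> \<le> sqrt B"
    and g: "0 < g" "g \<le> Lm 0 - L1" and e: "0 \<le> e" "3 * B * sqrt B * e \<le> 1 / (5 * sqrt B)"
  shows "(\<Sum>k\<in>{1..<r}. \<bar>Lm k * x k\<bar>) \<le> (if r = 1 then 0 else real r * (3 * B * sqrt B * e))"
    "g / (5 * sqrt B) \<le> \<bar>Lm 0 * x 0\<bar>" "k < r \<Longrightarrow> \<bar>Lm k * x k\<bar> \<le> sqrt B"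
proof -
  have B0: "0 < B" using X.B by simp
  have mono: "\<bar>Lm k * x k\<bar> \<le> \<bar>x k\<bar>" if "k < r" for k
    unfolding abs_mult using Lm(1,2)[OF that] by (intro mult_left_le_one_le) auto
  show "k < r \<Longrightarrow> \<bar>Lm k * x k\<bar> \<le> sqrt B" using mono[of k] kb[of k] by linarith
  \<comment> \<open>For \<open>r = 1\<close> the sum is empty; this is where the two values of
    \<kappa> originate.\<close>
  show "(\<Sum>k\<in>{1..<r}. \<bar>Lm k * x k\<bar>) \<le> (if r = 1 then 0 else real r * (3 * B * sqrt B * e))"
  proof (cases "r = 1")
    case False
    have "(\<Sum>k\<in>{1..<r}. \<bar>Lm k * x k\<bar>) \<le> (\<Sum>k\<in>{1..<r}. 3 * B * sqrt B * e)"
      using mono k1 by (intro sum_mono) (auto intro: order_trans)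
    also have "\<dots> \<le> real r * (3 * B * sqrt B * e)" using e B0 by (simp add: mult_right_mono)
    finally show ?thesis using False by simp
  qed simp
  have "g * (1 / (5 * sqrt B)) \<le> \<bar>Lm 0\<bar> * \<bar>x 0\<bar>"
  proof (rule mult_mono)
    have "2 / (5 * sqrt B) = 1 / (5 * sqrt B) + 1 / (5 * sqrt B)" by simp
    then show "1 / (5 * sqrt B) \<le> \<bar>x 0\<bar>" using k0 e by linarith
  qed (use g Lm(3) B0 in auto)
  then show "g / (5 * sqrt B) \<le> \<bar>Lm 0 * x 0\<bar>" by (simp add: abs_mult)
qed

text \<open>\<open>e\<close> is the error of the first stage, \<open>\<gamma>\<close> a lower bound
  for the leading weight, \<open>Rb\<close> the bias bound and \<open>Kc\<close> the constant of the
  normalized Lasso. The statement concerns a single sample that satisfies the listed inequalities;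
  the conditions in \<open>small\<close> hold eventually when \<open>\<nu>\<close> is of order
  \<open>\<theta>\<^sup>2\<close> and \<open>s * \<theta>\<close> tends to 0.\<close>

lemma colar_deterministic:
  fixes Ax0 Ay0 Axy0 Ax1 Ay1 Axy1 Axf Ayf F :: "real mat" and \<theta> t C C' c \<nu> s g :: real
  defines "Ks \<equiv> 2 / c * (4 / g) * (8 * real r * (t / C) + 3 / c)"
  defines "e \<equiv> Ks * (s * (C * \<theta>))" and "a \<equiv> 3 * C' / c" and "\<gamma> \<equiv> g / (5 * sqrt B)"
  defines "Rb \<equiv> (if r = 1 then 0 else real r * (3 * B * sqrt B * e))"
  defines "Kc \<equiv> 2 / \<gamma> * (a + B * t + sqrt B * sqrt (B + 1) * a + 3 * sqrt B)"
  assumes x0: "Ax0 \<in> carrier_mat p p" "psd Ax0" "near p r (t * \<theta>) (ent Ax0) Sx u"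
    "\<And>x. c * ip p x x - \<nu> * (l1 p x)\<^sup>2 \<le> bf p p x (ent Ax0) x"
    and y0: "Ay0 \<in> carrier_mat q q" "psd Ay0" "near q r (t * \<theta>) (ent Ay0) Sy v"
    "\<And>x. c * ip q x x - \<nu> * (l1 q x)\<^sup>2 \<le> bf q q x (ent Ay0) x"
    and xy0: "Axy0 \<in> carrier_mat p q" "\<And>i j. i < p \<Longrightarrow> j < q \<Longrightarrow> \<bar>Axy0 $$ (i, j) - Sxy i j\<bar> \<le> t * \<theta>"
    and x1: "Ax1 \<in> carrier_mat p p" "psd Ax1" "near p r (t * \<theta>) (ent Ax1) Sx u"
    "\<And>x. c * ip p x x - \<nu> * (l1 p x)\<^sup>2 \<le> bf p p x (ent Ax1) x"
    and y1: "Ay1 \<in> carrier_mat q q" "psd Ay1" "near q r (t * \<theta>) (ent Ay1) Sy v"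
    "\<And>x. c * ip q x x - \<nu> * (l1 q x)\<^sup>2 \<le> bf q q x (ent Ay1) x"
    and xy1: "Axy1 \<in> carrier_mat p q"
    and xf: "Axf \<in> carrier_mat p p" "psd Axf" "near p r (t * \<theta>) (ent Axf) Sx u"
    and yf: "Ayf \<in> carrier_mat q q" "psd Ayf" "near q r (t * \<theta>) (ent Ayf) Sy v"
    and stage1: "colar_stage1 Ax0 Ay0 Axy0 (C * \<theta>) F" and sv: "first_singular_vectors F a0 b0"
    and hx: "\<And>i. i < p \<Longrightarrow> \<bar>(Axy1 *\<^sub>v b0) $ i - mv q Sxy (($) b0) i\<bar> \<le> t * \<theta>"
    and hy: "\<And>j. j < q \<Longrightarrow> \<bar>(Axy1\<^sup>T *\<^sub>v a0) $ j - mv p (\<lambda>j i. Sxy i j) (($) a0) j\<bar> \<le> t * \<theta>"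
    and st2x: "colar_stage2 Ax1 Axy1 (C' * \<theta>) b0 xt" and st2y: "colar_stage2 Ay1 (Axy1\<^sup>T) (C' * \<theta>) a0 yt"
    and uv: "uv \<in> carrier_vec p" "\<And>i. i < p \<Longrightarrow> uv $ i = u 0 i"
    and vv: "vv \<in> carrier_vec q" "\<And>i. i < q \<Longrightarrow> vv $ i = v 0 i"
    and card: "real (card Jx) \<le> s" "real (card Jy) \<le> s" "1 \<le> s"
    and C: "2 * t * (1 + real r * (2 * sqrt B + 1)) \<le> C" and C': "4 * t * (1 + real r * sqrt B) \<le> C'"
    and gap: "0 < g" "g \<le> Lm 0 - L1" and pos: "0 < \<theta>" "0 < t" "0 < c" "0 \<le> \<nu>" "0 < C"
    and small: "t * \<theta> \<le> 1 / 4" "8 * real r * (t * \<theta>) \<le> g"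
      "32 * (\<nu> * (c + (B + 1))) * s\<^sup>2 \<le> c\<^sup>2 / 2" "2 * (\<nu> * (c + (B + 1))) * (16 * real r * (t / C))\<^sup>2 \<le> 1"
      "8 * B * e \<le> 1" "3 * B * sqrt B * e \<le> 1 / (5 * sqrt B)" "32 * \<nu> * s \<le> c" "16 * s * (t * \<theta>) \<le> 1"
      "2 * (sqrt B * (t * \<theta>) + sqrt (B + 1) * (a * (sqrt s * \<theta>)) + 2 * Rb) \<le> \<gamma>"
  shows "sign_dist l2_norm (colar_stage3 Axf xt) uv \<le> Kc * (sqrt s * \<theta> + Rb)"
    "sign_dist l1_norm (colar_stage3 Axf xt) uv \<le> 4 * sqrt s * (Kc * (sqrt s * \<theta> + Rb))"
    "sign_dist l2_norm (colar_stage3 Ayf yt) vv \<le> Kc * (sqrt s * \<theta> + Rb)"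
    "sign_dist l1_norm (colar_stage3 Ayf yt) vv \<le> 4 * sqrt s * (Kc * (sqrt s * \<theta> + Rb))"
proof -
  have B0: "0 < B" using X.B by simp
  have eta: "2 * (t * \<theta> * (1 + real r * (2 * sqrt B + 1))) \<le> C * \<theta>"
    using mult_right_mono[OF C, of \<theta>] pos by (simp add: mult_ac)
  have e0: "t * \<theta> \<le> t / C * (C * \<theta>)" "0 \<le> t / C" using pos by simp_all
  have tt: "0 \<le> t * \<theta>" "0 < C * \<theta>" using pos by simp_all
  note st1 = stage1_rate[OF x0(1,2) y0(1,2) xy0(1) x0(3) y0(3) xy0(2) x0(4) y0(4) stage1 card(1,2) eta e0 tt(1) small(1)
      gap small(2) tt(2) pos(3,4) card(3) small(3,4), folded Ks_def, folded e_def]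
  have e_nn: "0 \<le> e" using st1(2) by (meson fro2_nonneg order_trans real_sqrt_ge_zero)
  note cf = first_singular_vector_coefficients[OF x0(3) y0(3) small(1) st1 small(5) sv]
  define gx where "gx = (\<lambda>k. Lm k * ip q (($) b0) (mv q Sy (v k)))"
  define gy where "gy = (\<lambda>k. Lm k * ip p (($) a0) (mv p Sx (u k)))"
  note cx = target_coefficients[of "\<lambda>k. ip q (($) b0) (mv q Sy (v k))", OF cf(8,9,10) gap e_nn small(6), folded gx_def, folded Rb_def \<gamma>_def]
  note cy = target_coefficients[of "\<lambda>k. ip p (($) a0) (mv p Sx (u k))", OF cf(5,6,7) gap e_nn small(6), folded gy_def, folded Rb_def \<gamma>_def]
  have gx: "(\<Sum>k\<in>{1..<r}. \<bar>gx k\<bar>) \<le> Rb" "\<gamma> \<le> \<bar>gx 0\<bar>" "\<And>k. k < r \<Longrightarrow> \<bar>gx k\<bar> \<le> sqrt B"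
    using cx by (simp_all add: gx_def)
  have gy: "(\<Sum>k\<in>{1..<r}. \<bar>gy k\<bar>) \<le> Rb" "\<gamma> \<le> \<bar>gy 0\<bar>" "\<And>k. k < r \<Longrightarrow> \<bar>gy k\<bar> \<le> sqrt B"
    using cy by (simp_all add: gy_def)
  have \<gamma>: "0 < \<gamma>" using gap B0 by (simp add: \<gamma>_def)
  have hx': "\<bar>(Axy1 *\<^sub>v b0) $ i - (\<Sum>k<r. gx k * mv p Sx (u k) i)\<bar> \<le> t * \<theta>" if "i < p" for i
    using hx[OF that] unfolding Sxy_mult_right gx_def .
  have hy': "\<bar>(Axy1\<^sup>T *\<^sub>v a0) $ j - (\<Sum>k<r. gy k * mv q Sy (v k) j)\<bar> \<le> t * \<theta>" if "j < q" for j
    using hy[OF that] unfolding Sxy_mult_left gy_def .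
  have t1: "t * \<theta> \<le> 1" using small(1) by simp
  have sm: "2 * (sqrt B * (t * \<theta>) + sqrt (B + 1) * (3 * C' / c * (sqrt s * \<theta>)) + 2 * R) \<le> \<gamma>" if "R \<le> Rb" for R
    using small(9) that by (simp add: a_def)
  have xyT: "Axy1\<^sup>T \<in> carrier_mat q p" using xy1 by simp
  note rx = X.stage23_sign_dist[OF x1 xf xy1 cf(2) hx' st2x uv card(1,3) gx(3) \<gamma> gx(2) C' pos(1-4) small(7,8) t1 sm[OF gx(1)],
      folded a_def, folded Kc_def]
  note ry = Y.stage23_sign_dist[OF y1 yf xyT cf(1) hy' st2y vv card(2,3) gy(3) \<gamma> gy(2) C' pos(1-4) small(7,8) t1 sm[OF gy(1)],
      folded a_def, folded Kc_def]
  have "0 \<le> C'" using C' pos B0 by (smt (verit) mult_nonneg_nonneg of_nat_0_le_iff real_sqrt_ge_zero)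
  then have a0: "0 \<le> a" using pos by (simp add: a_def)
  have Kc0: "0 \<le> Kc" unfolding Kc_def using a0 \<gamma> B0 pos by (intro mult_nonneg_nonneg add_nonneg_nonneg) auto
  have up: "Kc * (sqrt s * \<theta> + R) \<le> Kc * (sqrt s * \<theta> + Rb)" if "R \<le> Rb" for R
    using that Kc0 by (intro mult_left_mono) auto
  have up1: "4 * sqrt s * (Kc * (sqrt s * \<theta> + R)) \<le> 4 * sqrt s * (Kc * (sqrt s * \<theta> + Rb))" if "R \<le> Rb" for R
    by (rule mult_left_mono[OF up[OF that]]) (use card in simp)
  show "sign_dist l2_norm (colar_stage3 Axf xt) uv \<le> Kc * (sqrt s * \<theta> + Rb)"
    by (rule order_trans[OF rx(1) up[OF gx(1)]])
  show "sign_dist l1_norm (colar_stage3 Axf xt) uv \<le> 4 * sqrt s * (Kc * (sqrt s * \<theta> + Rb))"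
    by (rule order_trans[OF rx(2) up1[OF gx(1)]])
  show "sign_dist l2_norm (colar_stage3 Ayf yt) vv \<le> Kc * (sqrt s * \<theta> + Rb)"
    by (rule order_trans[OF ry(1) up[OF gy(1)]])
  show "sign_dist l1_norm (colar_stage3 Ayf yt) vv \<le> 4 * sqrt s * (Kc * (sqrt s * \<theta> + Rb))"
    by (rule order_trans[OF ry(2) up1[OF gy(1)]])
qed

end

section \<open>Probability of the good event\<close>

definition xi :: "nat \<Rightarrow> (nat \<Rightarrow> real) \<Rightarrow> real Matrix.vec \<times> real Matrix.vec \<Rightarrow> real" where
  "xi p w = (\<lambda>z. ip p (($) (fst z)) w)"

definition eta :: "nat \<Rightarrow> (nat \<Rightarrow> real) \<Rightarrow> real Matrix.vec \<times> real Matrix.vec \<Rightarrow> real" where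
  "eta q w = (\<lambda>z. ip q (($) (snd z)) w)"

lemma xi_measurable [measurable]: "xi p w \<in> borel_measurable (pair_borel p q)"
  unfolding xi_def by (rule measurable_compose[OF measurable_fst measurable_ip_vec])

lemma eta_measurable [measurable]: "eta q w \<in> borel_measurable (pair_borel p q)"
  unfolding eta_def by (rule measurable_compose[OF measurable_snd measurable_ip_vec])

lemma emp_cov_carrier [simp]: "emp_cov I p q x y \<in> carrier_mat p q"
  by (simp add: emp_cov_def)

lemma emp_cov_bf:
  "bf p q w (ent (emp_cov I p q x y)) w' = (\<Sum>i\<in>I. ip p (($) (x i)) w * ip q (($) (y i)) w') / real (card I)"
proof -
  have "bf p q w (ent (emp_cov I p q x y)) w' =
      (\<Sum>j<p. \<Sum>k<q. \<Sum>i\<in>I. w j * (x i $ j * y i $ k) * w' k / real (card I))"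
    by (simp add: bf_sum emp_cov_def sum_distrib_left sum_distrib_right sum_divide_distrib)
  also have "\<dots> = (\<Sum>j<p. \<Sum>i\<in>I. \<Sum>k<q. w j * (x i $ j * y i $ k) * w' k / real (card I))"
    by (intro sum.cong refl sum.swap)
  also have "\<dots> = (\<Sum>i\<in>I. \<Sum>j<p. \<Sum>k<q. w j * (x i $ j * y i $ k) * w' k / real (card I))" by (rule sum.swap)
  also have "\<dots> = (\<Sum>i\<in>I. ip p (($) (x i)) w * ip q (($) (y i)) w' / real (card I))"
    by (intro sum.cong refl) (simp add: ip_def sum_product sum_divide_distrib mult_ac)
  finally show ?thesis by (simp add: sum_divide_distrib)
qed

lemma emp_cov_psd: "psd (emp_cov I p p x x)"
  unfolding psd_iff[OF emp_cov_carrier]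
proof (intro conjI allI impI)
  fix w
  show "0 \<le> ip p w (mv p (ent (emp_cov I p p x x)) w)"
    unfolding bf_def[symmetric] emp_cov_bf by (intro divide_nonneg_nonneg sum_nonneg) auto
qed (simp add: emp_cov_def mult.commute)

lemma integrable_product:
  assumes P: "prob_space P" and f: "subexp P L (\<lambda>z. (f z)\<^sup>2)" and g: "subexp P L (\<lambda>z. (g z)\<^sup>2)" and L: "0 < L"
    and m: "f \<in> borel_measurable P" "g \<in> borel_measurable P"
  shows "integrable P (\<lambda>z. f z * g z)"
  using prob_space.subexp_moments(1)[OF P subexp_product[OF f g L m] L] .

lemma (in prob_space) product_deviation_event:
  assumes ind: "indep_vars (\<lambda>_. N) Z I" and I: "finite I" "I \<noteq> {}"
    and law: "\<And>i. i \<in> I \<Longrightarrow> distr M N (Z i) = P" and P: "prob_space P" and sets: "sets P = sets N"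
    and Fe: "finite Fe" "\<And>f. f \<in> Fe \<Longrightarrow> f \<in> borel_measurable P" "\<And>f. f \<in> Fe \<Longrightarrow> subexp P L (\<lambda>z. (f z)\<^sup>2)"
    and L: "0 < L" and \<tau>: "0 < \<tau>" "\<tau> \<le> 8 * L"
  shows "\<exists>E\<in>events. prob E \<le> (real (card Fe))\<^sup>2 * (2 * exp (- (real (card I) * \<tau>\<^sup>2 / (32 * L\<^sup>2)))) \<and>
    (\<forall>\<omega>\<in>space M - E. \<forall>f\<in>Fe. \<forall>g\<in>Fe.
      \<bar>(\<Sum>i\<in>I. f (Z i \<omega>) * g (Z i \<omega>)) / real (card I) - (\<integral>z. f z * g z \<partial>P)\<bar> \<le> \<tau>)"
proof -
  define Ev where "Ev = (\<lambda>(f, g). {\<omega> \<in> space M. \<tau> < \<bar>(\<Sum>i\<in>I. f (Z i \<omega>) * g (Z i \<omega>)) / real (card I) - (\<integral>z. f z * g z \<partial>P)\<bar>})"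
  have conc: "Ev fg \<in> events" "prob (Ev fg) \<le> 2 * exp (- (real (card I) * \<tau>\<^sup>2 / (32 * L\<^sup>2)))"
    if fg0: "fg \<in> Fe \<times> Fe" for fg
  proof -
    obtain f g where fg: "fg = (f, g)" "f \<in> Fe" "g \<in> Fe" using fg0 by auto
    have "subexp P L (\<lambda>z. f z * g z)"
      by (rule subexp_product[OF Fe(3)[OF fg(2)] Fe(3)[OF fg(3)] L Fe(2)[OF fg(2)] Fe(2)[OF fg(3)]])
    from iid_concentration[OF ind I law P sets this L \<tau>]
    show "Ev fg \<in> events" "prob (Ev fg) \<le> 2 * exp (- (real (card I) * \<tau>\<^sup>2 / (32 * L\<^sup>2)))"
      by (simp_all add: Ev_def fg)
  qed
  define E where "E = (\<Union>fg\<in>Fe \<times> Fe. Ev fg)"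
  have E: "E \<in> events" unfolding E_def using Fe(1) conc(1) by (intro sets.finite_UN) auto
  have "prob E \<le> (\<Sum>fg\<in>Fe \<times> Fe. prob (Ev fg))"
    unfolding E_def using Fe(1) conc(1) by (intro finite_measure_subadditive_finite) auto
  also have "\<dots> \<le> (\<Sum>fg\<in>Fe \<times> Fe. 2 * exp (- (real (card I) * \<tau>\<^sup>2 / (32 * L\<^sup>2))))"
    by (rule sum_mono) (rule conc(2))
  also have "\<dots> = (real (card Fe))\<^sup>2 * (2 * exp (- (real (card I) * \<tau>\<^sup>2 / (32 * L\<^sup>2))))"
    by (simp add: card_cartesian_product power2_eq_square)
  finally have pE: "prob E \<le> (real (card Fe))\<^sup>2 * (2 * exp (- (real (card I) * \<tau>\<^sup>2 / (32 * L\<^sup>2))))" .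
  have "\<forall>\<omega>\<in>space M - E. \<forall>f\<in>Fe. \<forall>g\<in>Fe.
      \<bar>(\<Sum>i\<in>I. f (Z i \<omega>) * g (Z i \<omega>)) / real (card I) - (\<integral>z. f z * g z \<partial>P)\<bar> \<le> \<tau>"
    by (auto simp: E_def Ev_def not_less)
  then show ?thesis using E pE by (intro bexI[of _ E] conjI)
qed

lemma finite_signed_lists: "finite {ls :: (nat \<times> bool) list. set ls \<subseteq> {..<p} \<times> UNIV \<and> length ls = m}"
  "card {ls :: (nat \<times> bool) list. set ls \<subseteq> {..<p} \<times> UNIV \<and> length ls = m} = (2 * p) ^ m"
  using finite_lists_length_eq[of "{..<p} \<times> (UNIV :: bool set)" m] card_lists_length_eq[of "{..<p} \<times> (UNIV :: bool set)" m]
  by (simp_all add: card_cartesian_product mult.commute)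

text \<open>Half of the population value suffices from below, so a constant relative deviation is
  allowed and the exponent beats the \<open>(2 p)^m\<close> vectors with \<open>m\<close> of order \<open>n / log p\<close>.\<close>

lemma (in prob_space) restricted_eigenvalue_event:
  assumes ind: "indep_vars (\<lambda>_. N) Z I" and I: "finite I" "I \<noteq> {}"
    and law: "\<And>i. i \<in> I \<Longrightarrow> distr M N (Z i) = P" and P: "prob_space P" and sets: "sets P = sets N"
    and fe: "\<And>w. fe w \<in> borel_measurable P"
    and sg: "\<And>w b. ip p w w \<le> b \<Longrightarrow> 0 < b \<Longrightarrow> subexp P (K * b) (\<lambda>z. (fe w z)\<^sup>2)" and K: "0 < K" and B: "0 < B"
    and low: "\<And>w. ip p w w \<le> B * (\<integral>z. (fe w z)\<^sup>2 \<partial>P)"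
  shows "\<exists>E\<in>events. prob E \<le> (2 * real p) ^ m * (2 * exp (- (real (card I) / (128 * B\<^sup>2 * K\<^sup>2)))) \<and>
    (\<forall>\<omega>\<in>space M - E. \<forall>ls. length ls = m \<longrightarrow> set ls \<subseteq> {..<p} \<times> UNIV \<longrightarrow>
      1 / (2 * B) * ip p (signed_sum ls) (signed_sum ls) \<le> (\<Sum>i\<in>I. (fe (signed_sum ls) (Z i \<omega>))\<^sup>2) / real (card I))"
proof -
  define LS where "LS = {ls :: (nat \<times> bool) list. set ls \<subseteq> {..<p} \<times> UNIV \<and> length ls = m}"
  let ?\<mu> = "\<lambda>w. \<integral>z. (fe w z)\<^sup>2 \<partial>P"
  let ?b = "2 * exp (- (real (card I) / (128 * B\<^sup>2 * K\<^sup>2)))"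
  \<comment> \<open>The zero vector is set apart because its sub-exponential scale
    \<open>K * b\<close> would be 0; the desired inequality is trivial for it.\<close>
  define Ev where "Ev w = (if ip p w w = 0 then {} else {\<omega> \<in> space M. ?\<mu> w / 2 < \<bar>(\<Sum>i\<in>I. (fe w (Z i \<omega>))\<^sup>2) / real (card I) - ?\<mu> w\<bar>})" for w
  interpret P: prob_space P by (rule P)
  have conc: "Ev w \<in> events" "prob (Ev w) \<le> ?b" for w
  proof -
    have "Ev w \<in> events \<and> prob (Ev w) \<le> ?b"
    proof (cases "ip p w w = 0")
      case False
      \<comment> \<open>Mean and sub-exponential scale are both comparable to \<open>b\<close>, so
        \<open>b\<close> cancels from the exponent and all directions share one bound.\<close>
      define b where "b = ip p w w"
      have b: "0 < b" using False by (simp add: b_def less_le)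
      have KB: "0 < K * b" using K b by simp
      have h: "subexp P (K * b) (\<lambda>z. (fe w z)\<^sup>2)" by (rule sg) (use b in \<open>simp_all add: b_def\<close>)
      have \<mu>l: "b / B \<le> ?\<mu> w" using low[of w] B by (simp add: b_def field_simps)
      then have \<mu>0: "0 < ?\<mu> w" using b B by (smt (verit) divide_pos_pos)
      have \<mu>u: "?\<mu> w \<le> 2 * (K * b)" using P.subexp_moments(5)[OF h KB] by simp
      have "0 < ?\<mu> w / 2" "?\<mu> w / 2 \<le> 8 * (K * b)" using \<mu>0 \<mu>u KB by linarith+
      note c = iid_concentration[OF ind I law P sets h KB this]
      have "b / B / 2 \<le> ?\<mu> w / 2" using \<mu>l by simp
      then have "(b / B / 2)\<^sup>2 \<le> (?\<mu> w / 2)\<^sup>2" using b B by (intro power_mono) auto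
      then have "real (card I) * (b / B / 2)\<^sup>2 / (32 * (K * b)\<^sup>2) \<le> real (card I) * (?\<mu> w / 2)\<^sup>2 / (32 * (K * b)\<^sup>2)"
        by (intro divide_right_mono mult_left_mono) auto
      moreover have "real (card I) * (b / B / 2)\<^sup>2 / (32 * (K * b)\<^sup>2) = real (card I) / (128 * B\<^sup>2 * K\<^sup>2)"
        using b B K by (simp add: field_simps power2_eq_square)
      ultimately have ex: "2 * exp (- (real (card I) * (?\<mu> w / 2)\<^sup>2 / (32 * (K * b)\<^sup>2))) \<le> ?b" by simp
      have Ew: "Ev w = {\<omega> \<in> space M. ?\<mu> w / 2 < \<bar>(\<Sum>i\<in>I. (fe w (Z i \<omega>))\<^sup>2) / real (card I) - ?\<mu> w\<bar>}"
        using False by (simp only: Ev_def if_False)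
      show ?thesis unfolding Ew by (rule conjI[OF c(1) order_trans[OF c(2) ex]])
    qed (simp add: Ev_def)
    then show "Ev w \<in> events" "prob (Ev w) \<le> ?b" by auto
  qed
  define E where "E = (\<Union>ls\<in>LS. Ev (signed_sum ls))"
  have fin: "finite LS" unfolding LS_def by (rule finite_signed_lists)
  have "E \<in> events" unfolding E_def using fin conc(1) by (intro sets.finite_UN) auto
  moreover have "prob E \<le> (2 * real p) ^ m * ?b"
  proof -
    have "prob E \<le> (\<Sum>ls\<in>LS. prob (Ev (signed_sum ls)))"
      unfolding E_def using fin conc(1) by (intro finite_measure_subadditive_finite) auto
    also have "\<dots> \<le> (\<Sum>ls\<in>LS. ?b)" by (rule sum_mono) (rule conc(2))
    also have "\<dots> = (2 * real p) ^ m * ?b"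
      by (simp add: LS_def finite_signed_lists)
    finally show ?thesis .
  qed
  moreover have "1 / (2 * B) * ip p (signed_sum ls) (signed_sum ls) \<le> (\<Sum>i\<in>I. (fe (signed_sum ls) (Z i \<omega>))\<^sup>2) / real (card I)"
    if \<omega>: "\<omega> \<in> space M - E" and ls: "length ls = m" "set ls \<subseteq> {..<p} \<times> UNIV" for \<omega> ls
  proof -
    let ?w = "signed_sum ls"
    have nE: "\<omega> \<notin> Ev ?w" using \<omega> ls by (auto simp: E_def LS_def)
    show ?thesis
    proof (cases "ip p ?w ?w = 0")
      case True
      then show ?thesis by (simp add: sum_nonneg)
    next
      case False
      then have "\<bar>(\<Sum>i\<in>I. (fe ?w (Z i \<omega>))\<^sup>2) / real (card I) - ?\<mu> ?w\<bar> \<le> ?\<mu> ?w / 2"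
        using nE \<omega> by (auto simp: Ev_def not_less)
      then have "?\<mu> ?w / 2 \<le> (\<Sum>i\<in>I. (fe ?w (Z i \<omega>))\<^sup>2) / real (card I)" by linarith
      moreover have "1 / (2 * B) * ip p ?w ?w \<le> ?\<mu> ?w / 2" using low[of ?w] B by (simp add: field_simps)
      ultimately show ?thesis by linarith
    qed
  qed
  ultimately show ?thesis by blast
qed

text \<open>The vector \<open>W\<close> is random but independent of the sample indexed by \<open>I\<close>, so the deviation bound
  for fixed vectors applies conditionally on \<open>W\<close>.\<close>

lemma (in prob_space) independent_direction_event:
  fixes dir :: "('i \<Rightarrow> 'b) \<Rightarrow> 'b \<Rightarrow> real" and coord :: "nat \<Rightarrow> 'b \<Rightarrow> real" and Z :: "'i \<Rightarrow> 'a \<Rightarrow> 'b"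
  assumes ind: "indep_vars (\<lambda>_. N) Z I" and I: "finite I" "I \<noteq> {}"
    and law: "\<And>i. i \<in> I \<Longrightarrow> distr M N (Z i) = P" and P: "prob_space P" and sets: "sets P = sets N"
    and W: "indep_var S W (PiM I (\<lambda>_. N)) (\<lambda>\<omega>. \<lambda>i\<in>I. Z i \<omega>)"
    and U: "U \<in> sets S" "\<And>\<omega>. \<omega> \<in> space M \<Longrightarrow> W \<omega> \<in> U"
    and coord: "\<And>j. j < d \<Longrightarrow> coord j \<in> borel_measurable N"
    and dir: "(\<lambda>(w, z). dir w z) \<in> borel_measurable (S \<Otimes>\<^sub>M N)"
    and mean: "\<And>j. j < d \<Longrightarrow> mean j \<in> borel_measurable S"
      "\<And>j w. j < d \<Longrightarrow> w \<in> U \<Longrightarrow> mean j w = (\<integral>z. coord j z * dir w z \<partial>P)"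
    and sg: "\<And>j w. j < d \<Longrightarrow> w \<in> U \<Longrightarrow> subexp P L (\<lambda>z. coord j z * dir w z)"
    and L: "0 < L" and \<tau>: "0 < \<tau>" "\<tau> \<le> 8 * L"
  shows "\<exists>E\<in>events. prob E \<le> real d * (2 * exp (- (real (card I) * \<tau>\<^sup>2 / (32 * L\<^sup>2)))) \<and>
    (\<forall>\<omega>\<in>space M - E. \<forall>j<d. \<bar>(\<Sum>i\<in>I. coord j (Z i \<omega>) * dir (W \<omega>) (Z i \<omega>)) / real (card I) - mean j (W \<omega>)\<bar> \<le> \<tau>)"
proof -
  let ?T = "PiM I (\<lambda>_. N)"
  let ?b = "2 * exp (- (real (card I) * \<tau>\<^sup>2 / (32 * L\<^sup>2)))"
  define D where "D = (\<lambda>\<omega>. \<lambda>i\<in>I. Z i \<omega>)"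
  have WM: "W \<in> M \<rightarrow>\<^sub>M S" and DM: "D \<in> M \<rightarrow>\<^sub>M ?T"
    using W unfolding indep_var_eq D_def by auto
  define dev where "dev j = (\<lambda>(w, z). (\<Sum>i\<in>I. coord j (z i) * dir w (z i)) / real (card I) - mean j w)" for j
  have dev_meas: "dev j \<in> borel_measurable (S \<Otimes>\<^sub>M ?T)" if j: "j < d" for j
  proof -
    have zi: "(\<lambda>x. snd x i) \<in> S \<Otimes>\<^sub>M ?T \<rightarrow>\<^sub>M N" if "i \<in> I" for i
      by (rule measurable_compose[OF measurable_snd measurable_component_singleton[OF that]])
    have c: "(\<lambda>x. coord j (snd x i)) \<in> borel_measurable (S \<Otimes>\<^sub>M ?T)" if "i \<in> I" for i
      by (rule measurable_compose[OF zi[OF that] coord[OF j]])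
    have di: "(\<lambda>x. dir (fst x) (snd x i)) \<in> borel_measurable (S \<Otimes>\<^sub>M ?T)" if "i \<in> I" for i
    proof -
      have "(\<lambda>x. (fst x, snd x i)) \<in> S \<Otimes>\<^sub>M ?T \<rightarrow>\<^sub>M S \<Otimes>\<^sub>M N" using zi[OF that] by (intro measurable_Pair) auto
      from measurable_compose[OF this dir] show ?thesis by simp
    qed
    have m: "(\<lambda>x. mean j (fst x)) \<in> borel_measurable (S \<Otimes>\<^sub>M ?T)"
      by (rule measurable_compose[OF measurable_fst mean(1)[OF j]])
    show ?thesis unfolding dev_def case_prod_beta
      by (intro borel_measurable_diff borel_measurable_divide borel_measurable_sum borel_measurable_times c di m borel_measurable_const)
  qed
  \<comment> \<open>The intersection with \<open>U\<close> confines the sections to directions for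
    which \<open>sg\<close> and \<open>mean\<close> apply; the observed direction always lies in
    \<open>U\<close>.\<close>
  define G where "G j = {x \<in> space (S \<Otimes>\<^sub>M ?T). \<tau> < \<bar>dev j x\<bar>} \<inter> (U \<times> space ?T)" for j
  have G: "G j \<in> sets (S \<Otimes>\<^sub>M ?T)" if "j < d" for j
    unfolding G_def using dev_meas[OF that] U(1) by (intro sets.Int) (measurable, auto)
  define Ev where "Ev j = {\<omega> \<in> space M. (W \<omega>, D \<omega>) \<in> G j}" for j
  have Ev: "Ev j \<in> events" if "j < d" for j
  proof -
    have "(\<lambda>\<omega>. (W \<omega>, D \<omega>)) \<in> M \<rightarrow>\<^sub>M S \<Otimes>\<^sub>M ?T" using WM DM by (rule measurable_Pair)
    from measurable_sets[OF this G[OF that]] show ?thesis by (simp add: Ev_def vimage_def Int_def conj_commute)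
  qed
  have prob_Ev: "prob (Ev j) \<le> ?b" if j: "j < d" for j
    unfolding Ev_def
  proof (rule indep_section_bound[OF W[folded D_def] G[OF j]])
    fix w assume w: "w \<in> space S"
    show "prob {\<omega> \<in> space M. (w, D \<omega>) \<in> G j} \<le> ?b"
    proof (cases "w \<in> U")
      case True
      have "{\<omega> \<in> space M. (w, D \<omega>) \<in> G j} = {\<omega> \<in> space M. \<tau> < \<bar>(\<Sum>i\<in>I. coord j (Z i \<omega>) * dir w (Z i \<omega>)) / real (card I)
          - (\<integral>z. coord j z * dir w z \<partial>P)\<bar>}"
        using True w measurable_space[OF DM] by (auto simp: G_def dev_def D_def mean(2)[OF j] space_pair_measure cong: sum.cong)
      then show ?thesis using iid_concentration(2)[OF ind I law P sets sg[OF j True] L \<tau>] by simp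
    next
      case False
      then have "{\<omega> \<in> space M. (w, D \<omega>) \<in> G j} = {}" by (auto simp: G_def)
      then show ?thesis by (simp only: measure_empty) simp
    qed
  qed simp
  define E where "E = (\<Union>j<d. Ev j)"
  have "E \<in> events" unfolding E_def using Ev by (intro sets.finite_UN) auto
  moreover have "prob E \<le> real d * ?b"
  proof -
    have "prob E \<le> (\<Sum>j<d. prob (Ev j))"
      unfolding E_def using Ev by (intro finite_measure_subadditive_finite) auto
    also have "\<dots> \<le> (\<Sum>j<d. ?b)" by (rule sum_mono) (use prob_Ev in auto)
    finally show ?thesis by simp
  qed
  moreover have "\<bar>(\<Sum>i\<in>I. coord j (Z i \<omega>) * dir (W \<omega>) (Z i \<omega>)) / real (card I) - mean j (W \<omega>)\<bar> \<le> \<tau>"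
    if \<omega>: "\<omega> \<in> space M - E" and j: "j < d" for \<omega> j
  proof -
    have "(W \<omega>, D \<omega>) \<notin> G j" using \<omega> j by (auto simp: E_def Ev_def)
    moreover have "(W \<omega>, D \<omega>) \<in> space (S \<Otimes>\<^sub>M ?T)" "(W \<omega>, D \<omega>) \<in> U \<times> space ?T"
      using \<omega> U(2) measurable_space[OF WM] measurable_space[OF DM] by (auto simp: space_pair_measure)
    ultimately have "\<bar>dev j (W \<omega>, D \<omega>)\<bar> \<le> \<tau>" by (auto simp: G_def not_less)
    then show ?thesis by (simp add: dev_def D_def)
  qed
  ultimately show ?thesis by blast
qed

section \<open>The population model at one sample size\<close>

locale cca_model =
  fixes M :: "'a measure" and X Y :: "nat \<Rightarrow> 'a \<Rightarrow> real Matrix.vec"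
    and P :: "(real Matrix.vec \<times> real Matrix.vec) measure"
    and p q r n :: nat and SX SY SXY U V :: "real mat" and Lam :: "nat \<Rightarrow> real" and K \<epsilon>\<^sub>0 B :: real
  assumes law: "prob_space P" "sets P = sets (pair_borel p q)"
    and cent: "centered P p fst" "centered P q snd"
    and subgaussian: "subgaussian_norm P p fst \<le> ennreal K" "subgaussian_norm P q snd \<le> ennreal K"
    and prob_M: "prob_space M"
    and indep: "prob_space.indep_vars M (\<lambda>_. pair_borel p q) (\<lambda>i \<omega>. (X i \<omega>, Y i \<omega>)) {..<n}"
    and copies: "\<And>i. i < n \<Longrightarrow> distr M (pair_borel p q) (\<lambda>\<omega>. (X i \<omega>, Y i \<omega>)) = P"
    and SX: "SX = cov_mat P p p fst fst" and SY: "SY = cov_mat P q q snd snd" and SXY: "SXY = cov_mat P p q fst snd"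
    and r1: "1 \<le> r" and UV_dim: "U \<in> carrier_mat p r" "V \<in> carrier_mat q r"
    and decomposition: "SXY = SX * U * mat_diag r Lam * V\<^sup>T * SY"
    and normalized: "U\<^sup>T * SX * U = 1\<^sub>m r" "V\<^sup>T * SY * V = 1\<^sub>m r"
    and Lam_decreasing: "\<And>i j. i \<le> j \<Longrightarrow> j < r \<Longrightarrow> Lam j \<le> Lam i" and Lam_pos: "\<And>i. i < r \<Longrightarrow> 0 < Lam i"
    and gap: "0 < \<epsilon>\<^sub>0" "Lam 0 - (if r = 1 then 0 else Lam 1) > \<epsilon>\<^sub>0"
    and eigenvalues: "0 < B" "\<And>k. eigenvalue SX k \<Longrightarrow> k \<in> {1 / B..B}" "\<And>k. eigenvalue SY k \<Longrightarrow> k \<in> {1 / B..B}"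
begin

sublocale P: prob_space P by (rule law(1))
sublocale M: prob_space M by (rule prob_M)

abbreviation u where "u k i \<equiv> U $$ (i, k)"
abbreviation v where "v k i \<equiv> V $$ (i, k)"

text \<open>The square of the number chosen in \<open>psi2_norm_le_imp\<close>;
  \<open>Kq * b\<close> is the sub-exponential scale of squared projections onto directions of
  squared length at most \<open>b\<close>.\<close>

definition Kq :: real where "Kq = (max K 0 + 1)\<^sup>2"

lemma Kq: "0 < Kq"
  by (simp add: Kq_def power2_eq_square)

lemma xi_borel [measurable]: "xi p w \<in> borel_measurable P"
  unfolding measurable_cong_sets[OF law(2) refl] by (rule xi_measurable)

lemma eta_borel [measurable]: "eta q w \<in> borel_measurable P"
  unfolding measurable_cong_sets[OF law(2) refl] by (rule eta_measurable)

lemma xi_subexp: "ip p w w \<le> b \<Longrightarrow> 0 < b \<Longrightarrow> subexp P (Kq * b) (\<lambda>z. (xi p w z)\<^sup>2)"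
proof -
  assume b: "ip p w w \<le> b" "0 < b"
  have "fst \<in> P \<rightarrow>\<^sub>M vec_borel p" unfolding measurable_cong_sets[OF law(2) refl] by (rule measurable_fst)
  from subgaussian_square_subexp[OF law(1) this subgaussian(1) b] show ?thesis by (simp add: Kq_def xi_def)
qed

lemma eta_subexp: "ip q w w \<le> b \<Longrightarrow> 0 < b \<Longrightarrow> subexp P (Kq * b) (\<lambda>z. (eta q w z)\<^sup>2)"
proof -
  assume b: "ip q w w \<le> b" "0 < b"
  have "snd \<in> P \<rightarrow>\<^sub>M vec_borel q" unfolding measurable_cong_sets[OF law(2) refl] by (rule measurable_snd)
  from subgaussian_square_subexp[OF law(1) this subgaussian(2) b] show ?thesis by (simp add: Kq_def eta_def)
qed

lemma xi_subexp': "\<exists>L>0. subexp P L (\<lambda>z. (xi p w z)\<^sup>2)"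
proof -
  have "0 < ip p w w + 1" using ip_nonneg[of p w] by linarith
  then show ?thesis using xi_subexp[of w "ip p w w + 1"] Kq by (intro exI[of _ "Kq * (ip p w w + 1)"]) simp
qed

lemma eta_subexp': "\<exists>L>0. subexp P L (\<lambda>z. (eta q w z)\<^sup>2)"
proof -
  have "0 < ip q w w + 1" using ip_nonneg[of q w] by linarith
  then show ?thesis using eta_subexp[of w "ip q w w + 1"] Kq by (intro exI[of _ "Kq * (ip q w w + 1)"]) simp
qed

lemma integrable_products:
  "integrable P (\<lambda>z. xi p w z * xi p w' z)" "integrable P (\<lambda>z. eta q x z * eta q x' z)" "integrable P (\<lambda>z. xi p w z * eta q x z)"
proof -
  have *: "integrable P (\<lambda>z. f z * g z)"
    if h: "\<exists>L>0. subexp P L (\<lambda>z. (f z)\<^sup>2)" "\<exists>L>0. subexp P L (\<lambda>z. (g z)\<^sup>2)" "f \<in> borel_measurable P" "g \<in> borel_measurable P" for f g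
  proof -
    obtain L L' where L: "0 < L" "subexp P L (\<lambda>z. (f z)\<^sup>2)" and L': "0 < L'" "subexp P L' (\<lambda>z. (g z)\<^sup>2)" using h by blast
    have "subexp P (max L L') (\<lambda>z. (f z)\<^sup>2)" "subexp P (max L L') (\<lambda>z. (g z)\<^sup>2)"
      using L L' by (auto intro: subexp_mono)
    then show ?thesis using L h by (intro integrable_product[OF law(1), of "max L L'"]) auto
  qed
  show "integrable P (\<lambda>z. xi p w z * xi p w' z)" "integrable P (\<lambda>z. eta q x z * eta q x' z)" "integrable P (\<lambda>z. xi p w z * eta q x z)"
    by (rule *; (rule xi_subexp' eta_subexp' xi_borel eta_borel))+
qed

lemma coordinate_features: "i < p \<Longrightarrow> xi p (unitv i) z = fst z $ i" "j < q \<Longrightarrow> eta q (unitv j) z = snd z $ j"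
  by (simp_all add: xi_def eta_def ip_unitv)

lemma cov_bilinear:
  assumes cA: "\<And>i. i < d \<Longrightarrow> (\<integral>z. A z $ i \<partial>P) = 0" and cC: "\<And>j. j < d' \<Longrightarrow> (\<integral>z. C z $ j \<partial>P) = 0"
    and int: "\<And>i j. i < d \<Longrightarrow> j < d' \<Longrightarrow> integrable P (\<lambda>z. A z $ i * C z $ j)"
  shows "bf d d' w (ent (cov_mat P d d' A C)) w' = (\<integral>z. ip d (($) (A z)) w * ip d' (($) (C z)) w' \<partial>P)"
proof -
  have "(\<integral>z. ip d (($) (A z)) w * ip d' (($) (C z)) w' \<partial>P) = (\<integral>z. (\<Sum>i<d. \<Sum>j<d'. w i * w' j * (A z $ i * C z $ j)) \<partial>P)"
    by (simp add: ip_def sum_product mult_ac)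
  also have "\<dots> = (\<Sum>i<d. \<integral>z. (\<Sum>j<d'. w i * w' j * (A z $ i * C z $ j)) \<partial>P)"
    by (rule Bochner_Integration.integral_sum) (auto intro!: Bochner_Integration.integrable_sum integrable_mult_right int)
  also have "\<dots> = (\<Sum>i<d. \<Sum>j<d'. \<integral>z. w i * w' j * (A z $ i * C z $ j) \<partial>P)"
    by (intro sum.cong refl Bochner_Integration.integral_sum) (auto intro!: integrable_mult_right int)
  also have "\<dots> = (\<Sum>i<d. \<Sum>j<d'. w i * w' j * (\<integral>z. A z $ i * C z $ j \<partial>P))" by simp
  finally show ?thesis by (simp add: bf_sum cov_mat_def cA cC mult_ac)
qed

lemma mean_zero: "i < p \<Longrightarrow> (\<integral>z. fst z $ i \<partial>P) = 0" "j < q \<Longrightarrow> (\<integral>z. snd z $ j \<partial>P) = 0"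
  using cent by (auto simp: centered_def)

lemma integrable_coordinates:
  "i < p \<Longrightarrow> j < p \<Longrightarrow> integrable P (\<lambda>z. fst z $ i * fst z $ j)"
  "k < q \<Longrightarrow> l < q \<Longrightarrow> integrable P (\<lambda>z. snd z $ k * snd z $ l)"
  "i < p \<Longrightarrow> l < q \<Longrightarrow> integrable P (\<lambda>z. fst z $ i * snd z $ l)"
  using integrable_products(1)[of "unitv i" "unitv j"] integrable_products(2)[of "unitv k" "unitv l"]
    integrable_products(3)[of "unitv i" "unitv l"]
  by (simp_all add: coordinate_features)

lemma expectation_xi_xi: "(\<integral>z. xi p w z * xi p w' z \<partial>P) = bf p p w (ent SX) w'"
  unfolding SX xi_def
  by (rule cov_bilinear[symmetric])
     (use mean_zero integrable_coordinates in auto)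

lemma expectation_eta_eta: "(\<integral>z. eta q w z * eta q w' z \<partial>P) = bf q q w (ent SY) w'"
  unfolding SY eta_def
  by (rule cov_bilinear[symmetric])
     (use mean_zero integrable_coordinates in auto)

lemma expectation_xi_eta: "(\<integral>z. xi p w z * eta q w' z \<partial>P) = bf p q w (ent SXY) w'"
  unfolding SXY xi_def eta_def
  by (rule cov_bilinear[symmetric])
     (use mean_zero integrable_coordinates in auto)

lemma dims: "SX \<in> carrier_mat p p" "SY \<in> carrier_mat q q" "SXY \<in> carrier_mat p q"
  by (simp_all add: SX SY SXY cov_mat_def)

lemma sym: "i < p \<Longrightarrow> j < p \<Longrightarrow> SX $$ (i, j) = SX $$ (j, i)" "i < q \<Longrightarrow> j < q \<Longrightarrow> SY $$ (i, j) = SY $$ (j, i)"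
  by (simp_all add: SX SY cov_mat_def mult.commute)

lemma transpose_mult_mult_entry:
  assumes "A \<in> carrier_mat d d" "W \<in> carrier_mat d r" "k < r" "l < r"
  shows "(W\<^sup>T * A * W) $$ (k, l) = bf d d (\<lambda>i. W $$ (i, k)) (ent A) (\<lambda>i. W $$ (i, l))"
proof -
  have "W\<^sup>T * A * W = W\<^sup>T * (A * W)" by (rule assoc_mult_mat) (use assms in auto)
  then have "(W\<^sup>T * A * W) $$ (k, l) = (\<Sum>i<d. W\<^sup>T $$ (k, i) * (A * W) $$ (i, l))"
    using mult_mat_entry[of "W\<^sup>T" r d "A * W" r k l] assms by simp
  also have "\<dots> = (\<Sum>i<d. W $$ (i, k) * mv d (ent A) (\<lambda>i. W $$ (i, l)) i)"
    using assms mult_mat_entry[OF assms(1,2) _ assms(4)] by (intro sum.cong) (auto simp: mv_def)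
  finally show ?thesis by (simp add: bf_def ip_def)
qed

lemma u_orth: "k < r \<Longrightarrow> l < r \<Longrightarrow> bf p p (u k) (ent SX) (u l) = of_bool (k = l)"
proof -
  assume kl: "k < r" "l < r"
  have "bf p p (u k) (ent SX) (u l) = (U\<^sup>T * SX * U) $$ (k, l)"
    by (rule transpose_mult_mult_entry[OF dims(1) UV_dim(1) kl, symmetric])
  also have "\<dots> = of_bool (k = l)" unfolding normalized using kl by simp
  finally show ?thesis .
qed

lemma v_orth: "k < r \<Longrightarrow> l < r \<Longrightarrow> bf q q (v k) (ent SY) (v l) = of_bool (k = l)"
proof -
  assume kl: "k < r" "l < r"
  have "bf q q (v k) (ent SY) (v l) = (V\<^sup>T * SY * V) $$ (k, l)"
    by (rule transpose_mult_mult_entry[OF dims(2) UV_dim(2) kl, symmetric])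
  also have "\<dots> = of_bool (k = l)" unfolding normalized using kl by simp
  finally show ?thesis .
qed

lemma quadratic_bounds:
  "ip p x x \<le> B * bf p p x (ent SX) x" "bf p p x (ent SX) x \<le> B * ip p x x"
  "ip q y y \<le> B * bf q q y (ent SY) y" "bf q q y (ent SY) y \<le> B * ip q y y"
  using eigenvalue_bounds_quadratic_form[OF dims(1) sym(1) eigenvalues(2), of x]
    eigenvalue_bounds_quadratic_form[OF dims(2) sym(2) eigenvalues(3), of y] eigenvalues(1)
  by (simp_all add: bf_def field_simps)

text \<open>The Rayleigh quotient of \<open>u 0\<close> lies between 1 / B and B, so this interval
  is nonempty.\<close>

lemma B1: "1 \<le> B"
proof -
  have "bf p p (u 0) (ent SX) (u 0) = 1" using u_orth[of 0 0] r1 by simp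
  then have "ip p (u 0) (u 0) \<le> B" "1 \<le> B * ip p (u 0) (u 0)" using quadratic_bounds(1,2)[of "u 0"] by simp_all
  then have "1 \<le> B * B" using mult_left_mono[of "ip p (u 0) (u 0)" B B] eigenvalues(1) by linarith
  then have "1\<^sup>2 \<le> B\<^sup>2" by (simp add: power2_eq_square)
  then show ?thesis by (rule power2_le_imp_le) (use eigenvalues(1) in simp)
qed

definition "Jx = {i. i < p \<and> Matrix.row U i \<noteq> 0\<^sub>v r}"
definition "Jy = {i. i < q \<and> Matrix.row V i \<noteq> 0\<^sub>v r}"
definition "L1 = (if r = 1 then 0 else Lam 1)"

lemma supports: "k < r \<Longrightarrow> i < p \<Longrightarrow> i \<notin> Jx \<Longrightarrow> u k i = 0" "k < r \<Longrightarrow> j < q \<Longrightarrow> j \<notin> Jy \<Longrightarrow> v k j = 0"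
proof -
  assume a: "k < r" "i < p" "i \<notin> Jx"
  then have "Matrix.row U i $ k = 0" by (simp add: Jx_def)
  then show "u k i = 0" using a UV_dim by simp
next
  assume a: "k < r" "j < q" "j \<notin> Jy"
  then have "Matrix.row V j $ k = 0" by (simp add: Jy_def)
  then show "v k j = 0" using a UV_dim by simp
qed

lemma row_sparsity_card: "row_sparsity U = card Jx" "row_sparsity V = card Jy"
  using UV_dim by (simp_all add: row_sparsity_def Jx_def Jy_def)

sublocale PX: population p r "ent SX" u B Jx
  by unfold_locales (use sym B1 quadratic_bounds u_orth supports r1 in \<open>auto simp: Jx_def\<close>)

sublocale PY: population q r "ent SY" v B Jy
  by unfold_locales (use sym B1 quadratic_bounds v_orth supports r1 in \<open>auto simp: Jy_def\<close>)

lemma SXY_entry: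
  assumes ij: "i < p" "j < q"
  shows "SXY $$ (i, j) = (\<Sum>k<r. Lam k * (mv p (ent SX) (u k) i * mv q (ent SY) (v k) j))"
proof -
  have c: "SX * U \<in> carrier_mat p r" "SX * U * mat_diag r Lam \<in> carrier_mat p r" "V\<^sup>T * SY \<in> carrier_mat r q"
    using dims UV_dim by (auto intro!: mult_carrier_mat[OF _ mat_diag_dim])
  have "SXY = (SX * U * mat_diag r Lam) * (V\<^sup>T * SY)"
    unfolding decomposition by (rule assoc_mult_mat[OF c(2)]) (use dims UV_dim in auto)
  then have "SXY $$ (i, j) = (\<Sum>k<r. (SX * U * mat_diag r Lam) $$ (i, k) * (V\<^sup>T * SY) $$ (k, j))"
    using mult_mat_entry[OF c(2,3) ij] by simp
  also have "\<dots> = (\<Sum>k<r. (mv p (ent SX) (u k) i * Lam k) * mv q (ent SY) (v k) j)"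
  proof (intro sum.cong refl arg_cong2[where f = "(*)"])
    fix k assume "k \<in> {..<r}"
    then have k: "k < r" by simp
    have "(SX * U * mat_diag r Lam) $$ (i, k) = (SX * U) $$ (i, k) * Lam k"
      unfolding mat_diag_mult_right[OF c(1)] using ij k by simp
    then show "(SX * U * mat_diag r Lam) $$ (i, k) = mv p (ent SX) (u k) i * Lam k"
      using mult_mat_entry[OF dims(1) UV_dim(1) ij(1) k] by (simp add: mv_def)
    have "(V\<^sup>T * SY) $$ (k, j) = (\<Sum>l<q. V\<^sup>T $$ (k, l) * SY $$ (l, j))"
      by (rule mult_mat_entry) (use UV_dim dims ij k in auto)
    also have "\<dots> = (\<Sum>l<q. SY $$ (j, l) * v k l)"
      using UV_dim k sym(2) ij by (intro sum.cong) auto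
    finally show "(V\<^sup>T * SY) $$ (k, j) = mv q (ent SY) (v k) j" by (simp add: mv_def)
  qed
  finally show ?thesis by (simp add: mult_ac)
qed

text \<open>\<open>Lam k\<close> is the covariance of two variables of variance 1, and a product is
  at most the mean of the squares.\<close>

lemma Lam_le_1: "k < r \<Longrightarrow> Lam k \<le> 1"
proof -
  assume k: "k < r"
  have "bf p q (u k) (ent SXY) (v k) = (\<Sum>i<p. \<Sum>j<q. \<Sum>l<r. Lam l * ((u k i * mv p (ent SX) (u l) i) * (v k j * mv q (ent SY) (v l) j)))"
    by (simp add: bf_sum SXY_entry sum_distrib_left sum_distrib_right mult_ac)
  also have "\<dots> = (\<Sum>i<p. \<Sum>l<r. \<Sum>j<q. Lam l * ((u k i * mv p (ent SX) (u l) i) * (v k j * mv q (ent SY) (v l) j)))"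
    by (intro sum.cong refl sum.swap)
  also have "\<dots> = (\<Sum>l<r. \<Sum>i<p. \<Sum>j<q. Lam l * ((u k i * mv p (ent SX) (u l) i) * (v k j * mv q (ent SY) (v l) j)))"
    by (rule sum.swap)
  also have "\<dots> = (\<Sum>l<r. Lam l * (bf p p (u k) (ent SX) (u l) * bf q q (v k) (ent SY) (v l)))"
    by (simp add: bf_def ip_def sum_product) (simp add: sum_distrib_left)
  also have "\<dots> = (\<Sum>l<r. if l = k then Lam k else 0)"
    using k by (intro sum.cong) (auto simp: u_orth v_orth)
  also have "\<dots> = Lam k" using k by simp
  finally have "Lam k = (\<integral>z. xi p (u k) z * eta q (v k) z \<partial>P)" by (simp add: expectation_xi_eta)
  also have "\<dots> \<le> (\<integral>z. 1 / 2 * (xi p (u k) z * xi p (u k) z) + 1 / 2 * (eta q (v k) z * eta q (v k) z) \<partial>P)"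
  proof (rule integral_mono)
    fix z
    have "0 \<le> (xi p (u k) z - eta q (v k) z)\<^sup>2" by simp
    then show "xi p (u k) z * eta q (v k) z \<le> 1 / 2 * (xi p (u k) z * xi p (u k) z) + 1 / 2 * (eta q (v k) z * eta q (v k) z)"
      by (simp add: power2_eq_square algebra_simps)
  qed (use integrable_products in auto)
  also have "\<dots> = 1"
    using integrable_products k by (simp add: expectation_xi_xi expectation_eta_eta u_orth v_orth)
  finally show ?thesis .
qed

sublocale two_populations p q r "ent SX" "ent SY" u v B Jx Jy Lam L1
proof unfold_locales
  show "0 \<le> L1" using Lam_pos[of 1] r1 by (auto simp: L1_def intro: less_imp_le)
  show "L1 \<le> 1" using Lam_le_1[of 1] r1 by (auto simp: L1_def)
  show "\<And>k. 1 \<le> k \<Longrightarrow> k < r \<Longrightarrow> Lam k \<le> L1" using Lam_decreasing by (auto simp: L1_def)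
qed (use Lam_pos Lam_le_1 in \<open>auto intro: less_imp_le\<close>)

lemma SXY_Sxy: "i < p \<Longrightarrow> j < q \<Longrightarrow> SXY $$ (i, j) = Sxy i j"
  by (simp add: SXY_entry Sxy_def)

text \<open>Every number controlled by \<open>near\<close>, on either side, and every entry of the
  cross covariance comes from means of products of two of these functions, so one union bound over
  pairs covers them all.\<close>

definition features :: "(real Matrix.vec \<times> real Matrix.vec \<Rightarrow> real) set" where
  "features = ((\<lambda>i. xi p (unitv i)) ` {..<p} \<union> (\<lambda>k. xi p (u k)) ` {..<r}) \<union>
     ((\<lambda>j. eta q (unitv j)) ` {..<q} \<union> (\<lambda>k. eta q (v k)) ` {..<r})"

lemma features: "finite features" "card features \<le> p + q + 2 * r"
  "f \<in> features \<Longrightarrow> f \<in> borel_measurable P" "f \<in> features \<Longrightarrow> subexp P (Kq * B) (\<lambda>z. (f z)\<^sup>2)"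
proof -
  show "finite features" by (simp add: features_def)
  have "card features \<le> (card ((\<lambda>i. xi p (unitv i)) ` {..<p}) + card ((\<lambda>k. xi p (u k)) ` {..<r}))
      + (card ((\<lambda>j. eta q (unitv j)) ` {..<q}) + card ((\<lambda>k. eta q (v k)) ` {..<r}))"
    unfolding features_def by (intro order_trans[OF card_Un_le] add_mono card_Un_le)
  also have "\<dots> \<le> (p + r) + (q + r)"
    by (intro add_mono order_trans[OF card_image_le]) auto
  finally show "card features \<le> p + q + 2 * r" by simp
  show "f \<in> features \<Longrightarrow> f \<in> borel_measurable P" by (auto simp: features_def)
  have "ip p (unitv i) (unitv i) \<le> B" if "i < p" for i using that B1 by (simp add: ip_unitv) (simp add: unitv_def)
  moreover have "ip q (unitv i) (unitv i) \<le> B" if "i < q" for i using that B1 by (simp add: ip_unitv) (simp add: unitv_def)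
  moreover have "ip p (u k) (u k) \<le> B" "ip q (v k) (v k) \<le> B" if "k < r" for k
    using PX.S_lower[of "u k"] PY.S_lower[of "v k"] that by (simp_all add: u_orth v_orth)
  ultimately show "f \<in> features \<Longrightarrow> subexp P (Kq * B) (\<lambda>z. (f z)\<^sup>2)"
    using eigenvalues(1) by (auto simp: features_def intro!: xi_subexp eta_subexp)
qed

section \<open>High-probability events\<close>

abbreviation "Z \<equiv> (\<lambda>i \<omega>. (X i \<omega>, Y i \<omega>))"
abbreviation "covx I \<omega> \<equiv> emp_cov I p p (\<lambda>i. X i \<omega>) (\<lambda>i. X i \<omega>)"
abbreviation "covy I \<omega> \<equiv> emp_cov I q q (\<lambda>i. Y i \<omega>) (\<lambda>i. Y i \<omega>)"
abbreviation "covxy I \<omega> \<equiv> emp_cov I p q (\<lambda>i. X i \<omega>) (\<lambda>i. Y i \<omega>)"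

lemma emp_features:
  "(\<Sum>i\<in>I. xi p w (Z i \<omega>) * xi p w' (Z i \<omega>)) / real (card I) = bf p p w (ent (covx I \<omega>)) w'"
  "(\<Sum>i\<in>I. eta q x (Z i \<omega>) * eta q x' (Z i \<omega>)) / real (card I) = bf q q x (ent (covy I \<omega>)) x'"
  "(\<Sum>i\<in>I. xi p w (Z i \<omega>) * eta q x (Z i \<omega>)) / real (card I) = bf p q w (ent (covxy I \<omega>)) x"
  by (simp_all add: emp_cov_bf xi_def eta_def)

lemma indep_sub: "I \<subseteq> {..<n} \<Longrightarrow> M.indep_vars (\<lambda>_. pair_borel p q) Z I"
  by (rule M.indep_vars_subset[OF indep])

text \<open>\<open>N\<close> will be a common lower bound for the sizes of the two halves and of the
  full sample, which gives the three events the same probability bound.\<close>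

lemma near_event:
  assumes I: "I \<subseteq> {..<n}" "I \<noteq> {}" and N: "N \<le> real (card I)" and \<tau>: "0 < \<tau>" "\<tau> \<le> 8 * (Kq * B)"
  shows "\<exists>E\<in>M.events. M.prob E \<le> (real (p + q + 2 * r))\<^sup>2 * (2 * exp (- (N * \<tau>\<^sup>2 / (32 * (Kq * B)\<^sup>2)))) \<and>
    (\<forall>\<omega>\<in>space M - E. near p r \<tau> (ent (covx I \<omega>)) (ent SX) u \<and> near q r \<tau> (ent (covy I \<omega>)) (ent SY) v \<and>
      (\<forall>i<p. \<forall>j<q. \<bar>covxy I \<omega> $$ (i, j) - Sxy i j\<bar> \<le> \<tau>))"
proof -
  have L: "0 < Kq * B" using Kq eigenvalues(1) by simp
  have fin: "finite I" using I(1) finite_subset by blast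
  have cp: "\<And>i. i \<in> I \<Longrightarrow> distr M (pair_borel p q) (Z i) = P" using copies I(1) by auto
  obtain E where E: "E \<in> M.events"
    and pE: "M.prob E \<le> (real (card features))\<^sup>2 * (2 * exp (- (real (card I) * \<tau>\<^sup>2 / (32 * (Kq * B)\<^sup>2))))"
    and good: "\<And>\<omega> f g. \<omega> \<in> space M - E \<Longrightarrow> f \<in> features \<Longrightarrow> g \<in> features \<Longrightarrow>
      \<bar>(\<Sum>i\<in>I. f (Z i \<omega>) * g (Z i \<omega>)) / real (card I) - (\<integral>z. f z * g z \<partial>P)\<bar> \<le> \<tau>"
    using M.product_deviation_event[OF indep_sub[OF I(1)] fin I(2) cp law features(1,3,4) L \<tau>] by blast
  have "N * \<tau>\<^sup>2 / (32 * (Kq * B)\<^sup>2) \<le> real (card I) * \<tau>\<^sup>2 / (32 * (Kq * B)\<^sup>2)"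
    using N by (intro divide_right_mono mult_right_mono) auto
  then have "(real (card features))\<^sup>2 * (2 * exp (- (real (card I) * \<tau>\<^sup>2 / (32 * (Kq * B)\<^sup>2))))
      \<le> (real (p + q + 2 * r))\<^sup>2 * (2 * exp (- (N * \<tau>\<^sup>2 / (32 * (Kq * B)\<^sup>2))))"
    using features(2) by (intro mult_mono power_mono) auto
  then have pE': "M.prob E \<le> (real (p + q + 2 * r))\<^sup>2 * (2 * exp (- (N * \<tau>\<^sup>2 / (32 * (Kq * B)\<^sup>2))))"
    using pE by linarith
  have fe: "i < p \<Longrightarrow> xi p (unitv i) \<in> features" "k < r \<Longrightarrow> xi p (u k) \<in> features"
    "j < q \<Longrightarrow> eta q (unitv j) \<in> features" "k < r \<Longrightarrow> eta q (v k) \<in> features" for i j k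
    by (auto simp: features_def)
  have "near p r \<tau> (ent (covx I \<omega>)) (ent SX) u \<and> near q r \<tau> (ent (covy I \<omega>)) (ent SY) v \<and>
      (\<forall>i<p. \<forall>j<q. \<bar>covxy I \<omega> $$ (i, j) - Sxy i j\<bar> \<le> \<tau>)" if \<omega>: "\<omega> \<in> space M - E" for \<omega>
  proof -
    note g = good[OF \<omega>]
    have x: "\<bar>bf p p w (ent (covx I \<omega>)) w' - bf p p w (ent SX) w'\<bar> \<le> \<tau>" if "xi p w \<in> features" "xi p w' \<in> features" for w w'
      using g[OF that] by (simp add: emp_features expectation_xi_xi)
    have y: "\<bar>bf q q w (ent (covy I \<omega>)) w' - bf q q w (ent SY) w'\<bar> \<le> \<tau>" if "eta q w \<in> features" "eta q w' \<in> features" for w w'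
      using g[OF that] by (simp add: emp_features expectation_eta_eta)
    have xy: "\<bar>bf p q w (ent (covxy I \<omega>)) w' - bf p q w (ent SXY) w'\<bar> \<le> \<tau>" if "xi p w \<in> features" "eta q w' \<in> features" for w w'
      using g[OF that] by (simp add: emp_features expectation_xi_eta)
    have mvu: "bf d d' (unitv i) A w = mv d' A w i" if "i < d" for d d' i A and w :: "nat \<Rightarrow> real"
      using that by (simp add: bf_def ip_unitv)
    have "near p r \<tau> (ent (covx I \<omega>)) (ent SX) u"
      unfolding near_def
    proof (intro conjI allI impI)
      fix i j assume "i < p" "j < p"
      then show "\<bar>ent (covx I \<omega>) i j - ent SX i j\<bar> \<le> \<tau>" using x[OF fe(1) fe(1), of i j] by (simp add: bf_unitv)
    next
      fix i k assume "i < p" "k < r"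
      then show "\<bar>mv p (ent (covx I \<omega>)) (u k) i - mv p (ent SX) (u k) i\<bar> \<le> \<tau>" using x[OF fe(1) fe(2), of i k] by (simp add: mvu)
    next
      fix k l assume "k < r" "l < r"
      then show "\<bar>bf p p (u k) (ent (covx I \<omega>)) (u l) - of_bool (k = l)\<bar> \<le> \<tau>" using x[OF fe(2) fe(2), of k l] by (simp add: u_orth)
    qed
    moreover have "near q r \<tau> (ent (covy I \<omega>)) (ent SY) v"
      unfolding near_def
    proof (intro conjI allI impI)
      fix i j assume "i < q" "j < q"
      then show "\<bar>ent (covy I \<omega>) i j - ent SY i j\<bar> \<le> \<tau>" using y[OF fe(3) fe(3), of i j] by (simp add: bf_unitv)
    next
      fix i k assume "i < q" "k < r"
      then show "\<bar>mv q (ent (covy I \<omega>)) (v k) i - mv q (ent SY) (v k) i\<bar> \<le> \<tau>" using y[OF fe(3) fe(4), of i k] by (simp add: mvu)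
    next
      fix k l assume "k < r" "l < r"
      then show "\<bar>bf q q (v k) (ent (covy I \<omega>)) (v l) - of_bool (k = l)\<bar> \<le> \<tau>" using y[OF fe(4) fe(4), of k l] by (simp add: v_orth)
    qed
    moreover have "\<bar>covxy I \<omega> $$ (i, j) - Sxy i j\<bar> \<le> \<tau>" if "i < p" "j < q" for i j
      using xy[OF fe(1) fe(3), of i j] that by (simp add: bf_def ip_unitv mv_unitv SXY_Sxy)
    ultimately show ?thesis by blast
  qed
  then show ?thesis using E pE' by (intro bexI[of _ E] conjI ballI) auto
qed

text \<open>\<open>near\<close> enters only through the diagonal entries, whose bound
  \<open>B + 1\<close> is the constant in the restricted eigenvalue loss.\<close>

lemma restricted_eigenvalue_good_event:
  assumes I: "I \<subseteq> {..<n}" "I \<noteq> {}" and N: "N \<le> real (card I)" and m: "2 \<le> m"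
  shows "\<exists>E\<in>M.events. M.prob E \<le> ((2 * real p) ^ m + (2 * real q) ^ m) * (2 * exp (- (N / (128 * B\<^sup>2 * Kq\<^sup>2)))) \<and>
    (\<forall>\<omega>\<in>space M - E. \<forall>\<tau>\<le>1. near p r \<tau> (ent (covx I \<omega>)) (ent SX) u \<longrightarrow> near q r \<tau> (ent (covy I \<omega>)) (ent SY) v \<longrightarrow>
      (\<forall>x. 1 / (2 * B) * ip p x x - (B + 1) / (real m - 1) * (l1 p x)\<^sup>2 \<le> bf p p x (ent (covx I \<omega>)) x) \<and>
      (\<forall>x. 1 / (2 * B) * ip q x x - (B + 1) / (real m - 1) * (l1 q x)\<^sup>2 \<le> bf q q x (ent (covy I \<omega>)) x))"
proof -
  have fin: "finite I" using I(1) finite_subset by blast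
  have cp: "\<And>i. i \<in> I \<Longrightarrow> distr M (pair_borel p q) (Z i) = P" using copies I(1) by auto
  let ?e = "2 * exp (- (real (card I) / (128 * B\<^sup>2 * Kq\<^sup>2)))"
  have lx: "ip p w w \<le> B * (\<integral>z. (xi p w z)\<^sup>2 \<partial>P)" for w
    using quadratic_bounds(1)[of w] by (simp add: power2_eq_square expectation_xi_xi)
  have ly: "ip q w w \<le> B * (\<integral>z. (eta q w z)\<^sup>2 \<partial>P)" for w
    using quadratic_bounds(3)[of w] by (simp add: power2_eq_square expectation_eta_eta)
  obtain E1 where E1: "E1 \<in> M.events" "M.prob E1 \<le> (2 * real p) ^ m * ?e"
    and g1: "\<And>\<omega> ls. \<omega> \<in> space M - E1 \<Longrightarrow> length ls = m \<Longrightarrow> set ls \<subseteq> {..<p} \<times> UNIV \<Longrightarrow>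
      1 / (2 * B) * ip p (signed_sum ls) (signed_sum ls) \<le> (\<Sum>i\<in>I. (xi p (signed_sum ls) (Z i \<omega>))\<^sup>2) / real (card I)"
    using M.restricted_eigenvalue_event[OF indep_sub[OF I(1)] fin I(2) cp law xi_borel xi_subexp Kq eigenvalues(1) lx, of m] by blast
  obtain E2 where E2: "E2 \<in> M.events" "M.prob E2 \<le> (2 * real q) ^ m * ?e"
    and g2: "\<And>\<omega> ls. \<omega> \<in> space M - E2 \<Longrightarrow> length ls = m \<Longrightarrow> set ls \<subseteq> {..<q} \<times> UNIV \<Longrightarrow>
      1 / (2 * B) * ip q (signed_sum ls) (signed_sum ls) \<le> (\<Sum>i\<in>I. (eta q (signed_sum ls) (Z i \<omega>))\<^sup>2) / real (card I)"
    using M.restricted_eigenvalue_event[OF indep_sub[OF I(1)] fin I(2) cp law eta_borel eta_subexp Kq eigenvalues(1) ly, of m] by blast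
  have "M.prob (E1 \<union> E2) \<le> M.prob E1 + M.prob E2" by (rule measure_Un_le[OF E1(1) E2(1)])
  also have "\<dots> \<le> ((2 * real p) ^ m + (2 * real q) ^ m) * ?e" using E1(2) E2(2) by (simp add: distrib_right)
  also have "\<dots> \<le> ((2 * real p) ^ m + (2 * real q) ^ m) * (2 * exp (- (N / (128 * B\<^sup>2 * Kq\<^sup>2))))"
    using N by (intro mult_left_mono) (auto intro!: divide_right_mono)
  finally have pE: "M.prob (E1 \<union> E2) \<le> ((2 * real p) ^ m + (2 * real q) ^ m) * (2 * exp (- (N / (128 * B\<^sup>2 * Kq\<^sup>2))))" .
  have c: "0 \<le> 1 / (2 * B)" using eigenvalues(1) by simp
  have REx: "1 / (2 * B) * ip p x x - (B + 1) / (real m - 1) * (l1 p x)\<^sup>2 \<le> bf p p x (ent (covx I \<omega>)) x"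
    if \<omega>: "\<omega> \<in> space M - (E1 \<union> E2)" and \<tau>: "\<tau> \<le> 1" and near: "near p r \<tau> (ent (covx I \<omega>)) (ent SX) u" for \<omega> \<tau> x
  proof (rule restricted_eigenvalue[OF _ m c])
    fix i assume i: "i < p"
    have "\<bar>ent (covx I \<omega>) i i - ent SX i i\<bar> \<le> \<tau>" using near i by (auto simp: near_def)
    then show "ent (covx I \<omega>) i i \<le> B + 1" using PX.S_entry[OF i i] \<tau> by linarith
  next
    fix ls :: "(nat \<times> bool) list" assume ls: "length ls = m" "set ls \<subseteq> {..<p} \<times> UNIV"
    show "1 / (2 * B) * ip p (signed_sum ls) (signed_sum ls) \<le> bf p p (signed_sum ls) (ent (covx I \<omega>)) (signed_sum ls)"
      using g1[OF _ ls, of \<omega>] \<omega> unfolding power2_eq_square emp_features by blast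
  qed (simp add: emp_cov_def mult.commute)
  have REy: "1 / (2 * B) * ip q x x - (B + 1) / (real m - 1) * (l1 q x)\<^sup>2 \<le> bf q q x (ent (covy I \<omega>)) x"
    if \<omega>: "\<omega> \<in> space M - (E1 \<union> E2)" and \<tau>: "\<tau> \<le> 1" and near: "near q r \<tau> (ent (covy I \<omega>)) (ent SY) v" for \<omega> \<tau> x
  proof (rule restricted_eigenvalue[OF _ m c])
    fix i assume i: "i < q"
    have "\<bar>ent (covy I \<omega>) i i - ent SY i i\<bar> \<le> \<tau>" using near i by (auto simp: near_def)
    then show "ent (covy I \<omega>) i i \<le> B + 1" using PY.S_entry[OF i i] \<tau> by linarith
  next
    fix ls :: "(nat \<times> bool) list" assume ls: "length ls = m" "set ls \<subseteq> {..<q} \<times> UNIV"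
    show "1 / (2 * B) * ip q (signed_sum ls) (signed_sum ls) \<le> bf q q (signed_sum ls) (ent (covy I \<omega>)) (signed_sum ls)"
      using g2[OF _ ls, of \<omega>] \<omega> unfolding power2_eq_square emp_features by blast
  qed (simp add: emp_cov_def mult.commute)
  show ?thesis using E1(1) E2(1) pE REx REy by (intro bexI[of _ "E1 \<union> E2"] conjI ballI allI impI) auto
qed

lemma unitv_norm: "i < d \<Longrightarrow> ip d (unitv i) (unitv i) \<le> B"
  using B1 by (simp add: ip_unitv) (simp add: unitv_def)

lemma subexp_xi_eta: "ip p w w \<le> B \<Longrightarrow> ip q w' w' \<le> B \<Longrightarrow> subexp P (Kq * B) (\<lambda>z. xi p w z * eta q w' z)"
  using eigenvalues(1) Kq by (intro subexp_product xi_subexp eta_subexp xi_borel eta_borel) auto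

lemma measurable_pair_coordinates:
  "k < p \<Longrightarrow> (\<lambda>w. fst (w (0::nat)) $ k) \<in> borel_measurable (PiM {0} (\<lambda>_. pair_borel p q))"
  "k < q \<Longrightarrow> (\<lambda>w. snd (w (0::nat)) $ k) \<in> borel_measurable (PiM {0} (\<lambda>_. pair_borel p q))"
proof -
  have c: "(\<lambda>w. w (0::nat)) \<in> PiM {0} (\<lambda>_. pair_borel p q) \<rightarrow>\<^sub>M pair_borel p q"
    by (rule measurable_component_singleton) simp
  show "k < p \<Longrightarrow> (\<lambda>w. fst (w (0::nat)) $ k) \<in> borel_measurable (PiM {0} (\<lambda>_. pair_borel p q))"
    by (rule measurable_compose[OF measurable_compose[OF c measurable_fst] measurable_vec_coordinate])
  show "k < q \<Longrightarrow> (\<lambda>w. snd (w (0::nat)) $ k) \<in> borel_measurable (PiM {0} (\<lambda>_. pair_borel p q))"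
    by (rule measurable_compose[OF measurable_compose[OF c measurable_snd] measurable_vec_coordinate])
qed

text \<open>A third instead of a half because of rounding: for \<open>n = 3\<close> the first half
  has a single element.\<close>

lemma halves: "half0 n \<inter> half1 n = {}" "half0 n \<subseteq> {..<n}" "half1 n \<subseteq> {..<n}"
  "2 \<le> n \<Longrightarrow> half0 n \<noteq> {}" "2 \<le> n \<Longrightarrow> half1 n \<noteq> {}"
  "2 \<le> n \<Longrightarrow> real n / 3 \<le> real (card (half0 n))" "2 \<le> n \<Longrightarrow> real n / 3 \<le> real (card (half1 n))"
proof -
  show "half0 n \<inter> half1 n = {}" "half0 n \<subseteq> {..<n}" "half1 n \<subseteq> {..<n}"
    by (auto simp: half0_def half1_def)
  assume n: "2 \<le> n"
  have "n \<le> 3 * (n div 2)" "n \<le> 3 * (n - n div 2)" "n div 2 \<noteq> 0" "n div 2 < n" using n by presburger+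
  then show "half0 n \<noteq> {}" "half1 n \<noteq> {}"
    "real n / 3 \<le> real (card (half0 n))" "real n / 3 \<le> real (card (half1 n))"
    by (auto simp: half0_def half1_def lessThan_empty_iff simp del: of_nat_diff)
qed

text \<open>The halves have disjoint index sets, so they are independent, and \<open>W\<close> is
  measurable with respect to the first.\<close>

lemma independent_of_second_half:
  assumes "W \<in> sample_algebra M p q (half0 n) X Y \<rightarrow>\<^sub>M R"
    and "R = PiM {0::nat} (\<lambda>_. pair_borel p q)"
  shows "M.indep_var R W (PiM (half1 n) (\<lambda>_. pair_borel p q)) (\<lambda>\<omega>. \<lambda>i\<in>half1 n. Z i \<omega>)"
proof -
  have "M.indep_var (PiM (half0 n) (\<lambda>_. pair_borel p q)) (\<lambda>\<omega>. \<lambda>i\<in>half0 n. Z i \<omega>)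
      (PiM (half1 n) (\<lambda>_. pair_borel p q)) (\<lambda>\<omega>. \<lambda>i\<in>half1 n. Z i \<omega>)"
    by (rule M.indep_var_restrict[OF indep halves(1-3)])
  from M.indep_var_sub_algebra[OF this] assms show ?thesis by (simp add: sample_algebra_def)
qed

lemma direction_event_x:
  assumes b0: "b0 \<in> sample_algebra M p q (half0 n) X Y \<rightarrow>\<^sub>M vec_borel q"
    and unit: "\<And>\<omega>. \<omega> \<in> space M \<Longrightarrow> b0 \<omega> \<in> carrier_vec q \<and> l2_norm (b0 \<omega>) = 1"
    and n: "2 \<le> n" and \<tau>: "0 < \<tau>" "\<tau> \<le> 8 * (Kq * B)"
  shows "\<exists>E\<in>M.events. M.prob E \<le> real p * (2 * exp (- (real n / 3 * \<tau>\<^sup>2 / (32 * (Kq * B)\<^sup>2)))) \<and>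
    (\<forall>\<omega>\<in>space M - E. \<forall>i<p. \<bar>(covxy (half1 n) \<omega> *\<^sub>v b0 \<omega>) $ i - mv q Sxy (($) (b0 \<omega>)) i\<bar> \<le> \<tau>)"
proof -
  let ?S = "PiM {0::nat} (\<lambda>_. pair_borel p q)"
  let ?I = "half1 n"
  \<comment> \<open>The independence of two variables is expressible only for variables of the same type.\<close>
  define W where "W = (\<lambda>\<omega>. \<lambda>i\<in>{0::nat}. (0\<^sub>v p :: real Matrix.vec, b0 \<omega>))"
  have W: "W \<in> sample_algebra M p q (half0 n) X Y \<rightarrow>\<^sub>M ?S"
    unfolding W_def by (intro measurable_restrict measurable_Pair b0 measurable_const) simp
  define U where "U = {w \<in> space ?S. ip q (($) (snd (w 0))) (($) (snd (w 0))) = 1}"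
  have ipm: "(\<lambda>w. ip q (($) (snd (w (0::nat)))) (($) (snd (w 0)))) \<in> borel_measurable ?S"
    unfolding ip_def by (intro borel_measurable_sum borel_measurable_times measurable_pair_coordinates) auto
  then have U: "U \<in> sets ?S" unfolding U_def by measurable
  have sp: "space M = space (sample_algebra M p q (half0 n) X Y)" by (simp add: sample_algebra_def)
  have WU: "W \<omega> \<in> U" if "\<omega> \<in> space M" for \<omega>
    using measurable_space[OF W, of \<omega>] that unit[OF that] l2_norm_ip[of "b0 \<omega>" q]
    by (simp add: U_def W_def sp)
  have fin: "finite ?I" by (simp add: half1_def)
  have cp: "\<And>i. i \<in> ?I \<Longrightarrow> distr M (pair_borel p q) (Z i) = P" using copies halves(3) by auto
  have L: "0 < Kq * B" using Kq eigenvalues(1) by simp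
  have dir: "(\<lambda>(w, z). eta q (($) (snd (w (0::nat)))) z) \<in> borel_measurable (?S \<Otimes>\<^sub>M pair_borel p q)"
    unfolding eta_def ip_def case_prod_beta
    by (intro borel_measurable_sum borel_measurable_times measurable_compose[OF measurable_fst measurable_pair_coordinates(2)]
        measurable_compose[OF measurable_compose[OF measurable_snd measurable_snd] measurable_vec_coordinate]) auto
  have mean1: "(\<lambda>w. bf p q (unitv j) (ent SXY) (($) (snd (w (0::nat))))) \<in> borel_measurable ?S" for j
    unfolding bf_sum by (intro borel_measurable_sum borel_measurable_times borel_measurable_const measurable_pair_coordinates) auto
  have sg: "subexp P (Kq * B) (\<lambda>z. xi p (unitv j) z * eta q (($) (snd (w 0))) z)" if "j < p" "w \<in> U" for j w
    using that B1 unitv_norm by (intro subexp_xi_eta) (auto simp: U_def)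
  obtain E where E: "E \<in> M.events"
    and pE: "M.prob E \<le> real p * (2 * exp (- (real (card ?I) * \<tau>\<^sup>2 / (32 * (Kq * B)\<^sup>2))))"
    and good: "\<And>\<omega> j. \<omega> \<in> space M - E \<Longrightarrow> j < p \<Longrightarrow>
      \<bar>(\<Sum>i\<in>?I. xi p (unitv j) (Z i \<omega>) * eta q (($) (snd (W \<omega> 0))) (Z i \<omega>)) / real (card ?I)
        - bf p q (unitv j) (ent SXY) (($) (snd (W \<omega> 0)))\<bar> \<le> \<tau>"
  proof -
    have "\<exists>E\<in>M.events. M.prob E \<le> real p * (2 * exp (- (real (card ?I) * \<tau>\<^sup>2 / (32 * (Kq * B)\<^sup>2)))) \<and> 
      (\<forall>\<omega>\<in>space M - E. \<forall>j<p. \<bar>(\<Sum>i\<in>?I. xi p (unitv j) (Z i \<omega>) * eta q (($) (snd (W \<omega> 0))) (Z i \<omega>)) / real (card ?I) - bf p q (unitv j) (ent SXY) (($) (snd (W \<omega> 0)))\<bar> \<le> \<tau>)"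
    proof (rule M.independent_direction_event[where I = ?I and Z = Z and N = "pair_borel p q" and P = P and S = ?S and W = W and U = U
        and L = "Kq * B" and \<tau> = \<tau> and d = p and coord = "\<lambda>j. xi p (unitv j)" and dir = "\<lambda>w z. eta q (($) (snd (w 0))) z"
        and mean = "\<lambda>j w. bf p q (unitv j) (ent SXY) (($) (snd (w 0)))"])
      show "M.indep_vars (\<lambda>_. pair_borel p q) Z ?I" by (rule indep_sub[OF halves(3)])
      show "M.indep_var ?S W (PiM ?I (\<lambda>_. pair_borel p q)) (\<lambda>\<omega>. \<lambda>i\<in>?I. Z i \<omega>)"
        by (rule independent_of_second_half[OF W refl])
      show "bf p q (unitv j) (ent SXY) (($) (snd (w 0))) = (\<integral>z. xi p (unitv j) z * eta q (($) (snd (w 0))) z \<partial>P)" if "j < p" "w \<in> U" for j w by (rule expectation_xi_eta[symmetric])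
      show "xi p (unitv j) \<in> borel_measurable (pair_borel p q)" for j by (rule xi_measurable)
      show "(\<lambda>w. bf p q (unitv j) (ent SXY) (($) (snd (w 0)))) \<in> borel_measurable ?S" for j by (rule mean1)
    qed (fact fin halves(5)[OF n] cp law U WU dir sg L \<tau>)+
    then show thesis using that by blast
  qed
  have "real n / 3 * \<tau>\<^sup>2 / (32 * (Kq * B)\<^sup>2) \<le> real (card ?I) * \<tau>\<^sup>2 / (32 * (Kq * B)\<^sup>2)"
    using halves(7)[OF n] by (intro divide_right_mono mult_right_mono) auto
  then have "real p * (2 * exp (- (real (card ?I) * \<tau>\<^sup>2 / (32 * (Kq * B)\<^sup>2))))
      \<le> real p * (2 * exp (- (real n / 3 * \<tau>\<^sup>2 / (32 * (Kq * B)\<^sup>2))))" by (intro mult_left_mono) auto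
  then have pE': "M.prob E \<le> real p * (2 * exp (- (real n / 3 * \<tau>\<^sup>2 / (32 * (Kq * B)\<^sup>2))))" using pE by linarith
  have "\<bar>(covxy ?I \<omega> *\<^sub>v b0 \<omega>) $ i - mv q Sxy (($) (b0 \<omega>)) i\<bar> \<le> \<tau>" if \<omega>: "\<omega> \<in> space M - E" and i: "i < p" for \<omega> i
  proof -
    have bc: "b0 \<omega> \<in> carrier_vec q" using unit \<omega> by blast
    have a: "(covxy ?I \<omega> *\<^sub>v b0 \<omega>) $ i = bf p q (unitv i) (ent (covxy ?I \<omega>)) (($) (b0 \<omega>))"
      unfolding mult_mat_vec_mv[OF emp_cov_carrier bc i] using i by (simp add: bf_def ip_unitv)
    have "mv q Sxy (($) (b0 \<omega>)) i = mv q (ent SXY) (($) (b0 \<omega>)) i"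
      unfolding mv_def using i by (intro sum.cong) (auto simp: SXY_Sxy)
    then have b: "mv q Sxy (($) (b0 \<omega>)) i = bf p q (unitv i) (ent SXY) (($) (b0 \<omega>))"
      using i by (simp add: bf_def ip_unitv)
    show ?thesis using good[OF \<omega> i] unfolding a b emp_features by (simp add: W_def)
  qed
  then show ?thesis using E pE' by (intro bexI[of _ E] conjI ballI allI impI) auto
qed

lemma direction_event_y:
  assumes a0: "a0 \<in> sample_algebra M p q (half0 n) X Y \<rightarrow>\<^sub>M vec_borel p"
    and unit: "\<And>\<omega>. \<omega> \<in> space M \<Longrightarrow> a0 \<omega> \<in> carrier_vec p \<and> l2_norm (a0 \<omega>) = 1"
    and n: "2 \<le> n" and \<tau>: "0 < \<tau>" "\<tau> \<le> 8 * (Kq * B)"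
  shows "\<exists>E\<in>M.events. M.prob E \<le> real q * (2 * exp (- (real n / 3 * \<tau>\<^sup>2 / (32 * (Kq * B)\<^sup>2)))) \<and>
    (\<forall>\<omega>\<in>space M - E. \<forall>j<q. \<bar>((covxy (half1 n) \<omega>)\<^sup>T *\<^sub>v a0 \<omega>) $ j - mv p (\<lambda>j i. Sxy i j) (($) (a0 \<omega>)) j\<bar> \<le> \<tau>)"
proof -
  let ?S = "PiM {0::nat} (\<lambda>_. pair_borel p q)"
  let ?I = "half1 n"
  define W where "W = (\<lambda>\<omega>. \<lambda>i\<in>{0::nat}. (a0 \<omega>, 0\<^sub>v q :: real Matrix.vec))"
  have W: "W \<in> sample_algebra M p q (half0 n) X Y \<rightarrow>\<^sub>M ?S"
    unfolding W_def by (intro measurable_restrict measurable_Pair a0 measurable_const) simp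
  define U where "U = {w \<in> space ?S. ip p (($) (fst (w 0))) (($) (fst (w 0))) = 1}"
  have ipm: "(\<lambda>w. ip p (($) (fst (w (0::nat)))) (($) (fst (w 0)))) \<in> borel_measurable ?S"
    unfolding ip_def by (intro borel_measurable_sum borel_measurable_times measurable_pair_coordinates) auto
  then have U: "U \<in> sets ?S" unfolding U_def by measurable
  have sp: "space M = space (sample_algebra M p q (half0 n) X Y)" by (simp add: sample_algebra_def)
  have WU: "W \<omega> \<in> U" if "\<omega> \<in> space M" for \<omega>
    using measurable_space[OF W, of \<omega>] that unit[OF that] l2_norm_ip[of "a0 \<omega>" p]
    by (simp add: U_def W_def sp)
  have fin: "finite ?I" by (simp add: half1_def)
  have cp: "\<And>i. i \<in> ?I \<Longrightarrow> distr M (pair_borel p q) (Z i) = P" using copies halves(3) by auto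
  have L: "0 < Kq * B" using Kq eigenvalues(1) by simp
  have dir: "(\<lambda>(w, z). xi p (($) (fst (w (0::nat)))) z) \<in> borel_measurable (?S \<Otimes>\<^sub>M pair_borel p q)"
    unfolding xi_def ip_def case_prod_beta
    by (intro borel_measurable_sum borel_measurable_times measurable_compose[OF measurable_fst measurable_pair_coordinates(1)]
        measurable_compose[OF measurable_compose[OF measurable_snd measurable_fst] measurable_vec_coordinate]) auto
  have mean1: "(\<lambda>w. bf p q (($) (fst (w (0::nat)))) (ent SXY) (unitv j)) \<in> borel_measurable ?S" for j
    unfolding bf_sum by (intro borel_measurable_sum borel_measurable_times borel_measurable_const measurable_pair_coordinates) auto
  have mean2: "bf p q w (ent SXY) (unitv j) = (\<integral>z. eta q (unitv j) z * xi p w z \<partial>P)" for w j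
    using expectation_xi_eta[of w "unitv j"] by (simp add: mult.commute)
  have sg: "subexp P (Kq * B) (\<lambda>z. eta q (unitv j) z * xi p (($) (fst (w 0))) z)" if "j < q" "w \<in> U" for j w
    using subexp_xi_eta[of "($) (fst (w 0))" "unitv j"] that B1 unitv_norm[of j q] by (simp add: U_def mult.commute)
  obtain E where E: "E \<in> M.events"
    and pE: "M.prob E \<le> real q * (2 * exp (- (real (card ?I) * \<tau>\<^sup>2 / (32 * (Kq * B)\<^sup>2))))"
    and good: "\<And>\<omega> j. \<omega> \<in> space M - E \<Longrightarrow> j < q \<Longrightarrow>
      \<bar>(\<Sum>i\<in>?I. eta q (unitv j) (Z i \<omega>) * xi p (($) (fst (W \<omega> 0))) (Z i \<omega>)) / real (card ?I)
        - bf p q (($) (fst (W \<omega> 0))) (ent SXY) (unitv j)\<bar> \<le> \<tau>"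
  proof -
    have "\<exists>E\<in>M.events. M.prob E \<le> real q * (2 * exp (- (real (card ?I) * \<tau>\<^sup>2 / (32 * (Kq * B)\<^sup>2)))) \<and> 
      (\<forall>\<omega>\<in>space M - E. \<forall>j<q. \<bar>(\<Sum>i\<in>?I. eta q (unitv j) (Z i \<omega>) * xi p (($) (fst (W \<omega> 0))) (Z i \<omega>)) / real (card ?I) - bf p q (($) (fst (W \<omega> 0))) (ent SXY) (unitv j)\<bar> \<le> \<tau>)"
    proof (rule M.independent_direction_event[where I = ?I and Z = Z and N = "pair_borel p q" and P = P and S = ?S and W = W and U = U
        and L = "Kq * B" and \<tau> = \<tau> and d = q and coord = "\<lambda>j. eta q (unitv j)" and dir = "\<lambda>w z. xi p (($) (fst (w 0))) z"
        and mean = "\<lambda>j w. bf p q (($) (fst (w 0))) (ent SXY) (unitv j)"])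
      show "M.indep_vars (\<lambda>_. pair_borel p q) Z ?I" by (rule indep_sub[OF halves(3)])
      show "M.indep_var ?S W (PiM ?I (\<lambda>_. pair_borel p q)) (\<lambda>\<omega>. \<lambda>i\<in>?I. Z i \<omega>)"
        by (rule independent_of_second_half[OF W refl])
      show "bf p q (($) (fst (w 0))) (ent SXY) (unitv j) = (\<integral>z. eta q (unitv j) z * xi p (($) (fst (w 0))) z \<partial>P)" if "j < q" "w \<in> U" for j w by (rule mean2)
      show "eta q (unitv j) \<in> borel_measurable (pair_borel p q)" for j by (rule eta_measurable)
      show "(\<lambda>w. bf p q (($) (fst (w 0))) (ent SXY) (unitv j)) \<in> borel_measurable ?S" for j by (rule mean1)
    qed (fact fin halves(5)[OF n] cp law U WU dir sg L \<tau>)+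
    then show thesis using that by blast
  qed
  have "real n / 3 * \<tau>\<^sup>2 / (32 * (Kq * B)\<^sup>2) \<le> real (card ?I) * \<tau>\<^sup>2 / (32 * (Kq * B)\<^sup>2)"
    using halves(7)[OF n] by (intro divide_right_mono mult_right_mono) auto
  then have "real q * (2 * exp (- (real (card ?I) * \<tau>\<^sup>2 / (32 * (Kq * B)\<^sup>2))))
      \<le> real q * (2 * exp (- (real n / 3 * \<tau>\<^sup>2 / (32 * (Kq * B)\<^sup>2))))" by (intro mult_left_mono) auto
  then have pE': "M.prob E \<le> real q * (2 * exp (- (real n / 3 * \<tau>\<^sup>2 / (32 * (Kq * B)\<^sup>2))))" using pE by linarith
  have "\<bar>((covxy ?I \<omega>)\<^sup>T *\<^sub>v a0 \<omega>) $ j - mv p (\<lambda>j i. Sxy i j) (($) (a0 \<omega>)) j\<bar> \<le> \<tau>"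
    if \<omega>: "\<omega> \<in> space M - E" and j: "j < q" for \<omega> j
  proof -
    have ac: "a0 \<omega> \<in> carrier_vec p" using unit \<omega> by blast
    have cT: "(covxy ?I \<omega>)\<^sup>T \<in> carrier_mat q p" by simp
    have bfu: "bf p q x A (unitv j) = (\<Sum>i<p. A i j * x i)" for x A
      using j by (simp add: bf_def mv_unitv ip_def mult.commute)
    have a: "((covxy ?I \<omega>)\<^sup>T *\<^sub>v a0 \<omega>) $ j = bf p q (($) (a0 \<omega>)) (ent (covxy ?I \<omega>)) (unitv j)"
      unfolding mult_mat_vec_mv[OF cT ac j] bfu mv_def using j
      by (intro sum.cong) (auto simp: emp_cov_def)
    have b: "mv p (\<lambda>j i. Sxy i j) (($) (a0 \<omega>)) j = bf p q (($) (a0 \<omega>)) (ent SXY) (unitv j)"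
      unfolding bfu mv_def using j by (intro sum.cong) (auto simp: SXY_Sxy)
    have c: "(\<Sum>i\<in>?I. eta q (unitv j) (Z i \<omega>) * xi p w (Z i \<omega>)) / real (card ?I) = bf p q w (ent (covxy ?I \<omega>)) (unitv j)" for w
      using emp_features(3)[of w \<omega> "unitv j" ?I] by (simp add: mult.commute)
    show ?thesis using good[OF \<omega> j] unfolding a b c by (simp add: W_def)
  qed
  then show ?thesis using E pE' by (intro bexI[of _ E] conjI ballI allI impI) auto
qed

text \<open>A zero first direction would violate the normalization. This is the source of
  \<open>1 \<le> s\<close>.\<close>

lemma row_sparsity_pos: "1 \<le> row_sparsity U"
proof -
  have r0: "0 < r" using r1 by simp
  have "Jx \<noteq> {}"
  proof
    assume "Jx = {}"
    then have "\<forall>i<p. u 0 i = 0" using supports(1)[OF r0] by blast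
    then have "bf p p (u 0) (ent SX) (u 0) = 0" by (simp add: bf_sum)
    then show False using u_orth[OF r0 r0] by simp
  qed
  then show ?thesis by (simp add: Suc_le_eq card_gt_0_iff Jx_def row_sparsity_card)
qed

text \<open>Seven bad events are united: the covariances of both halves and of the full sample
  (factor 3), the restricted eigenvalues of both halves (factor 2), and the two directions
  independent of the second half. The full sample serves only for normalization, where upper bounds
  on the error suffice.\<close>

lemma colar_event:
  fixes \<theta> t C C' \<nu> s c Ks e a \<gamma> Rb Kc e1 e2 :: real and m :: nat
  assumes c_def: "c = 1 / (2 * B)"
    and Ks_def: "Ks = 2 / c * (4 / \<epsilon>\<^sub>0) * (8 * real r * (t / C) + 3 / c)"
    and e_def: "e = Ks * (s * (C * \<theta>))" and a_def: "a = 3 * C' / c" and \<gamma>_def: "\<gamma> = \<epsilon>\<^sub>0 / (5 * sqrt B)"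
    and Rb_def: "Rb = (if r = 1 then 0 else real r * (3 * B * sqrt B * e))"
    and Kc_def: "Kc = 2 / \<gamma> * (a + B * t + sqrt B * sqrt (B + 1) * a + 3 * sqrt B)"
    and e1_def: "e1 = exp (- (real n / 3 * (t * \<theta>)\<^sup>2 / (32 * (Kq * B)\<^sup>2)))"
    and e2_def: "e2 = exp (- (real n / 3 / (128 * B\<^sup>2 * Kq\<^sup>2)))"
    and colar: "modified_colar M p q n X Y (C * \<theta>) (C' * \<theta>) al be"
    and s: "s = real (row_sparsity U + row_sparsity V)" and n: "2 \<le> n" and m: "2 \<le> m" and \<nu>: "(B + 1) / (real m - 1) \<le> \<nu>"
    and C: "2 * t * (1 + real r * (2 * sqrt B + 1)) \<le> C" and C': "4 * t * (1 + real r * sqrt B) \<le> C'"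
    and pos: "0 < \<theta>" "0 < t" "0 < C" and \<tau>: "t * \<theta> \<le> 8 * (Kq * B)"
    and small: "t * \<theta> \<le> 1 / 4" "8 * real r * (t * \<theta>) \<le> \<epsilon>\<^sub>0"
      "32 * (\<nu> * (c + (B + 1))) * s\<^sup>2 \<le> c\<^sup>2 / 2" "2 * (\<nu> * (c + (B + 1))) * (16 * real r * (t / C))\<^sup>2 \<le> 1"
      "8 * B * e \<le> 1" "3 * B * sqrt B * e \<le> 1 / (5 * sqrt B)" "32 * \<nu> * s \<le> c" "16 * s * (t * \<theta>) \<le> 1"
      "2 * (sqrt B * (t * \<theta>) + sqrt (B + 1) * (a * (sqrt s * \<theta>)) + 2 * Rb) \<le> \<gamma>"
  shows "\<exists>E\<in>M.events. M.prob E \<le> 3 * ((real (p + q + 2 * r))\<^sup>2 * (2 * e1))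
      + 2 * (((2 * real p) ^ m + (2 * real q) ^ m) * (2 * e2)) + (real p * (2 * e1) + real q * (2 * e1)) \<and>
    (\<forall>\<omega>\<in>space M - E.
      sign_dist l2_norm (al \<omega>) (col U 0) + sign_dist l2_norm (be \<omega>) (col V 0) \<le> 2 * (Kc * (sqrt s * \<theta> + Rb)) \<and>
      sign_dist l1_norm (al \<omega>) (col U 0) + sign_dist l1_norm (be \<omega>) (col V 0) \<le> 8 * sqrt s * (Kc * (sqrt s * \<theta> + Rb)))"
proof -
  obtain F a0 b0 where
    a0: "a0 \<in> sample_algebra M p q (half0 n) X Y \<rightarrow>\<^sub>M vec_borel p" and
    b0: "b0 \<in> sample_algebra M p q (half0 n) X Y \<rightarrow>\<^sub>M vec_borel q" and
    est: "\<And>\<omega>. \<omega> \<in> space M \<Longrightarrow> colar_stage1 (covx (half0 n) \<omega>) (covy (half0 n) \<omega>) (covxy (half0 n) \<omega>) (C * \<theta>) (F \<omega>) \<and>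
      first_singular_vectors (F \<omega>) (a0 \<omega>) (b0 \<omega>) \<and>
      (\<exists>xt. colar_stage2 (covx (half1 n) \<omega>) (covxy (half1 n) \<omega>) (C' * \<theta>) (b0 \<omega>) xt \<and> al \<omega> = colar_stage3 (covx {..<n} \<omega>) xt) \<and>
      (\<exists>yt. colar_stage2 (covy (half1 n) \<omega>) ((covxy (half1 n) \<omega>)\<^sup>T) (C' * \<theta>) (a0 \<omega>) yt \<and> be \<omega> = colar_stage3 (covy {..<n} \<omega>) yt)"
    using colar unfolding modified_colar_def Let_def by blast
  have unit: "a0 \<omega> \<in> carrier_vec p \<and> l2_norm (a0 \<omega>) = 1" "b0 \<omega> \<in> carrier_vec q \<and> l2_norm (b0 \<omega>) = 1" if "\<omega> \<in> space M" for \<omega>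
  proof -
    have "a0 \<omega> \<in> carrier_vec p" using measurable_space[OF a0, of \<omega>] that by (simp add: sample_algebra_def)
    moreover have "b0 \<omega> \<in> carrier_vec q" using measurable_space[OF b0, of \<omega>] that by (simp add: sample_algebra_def)
    moreover have "l2_norm (a0 \<omega>) = 1" "l2_norm (b0 \<omega>) = 1"
      using est[OF that] unfolding first_singular_vectors_def singular_triple_def by blast+
    ultimately show "a0 \<omega> \<in> carrier_vec p \<and> l2_norm (a0 \<omega>) = 1" "b0 \<omega> \<in> carrier_vec q \<and> l2_norm (b0 \<omega>) = 1" by auto
  qed
  have t0: "0 < t * \<theta>" using pos by simp
  have nn: "{..<n} \<noteq> {}" "real n / 3 \<le> real (card {..<n})" using n by (auto simp: lessThan_empty_iff)
  obtain E0 where E0: "E0 \<in> M.events" "M.prob E0 \<le> (real (p + q + 2 * r))\<^sup>2 * (2 * e1)"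
    and g0: "\<And>\<omega>. \<omega> \<in> space M - E0 \<Longrightarrow> near p r (t * \<theta>) (ent (covx (half0 n) \<omega>)) (ent SX) u \<and> near q r (t * \<theta>) (ent (covy (half0 n) \<omega>)) (ent SY) v \<and>
      (\<forall>i<p. \<forall>j<q. \<bar>covxy (half0 n) \<omega> $$ (i, j) - Sxy i j\<bar> \<le> t * \<theta>)"
    using near_event[OF halves(2) halves(4)[OF n] halves(6)[OF n] t0 \<tau>] unfolding e1_def by blast
  obtain E1 where E1: "E1 \<in> M.events" "M.prob E1 \<le> (real (p + q + 2 * r))\<^sup>2 * (2 * e1)"
    and g1: "\<And>\<omega>. \<omega> \<in> space M - E1 \<Longrightarrow> near p r (t * \<theta>) (ent (covx (half1 n) \<omega>)) (ent SX) u \<and> near q r (t * \<theta>) (ent (covy (half1 n) \<omega>)) (ent SY) v"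
    using near_event[OF halves(3) halves(5)[OF n] halves(7)[OF n] t0 \<tau>] unfolding e1_def by blast
  obtain E2 where E2: "E2 \<in> M.events" "M.prob E2 \<le> (real (p + q + 2 * r))\<^sup>2 * (2 * e1)"
    and g2: "\<And>\<omega>. \<omega> \<in> space M - E2 \<Longrightarrow> near p r (t * \<theta>) (ent (covx {..<n} \<omega>)) (ent SX) u \<and> near q r (t * \<theta>) (ent (covy {..<n} \<omega>)) (ent SY) v"
    using near_event[OF order_refl nn t0 \<tau>] unfolding e1_def by blast
  obtain E3 where E3: "E3 \<in> M.events" "M.prob E3 \<le> ((2 * real p) ^ m + (2 * real q) ^ m) * (2 * e2)"
    and g3: "\<And>\<omega> \<tau>. \<omega> \<in> space M - E3 \<Longrightarrow> \<tau> \<le> 1 \<Longrightarrow> near p r \<tau> (ent (covx (half0 n) \<omega>)) (ent SX) u \<Longrightarrow> near q r \<tau> (ent (covy (half0 n) \<omega>)) (ent SY) v \<Longrightarrow>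
      (\<forall>x. c * ip p x x - (B + 1) / (real m - 1) * (l1 p x)\<^sup>2 \<le> bf p p x (ent (covx (half0 n) \<omega>)) x) \<and>
      (\<forall>x. c * ip q x x - (B + 1) / (real m - 1) * (l1 q x)\<^sup>2 \<le> bf q q x (ent (covy (half0 n) \<omega>)) x)"
    using restricted_eigenvalue_good_event[OF halves(2) halves(4)[OF n] halves(6)[OF n] m] unfolding e2_def c_def by blast
  obtain E4 where E4: "E4 \<in> M.events" "M.prob E4 \<le> ((2 * real p) ^ m + (2 * real q) ^ m) * (2 * e2)"
    and g4: "\<And>\<omega> \<tau>. \<omega> \<in> space M - E4 \<Longrightarrow> \<tau> \<le> 1 \<Longrightarrow> near p r \<tau> (ent (covx (half1 n) \<omega>)) (ent SX) u \<Longrightarrow> near q r \<tau> (ent (covy (half1 n) \<omega>)) (ent SY) v \<Longrightarrow>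
      (\<forall>x. c * ip p x x - (B + 1) / (real m - 1) * (l1 p x)\<^sup>2 \<le> bf p p x (ent (covx (half1 n) \<omega>)) x) \<and>
      (\<forall>x. c * ip q x x - (B + 1) / (real m - 1) * (l1 q x)\<^sup>2 \<le> bf q q x (ent (covy (half1 n) \<omega>)) x)"
    using restricted_eigenvalue_good_event[OF halves(3) halves(5)[OF n] halves(7)[OF n] m] unfolding e2_def c_def by blast
  obtain E5 where E5: "E5 \<in> M.events" "M.prob E5 \<le> real p * (2 * e1)"
    and g5: "\<And>\<omega> i. \<omega> \<in> space M - E5 \<Longrightarrow> i < p \<Longrightarrow> \<bar>(covxy (half1 n) \<omega> *\<^sub>v b0 \<omega>) $ i - mv q Sxy (($) (b0 \<omega>)) i\<bar> \<le> t * \<theta>"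
    using direction_event_x[OF b0 unit(2) n t0 \<tau>] unfolding e1_def by blast
  obtain E6 where E6: "E6 \<in> M.events" "M.prob E6 \<le> real q * (2 * e1)"
    and g6: "\<And>\<omega> j. \<omega> \<in> space M - E6 \<Longrightarrow> j < q \<Longrightarrow> \<bar>((covxy (half1 n) \<omega>)\<^sup>T *\<^sub>v a0 \<omega>) $ j - mv p (\<lambda>j i. Sxy i j) (($) (a0 \<omega>)) j\<bar> \<le> t * \<theta>"
    using direction_event_y[OF a0 unit(1) n t0 \<tau>] unfolding e1_def by blast
  define E where "E = E0 \<union> (E1 \<union> (E2 \<union> (E3 \<union> (E4 \<union> (E5 \<union> E6)))))"
  have E: "E \<in> M.events" unfolding E_def by (intro sets.Un E0 E1 E2 E3 E4 E5 E6)
  have un: "M.prob (A \<union> A') \<le> x + y" if "A \<in> M.events" "A' \<in> M.events" "M.prob A \<le> x" "M.prob A' \<le> y" for A A' x y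
    using measure_Un_le[OF that(1,2)] that(3,4) by linarith
  let ?a = "(real (p + q + 2 * r))\<^sup>2 * (2 * e1)" and ?b = "((2 * real p) ^ m + (2 * real q) ^ m) * (2 * e2)"
  have "M.prob E \<le> ?a + (?a + (?a + (?b + (?b + (real p * (2 * e1) + real q * (2 * e1))))))"
    unfolding E_def by (intro un sets.Un E0 E1 E2 E3 E4 E5 E6)
  then have pE: "M.prob E \<le> 3 * ?a + 2 * ?b + (real p * (2 * e1) + real q * (2 * e1))" by linarith
  have r0: "0 < r" using r1 by simp
  have cardJ: "real (card Jx) \<le> s" "real (card Jy) \<le> s" by (simp_all add: s row_sparsity_card)
  have s1: "1 \<le> s" using row_sparsity_pos by (simp add: s)
  have m1: "0 < real m - 1" using m by simp
  have \<nu>0: "0 \<le> \<nu>" using \<nu> m1 B1 by (smt (verit) divide_nonneg_pos)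
  have c0: "0 < c" using B1 by (simp add: c_def)
  have gap': "\<epsilon>\<^sub>0 \<le> Lam 0 - L1" using gap(2) by (simp add: L1_def)
  have relax: "c * ip d x x - \<nu> * (l1 d x)\<^sup>2 \<le> y" if "c * ip d x x - (B + 1) / (real m - 1) * (l1 d x)\<^sup>2 \<le> y" for d x y
    using mult_right_mono[OF \<nu>, of "(l1 d x)\<^sup>2"] that by simp
  have uv: "col U 0 \<in> carrier_vec p" "\<And>i. i < p \<Longrightarrow> col U 0 $ i = u 0 i"
    and vv: "col V 0 \<in> carrier_vec q" "\<And>i. i < q \<Longrightarrow> col V 0 $ i = v 0 i"
    using UV_dim r0 by auto
  have bounds: "sign_dist l2_norm (al \<omega>) (col U 0) \<le> Kc * (sqrt s * \<theta> + Rb) \<and>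
      sign_dist l1_norm (al \<omega>) (col U 0) \<le> 4 * sqrt s * (Kc * (sqrt s * \<theta> + Rb)) \<and>
      sign_dist l2_norm (be \<omega>) (col V 0) \<le> Kc * (sqrt s * \<theta> + Rb) \<and>
      sign_dist l1_norm (be \<omega>) (col V 0) \<le> 4 * sqrt s * (Kc * (sqrt s * \<theta> + Rb))" if \<omega>: "\<omega> \<in> space M - E" for \<omega>
  proof -
    have \<omega>s: "\<omega> \<in> space M" "\<omega> \<in> space M - E0" "\<omega> \<in> space M - E1" "\<omega> \<in> space M - E2" "\<omega> \<in> space M - E3"
      "\<omega> \<in> space M - E4" "\<omega> \<in> space M - E5" "\<omega> \<in> space M - E6" using \<omega> by (auto simp: E_def)
    obtain xt yt where st1: "colar_stage1 (covx (half0 n) \<omega>) (covy (half0 n) \<omega>) (covxy (half0 n) \<omega>) (C * \<theta>) (F \<omega>)"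
      and sv: "first_singular_vectors (F \<omega>) (a0 \<omega>) (b0 \<omega>)"
      and sx: "colar_stage2 (covx (half1 n) \<omega>) (covxy (half1 n) \<omega>) (C' * \<theta>) (b0 \<omega>) xt" "al \<omega> = colar_stage3 (covx {..<n} \<omega>) xt"
      and sy: "colar_stage2 (covy (half1 n) \<omega>) ((covxy (half1 n) \<omega>)\<^sup>T) (C' * \<theta>) (a0 \<omega>) yt" "be \<omega> = colar_stage3 (covy {..<n} \<omega>) yt"
      using est[OF \<omega>s(1)] by blast
    have t1: "t * \<theta> \<le> 1" using small(1) by simp
    have n0: "near p r (t * \<theta>) (ent (covx (half0 n) \<omega>)) (ent SX) u" "near q r (t * \<theta>) (ent (covy (half0 n) \<omega>)) (ent SY) v"
      "\<And>i j. i < p \<Longrightarrow> j < q \<Longrightarrow> \<bar>covxy (half0 n) \<omega> $$ (i, j) - Sxy i j\<bar> \<le> t * \<theta>"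
      using g0[OF \<omega>s(2)] by auto
    have n1: "near p r (t * \<theta>) (ent (covx (half1 n) \<omega>)) (ent SX) u" "near q r (t * \<theta>) (ent (covy (half1 n) \<omega>)) (ent SY) v"
      using g1[OF \<omega>s(3)] by auto
    have n2: "near p r (t * \<theta>) (ent (covx {..<n} \<omega>)) (ent SX) u" "near q r (t * \<theta>) (ent (covy {..<n} \<omega>)) (ent SY) v"
      using g2[OF \<omega>s(4)] by auto
    have re0: "c * ip p x x - \<nu> * (l1 p x)\<^sup>2 \<le> bf p p x (ent (covx (half0 n) \<omega>)) x"
      "c * ip q y y - \<nu> * (l1 q y)\<^sup>2 \<le> bf q q y (ent (covy (half0 n) \<omega>)) y" for x y
      using g3[OF \<omega>s(5) t1 n0(1,2)] by (blast intro: relax)+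
    have re1: "c * ip p x x - \<nu> * (l1 p x)\<^sup>2 \<le> bf p p x (ent (covx (half1 n) \<omega>)) x"
      "c * ip q y y - \<nu> * (l1 q y)\<^sup>2 \<le> bf q q y (ent (covy (half1 n) \<omega>)) y" for x y
      using g4[OF \<omega>s(6) t1 n1] by (blast intro: relax)+
    note det = colar_deterministic[OF emp_cov_carrier emp_cov_psd n0(1) re0(1) emp_cov_carrier emp_cov_psd n0(2) re0(2)
        emp_cov_carrier n0(3) emp_cov_carrier emp_cov_psd n1(1) re1(1) emp_cov_carrier emp_cov_psd n1(2) re1(2) emp_cov_carrier
        emp_cov_carrier emp_cov_psd n2(1) emp_cov_carrier emp_cov_psd n2(2) st1 sv g5[OF \<omega>s(7)] g6[OF \<omega>s(8)] sx(1) sy(1)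
        uv vv cardJ s1 C C' gap(1) gap' pos(1,2) c0 \<nu>0 pos(3) small(1-4)
        small(5)[unfolded e_def Ks_def] small(6)[unfolded e_def Ks_def] small(7,8)
        small(9)[unfolded Rb_def e_def Ks_def a_def \<gamma>_def],
        folded Ks_def, folded e_def, folded a_def \<gamma>_def Rb_def, folded Kc_def]
    show ?thesis unfolding sx(2) sy(2) using det by blast
  qed
  have "sign_dist l2_norm (al \<omega>) (col U 0) + sign_dist l2_norm (be \<omega>) (col V 0) \<le> 2 * (Kc * (sqrt s * \<theta> + Rb)) \<and>
      sign_dist l1_norm (al \<omega>) (col U 0) + sign_dist l1_norm (be \<omega>) (col V 0) \<le> 8 * sqrt s * (Kc * (sqrt s * \<theta> + Rb))"
    if "\<omega> \<in> space M - E" for \<omega>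
    using bounds[OF that] by auto
  then show ?thesis using E pE by (intro bexI[of _ E] conjI ballI) auto
qed

end

text \<open>The factor 17 makes the exponent of \<open>e1\<close> at least \<open>3 log (p \<squnion> q)\<close>, which pays for a union bound over
  quadratically many features.\<close>

lemma failure_probability_bound:
  fixes \<theta> k B k0 :: real and p q r n m :: nat
  assumes d: "2 \<le> max p q" and \<theta>: "0 < \<theta>" "real n * \<theta>\<^sup>2 = ln (real (max p q))" and pos: "0 < k" "0 < B"
    and k0: "k0 = 1 / (384 * B\<^sup>2 * k\<^sup>2)" and m: "real m \<le> k0 / (4 * \<theta>\<^sup>2)"
    and e1: "e1 = exp (- (real n / 3 * (17 * (k * B) * \<theta>)\<^sup>2 / (32 * (k * B)\<^sup>2)))"
    and e2: "e2 = exp (- (real n / 3 / (128 * B\<^sup>2 * k\<^sup>2)))"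
  shows "3 * ((real (p + q + 2 * r))\<^sup>2 * (2 * e1)) + 2 * (((2 * real p) ^ m + (2 * real q) ^ m) * (2 * e2))
      + (real p * (2 * e1) + real q * (2 * e1))
    \<le> (6 * (2 + 2 * real r)\<^sup>2 + 4) / real (max p q) + 8 * exp (- (k0 / 2)) ^ n"
proof -
  define D where "D = real (max p q)"
  have D: "2 \<le> D" "real p \<le> D" "real q \<le> D" using d by (auto simp: D_def)
  have D0: "0 < D" "1 \<le> D" using D(1) by auto
  \<comment> \<open>289 is the square of 17, and 289 / 96 is just above 3.\<close>
  have "real n / 3 * (17 * (k * B) * \<theta>)\<^sup>2 / (32 * (k * B)\<^sup>2) = 289 / 96 * (real n * \<theta>\<^sup>2)"
    using pos by (simp add: power_mult_distrib)
  also have "\<dots> \<ge> 3 * ln D" using D0 unfolding \<theta>(2) D_def[symmetric] by simp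
  finally have "e1 \<le> exp (- (3 * ln D))" unfolding e1 by simp
  also have "exp (- (3 * ln D)) = 1 / D ^ 3"
  proof -
    have "exp (3 * ln D) = exp (ln D) ^ 3" using exp_of_nat_mult[of 3 "ln D"] by simp
    then show ?thesis using D0 by (simp add: exp_minus inverse_eq_divide)
  qed
  finally have e1_le: "e1 \<le> 1 / D ^ 3" .
  have e1_0: "0 \<le> e1" "0 \<le> e2" by (simp_all add: e1 e2)
  have "(real (p + q + 2 * r))\<^sup>2 \<le> ((2 + 2 * real r) * D)\<^sup>2"
  proof (rule power_mono)
    have "2 * real r \<le> 2 * real r * D" using D0 by (simp add: mult_le_cancel_left1)
    then show "real (p + q + 2 * r) \<le> (2 + 2 * real r) * D" using D by (simp add: algebra_simps)
  qed simp
  then have "(real (p + q + 2 * r))\<^sup>2 * (2 * e1) \<le> ((2 + 2 * real r) * D)\<^sup>2 * (2 * (1 / D ^ 3))"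
    using e1_le e1_0 by (intro mult_mono) auto
  also have "\<dots> = 2 * (2 + 2 * real r)\<^sup>2 / D"
    using D0 by (simp add: power_mult_distrib power2_eq_square power3_eq_cube)
  finally have A: "3 * ((real (p + q + 2 * r))\<^sup>2 * (2 * e1)) \<le> 6 * (2 + 2 * real r)\<^sup>2 / D" by simp
  have B': "x * (2 * e1) \<le> 2 / D" if "x \<le> D" for x
  proof -
    have "x * (2 * e1) \<le> D * (2 * (1 / D ^ 3))" using that e1_le e1_0 D0 by (intro mult_mono) auto
    also have "\<dots> = 2 / D / D" using D0 by (simp add: power3_eq_cube)
    also have "\<dots> \<le> 2 / D" using D0 by (simp add: divide_le_eq mult_le_cancel_left1)
    finally show ?thesis .
  qed
  have e2': "e2 = exp (- (k0 * real n))" unfolding e2 k0 by (simp add: field_simps)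
  have C: "(2 * x) ^ m * (2 * e2) \<le> 2 * exp (- (k0 / 2)) ^ n" if x: "0 \<le> x" "x \<le> D" for x
  proof -
    \<comment> \<open>This needs \<open>2 \<le> D\<close>. Each of the \<open>m\<close> factors then
      costs \<open>2 * ln D\<close> in the exponent, and the choice of \<open>m\<close> keeps the
      total at half of \<open>k0 * real n\<close>.\<close>
    have "2 * x \<le> D * D" using x D(1) by (intro mult_mono) auto
    then have "(2 * x) ^ m \<le> (D * D) ^ m" using x by (intro power_mono) auto
    also have "D * D = exp (2 * ln D)"
      unfolding mult_2 exp_add using D0 by simp
    also have "exp (2 * ln D) ^ m = exp (real m * (2 * ln D))"
      by (rule exp_of_nat_mult[symmetric])
    also have "real m * (2 * ln D) \<le> k0 / (4 * \<theta>\<^sup>2) * (2 * ln D)" using m D0 by (intro mult_right_mono) auto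
    also have "k0 / (4 * \<theta>\<^sup>2) * (2 * ln D) = k0 * real n / 2"
      using \<theta>(1) unfolding D_def \<theta>(2)[symmetric] by (simp add: field_simps)
    finally have "(2 * x) ^ m \<le> exp (k0 * real n / 2)" by simp
    then have "(2 * x) ^ m * (2 * e2) \<le> exp (k0 * real n / 2) * (2 * e2)" using e1_0 by (intro mult_right_mono) auto
    also have "\<dots> = 2 * exp (real n * (- (k0 / 2)))" unfolding e2' by (simp add: exp_add[symmetric] field_simps)
    finally show ?thesis by (simp only: exp_of_nat_mult)
  qed
  have "6 * (2 + 2 * real r)\<^sup>2 / D + (2 / D + 2 / D) = (6 * (2 + 2 * real r)\<^sup>2 + 4) / D" by (simp add: add_divide_distrib)
  then show ?thesis using A B'[OF D(2)] B'[OF D(3)] C[OF _ D(2)] C[OF _ D(3)] unfolding D_def[symmetric]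
    by (simp add: distrib_right)
qed

context cca_model
begin

text \<open>The free length \<open>m\<close> is fixed here, and the conditions of
  \<open>colar_event\<close> are reduced to bounds on \<open>\<theta>\<close> and
  \<open>s * \<theta>\<close> that hold eventually.\<close>

lemma colar_event_at_rate:
  fixes \<theta> t C C' s c Ks a \<gamma> \<rho> Kc k0 \<kappa> :: real
  assumes c_def: "c = 1 / (2 * B)" and t_def: "t = 17 * (Kq * B)"
    and Ks_def: "Ks = 2 / c * (4 / \<epsilon>\<^sub>0) * (8 * real r * (t / C) + 3 / c)"
    and a_def: "a = 3 * C' / c" and \<gamma>_def: "\<gamma> = \<epsilon>\<^sub>0 / (5 * sqrt B)"
    and \<rho>_def: "\<rho> = real r * (3 * B * sqrt B * (Ks * C))"
    and Kc_def: "Kc = 2 / \<gamma> * (a + B * t + sqrt B * sqrt (B + 1) * a + 3 * sqrt B)"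
    and k0_def: "k0 = 1 / (384 * B\<^sup>2 * Kq\<^sup>2)" and \<kappa>_def: "\<kappa> = (if r = 1 then 1 / 2 else 1)"
    and colar: "modified_colar M p q n X Y (C * \<theta>) (C' * \<theta>) al be"
    and s: "s = real (row_sparsity U + row_sparsity V)" and n: "2 \<le> n"
    and C: "2 * t * (1 + real r * (2 * sqrt B + 1)) \<le> C" and C': "4 * t * (1 + real r * sqrt B) \<le> C'"
    and \<theta>: "0 < \<theta>" "real n * \<theta>\<^sup>2 = ln (real (max p q))" and d: "2 \<le> max p q"
    and small: "\<theta>\<^sup>2 \<le> k0 / 16" "t * \<theta> \<le> 1 / 4" "t * \<theta> \<le> 8 * (Kq * B)" "8 * real r * (t * \<theta>) \<le> \<epsilon>\<^sub>0"
      "256 * (B + 1) / k0 * (c + (B + 1)) * (s * \<theta>)\<^sup>2 \<le> c\<^sup>2 / 2"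
      "16 * (B + 1) / k0 * (c + (B + 1)) * (16 * real r * (t / C))\<^sup>2 * \<theta>\<^sup>2 \<le> 1"
      "8 * B * (Ks * C) * (s * \<theta>) \<le> 1" "3 * B * sqrt B * (Ks * C) * (s * \<theta>) \<le> 1 / (5 * sqrt B)"
      "256 * (B + 1) / k0 * (s * \<theta>) * \<theta> \<le> c" "16 * t * (s * \<theta>) \<le> 1"
      "2 * (sqrt B * t + sqrt (B + 1) * a + 2 * \<rho>) * (s * \<theta>) \<le> \<gamma>"
  shows "0 < Kc" "0 < \<rho>"
    "\<exists>E\<in>M.events. M.prob E \<le> (6 * (2 + 2 * real r)\<^sup>2 + 4) / real (max p q) + 8 * exp (- (k0 / 2)) ^ n \<and>
    (\<forall>\<omega>\<in>space M - E.
      sign_dist l2_norm (al \<omega>) (col U 0) + sign_dist l2_norm (be \<omega>) (col V 0) \<le> 2 * (Kc * (1 + \<rho>)) * (s powr \<kappa> * \<theta>) \<and>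
      sign_dist l1_norm (al \<omega>) (col U 0) + sign_dist l1_norm (be \<omega>) (col V 0) \<le> 8 * (Kc * (1 + \<rho>)) * (s powr (\<kappa> + 1 / 2) * \<theta>))"
proof -
  have B0: "0 < B" and c0: "0 < c" using eigenvalues(1) by (simp_all add: c_def)
  have t0: "0 < t" using B0 Kq by (simp add: t_def)
  have "0 < 2 * t * (1 + real r * (2 * sqrt B + 1))" using t0 B0 by (intro mult_pos_pos add_pos_nonneg) auto
  then have C0: "0 < C" using C by linarith
  have "0 < 4 * t * (1 + real r * sqrt B)" using t0 B0 by (intro mult_pos_pos add_pos_nonneg) auto
  then have a0: "0 < a" using C' c0 by (simp add: a_def)
  have \<gamma>0: "0 < \<gamma>" using gap(1) B0 by (simp add: \<gamma>_def)
  have Ks0: "0 < Ks" unfolding Ks_def using c0 gap(1) t0 C0 by (intro mult_pos_pos add_nonneg_pos divide_pos_pos) auto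
  show \<rho>0: "0 < \<rho>" unfolding \<rho>_def using r1 B0 Ks0 C0 by simp
  show Kc0: "0 < Kc" unfolding Kc_def using \<gamma>0 a0 B0 t0 by (intro mult_pos_pos add_pos_pos) auto
  have k0: "0 < k0" using B0 Kq by (simp add: k0_def)
  have s1: "1 \<le> s" using row_sparsity_pos by (simp add: s)
  have sqrt_s: "sqrt s \<le> s" using real_sqrt_le_mono[of s "s * s"] s1 by (simp add: mult_le_cancel_left1)
  \<comment> \<open>The length, before rounding, for which the number of signed sums costs at most
    half of the exponent.\<close>
  define y where "y = k0 / (4 * \<theta>\<^sup>2)"
  define m where "m = nat \<lfloor>y\<rfloor>"
  have y4: "4 \<le> y" using small(1) \<theta>(1) by (simp add: y_def pos_le_divide_eq)
  have m: "real m \<le> y" "y < real m + 1" unfolding m_def using y4 by linarith+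
  have m2: "2 \<le> m" using m(2) y4 by linarith
  define \<nu> where "\<nu> = 8 * (B + 1) * \<theta>\<^sup>2 / k0"
  \<comment> \<open>By \<open>4 \<le> y\<close>, even after rounding down, \<open>m - 1\<close>
    exceeds \<open>y / 2\<close>; this makes \<open>\<nu>\<close> a multiple of
    \<open>\<theta>\<^sup>2\<close>.\<close>
  have "(B + 1) / (real m - 1) \<le> (B + 1) / (y / 2)"
    using m(2) y4 B0 by (intro divide_left_mono mult_pos_pos) auto
  also have "\<dots> = \<nu>" using k0 \<theta>(1) by (simp add: \<nu>_def y_def)
  finally have \<nu>: "(B + 1) / (real m - 1) \<le> \<nu>" .
  define e where "e = Ks * (s * (C * \<theta>))"
  define Rb where "Rb = (if r = 1 then 0 else real r * (3 * B * sqrt B * e))"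
  have Rb: "Rb = (if r = 1 then 0 else \<rho> * (s * \<theta>))" by (simp add: Rb_def \<rho>_def e_def)
  have Rb_le: "Rb \<le> \<rho> * (s * \<theta>)" using Rb \<rho>0 s1 \<theta>(1) by simp
  have z: "\<theta> \<le> s * \<theta>" "sqrt s * \<theta> \<le> s * \<theta>" using s1 sqrt_s \<theta>(1) by simp_all
  have sm1: "32 * (\<nu> * (c + (B + 1))) * s\<^sup>2 \<le> c\<^sup>2 / 2"
    using small(5) by (simp add: \<nu>_def power_mult_distrib mult_ac)
  have sm2: "2 * (\<nu> * (c + (B + 1))) * (16 * real r * (t / C))\<^sup>2 \<le> 1"
  proof -
    have "2 * (\<nu> * (c + (B + 1))) * z = 16 * (B + 1) / k0 * (c + (B + 1)) * z * \<theta>\<^sup>2" for z by (simp add: \<nu>_def)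
    then show ?thesis using small(6) by simp
  qed
  have sm3: "8 * B * e \<le> 1" "3 * B * sqrt B * e \<le> 1 / (5 * sqrt B)"
    using small(7,8) by (simp_all add: e_def mult_ac)
  have sm4: "32 * \<nu> * s \<le> c" using small(9) by (simp add: \<nu>_def power2_eq_square mult_ac)
  have sm5: "16 * s * (t * \<theta>) \<le> 1" using small(10) by (simp add: mult_ac)
  have sm6: "2 * (sqrt B * (t * \<theta>) + sqrt (B + 1) * (a * (sqrt s * \<theta>)) + 2 * Rb) \<le> \<gamma>"
  proof -
    have h1: "sqrt B * (t * \<theta>) \<le> sqrt B * (t * (s * \<theta>))" using z(1) t0 B0 by (intro mult_left_mono) auto
    have h2: "sqrt (B + 1) * (a * (sqrt s * \<theta>)) \<le> sqrt (B + 1) * (a * (s * \<theta>))"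
      using z(2) a0 B0 by (intro mult_left_mono) auto
    have h3: "2 * Rb \<le> 2 * (\<rho> * (s * \<theta>))" using Rb_le by simp
    have "2 * (sqrt B * (t * \<theta>) + sqrt (B + 1) * (a * (sqrt s * \<theta>)) + 2 * Rb)
        \<le> 2 * (sqrt B * (t * (s * \<theta>)) + sqrt (B + 1) * (a * (s * \<theta>)) + 2 * (\<rho> * (s * \<theta>)))"
      by (rule mult_left_mono[OF add_mono[OF add_mono[OF h1 h2] h3]]) simp
    also have "\<dots> = 2 * (sqrt B * t + sqrt (B + 1) * a + 2 * \<rho>) * (s * \<theta>)" by (simp only: distrib_right mult.assoc)
    also note small(11)
    finally show ?thesis .
  qed
  note ev = colar_event[OF c_def Ks_def e_def a_def \<gamma>_def Rb_def Kc_def refl refl colar s n m2 \<nu> C C' \<theta>(1) t0 C0 small(3)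
        small(2) small(4) sm1 sm2 sm3 sm4 sm5 sm6]
  obtain E where E: "E \<in> M.events"
    and pE: "M.prob E \<le> 3 * ((real (p + q + 2 * r))\<^sup>2 * (2 * exp (- (real n / 3 * (t * \<theta>)\<^sup>2 / (32 * (Kq * B)\<^sup>2)))))
      + 2 * (((2 * real p) ^ m + (2 * real q) ^ m) * (2 * exp (- (real n / 3 / (128 * B\<^sup>2 * Kq\<^sup>2)))))
      + (real p * (2 * exp (- (real n / 3 * (t * \<theta>)\<^sup>2 / (32 * (Kq * B)\<^sup>2)))) + real q * (2 * exp (- (real n / 3 * (t * \<theta>)\<^sup>2 / (32 * (Kq * B)\<^sup>2)))))"
    and good: "\<And>\<omega>. \<omega> \<in> space M - E \<Longrightarrow>
      sign_dist l2_norm (al \<omega>) (col U 0) + sign_dist l2_norm (be \<omega>) (col V 0) \<le> 2 * (Kc * (sqrt s * \<theta> + Rb)) \<and>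
      sign_dist l1_norm (al \<omega>) (col U 0) + sign_dist l1_norm (be \<omega>) (col V 0) \<le> 8 * sqrt s * (Kc * (sqrt s * \<theta> + Rb))"
    using ev by (elim bexE conjE) (rule that, assumption, assumption, erule bspec)
  have prE: "M.prob E \<le> (6 * (2 + 2 * real r)\<^sup>2 + 4) / real (max p q) + 8 * exp (- (k0 / 2)) ^ n"
  proof (rule order_trans[OF pE], rule failure_probability_bound[OF d \<theta> Kq B0 k0_def m(1)[unfolded y_def]])
    show "exp (- (real n / 3 * (t * \<theta>)\<^sup>2 / (32 * (Kq * B)\<^sup>2))) = exp (- (real n / 3 * (17 * (Kq * B) * \<theta>)\<^sup>2 / (32 * (Kq * B)\<^sup>2)))"
      by (simp only: t_def)
  qed (rule refl)
  \<comment> \<open>Without bias the rate is \<open>sqrt s * \<theta>\<close>; otherwise the bias of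
    order \<open>s * \<theta>\<close> sets it.\<close>
  have R: "sqrt s * \<theta> + Rb \<le> (1 + \<rho>) * (s powr \<kappa> * \<theta>)"
  proof (cases "r = 1")
    case True
    then have "sqrt s * \<theta> + Rb = 1 * (s powr \<kappa> * \<theta>)" using s1 by (simp add: Rb \<kappa>_def powr_half_sqrt)
    also have "\<dots> \<le> (1 + \<rho>) * (s powr \<kappa> * \<theta>)" using \<rho>0 \<theta>(1) by (intro mult_right_mono) auto
    finally show ?thesis .
  next
    case False
    then show ?thesis using z(2) s1 by (simp add: Rb \<kappa>_def distrib_right)
  qed
  have Q: "Kc * (sqrt s * \<theta> + Rb) \<le> Kc * (1 + \<rho>) * (s powr \<kappa> * \<theta>)"
    using mult_left_mono[OF R, of Kc] Kc0 by (simp add: mult.assoc)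
  have "8 * sqrt s * (Kc * (sqrt s * \<theta> + Rb)) \<le> 8 * sqrt s * (Kc * (1 + \<rho>) * (s powr \<kappa> * \<theta>))"
    using s1 by (intro mult_left_mono[OF Q]) simp
  also have "\<dots> = 8 * (Kc * (1 + \<rho>)) * (s powr (\<kappa> + 1 / 2) * \<theta>)"
    using s1 by (simp add: powr_add powr_half_sqrt)
  finally have Q': "8 * sqrt s * (Kc * (sqrt s * \<theta> + Rb)) \<le> 8 * (Kc * (1 + \<rho>)) * (s powr (\<kappa> + 1 / 2) * \<theta>)" .
  have Q2: "2 * (Kc * (sqrt s * \<theta> + Rb)) \<le> 2 * (Kc * (1 + \<rho>)) * (s powr \<kappa> * \<theta>)" using Q by simp
  have "\<forall>\<omega>\<in>space M - E.
      sign_dist l2_norm (al \<omega>) (col U 0) + sign_dist l2_norm (be \<omega>) (col V 0) \<le> 2 * (Kc * (1 + \<rho>)) * (s powr \<kappa> * \<theta>) \<and>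
      sign_dist l1_norm (al \<omega>) (col U 0) + sign_dist l1_norm (be \<omega>) (col V 0) \<le> 8 * (Kc * (1 + \<rho>)) * (s powr (\<kappa> + 1 / 2) * \<theta>)"
    using good order_trans[OF _ Q'] order_trans[OF _ Q2] by blast
  then show "\<exists>E\<in>M.events. M.prob E \<le> (6 * (2 + 2 * real r)\<^sup>2 + 4) / real (max p q) + 8 * exp (- (k0 / 2)) ^ n \<and>
    (\<forall>\<omega>\<in>space M - E.
      sign_dist l2_norm (al \<omega>) (col U 0) + sign_dist l2_norm (be \<omega>) (col V 0) \<le> 2 * (Kc * (1 + \<rho>)) * (s powr \<kappa> * \<theta>) \<and>
      sign_dist l1_norm (al \<omega>) (col U 0) + sign_dist l1_norm (be \<omega>) (col V 0) \<le> 8 * (Kc * (1 + \<rho>)) * (s powr (\<kappa> + 1 / 2) * \<theta>))"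
    using E prE by blast
qed

end

section \<open>Asymptotics\<close>

lemma eventually_small: "(f \<longlongrightarrow> (0::real)) F \<Longrightarrow> 0 < b \<Longrightarrow> \<forall>\<^sub>F n in F. f n \<le> b"
  using order_tendstoD(2)[of f 0 F b] by (auto elim: eventually_mono)

theorem theorem3:
  fixes M :: "nat \<Rightarrow> 'a measure"
    and X Y :: "nat \<Rightarrow> nat \<Rightarrow> 'a \<Rightarrow> real Matrix.vec"
    and P :: "nat \<Rightarrow> (real Matrix.vec \<times> real Matrix.vec) measure"
    and p q :: "nat \<Rightarrow> nat"
    and r :: nat
    and Sx Sy Sxy U V :: "nat \<Rightarrow> real mat"
    and Lam :: "nat \<Rightarrow> nat \<Rightarrow> real"
    and s :: "nat \<Rightarrow> nat"
    and K \<epsilon>\<^sub>0 B \<kappa> :: real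
  assumes law: "\<And>n. prob_space (P n)" "\<And>n. sets (P n) = sets (pair_borel (p n) (q n))"
    and centered: "\<And>n. centered (P n) (p n) fst" "\<And>n. centered (P n) (q n) snd"
    and subgaussian: "\<And>n. subgaussian_norm (P n) (p n) fst \<le> ennreal K"
      "\<And>n. subgaussian_norm (P n) (q n) snd \<le> ennreal K"
    and prob: "\<And>n. prob_space (M n)"
    and indep: "\<And>n. prob_space.indep_vars (M n) (\<lambda>_. pair_borel (p n) (q n))
                  (\<lambda>i \<omega>. (X n i \<omega>, Y n i \<omega>)) {..<n}"
    and copies: "\<And>n i. i < n \<Longrightarrow> distr (M n) (pair_borel (p n) (q n)) (\<lambda>\<omega>. (X n i \<omega>, Y n i \<omega>)) = P n"
    and Sx: "\<And>n. Sx n = cov_mat (P n) (p n) (p n) fst fst"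
    and Sy: "\<And>n. Sy n = cov_mat (P n) (q n) (q n) snd snd"
    and Sxy: "\<And>n. Sxy n = cov_mat (P n) (p n) (q n) fst snd"
    and r: "1 \<le> r" "\<And>n. vec_space.rank (p n) (Sxy n) = r"
    and UV_dim: "\<And>n. U n \<in> carrier_mat (p n) r" "\<And>n. V n \<in> carrier_mat (q n) r"
    and decomposition: "\<And>n. Sxy n = Sx n * U n * mat_diag r (Lam n) * (V n)\<^sup>T * Sy n"
    and normalized: "\<And>n. (U n)\<^sup>T * Sx n * U n = 1\<^sub>m r" "\<And>n. (V n)\<^sup>T * Sy n * V n = 1\<^sub>m r"
    and Lam_decreasing: "\<And>n i j. i \<le> j \<Longrightarrow> j < r \<Longrightarrow> Lam n j \<le> Lam n i"
    and Lam_pos: "\<And>n i. i < r \<Longrightarrow> 0 < Lam n i"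
    and gap: "0 < \<epsilon>\<^sub>0" "\<epsilon>\<^sub>0 < 1" "\<And>n. Lam n 0 - (if r = 1 then 0 else Lam n 1) > \<epsilon>\<^sub>0"
    and eigenvalues: "0 < B" "\<And>n k. eigenvalue (Sx n) k \<Longrightarrow> k \<in> {1 / B..B}"
      "\<And>n k. eigenvalue (Sy n) k \<Longrightarrow> k \<in> {1 / B..B}"
    and s: "\<And>n. s n = row_sparsity (U n) + row_sparsity (V n)"
    and s_lam: "(\<lambda>n. real (s n) * lam (p n) (q n) n) \<longlonglongrightarrow> 0"
    and s_p: "(\<lambda>n. real (s n)) \<in> o(\<lambda>n. real (p n))"
    and kappa: "\<kappa> = (if r = 1 then 1 / 2 else 1)"
  shows "\<exists>C1>0. \<exists>C2>0. \<forall>C>C1. \<forall>C'>C2. \<forall>a b.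
    (\<forall>n. modified_colar (M n) (p n) (q n) n (X n) (Y n)
           (C * lam (p n) (q n) n) (C' * lam (p n) (q n) n) (a n) (b n)) \<longrightarrow>
    bounded_in_prob M
      (\<lambda>n \<omega>. sign_dist l2_norm (a n \<omega>) (col (U n) 0) + sign_dist l2_norm (b n \<omega>) (col (V n) 0))
      (\<lambda>n. real (s n) powr \<kappa> * lam (p n) (q n) n) \<and>
    bounded_in_prob M
      (\<lambda>n \<omega>. sign_dist l1_norm (a n \<omega>) (col (U n) 0) + sign_dist l1_norm (b n \<omega>) (col (V n) 0))
      (\<lambda>n. real (s n) powr (\<kappa> + 1 / 2) * lam (p n) (q n) n)"
proof -
  have model: "cca_model (M n) (X n) (Y n) (P n) (p n) (q n) r n (Sx n) (Sy n) (Sxy n) (U n) (V n) (Lam n) K \<epsilon>\<^sub>0 B" for n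
    by (rule cca_model.intro; (erule eigenvalues(2) eigenvalues(3))?;
        (rule law centered subgaussian prob indep copies Sx Sy Sxy r(1) UV_dim decomposition normalized Lam_decreasing Lam_pos gap(1,3) eigenvalues(1); assumption?)?)
  define k where "k = cca_model.Kq K"
  have k: "0 < k" unfolding k_def by (rule cca_model.Kq[OF model])
  have B0: "0 < B" by (rule eigenvalues(1))
  define t where "t = 17 * (k * B)"
  have t0: "0 < t" using k B0 by (simp add: t_def)
  \<comment> \<open>\<open>C1\<close> makes the entrywise noise of the first stage at most half of
    its penalty, \<open>C2\<close> that of the second stage at most a quarter.\<close>
  define C1 where "C1 = 2 * t * (1 + real r * (2 * sqrt B + 1))"
  define C2 where "C2 = 4 * t * (1 + real r * sqrt B)"
  have C1: "0 < C1" and C2: "0 < C2" unfolding C1_def C2_def using t0 B0 by (intro mult_pos_pos add_pos_nonneg; auto)+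
  define \<theta> where "\<theta> n = lam (p n) (q n) n" for n
  have s1: "1 \<le> real (s n)" for n using cca_model.row_sparsity_pos[OF model, of n] by (simp add: s)
  have x: "(\<lambda>n. real (s n) * \<theta> n) \<longlonglongrightarrow> 0" using s_lam by (simp add: \<theta>_def)
  \<comment> \<open>Every \<open>s n\<close> is at least 1, so the smallness of s relative to p is
    growth of p.\<close>
  have p_top: "filterlim (\<lambda>n. real (p n)) at_top sequentially"
    unfolding filterlim_at_top
  proof
    fix z :: real
    have "\<forall>\<^sub>F n in sequentially. norm (real (s n)) \<le> 1 / max z 1 * norm (real (p n))"
      by (rule landau_o.smallD[OF s_p]) simp
    then show "\<forall>\<^sub>F n in sequentially. z \<le> real (p n)"
    proof eventually_elim
      case (elim n)
      then have "real (s n) \<le> real (p n) / max z 1" by simp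
      with s1[of n] have "1 \<le> real (p n) / max z 1" by linarith
      then have "1 * max z 1 \<le> real (p n)" by (subst (asm) pos_le_divide_eq) auto
      then show ?case by linarith
    qed
  qed
  have d_top: "filterlim (\<lambda>n. real (max (p n) (q n))) at_top sequentially"
    by (rule filterlim_at_top_mono[OF p_top]) simp
  have d2: "\<forall>\<^sub>F n in sequentially. 2 \<le> max (p n) (q n)"
    using filterlim_at_top[THEN iffD1, OF d_top, rule_format, of 2] by eventually_elim linarith
  have n2: "\<forall>\<^sub>F n::nat in sequentially. 2 \<le> n" by (rule eventually_ge_at_top)
  \<comment> \<open>Small cases are excluded: with \<open>n = 0\<close> or
    \<open>max p q = 1\<close> the rate would be 0.\<close>
  have \<theta>pos: "\<forall>\<^sub>F n in sequentially. 0 < \<theta> n \<and> real n * (\<theta> n)\<^sup>2 = ln (real (max (p n) (q n)))"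
    using d2 n2
  proof eventually_elim
    case (elim n)
    then have "0 < ln (real (max (p n) (q n)))" by (intro ln_gt_zero) linarith
    then show ?case using elim(2) by (simp add: \<theta>_def lam_def)
  qed
  \<comment> \<open>\<open>1 \<le> s\<close> bounds \<open>\<theta>\<close> by the product that
    tends to 0.\<close>
  have \<theta>0: "\<theta> \<longlonglongrightarrow> 0"
  proof (rule tendsto_sandwich[OF _ _ tendsto_const x])
    show "\<forall>\<^sub>F n in sequentially. 0 \<le> \<theta> n" using \<theta>pos by eventually_elim simp
    show "\<forall>\<^sub>F n in sequentially. \<theta> n \<le> real (s n) * \<theta> n"
      using \<theta>pos by eventually_elim (use s1 in \<open>simp add: mult_le_cancel_right1\<close>)
  qed
  \<comment> \<open>\<open>D\<close> and \<open>f\<close> may depend on the penalties but not on the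
    tolerance of the O_p statement.\<close>
  have main: "\<exists>D>0. (\<lambda>n. f n) \<longlonglongrightarrow> 0 \<and> (\<forall>\<^sub>F n in sequentially. \<exists>E\<in>sets (M n). measure (M n) E \<le> f n \<and> (\<forall>\<omega>\<in>space (M n) - E.
      sign_dist l2_norm (a n \<omega>) (col (U n) 0) + sign_dist l2_norm (b n \<omega>) (col (V n) 0) \<le> D * (real (s n) powr \<kappa> * \<theta> n) \<and>
      sign_dist l1_norm (a n \<omega>) (col (U n) 0) + sign_dist l1_norm (b n \<omega>) (col (V n) 0) \<le> D * (real (s n) powr (\<kappa> + 1 / 2) * \<theta> n)))"
    if C: "C1 < C" and C': "C2 < C'" and f: "f = (\<lambda>n. (6 * (2 + 2 * real r)\<^sup>2 + 4) / real (max (p n) (q n)) + 8 * exp (- (1 / (384 * B\<^sup>2 * k\<^sup>2) / 2)) ^ n)"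
      and colar: "\<And>n. modified_colar (M n) (p n) (q n) n (X n) (Y n) (C * \<theta> n) (C' * \<theta> n) (a n) (b n)"
    for C C' a b f
  proof -
    define c where "c = 1 / (2 * B)"
    define Ks where "Ks = 2 / c * (4 / \<epsilon>\<^sub>0) * (8 * real r * (t / C) + 3 / c)"
    define A where "A = 3 * C' / c"
    define \<gamma> where "\<gamma> = \<epsilon>\<^sub>0 / (5 * sqrt B)"
    define \<rho> where "\<rho> = real r * (3 * B * sqrt B * (Ks * C))"
    define Kc where "Kc = 2 / \<gamma> * (A + B * t + sqrt B * sqrt (B + 1) * A + 3 * sqrt B)"
    define k0 where "k0 = 1 / (384 * B\<^sup>2 * k\<^sup>2)"
    have c0: "0 < c" and k0: "0 < k0" and \<gamma>0: "0 < \<gamma>" using B0 k gap(1) by (simp_all add: c_def k0_def \<gamma>_def)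
    have lim: "(\<lambda>n. w * (real (s n) * \<theta> n)) \<longlonglongrightarrow> 0" "(\<lambda>n. w * \<theta> n) \<longlonglongrightarrow> 0" "(\<lambda>n. w * (\<theta> n)\<^sup>2) \<longlonglongrightarrow> 0"
      "(\<lambda>n. w * (real (s n) * \<theta> n)\<^sup>2) \<longlonglongrightarrow> 0" "(\<lambda>n. w * (real (s n) * \<theta> n) * \<theta> n) \<longlonglongrightarrow> 0" for w
      using tendsto_mult_left[OF x, of w] tendsto_mult_left[OF \<theta>0, of w] tendsto_mult_left[OF tendsto_power[OF \<theta>0, of 2], of w]
        tendsto_mult_left[OF tendsto_power[OF x, of 2], of w] tendsto_mult[OF tendsto_mult_left[OF x, of w] \<theta>0] by simp_all
    have sm1: "\<forall>\<^sub>F n in sequentially. 1 * (\<theta> n)\<^sup>2 \<le> k0 / 16" by (rule eventually_small[OF lim(3)]) (use k0 in simp)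
    have sm2: "\<forall>\<^sub>F n in sequentially. t * \<theta> n \<le> 1 / 4" by (rule eventually_small[OF lim(2)]) simp
    have sm3: "\<forall>\<^sub>F n in sequentially. t * \<theta> n \<le> 8 * (k * B)" by (rule eventually_small[OF lim(2)]) (use k B0 in simp)
    have sm4: "\<forall>\<^sub>F n in sequentially. 8 * real r * t * \<theta> n \<le> \<epsilon>\<^sub>0" by (rule eventually_small[OF lim(2)]) (rule gap(1))
    have sm5: "\<forall>\<^sub>F n in sequentially. 256 * (B + 1) / k0 * (c + (B + 1)) * (real (s n) * \<theta> n)\<^sup>2 \<le> c\<^sup>2 / 2"
      by (rule eventually_small[OF lim(4)]) (use c0 in simp)
    have sm6: "\<forall>\<^sub>F n in sequentially. 16 * (B + 1) / k0 * (c + (B + 1)) * (16 * real r * (t / C))\<^sup>2 * (\<theta> n)\<^sup>2 \<le> 1"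
      by (rule eventually_small[OF lim(3)]) simp
    have sm7: "\<forall>\<^sub>F n in sequentially. 8 * B * (Ks * C) * (real (s n) * \<theta> n) \<le> 1" by (rule eventually_small[OF lim(1)]) simp
    have sm8: "\<forall>\<^sub>F n in sequentially. 3 * B * sqrt B * (Ks * C) * (real (s n) * \<theta> n) \<le> 1 / (5 * sqrt B)"
      by (rule eventually_small[OF lim(1)]) (use B0 in simp)
    have sm9: "\<forall>\<^sub>F n in sequentially. 256 * (B + 1) / k0 * (real (s n) * \<theta> n) * \<theta> n \<le> c" by (rule eventually_small[OF lim(5) c0])
    have sm10: "\<forall>\<^sub>F n in sequentially. 16 * t * (real (s n) * \<theta> n) \<le> 1" by (rule eventually_small[OF lim(1)]) simp
    have sm11: "\<forall>\<^sub>F n in sequentially. 2 * (sqrt B * t + sqrt (B + 1) * A + 2 * \<rho>) * (real (s n) * \<theta> n) \<le> \<gamma>"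
      by (rule eventually_small[OF lim(1) \<gamma>0])
    \<comment> \<open>The factor 8 of the l1 bound also covers the factor 2 of the l2 bound.\<close>
    define D where "D = 8 * (Kc * (1 + \<rho>))"
    have ev: "\<forall>\<^sub>F n in sequentially. 0 < D \<and> (\<exists>E\<in>sets (M n). measure (M n) E \<le> f n \<and> (\<forall>\<omega>\<in>space (M n) - E.
      sign_dist l2_norm (a n \<omega>) (col (U n) 0) + sign_dist l2_norm (b n \<omega>) (col (V n) 0) \<le> D * (real (s n) powr \<kappa> * \<theta> n) \<and>
      sign_dist l1_norm (a n \<omega>) (col (U n) 0) + sign_dist l1_norm (b n \<omega>) (col (V n) 0) \<le> D * (real (s n) powr (\<kappa> + 1 / 2) * \<theta> n)))"
      using \<theta>pos d2 n2 sm1 sm2 sm3 sm4 sm5 sm6 sm7 sm8 sm9 sm10 sm11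
    proof eventually_elim
      case (elim n)
      have sn: "real (s n) = real (row_sparsity (U n) + row_sparsity (V n))" by (simp add: s)
      have e4: "8 * real r * (t * \<theta> n) \<le> \<epsilon>\<^sub>0" and e1: "(\<theta> n)\<^sup>2 \<le> k0 / 16" using elim(4,7) by (simp_all add: mult.assoc)
      have \<theta>n: "0 < \<theta> n" "real n * (\<theta> n)\<^sup>2 = ln (real (max (p n) (q n)))" using elim(1) by auto
      note rate = cca_model.colar_event_at_rate[OF model, unfolded k_def[symmetric], OF c_def t_def Ks_def A_def \<gamma>_def \<rho>_def Kc_def k0_def kappa
        colar sn elim(3) less_imp_le[OF C[unfolded C1_def]] less_imp_le[OF C'[unfolded C2_def]] \<theta>n elim(2) e1 elim(5,6) e4 elim(8-14)]
      have D0: "0 < Kc" "0 < \<rho>" by (rule rate(1), rule rate(2))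
      obtain E where E: "E \<in> sets (M n)" "measure (M n) E \<le> f n"
        and good: "\<And>\<omega>. \<omega> \<in> space (M n) - E \<Longrightarrow>
          sign_dist l2_norm (a n \<omega>) (col (U n) 0) + sign_dist l2_norm (b n \<omega>) (col (V n) 0) \<le> 2 * (Kc * (1 + \<rho>)) * (real (s n) powr \<kappa> * \<theta> n) \<and>
          sign_dist l1_norm (a n \<omega>) (col (U n) 0) + sign_dist l1_norm (b n \<omega>) (col (V n) 0) \<le> 8 * (Kc * (1 + \<rho>)) * (real (s n) powr (\<kappa> + 1 / 2) * \<theta> n)"
        using rate(3) unfolding f k0_def by blast
      have "2 * (Kc * (1 + \<rho>)) * (real (s n) powr \<kappa> * \<theta> n) \<le> D * (real (s n) powr \<kappa> * \<theta> n)"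
        unfolding D_def using D0 \<theta>n(1) by (intro mult_right_mono) auto
      note le = order_trans[OF _ this]
      have "\<forall>\<omega>\<in>space (M n) - E.
        sign_dist l2_norm (a n \<omega>) (col (U n) 0) + sign_dist l2_norm (b n \<omega>) (col (V n) 0) \<le> D * (real (s n) powr \<kappa> * \<theta> n) \<and>
        sign_dist l1_norm (a n \<omega>) (col (U n) 0) + sign_dist l1_norm (b n \<omega>) (col (V n) 0) \<le> D * (real (s n) powr (\<kappa> + 1 / 2) * \<theta> n)"
      proof (intro ballI conjI)
        fix \<omega> assume \<omega>: "\<omega> \<in> space (M n) - E"
        show "sign_dist l2_norm (a n \<omega>) (col (U n) 0) + sign_dist l2_norm (b n \<omega>) (col (V n) 0) \<le> D * (real (s n) powr \<kappa> * \<theta> n)"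
          by (rule le) (use good[OF \<omega>] in blast)
        show "sign_dist l1_norm (a n \<omega>) (col (U n) 0) + sign_dist l1_norm (b n \<omega>) (col (V n) 0) \<le> D * (real (s n) powr (\<kappa> + 1 / 2) * \<theta> n)"
          unfolding D_def using good[OF \<omega>] by blast
      qed
      moreover have "0 < D" using D0 by (simp add: D_def)
      ultimately show ?case using E by blast
    qed
    \<comment> \<open>Positivity of \<open>Kc\<close> and \<open>\<rho>\<close> comes from a lemma
      that applies only for large \<open>n\<close>; one such \<open>n\<close> suffices because
      \<open>D\<close> does not depend on it.\<close>
    have D0: "0 < D" using eventually_happens[OF ev] by auto
    have l1: "(\<lambda>n. (6 * (2 + 2 * real r)\<^sup>2 + 4) / real (max (p n) (q n))) \<longlonglongrightarrow> 0"
      by (rule real_tendsto_divide_at_top[OF tendsto_const d_top])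
    have l2: "(\<lambda>n. exp (- (k0 / 2)) ^ n) \<longlonglongrightarrow> 0" using k0 by (intro LIMSEQ_realpow_zero) auto
    have "f \<longlonglongrightarrow> 0" using tendsto_add[OF l1 tendsto_mult_left[OF l2, of 8]] unfolding f k0_def[symmetric] by simp
    then show ?thesis using D0 ev by (intro exI[of _ D] conjI) (auto elim: eventually_mono)
  qed
  \<comment> \<open>One constant serves every tolerance, since the failure probability tends to
    0.\<close>
  have bounded: "bounded_in_prob M W g"
    if D: "0 < D" and f: "f \<longlonglongrightarrow> 0" and W: "\<And>n \<omega>. 0 \<le> W n \<omega>"
      and ev: "\<forall>\<^sub>F n in sequentially. \<exists>E\<in>sets (M n). measure (M n) E \<le> f n \<and> (\<forall>\<omega>\<in>space (M n) - E. W n \<omega> \<le> D * g n)"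
    for W g D and f :: "nat \<Rightarrow> real"
    unfolding bounded_in_prob_def
  proof (intro allI impI exI[of _ D] conjI D)
    fix \<delta> :: real assume "0 < \<delta>"
    with order_tendstoD(2)[OF f] have "\<forall>\<^sub>F n in sequentially. f n < \<delta>" by blast
    with ev show "\<forall>\<^sub>F n in sequentially. \<exists>A\<in>sets (M n). {\<omega>\<in>space (M n). \<bar>W n \<omega>\<bar> > D * g n} \<subseteq> A \<and> measure (M n) A < \<delta>"
    proof eventually_elim
      case (elim n)
      then obtain E where E: "E \<in> sets (M n)" "measure (M n) E \<le> f n" "\<And>\<omega>. \<omega> \<in> space (M n) - E \<Longrightarrow> W n \<omega> \<le> D * g n" by blast
      have "{\<omega>\<in>space (M n). \<bar>W n \<omega>\<bar> > D * g n} \<subseteq> E" using E(3) W by (force simp: abs_of_nonneg)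
      then show ?case using E(1,2) elim(2) by (intro bexI[of _ E]) auto
    qed
  qed
  show ?thesis
  proof (rule exI[of _ C1], rule conjI[OF C1], rule exI[of _ C2], rule conjI[OF C2], intro allI impI conjI)
    fix C C' a b
    assume C: "C1 < C" "C2 < C'"
      and colar: "\<forall>n. modified_colar (M n) (p n) (q n) n (X n) (Y n) (C * lam (p n) (q n) n) (C' * lam (p n) (q n) n) (a n) (b n)"
    obtain D f where D: "0 < D" "f \<longlonglongrightarrow> 0"
      and ev: "\<forall>\<^sub>F n in sequentially. \<exists>E\<in>sets (M n). measure (M n) E \<le> f n \<and> (\<forall>\<omega>\<in>space (M n) - E.
        sign_dist l2_norm (a n \<omega>) (col (U n) 0) + sign_dist l2_norm (b n \<omega>) (col (V n) 0) \<le> D * (real (s n) powr \<kappa> * \<theta> n) \<and>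
        sign_dist l1_norm (a n \<omega>) (col (U n) 0) + sign_dist l1_norm (b n \<omega>) (col (V n) 0) \<le> D * (real (s n) powr (\<kappa> + 1 / 2) * \<theta> n))"
      using main[OF C refl, of a b] colar unfolding \<theta>_def by blast
    have nn: "0 \<le> sign_dist l2_norm x y + sign_dist l2_norm x' y'" "0 \<le> sign_dist l1_norm x y + sign_dist l1_norm x' y'" for x y x' y'
      by (intro add_nonneg_nonneg sign_dist_nonneg l2_norm_nonneg l1_norm_nonneg)+
    show "bounded_in_prob M
      (\<lambda>n \<omega>. sign_dist l2_norm (a n \<omega>) (col (U n) 0) + sign_dist l2_norm (b n \<omega>) (col (V n) 0))
      (\<lambda>n. real (s n) powr \<kappa> * lam (p n) (q n) n)"
      by (rule bounded[OF D nn(1)], rule eventually_mono[OF ev]) (auto simp: \<theta>_def)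
    show "bounded_in_prob M
      (\<lambda>n \<omega>. sign_dist l1_norm (a n \<omega>) (col (U n) 0) + sign_dist l1_norm (b n \<omega>) (col (V n) 0))
      (\<lambda>n. real (s n) powr (\<kappa> + 1 / 2) * lam (p n) (q n) n)"
      by (rule bounded[OF D nn(2)], rule eventually_mono[OF ev]) (auto simp: \<theta>_def)
  qed
qed

end
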